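(* Let $M$ be a three-dimensional manifold. (1) Every even Dirac structure on $M$ is the union of a presymplectic manifold and a foliated Poisson manifold. These manifolds are glued along the region $M_{(1,0)}$. (2) Every odd Dirac structure on $M$ is the union of a Poisson manifold and a foliated presymplectic manifold. These manifolds are glued along the region $M_{(0,1)}$.
   Context: For a real vector space $V$ of dimension $n$, $V\oplus V^*$ carries the inner product $\langle v+\xi,w+\eta\rangle=\tfrac12(\xi(w)+\eta(v))$ and the projections $\rho:V\oplus V^*\to V$, $\widehat\rho:V\oplus V^*\to V^*$. A subspace $L$ is Lagrangian if it is $n$-dimensional and isotropic. The type of $L$ is the pair $(\dim(L\cap V),\dim(L\cap V^* ))$; $L$ is even if $\dim(L\cap V^* )$ is even, and odd otherwise. Put $\Delta:=\rho(L)$ and $\widehat\Delta:=\widehat\rho(L)=\mathrm{Ann}(L\cap V)$. A Lagrangian $L$ defines $\epsilon\in\wedge^2\Delta^*$ and $\Pi\in\wedge^2\widehat\Delta^*\cong\wedge^2(V/(L\cap V))$ by $$\epsilon(\rho(x))=\widehat\rho(x)|_{\Delta},\qquad \Pi(\widehat\rho(x))=\rho(x)|_{\widehat\Delta}\qquad(x\in L),$$ and $L$ is uniquely specified by the pair $(\Delta,\epsilon)$, and also by the pair $(\widehat\Delta,\Pi)$. For a manifold $M$, $\mathbb{T}M:=TM\oplus T^*M$ has the pointwise inner product above and the Courant bracket on sections $$[X+\xi,Y+\eta]=[X,Y]+\mathcal{L}_X\eta-\mathcal{L}_Y\xi-\tfrac12 d(\iota_X\eta-\iota_Y\xi).$$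 An almost Dirac structure is a Lagrangian subbundle $E\subseteq\mathbb{T}M$; it is a Dirac structure if the Courant bracket of two sections of $E$ is again a section of $E$. $E$ is even (resp. odd) if every fiber $E_x$ is even (resp. odd). Given $E$, $M_{(a,b)}:=\{x\in M\mid E_x\text{ has type }(a,b)\}$. Let $D\subseteq TM$ be a distribution given by a regular foliation. The foliated exterior derivative $d_D:\Gamma(\wedge^kD^* )\to\Gamma(\wedge^{k+1}D^* )$ is given by the usual Cartan formula $$d_D\omega(V_0,\dots,V_k)=\sum_i(-1)^iV_i\big(\omega(V_0,\dots,\widehat{V_i},\dots,V_k)\big)+\sum_{i<j}(-1)^{i+j}\omega([V_i,V_j],V_0,\dots,\widehat{V_i},\dots,\widehat{V_j},\dots,V_k)$$ for sections $V_0,\dots,V_k$ of $D$. A foliated presymplectic form is a $d_D$-closed $\omega\in\Gamma(\wedge^2D^* )$; for $D=TM$ this is an ordinary presymplectic (closed) 2-form. The sheaf $C^\infty_D$ of admissible functions consists of the functions constant on the leaves of $D$. A foliated Poisson structure is a Poisson bracket on $C^\infty_D$. These structures are viewed as Dirac structures as follows: a presymplectic form (closed 2-form) and a Poisson bivector are identified with their graphs in $\mathbb{T}M$; a foliated presymplectic form $\epsilon$ with respect to $D$ is identified with the Dirac structure specified by the pair $(\Delta=D,\epsilon)$; a foliated Poisson structure with respect to $D$, given by $\Pi\in\Gamma(\wedge^2\widehat\Delta^* )$ with $\widehat\Delta=\mathrm{Ann}(D)$, is identified with the Dirac structure specified by $(\widehat\Delta,\Pi)$, for which $E\cap TM=D$.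 *)

theory Defs
  imports "HOL-Analysis.Analysis"
begin

section \<open>Smooth maps between open sets of normed spaces\<close>

text \<open>
  All of the following is meant for open \<open>S\<close> and finite-dimensional domain, where it says that
  \<open>f\<close> has continuous iterated directional derivatives up to order \<open>k\<close>, i.e. is of class \<open>C^k\<close>.
\<close>

primrec Ck_on ::
  "nat \<Rightarrow> 'b::real_normed_vector set \<Rightarrow> ('b \<Rightarrow> 'c::real_normed_vector) \<Rightarrow> bool" where
  "Ck_on 0 S f \<longleftrightarrow> continuous_on S f"
| "Ck_on (Suc k) S f \<longleftrightarrow>
     (\<forall>x\<in>S. f differentiable (at x)) \<and> (\<forall>v. Ck_on k S (\<lambda>x. frechet_derivative f (at x) v))"

definition smooth_on :: "'b::real_normed_vector set \<Rightarrow> ('b \<Rightarrow> 'c::real_normed_vector) \<Rightarrow> bool" where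
  "smooth_on S f \<longleftrightarrow> (\<forall>k. Ck_on k S f)"


section \<open>Smooth manifolds\<close>

text \<open>
  The points of the manifold are the elements of a topological type \<open>'a\<close>, the model space is
  \<open>'b\<close>. A chart is a pair of its domain and the coordinate map.
\<close>

type_synonym ('a, 'b) chart = "'a set \<times> ('a \<Rightarrow> 'b)"

definition chart_inv :: "('a, 'b) chart \<Rightarrow> 'b \<Rightarrow> 'a" where
  "chart_inv c = inv_into (fst c) (snd c)"

definition smooth_atlas :: "('a::topological_space, 'b::euclidean_space) chart set \<Rightarrow> bool" where
  "smooth_atlas A \<longleftrightarrow>
     (\<forall>c\<in>A. open (fst c) \<and> open (snd c ` fst c) \<and>
        homeomorphism (fst c) (snd c ` fst c) (snd c) (chart_inv c)) \<and>
     (\<Union>c\<in>A. fst c) = UNIV \<and>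
     (\<forall>c\<in>A. \<forall>d\<in>A. smooth_on (snd c ` (fst c \<inter> fst d)) (snd d \<circ> chart_inv c))"

text \<open>A chart of the maximal atlas containing \<open>A\<close>.\<close>

definition compatible_chart ::
  "('a::topological_space, 'b::euclidean_space) chart set \<Rightarrow> ('a, 'b) chart \<Rightarrow> bool" where
  "compatible_chart A c \<longleftrightarrow> smooth_atlas (insert c A)"

text \<open>
  For every point one chart around it is chosen, and the tangent space at \<open>p\<close> is the
  model space \<open>'b\<close>: the vector \<open>v\<close> stands for the tangent vector at \<open>p\<close> whose coordinates in the
  chosen chart at \<open>p\<close> are \<open>v\<close>. The cotangent space is the dual \<open>'b \<Rightarrow>\<^sub>L real\<close>. The chosen chart
  in general jumps from point to point, so smoothness of a field is not smoothness of the function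
  \<open>'a \<Rightarrow> 'b\<close> itself, but is defined below by passing to the coordinates of a fixed chart.
\<close>

definition chart_at :: "('a, 'b) chart set \<Rightarrow> 'a \<Rightarrow> ('a, 'b) chart" where
  "chart_at A p = (SOME c. c \<in> A \<and> p \<in> fst c)"

text \<open>
  The differential at \<open>p\<close> of a map from the manifold to a vector space, as a linear map on the
  tangent space at \<open>p\<close>. For a coordinate map \<open>snd c\<close> it converts tangent vectors at \<open>p\<close> into
  their coordinates with respect to \<open>c\<close>.
\<close>

definition mderiv ::
  "('a, 'b::euclidean_space) chart set \<Rightarrow> ('a \<Rightarrow> 'c::real_normed_vector) \<Rightarrow> 'a \<Rightarrow> 'b \<Rightarrow> 'c" where
  "mderiv A f p =
     (let c = chart_at A p in frechet_derivative (f \<circ> chart_inv c) (at (snd c p)))"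

definition dfun ::
  "('a, 'b::euclidean_space) chart set \<Rightarrow> ('a \<Rightarrow> real) \<Rightarrow> 'a \<Rightarrow> 'b \<Rightarrow>\<^sub>L real" where
  "dfun A f p = Blinfun (mderiv A f p)"

text \<open>Coordinate expressions of vector fields and one-forms in a chart \<open>c\<close>.\<close>

definition vec_rep ::
  "('a, 'b::euclidean_space) chart set \<Rightarrow> ('a, 'b) chart \<Rightarrow> ('a \<Rightarrow> 'b) \<Rightarrow> 'b \<Rightarrow> 'b" where
  "vec_rep A c X y = (let p = chart_inv c y in mderiv A (snd c) p (X p))"

definition covec_rep ::
  "('a, 'b::euclidean_space) chart set \<Rightarrow> ('a, 'b) chart \<Rightarrow> ('a \<Rightarrow> 'b \<Rightarrow>\<^sub>L real) \<Rightarrow> 'b \<Rightarrow> 'b \<Rightarrow>\<^sub>L real" where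
  "covec_rep A c \<xi> y =
     (let p = chart_inv c y in Blinfun (\<lambda>v. blinfun_apply (\<xi> p) (inv (mderiv A (snd c) p) v)))"

definition smooth_fun ::
  "('a::topological_space, 'b::euclidean_space) chart set \<Rightarrow> 'a set \<Rightarrow> ('a \<Rightarrow> real) \<Rightarrow> bool" where
  "smooth_fun A W f \<longleftrightarrow> (\<forall>c\<in>A. smooth_on (snd c ` (fst c \<inter> W)) (f \<circ> chart_inv c))"

definition smooth_vec ::
  "('a::topological_space, 'b::euclidean_space) chart set \<Rightarrow> 'a set \<Rightarrow> ('a \<Rightarrow> 'b) \<Rightarrow> bool" where
  "smooth_vec A W X \<longleftrightarrow> (\<forall>c\<in>A. smooth_on (snd c ` (fst c \<inter> W)) (vec_rep A c X))"

definition smooth_covec ::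
  "('a::topological_space, 'b::euclidean_space) chart set \<Rightarrow> 'a set \<Rightarrow> ('a \<Rightarrow> 'b \<Rightarrow>\<^sub>L real) \<Rightarrow> bool" where
  "smooth_covec A W \<xi> \<longleftrightarrow> (\<forall>c\<in>A. smooth_on (snd c ` (fst c \<inter> W)) (covec_rep A c \<xi>))"

text \<open>
  The coordinate formulas for the Lie bracket and the Lie derivative of a one-form,
  \<open>[X,Y]\<^sup>i = X\<^sup>j \<partial>\<^sub>j Y\<^sup>i - Y\<^sup>j \<partial>\<^sub>j X\<^sup>i\<close> and \<open>(L\<^sub>X \<eta>)\<^sub>i = X\<^sup>j \<partial>\<^sub>j \<eta>\<^sub>i + \<eta>\<^sub>j \<partial>\<^sub>i X\<^sup>j\<close>,
  evaluated at \<open>p\<close> in the chosen chart at \<open>p\<close>.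
\<close>

definition lie_bracket ::
  "('a, 'b::euclidean_space) chart set \<Rightarrow> ('a \<Rightarrow> 'b) \<Rightarrow> ('a \<Rightarrow> 'b) \<Rightarrow> 'a \<Rightarrow> 'b" where
  "lie_bracket A X Y p =
     (let c = chart_at A p; y = snd c p; X' = vec_rep A c X; Y' = vec_rep A c Y
      in frechet_derivative Y' (at y) (X' y) - frechet_derivative X' (at y) (Y' y))"

definition lie_deriv ::
  "('a, 'b::euclidean_space) chart set \<Rightarrow> ('a \<Rightarrow> 'b) \<Rightarrow> ('a \<Rightarrow> 'b \<Rightarrow>\<^sub>L real) \<Rightarrow> 'a \<Rightarrow> 'b \<Rightarrow>\<^sub>L real" where
  "lie_deriv A X \<eta> p =
     (let c = chart_at A p; y = snd c p; X' = vec_rep A c X; \<eta>' = covec_rep A c \<eta>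
      in Blinfun (\<lambda>v. blinfun_apply (frechet_derivative \<eta>' (at y) (X' y)) v
                    + blinfun_apply (\<eta>' y) (frechet_derivative X' (at y) v)))"


section \<open>Linear algebra of \<open>V \<oplus> V\<^sup>*\<close>\<close>

type_synonym 'b gen = "'b \<times> ('b \<Rightarrow>\<^sub>L real)"

definition gen_inner :: "'b::euclidean_space gen \<Rightarrow> 'b gen \<Rightarrow> real" where
  "gen_inner x y = (blinfun_apply (snd x) (fst y) + blinfun_apply (snd y) (fst x)) / 2"

definition lagrangian :: "'b::euclidean_space gen set \<Rightarrow> bool" where
  "lagrangian L \<longleftrightarrow>
     subspace L \<and> dim L = DIM('b) \<and> (\<forall>x\<in>L. \<forall>y\<in>L. gen_inner x y = 0)"

definition lag_type :: "'b::euclidean_space gen set \<Rightarrow> nat \<times> nat" where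
  "lag_type L = (dim (L \<inter> UNIV \<times> {0}), dim (L \<inter> {0} \<times> UNIV))"

definition even_lagrangian :: "'b::euclidean_space gen set \<Rightarrow> bool" where
  "even_lagrangian L \<longleftrightarrow> even (snd (lag_type L))"

definition odd_lagrangian :: "'b::euclidean_space gen set \<Rightarrow> bool" where
  "odd_lagrangian L \<longleftrightarrow> odd (snd (lag_type L))"

definition annihilator :: "'b::euclidean_space set \<Rightarrow> ('b \<Rightarrow>\<^sub>L real) set" where
  "annihilator D = {\<xi>. \<forall>v\<in>D. blinfun_apply \<xi> v = 0}"

text \<open>Alternating bilinear forms on a subspace \<open>S\<close>; values outside \<open>S\<close> are irrelevant.\<close>

definition alternating_on :: "'v::real_vector set \<Rightarrow> ('v \<Rightarrow> 'v \<Rightarrow> real) \<Rightarrow> bool" where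
  "alternating_on S B \<longleftrightarrow>
     (\<forall>u\<in>S. \<forall>v\<in>S. \<forall>w\<in>S. \<forall>a b. B (a *\<^sub>R u + b *\<^sub>R v) w = a * B u w + b * B v w) \<and>
     (\<forall>u\<in>S. \<forall>v\<in>S. \<forall>w\<in>S. \<forall>a b. B w (a *\<^sub>R u + b *\<^sub>R v) = a * B w u + b * B w v) \<and>
     (\<forall>v\<in>S. B v v = 0)"

text \<open>
  The Lagrangian \<open>L\<close> specified by \<open>(\<Delta>, \<epsilon>)\<close>, where \<open>\<epsilon>(v) = \<xi>|\<^sub>\<Delta>\<close> for \<open>v + \<xi> \<in> L\<close>, and the one
  specified by \<open>(\<Delta>', P)\<close> with \<open>\<Delta>' \<subseteq> V\<^sup>*\<close>, where \<open>P(\<xi>) = v|\<close> on \<open>\<Delta>'\<close> for \<open>v + \<xi> \<in> L\<close>. A bilinear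
  form \<open>B\<close> is regarded as the map sending \<open>u\<close> to \<open>B u\<close>.
\<close>

definition lag_of_form :: "'b::euclidean_space set \<Rightarrow> ('b \<Rightarrow> 'b \<Rightarrow> real) \<Rightarrow> 'b gen set" where
  "lag_of_form \<Delta> \<epsilon> = {(v, \<xi>). v \<in> \<Delta> \<and> (\<forall>w\<in>\<Delta>. blinfun_apply \<xi> w = \<epsilon> v w)}"

definition lag_of_bivector ::
  "('b::euclidean_space \<Rightarrow>\<^sub>L real) set \<Rightarrow> (('b \<Rightarrow>\<^sub>L real) \<Rightarrow> ('b \<Rightarrow>\<^sub>L real) \<Rightarrow> real) \<Rightarrow> 'b gen set" where
  "lag_of_bivector \<Delta>' P = {(v, \<xi>). \<xi> \<in> \<Delta>' \<and> (\<forall>\<eta>\<in>\<Delta>'. blinfun_apply \<eta> v = P \<xi> \<eta>)}"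


section \<open>Dirac structures\<close>

definition courant ::
  "('a, 'b::euclidean_space) chart set \<Rightarrow> ('a \<Rightarrow> 'b gen) \<Rightarrow> ('a \<Rightarrow> 'b gen) \<Rightarrow> 'a \<Rightarrow> 'b gen" where
  "courant A x y p =
     (let X = fst \<circ> x; \<xi> = snd \<circ> x; Y = fst \<circ> y; \<eta> = snd \<circ> y
      in (lie_bracket A X Y p,
          lie_deriv A X \<eta> p - lie_deriv A Y \<xi> p
            - (1/2) *\<^sub>R dfun A (\<lambda>q. blinfun_apply (\<eta> q) (X q) - blinfun_apply (\<xi> q) (Y q)) p))"

definition smooth_gen ::
  "('a::topological_space, 'b::euclidean_space) chart set \<Rightarrow> 'a set \<Rightarrow> ('a \<Rightarrow> 'b gen) \<Rightarrow> bool" where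
  "smooth_gen A W x \<longleftrightarrow> smooth_vec A W (fst \<circ> x) \<and> smooth_covec A W (snd \<circ> x)"

text \<open>The local frames are pointwise independent, as they span spaces of dimension \<open>DIM('b)\<close>.\<close>

definition lagrangian_subbundle ::
  "('a::topological_space, 'b::euclidean_space) chart set \<Rightarrow> ('a \<Rightarrow> 'b gen set) \<Rightarrow> bool" where
  "lagrangian_subbundle A E \<longleftrightarrow>
     (\<forall>p. lagrangian (E p)) \<and>
     (\<forall>p. \<exists>W (e :: nat \<Rightarrow> 'a \<Rightarrow> 'b gen). open W \<and> p \<in> W \<and>
        (\<forall>i<DIM('b). smooth_gen A W (e i)) \<and>
        (\<forall>q\<in>W. span ((\<lambda>i. e i q) ` {..<DIM('b)}) = E q))"

text \<open>
  Involutivity is required for sections over all open sets. The Courant bracket of smooth sections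
  is automatically smooth, so only its values have to be constrained.
\<close>

definition dirac_structure ::
  "('a::topological_space, 'b::euclidean_space) chart set \<Rightarrow> ('a \<Rightarrow> 'b gen set) \<Rightarrow> bool" where
  "dirac_structure A E \<longleftrightarrow> lagrangian_subbundle A E \<and>
     (\<forall>W x y. open W \<longrightarrow> smooth_gen A W x \<longrightarrow> smooth_gen A W y \<longrightarrow>
        (\<forall>p\<in>W. x p \<in> E p) \<longrightarrow> (\<forall>p\<in>W. y p \<in> E p) \<longrightarrow> (\<forall>p\<in>W. courant A x y p \<in> E p))"

definition type_region :: "('a \<Rightarrow> 'b::euclidean_space gen set) \<Rightarrow> nat \<times> nat \<Rightarrow> 'a set" where
  "type_region E ab = {p. lag_type (E p) = ab}"


section \<open>Foliations and admissible functions\<close>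

text \<open>
  The distribution \<open>D\<close> over the open set \<open>U\<close> is tangent to a regular foliation of some rank \<open>k\<close>:
  every point of \<open>U\<close> has a flat chart, in which the leaves are the slices parallel to a fixed
  \<open>k\<close>-dimensional subspace \<open>F\<close> of the model space.
\<close>

definition regular_foliation_on ::
  "('a::topological_space, 'b::euclidean_space) chart set \<Rightarrow> 'a set \<Rightarrow> ('a \<Rightarrow> 'b set) \<Rightarrow> bool" where
  "regular_foliation_on A U D \<longleftrightarrow>
     (\<exists>k. \<forall>p\<in>U. \<exists>c F. compatible_chart A c \<and> p \<in> fst c \<and> fst c \<subseteq> U \<and>
        subspace F \<and> dim F = k \<and> (\<forall>q\<in>fst c. D q = {v. mderiv A (snd c) q v \<in> F}))"

definition tangent_curve ::
  "('a::topological_space, 'b::euclidean_space) chart set \<Rightarrow> ('a \<Rightarrow> 'b set) \<Rightarrow> 'a set \<Rightarrow>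
     (real \<Rightarrow> 'a) \<Rightarrow> bool" where
  "tangent_curve A D W \<gamma> \<longleftrightarrow> continuous_on {0..1} \<gamma> \<and> \<gamma> ` {0..1} \<subseteq> W \<and>
     (\<forall>t\<in>{0..1}. \<exists>v\<in>D (\<gamma> t).
        (snd (chart_at A (\<gamma> t)) \<circ> \<gamma> has_vector_derivative v) (at t within {0..1}))"

text \<open>
  The leaf through \<open>p\<close> of the foliation of the open set \<open>W\<close> given by \<open>D\<close>: all points that can
  be joined to \<open>p\<close> inside \<open>W\<close> by finitely many consecutive curves tangent to \<open>D\<close>.
\<close>

definition leaf ::
  "('a::topological_space, 'b::euclidean_space) chart set \<Rightarrow> ('a \<Rightarrow> 'b set) \<Rightarrow> 'a set \<Rightarrow> 'a \<Rightarrow> 'a set" where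
  "leaf A D W p = {q. (\<lambda>a b. \<exists>\<gamma>. tangent_curve A D W \<gamma> \<and> \<gamma> 0 = a \<and> \<gamma> 1 = b)\<^sup>*\<^sup>* p q}"

definition admissible ::
  "('a::topological_space, 'b::euclidean_space) chart set \<Rightarrow> ('a \<Rightarrow> 'b set) \<Rightarrow> 'a set \<Rightarrow>
     ('a \<Rightarrow> real) set" where
  "admissible A D W = {f. smooth_fun A W f \<and> (\<forall>p\<in>W. \<forall>q\<in>leaf A D W p. f q = f p)}"


section \<open>Presymplectic and foliated presymplectic structures\<close>

text \<open>Smooth sections over \<open>U\<close> of the second exterior power of \<open>D\<^sup>*\<close>.\<close>

definition fol_two_form_on ::
  "('a::topological_space, 'b::euclidean_space) chart set \<Rightarrow> 'a set \<Rightarrow> ('a \<Rightarrow> 'b set) \<Rightarrow>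
     ('a \<Rightarrow> 'b \<Rightarrow> 'b \<Rightarrow> real) \<Rightarrow> bool" where
  "fol_two_form_on A U D \<omega> \<longleftrightarrow>
     (\<forall>p\<in>U. alternating_on (D p) (\<omega> p)) \<and>
     (\<forall>W X Y. open W \<longrightarrow> W \<subseteq> U \<longrightarrow> smooth_vec A W X \<longrightarrow> smooth_vec A W Y \<longrightarrow>
        (\<forall>p\<in>W. X p \<in> D p) \<longrightarrow> (\<forall>p\<in>W. Y p \<in> D p) \<longrightarrow> smooth_fun A W (\<lambda>p. \<omega> p (X p) (Y p)))"

text \<open>The Cartan formula for the foliated exterior derivative of a two-form.\<close>

definition d_two_form ::
  "('a, 'b::euclidean_space) chart set \<Rightarrow> ('a \<Rightarrow> 'b \<Rightarrow> 'b \<Rightarrow> real) \<Rightarrow>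
     ('a \<Rightarrow> 'b) \<Rightarrow> ('a \<Rightarrow> 'b) \<Rightarrow> ('a \<Rightarrow> 'b) \<Rightarrow> 'a \<Rightarrow> real" where
  "d_two_form A \<omega> V0 V1 V2 p =
       mderiv A (\<lambda>q. \<omega> q (V1 q) (V2 q)) p (V0 p)
     - mderiv A (\<lambda>q. \<omega> q (V0 q) (V2 q)) p (V1 p)
     + mderiv A (\<lambda>q. \<omega> q (V0 q) (V1 q)) p (V2 p)
     - \<omega> p (lie_bracket A V0 V1 p) (V2 p)
     + \<omega> p (lie_bracket A V0 V2 p) (V1 p)
     - \<omega> p (lie_bracket A V1 V2 p) (V0 p)"

definition fol_closed_on ::
  "('a::topological_space, 'b::euclidean_space) chart set \<Rightarrow> 'a set \<Rightarrow> ('a \<Rightarrow> 'b set) \<Rightarrow>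
     ('a \<Rightarrow> 'b \<Rightarrow> 'b \<Rightarrow> real) \<Rightarrow> bool" where
  "fol_closed_on A U D \<omega> \<longleftrightarrow>
     (\<forall>W V0 V1 V2. open W \<longrightarrow> W \<subseteq> U \<longrightarrow>
        smooth_vec A W V0 \<longrightarrow> smooth_vec A W V1 \<longrightarrow> smooth_vec A W V2 \<longrightarrow>
        (\<forall>p\<in>W. V0 p \<in> D p \<and> V1 p \<in> D p \<and> V2 p \<in> D p) \<longrightarrow>
        (\<forall>p\<in>W. d_two_form A \<omega> V0 V1 V2 p = 0))"

definition foliated_presymplectic_on ::
  "('a::topological_space, 'b::euclidean_space) chart set \<Rightarrow> 'a set \<Rightarrow> ('a \<Rightarrow> 'b set) \<Rightarrow>
     ('a \<Rightarrow> 'b \<Rightarrow> 'b \<Rightarrow> real) \<Rightarrow> bool" where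
  "foliated_presymplectic_on A U D \<omega> \<longleftrightarrow>
     regular_foliation_on A U D \<and> fol_two_form_on A U D \<omega> \<and> fol_closed_on A U D \<omega>"

definition presymplectic_on ::
  "('a::topological_space, 'b::euclidean_space) chart set \<Rightarrow> 'a set \<Rightarrow>
     ('a \<Rightarrow> 'b \<Rightarrow> 'b \<Rightarrow> real) \<Rightarrow> bool" where
  "presymplectic_on A U \<omega> \<longleftrightarrow>
     fol_two_form_on A U (\<lambda>_. UNIV) \<omega> \<and> fol_closed_on A U (\<lambda>_. UNIV) \<omega>"


section \<open>Poisson and foliated Poisson structures\<close>

text \<open>
  \<open>br\<close> is a Poisson bracket on the algebra \<open>C\<close> of functions on \<open>W\<close>; functions are compared on
  \<open>W\<close> only.
\<close>

definition poisson_bracket_on ::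
  "'a set \<Rightarrow> ('a \<Rightarrow> real) set \<Rightarrow> (('a \<Rightarrow> real) \<Rightarrow> ('a \<Rightarrow> real) \<Rightarrow> 'a \<Rightarrow> real) \<Rightarrow> bool" where
  "poisson_bracket_on W C br \<longleftrightarrow>
     (\<forall>f\<in>C. \<forall>g\<in>C. br f g \<in> C) \<and>
     (\<forall>f\<in>C. \<forall>g\<in>C. \<forall>p\<in>W. br f g p = - br g f p) \<and>
     (\<forall>f\<in>C. \<forall>g\<in>C. \<forall>h\<in>C. \<forall>a b. \<forall>p\<in>W.
        br h (\<lambda>q. a * f q + b * g q) p = a * br h f p + b * br h g p) \<and>
     (\<forall>f\<in>C. \<forall>g\<in>C. \<forall>h\<in>C. \<forall>p\<in>W. br h (\<lambda>q. f q * g q) p = br h f p * g p + f p * br h g p) \<and>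
     (\<forall>f\<in>C. \<forall>g\<in>C. \<forall>h\<in>C. \<forall>p\<in>W. br f (br g h) p + br g (br h f) p + br h (br f g) p = 0)"

text \<open>Smooth sections over \<open>U\<close> of the second exterior power of the dual of \<open>\<Delta>' \<subseteq> T\<^sup>*M\<close>.\<close>

definition bivector_on ::
  "('a::topological_space, 'b::euclidean_space) chart set \<Rightarrow> 'a set \<Rightarrow> ('a \<Rightarrow> ('b \<Rightarrow>\<^sub>L real) set) \<Rightarrow>
     ('a \<Rightarrow> ('b \<Rightarrow>\<^sub>L real) \<Rightarrow> ('b \<Rightarrow>\<^sub>L real) \<Rightarrow> real) \<Rightarrow> bool" where
  "bivector_on A U \<Delta>' P \<longleftrightarrow>
     (\<forall>p\<in>U. alternating_on (\<Delta>' p) (P p)) \<and>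
     (\<forall>W \<xi> \<eta>. open W \<longrightarrow> W \<subseteq> U \<longrightarrow> smooth_covec A W \<xi> \<longrightarrow> smooth_covec A W \<eta> \<longrightarrow>
        (\<forall>p\<in>W. \<xi> p \<in> \<Delta>' p) \<longrightarrow> (\<forall>p\<in>W. \<eta> p \<in> \<Delta>' p) \<longrightarrow> smooth_fun A W (\<lambda>p. P p (\<xi> p) (\<eta> p)))"

definition bivector_bracket ::
  "('a, 'b::euclidean_space) chart set \<Rightarrow> ('a \<Rightarrow> ('b \<Rightarrow>\<^sub>L real) \<Rightarrow> ('b \<Rightarrow>\<^sub>L real) \<Rightarrow> real) \<Rightarrow>
     ('a \<Rightarrow> real) \<Rightarrow> ('a \<Rightarrow> real) \<Rightarrow> 'a \<Rightarrow> real" where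
  "bivector_bracket A P f g p = P p (dfun A f p) (dfun A g p)"

definition poisson_on ::
  "('a::topological_space, 'b::euclidean_space) chart set \<Rightarrow> 'a set \<Rightarrow>
     ('a \<Rightarrow> ('b \<Rightarrow>\<^sub>L real) \<Rightarrow> ('b \<Rightarrow>\<^sub>L real) \<Rightarrow> real) \<Rightarrow> bool" where
  "poisson_on A U P \<longleftrightarrow> bivector_on A U (\<lambda>_. UNIV) P \<and>
     (\<forall>W. open W \<longrightarrow> W \<subseteq> U \<longrightarrow>
        poisson_bracket_on W {f. smooth_fun A W f} (bivector_bracket A P))"

text \<open>
  A Poisson bracket on the sheaf of admissible functions, given by a section \<open>P\<close> over the
  annihilator of \<open>D\<close> through \<open>{f, g} = P(df, dg)\<close>. Compatibility with restrictions is automatic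
  since this bracket is defined pointwise.
\<close>

definition foliated_poisson_on ::
  "('a::topological_space, 'b::euclidean_space) chart set \<Rightarrow> 'a set \<Rightarrow> ('a \<Rightarrow> 'b set) \<Rightarrow>
     ('a \<Rightarrow> ('b \<Rightarrow>\<^sub>L real) \<Rightarrow> ('b \<Rightarrow>\<^sub>L real) \<Rightarrow> real) \<Rightarrow> bool" where
  "foliated_poisson_on A U D P \<longleftrightarrow>
     regular_foliation_on A U D \<and> bivector_on A U (\<lambda>p. annihilator (D p)) P \<and>
     (\<forall>W. open W \<longrightarrow> W \<subseteq> U \<longrightarrow>
        poisson_bracket_on W (admissible A D W) (bivector_bracket A P))"

end

theory Submission
  imports Defs
begin

text \<open>
  Let \<open>L\<close> be a Lagrangian subspace with image \<open>\<Delta>\<close> in \<open>V\<close> and kernel \<open>K = L \<inter> V\<close>. In dimension three an even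
  \<open>L\<close> has \<open>dim \<Delta> = 3\<close> or \<open>dim K = 1\<close>, an odd one has \<open>dim K = 0\<close> or \<open>dim \<Delta> = 2\<close>. These four conditions
  are open: if \<open>F\<close> is \<open>\<Delta>\<close> or \<open>K\<close> at one point, the Lagrangians nearby are parametrized by
  \<open>v + \<xi> \<mapsto> P v + (1 - P) \<xi>\<close> with \<open>P\<close> the orthogonal projection onto \<open>F\<close>, and when \<open>F\<close> has corank
  (respectively rank) at most one, isotropy forces their image (kernel) to be a graph over \<open>F\<close>.
  Involutivity under the Courant bracket makes this distribution integrable, so the Frobenius theorem
  gives the foliation; it is proved by flowing along the constant combinations of the graph frame, which
  needs smooth dependence of solutions of differential equations on parameters. Finally
  \<open>\<langle>[x, y], z\<rangle> = 0\<close> for sections \<open>x, y, z\<close> is the closedness of the form on \<open>\<Delta>\<close> and, for sections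
  \<open>X\<^sub>f + df\<close>, the Jacobi identity of the bracket on functions with differentials in \<open>Ann K\<close>.
\<close>

section \<open>Calculus of smooth maps\<close>

text \<open>No single description of E can hold everywhere, because ranks jump: where E is the graph
  of a two-form that vanishes at a point, K is the whole tangent space there but may be a line
  nearby. Hence the cover by two open regions. In dimension three the even types are (3,0), (1,0),
  (1,2), the first two with dim \<Delta> = 3 and the last two with dim K = 1; the odd ones are
  (0,3), (0,1), (2,1), the first two with dim K = 0 and the last two with dim \<Delta> = 2. Type
  (0,2) cannot occur, since an alternating form on a line vanishes. Openness of the regions does not
  come from parity but from the bound on the corank or rank. The bracket condition constrains
  sections of E only, so fields in \<Delta> and one-forms in Ann K must first be lifted smoothly to
  E; the graph parametrization supplies the lifts. A foliation chart has to belong to the maximal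
  smooth atlas, so the flow must be smooth and not just C^1: solutions are shown to be C^k for every
  k on a time interval that does not shrink with k.\<close>

lemma Ck_on_cong:
  assumes "open S" "\<And>x. x \<in> S \<Longrightarrow> f x = g x" "Ck_on k S f"
  shows "Ck_on k S g"
  using assms(2,3)
proof (induction k arbitrary: f g)
  case 0
  then show ?case by (simp cong: continuous_on_cong)
next
  case (Suc k)
  have fg: "frechet_derivative f (at x) = frechet_derivative g (at x)"
      and dg: "g differentiable (at x)" if "x \<in> S" for x
  proof -
    have f: "f differentiable (at x)" using Suc.prems(2) that by simp
    show "frechet_derivative f (at x) = frechet_derivative g (at x)"
      by (rule frechet_derivative_transform_within_open[OF f assms(1) that Suc.prems(1)])
    show "g differentiable (at x)"
      using f has_derivative_transform_within_open[of f _ x UNIV S g] assms(1) that Suc.prems(1)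
      unfolding differentiable_def by auto
  qed
  have "Ck_on k S (\<lambda>x. frechet_derivative g (at x) v)" for v
    by (rule Suc.IH[of "\<lambda>x. frechet_derivative f (at x) v"]) (use fg Suc.prems(2) in auto)
  then show ?case using dg by simp
qed

lemma Ck_on_subset: "Ck_on k S f \<Longrightarrow> T \<subseteq> S \<Longrightarrow> Ck_on k T f"
  by (induction k arbitrary: f) (auto intro: continuous_on_subset)

text \<open>Every clause of \<open>Ck_on\<close> concerns continuity or full derivatives at single
  points, so open neighbourhoods suffice and S may be any set.\<close>

lemma Ck_on_local:
  assumes "\<And>x. x \<in> S \<Longrightarrow> \<exists>T. open T \<and> x \<in> T \<and> Ck_on k T f"
  shows "Ck_on k S f"
  using assms
proof (induction k arbitrary: f)
  case 0
  have "continuous (at x within S) f" if x: "x \<in> S" for x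
    using 0[OF x] by (auto simp: continuous_on_eq_continuous_at intro: continuous_at_imp_continuous_at_within)
  then show ?case by (simp add: continuous_on_eq_continuous_within)
next
  case (Suc k)
  have "f differentiable at x" if "x \<in> S" for x
    using Suc.prems[OF that] by auto
  moreover have "Ck_on k S (\<lambda>x. frechet_derivative f (at x) v)" for v
    by (rule Suc.IH) (use Suc.prems in fastforce)
  ultimately show ?case by simp
qed

lemma Ck_on_SucD: "Ck_on (Suc k) S f \<Longrightarrow> Ck_on k S f"
proof (induction k arbitrary: f)
  case 0
  then show ?case
    by (simp add: differentiable_at_imp_differentiable_on differentiable_imp_continuous_on)
next
  case (Suc k)
  then show ?case using Ck_on.simps(2) by blast
qed

text \<open>The inductions on k below go through this rule: on an open set a derivative given by a
  formula may replace \<open>frechet_derivative\<close>, by uniqueness.\<close>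

lemma Ck_on_SucI:
  assumes "open S" "\<And>x. x \<in> S \<Longrightarrow> (f has_derivative f' x) (at x)"
    "\<And>v. Ck_on k S (\<lambda>x. f' x v)"
  shows "Ck_on (Suc k) S f"
proof -
  have *: "f' x = frechet_derivative f (at x)" if "x \<in> S" for x
    using frechet_derivative_at[OF assms(2)[OF that]] .
  have "Ck_on k S (\<lambda>x. frechet_derivative f (at x) v)" for v
    by (rule Ck_on_cong[OF assms(1) _ assms(3)[of v]]) (simp add: *)
  then show ?thesis using assms(2) by (auto simp: differentiable_def)
qed

lemma Ck_on_has_derivative:
  assumes "Ck_on (Suc k) S f" "x \<in> S"
  shows "(f has_derivative frechet_derivative f (at x)) (at x)"
  using assms by (simp add: frechet_derivative_works)

lemma Ck_on_const: "Ck_on k S (\<lambda>x. c)"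
  by (induction k arbitrary: c) auto

lemma Ck_on_bounded_linear:
  assumes "bounded_linear h" "open S" "Ck_on k S f"
  shows "Ck_on k S (\<lambda>x. h (f x))"
  using assms(3)
proof (induction k arbitrary: f)
  case 0
  then show ?case
    by (simp add: bounded_linear.continuous_on[OF assms(1)])
next
  case (Suc k)
  show ?case
    by (rule Ck_on_SucI[OF assms(2) bounded_linear.has_derivative[OF assms(1) Ck_on_has_derivative[OF Suc.prems]]])
      (use Suc in auto)
qed

lemma Ck_on_add:
  assumes "open S" "Ck_on k S f" "Ck_on k S g"
  shows "Ck_on k S (\<lambda>x. f x + g x)"
  using assms(2,3)
proof (induction k arbitrary: f g)
  case 0
  then show ?case by (simp add: continuous_on_add)
next
  case (Suc k)
  show ?case
    by (rule Ck_on_SucI[OF assms(1) has_derivative_add[OF Ck_on_has_derivative[OF Suc.prems(1)] Ck_on_has_derivative[OF Suc.prems(2)]]])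
      (use Suc in auto)
qed

lemma Ck_on_sum:
  assumes "open S" "\<And>i. i \<in> I \<Longrightarrow> Ck_on k S (f i)"
  shows "Ck_on k S (\<lambda>x. \<Sum>i\<in>I. f i x)"
  using assms(2)
  by (induction I rule: infinite_finite_induct) (auto simp: Ck_on_const intro!: Ck_on_add assms(1))

lemma Ck_on_bilinear:
  assumes B: "bounded_bilinear B" and S: "open S" and "Ck_on k S f" "Ck_on k S g"
  shows "Ck_on k S (\<lambda>x. B (f x) (g x))"
  using assms(3,4)
proof (induction k arbitrary: f g)
  case 0
  then show ?case by (simp add: bounded_bilinear.continuous_on[OF B])
next
  case (Suc k)
  show ?case
    by (rule Ck_on_SucI[OF S bounded_bilinear.FDERIV[OF B Ck_on_has_derivative[OF Suc.prems(1)] Ck_on_has_derivative[OF Suc.prems(2)]]])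
      (use Suc.prems in \<open>auto intro!: Ck_on_add S Suc.IH Ck_on_SucD[of k S f] Ck_on_SucD[of k S g]\<close>)
qed

text \<open>The derivative of 1/f is a product of Df with two factors 1/f, and these factors are C^k
  by the induction hypothesis.\<close>

lemma Ck_on_inverse:
  fixes f :: "'a::real_normed_vector \<Rightarrow> real"
  assumes S: "open S" and "Ck_on k S f" "\<And>x. x \<in> S \<Longrightarrow> f x \<noteq> 0"
  shows "Ck_on k S (\<lambda>x. inverse (f x))"
  using assms(2,3)
proof (induction k)
  case 0
  then show ?case by (simp add: continuous_on_inverse)
next
  case (Suc k)
  have fk: "Ck_on k S f" using Ck_on_SucD Suc.prems(1) by blast
  have ik: "Ck_on k S (\<lambda>x. inverse (f x))" by (rule Suc.IH[OF fk Suc.prems(2)])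
  note m = Ck_on_bilinear[OF bounded_bilinear_mult S]
  show ?case
  proof (rule Ck_on_SucI[OF S])
    fix x assume "x \<in> S"
    show "((\<lambda>x. inverse (f x)) has_derivative (\<lambda>v. - 1 * (inverse (f x) * frechet_derivative f (at x) v * inverse (f x)))) (at x)"
      using Deriv.has_derivative_inverse[OF Suc.prems(2)[OF \<open>x \<in> S\<close>] Ck_on_has_derivative[OF Suc.prems(1) \<open>x \<in> S\<close>]] by simp
  next
    fix v
    show "Ck_on k S (\<lambda>x. - 1 * (inverse (f x) * frechet_derivative f (at x) v * inverse (f x)))"
      by (intro m ik Ck_on_const) (use Suc.prems in simp)
  qed
qed

text \<open>\<open>Ck_on\<close> speaks of derivatives along fixed vectors only. A derivative
  applied to a varying vector is reduced to fixed directions by this expansion.\<close>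

lemma bounded_linear_sum_Basis:
  fixes h :: "'b::euclidean_space \<Rightarrow> 'c::real_normed_vector"
  assumes "linear h"
  shows "h v = (\<Sum>b\<in>Basis. (v \<bullet> b) *\<^sub>R h b)"
proof -
  have "h v = h (\<Sum>b\<in>Basis. (v \<bullet> b) *\<^sub>R b)" by (simp add: euclidean_representation)
  then show ?thesis using assms by (simp add: linear_sum linear_cmul)
qed

text \<open>F x is the sum over the basis of the rank-one maps that send v to (v \<bullet> b) F x b,
  and each of these depends on F x b through a bounded linear map.\<close>

lemma Ck_on_blinfun:
  fixes F :: "'a::real_normed_vector \<Rightarrow> 'b::euclidean_space \<Rightarrow>\<^sub>L 'c::real_normed_vector"
  assumes "open S" "\<And>b. b \<in> Basis \<Longrightarrow> Ck_on k S (\<lambda>x. F x b)"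
  shows "Ck_on k S F"
proof -
  have "Ck_on k S (\<lambda>x. \<Sum>b\<in>Basis. blinfun_scaleR_left (F x b) o\<^sub>L blinfun_inner_left b)"
    by (intro Ck_on_sum assms(1) Ck_on_bounded_linear[OF bounded_linear_compose[OF
        bounded_bilinear.bounded_linear_left[OF bounded_bilinear_blinfun_compose] bounded_linear_blinfun_scaleR_left]]) (use assms in auto)
  moreover have "(\<Sum>b\<in>Basis. blinfun_scaleR_left (F x b) o\<^sub>L blinfun_inner_left b) = F x" for x
    by (rule blinfun_eqI)
      (simp add: blinfun.sum_left inner_commute bounded_linear_sum_Basis[OF bounded_linear.linear[OF blinfun.bounded_linear_right[of "F x"]], symmetric])
  ultimately show ?thesis by simp
qed

text \<open>In the chain rule Df is applied to the varying vector Dg(x)v, which is expanded over the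
  basis of the intermediate space. The induction hypothesis then applies to the functions Df(.)b
  with fixed b.\<close>

lemma Ck_on_compose:
  fixes f :: "'b::euclidean_space \<Rightarrow> 'c::real_normed_vector" and g :: "'a::real_normed_vector \<Rightarrow> 'b"
  assumes T: "open T" and S: "open S" and "Ck_on k T f" "Ck_on k S g" "g ` S \<subseteq> T"
  shows "Ck_on k S (\<lambda>x. f (g x))"
  using assms(3,4)
proof (induction k arbitrary: f)
  case 0
  then show ?case using assms(5) by (auto intro: continuous_on_compose2)
next
  case (Suc k)
  have gk: "Ck_on k S g" using Ck_on_SucD Suc.prems(2) by blast
  show ?case
  proof (rule Ck_on_SucI[OF S])
    fix x assume x: "x \<in> S"
    have D: "(f has_derivative frechet_derivative f (at (g x))) (at (g x))"
      using Ck_on_has_derivative[OF Suc.prems(1)] x assms(5) by blast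
    have "((\<lambda>x. f (g x)) has_derivative (\<lambda>v. frechet_derivative f (at (g x)) (frechet_derivative g (at x) v))) (at x)"
      by (rule has_derivative_compose[OF Ck_on_has_derivative[OF Suc.prems(2) x] D])
    moreover have "(\<lambda>v. frechet_derivative f (at (g x)) (frechet_derivative g (at x) v)) =
       (\<lambda>v. \<Sum>b\<in>Basis. (frechet_derivative g (at x) v \<bullet> b) *\<^sub>R frechet_derivative f (at (g x)) b)"
      by (rule ext, rule bounded_linear_sum_Basis) (rule has_derivative_linear[OF D])
    ultimately show "((\<lambda>x. f (g x)) has_derivative (\<lambda>v. \<Sum>b\<in>Basis. (frechet_derivative g (at x) v \<bullet> b) *\<^sub>R frechet_derivative f (at (g x)) b)) (at x)"
      by simp
  next
    fix v
    show "Ck_on k S (\<lambda>x. \<Sum>b\<in>Basis. (frechet_derivative g (at x) v \<bullet> b) *\<^sub>R frechet_derivative f (at (g x)) b)"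
      by (intro Ck_on_sum S Ck_on_bilinear[OF bounded_bilinear_scaleR]
          Ck_on_bounded_linear[OF bounded_linear_inner_left] Suc.IH gk)
        (use Suc.prems in auto)
  qed
qed

section \<open>Smooth maps, by transfer from C^k for all k\<close>

lemma smooth_on_cong:
  "open S \<Longrightarrow> (\<And>x. x \<in> S \<Longrightarrow> f x = g x) \<Longrightarrow> smooth_on S f \<Longrightarrow> smooth_on S g"
  unfolding smooth_on_def using Ck_on_cong by blast

lemma smooth_on_subset: "smooth_on S f \<Longrightarrow> T \<subseteq> S \<Longrightarrow> smooth_on T f"
  unfolding smooth_on_def using Ck_on_subset by blast

lemma smooth_on_local:
  "(\<And>x. x \<in> S \<Longrightarrow> \<exists>T. open T \<and> x \<in> T \<and> smooth_on T f) \<Longrightarrow> smooth_on S f"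
  unfolding smooth_on_def by (meson Ck_on_local)

lemma smooth_on_const: "smooth_on S (\<lambda>x. c)"
  by (simp add: smooth_on_def Ck_on_const)

lemma smooth_on_bounded_linear:
  "bounded_linear h \<Longrightarrow> open S \<Longrightarrow> smooth_on S f \<Longrightarrow> smooth_on S (\<lambda>x. h (f x))"
  by (simp add: smooth_on_def Ck_on_bounded_linear)

lemma smooth_on_ident: "smooth_on S (\<lambda>x. x)"
proof -
  have "Ck_on k S (\<lambda>x. x)" for k
    by (cases k) (auto simp: Ck_on_const)
  then show ?thesis by (simp add: smooth_on_def)
qed

lemma smooth_on_linear: "bounded_linear h \<Longrightarrow> smooth_on S h"
  using smooth_on_bounded_linear[OF _ open_UNIV smooth_on_ident] smooth_on_subset subset_UNIV by blast

lemma smooth_on_add: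
  "open S \<Longrightarrow> smooth_on S f \<Longrightarrow> smooth_on S g \<Longrightarrow> smooth_on S (\<lambda>x. f x + g x)"
  by (simp add: smooth_on_def Ck_on_add)

lemma smooth_on_sum:
  "open S \<Longrightarrow> (\<And>i. i \<in> I \<Longrightarrow> smooth_on S (f i)) \<Longrightarrow> smooth_on S (\<lambda>x. \<Sum>i\<in>I. f i x)"
  by (simp add: smooth_on_def Ck_on_sum)

lemma smooth_on_bilinear:
  "bounded_bilinear B \<Longrightarrow> open S \<Longrightarrow> smooth_on S f \<Longrightarrow> smooth_on S g \<Longrightarrow> smooth_on S (\<lambda>x. B (f x) (g x))"
  by (simp add: smooth_on_def Ck_on_bilinear)

lemma smooth_on_diff:
  assumes "open S" "smooth_on S f" "smooth_on S g" shows "smooth_on S (\<lambda>x. f x - g x)"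
  using smooth_on_add[OF assms(1,2) smooth_on_bounded_linear[OF bounded_linear_minus[OF bounded_linear_ident] assms(1,3)]]
  by simp

lemma smooth_on_prod:
  fixes f :: "'i \<Rightarrow> 'a::real_normed_vector \<Rightarrow> real"
  assumes "open S" "\<And>i. i \<in> I \<Longrightarrow> smooth_on S (f i)"
  shows "smooth_on S (\<lambda>x. \<Prod>i\<in>I. f i x)"
  using assms(2)
  by (induction I rule: infinite_finite_induct)
    (auto simp: smooth_on_const intro!: smooth_on_bilinear[OF bounded_bilinear_mult] assms(1))

lemma smooth_on_inverse:
  fixes f :: "'a::real_normed_vector \<Rightarrow> real"
  shows "open S \<Longrightarrow> smooth_on S f \<Longrightarrow> (\<And>x. x \<in> S \<Longrightarrow> f x \<noteq> 0) \<Longrightarrow> smooth_on S (\<lambda>x. inverse (f x))"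
  by (simp add: smooth_on_def Ck_on_inverse)

lemma smooth_on_blinfun:
  fixes F :: "'a::real_normed_vector \<Rightarrow> 'b::euclidean_space \<Rightarrow>\<^sub>L 'c::real_normed_vector"
  shows "open S \<Longrightarrow> (\<And>b. b \<in> Basis \<Longrightarrow> smooth_on S (\<lambda>x. F x b)) \<Longrightarrow> smooth_on S F"
  by (simp add: smooth_on_def Ck_on_blinfun)

lemma smooth_on_compose:
  fixes f :: "'b::euclidean_space \<Rightarrow> 'c::real_normed_vector" and g :: "'a::real_normed_vector \<Rightarrow> 'b"
  shows "open T \<Longrightarrow> open S \<Longrightarrow> smooth_on T f \<Longrightarrow> smooth_on S g \<Longrightarrow> g ` S \<subseteq> T \<Longrightarrow> smooth_on S (\<lambda>x. f (g x))"
  by (simp add: smooth_on_def Ck_on_compose)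

lemma Ck_on_Pair:
  assumes S: "open S" and "Ck_on k S f" "Ck_on k S g" shows "Ck_on k S (\<lambda>x. (f x, g x))"
proof -
  have "Ck_on k S (\<lambda>x. (f x, 0) + (0, g x))"
    by (intro Ck_on_add S Ck_on_bounded_linear[OF bounded_linear_Pair[OF bounded_linear_ident bounded_linear_zero]]
        Ck_on_bounded_linear[OF bounded_linear_Pair[OF bounded_linear_zero bounded_linear_ident]] assms)
  then show ?thesis by simp
qed

lemma smooth_on_continuous: "smooth_on S f \<Longrightarrow> continuous_on S f"
  unfolding smooth_on_def using Ck_on.simps(1) by blast

lemma smooth_on_differentiable: "smooth_on S f \<Longrightarrow> x \<in> S \<Longrightarrow> f differentiable (at x)"
  unfolding smooth_on_def using Ck_on.simps(2) by blast

lemma smooth_on_has_derivative: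
  "smooth_on S f \<Longrightarrow> x \<in> S \<Longrightarrow> (f has_derivative frechet_derivative f (at x)) (at x)"
  using smooth_on_differentiable frechet_derivative_works by blast

lemma smooth_on_frechet: "smooth_on S f \<Longrightarrow> smooth_on S (\<lambda>x. frechet_derivative f (at x) v)"
  unfolding smooth_on_def using Ck_on.simps(2) by blast

lemma smooth_on_Blinfun_frechet:
  fixes f :: "'a::euclidean_space \<Rightarrow> 'c::real_normed_vector"
  assumes "open S" "smooth_on S f"
  shows "smooth_on S (\<lambda>x. Blinfun (frechet_derivative f (at x)))"
proof (rule smooth_on_blinfun[OF assms(1)])
  fix b :: 'a
  show "smooth_on S (\<lambda>x. Blinfun (frechet_derivative f (at x)) b)"
    by (rule smooth_on_cong[OF assms(1) _ smooth_on_frechet[OF assms(2), of b]])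
      (simp add: bounded_linear_Blinfun_apply has_derivative_bounded_linear[OF smooth_on_has_derivative[OF assms(2)]])
qed

text \<open>
  The mixed second difference of \<open>f\<close> is estimated with the mean value theorem in both orders.
\<close>

lemma second_difference_tendsto:
  fixes f :: "'a::real_normed_vector \<Rightarrow> real"
  assumes S: "open S" and x: "x \<in> S" and f: "Ck_on 2 S f" and "0 < e"
  shows "\<exists>d>0. \<forall>t. 0 < t \<longrightarrow> t < d \<longrightarrow>
    \<bar>(f (x + t *\<^sub>R v + t *\<^sub>R w) - f (x + t *\<^sub>R v) - f (x + t *\<^sub>R w) + f x) / t\<^sup>2
      - frechet_derivative (\<lambda>y. frechet_derivative f (at y) v) (at x) w\<bar> < e"
proof -
  let ?fv = "\<lambda>y. frechet_derivative f (at y) v"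
  let ?H = "\<lambda>y. frechet_derivative ?fv (at y) w"
  have f': "Ck_on (Suc (Suc 0)) S f" using f by (simp add: numeral_2_eq_2 del: Ck_on.simps)
  then have fv: "Ck_on (Suc 0) S ?fv" by simp
  then have H: "continuous_on S ?H" by simp
  obtain r where r: "r > 0" "ball x r \<subseteq> S" using S x open_contains_ball by blast
  obtain r2 where r2: "r2 > 0" "\<And>y. dist y x < r2 \<Longrightarrow> y \<in> S \<Longrightarrow> dist (?H y) (?H x) < e"
    using H x \<open>0 < e\<close> unfolding continuous_on_iff by metis
  \<comment> \<open>For t < d the parallelogram with sides t v and t w stays within
    \<open>min r r2\<close> of x. The summand 1 keeps the denominator positive when v = w =
    0.\<close>
  define d where "d = min r r2 / (1 + norm v + norm w)"
  have pos: "1 + norm v + norm w > 0" by (smt (verit) norm_ge_zero)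
  have d: "d > 0" using r r2 pos by (simp add: d_def)
  have near: "dist (x + a *\<^sub>R v + b *\<^sub>R w) x < min r r2" if "0 \<le> a" "a \<le> t" "0 \<le> b" "b \<le> t" "t < d" for a b t
  proof -
    have "dist (x + a *\<^sub>R v + b *\<^sub>R w) x \<le> a * norm v + b * norm w"
      using norm_triangle_ineq[of "a *\<^sub>R v" "b *\<^sub>R w"] that by (simp add: dist_norm add.assoc)
    also have "\<dots> \<le> t * norm v + t * norm w"
      using that by (intro add_mono mult_right_mono) auto
    also have "\<dots> \<le> t * (1 + norm v + norm w)" using that by (simp add: algebra_simps)
    also have "\<dots> < d * (1 + norm v + norm w)" using that pos by simp
    also have "\<dots> = min r r2" using pos by (simp add: d_def)
    finally show ?thesis .
  qed
  have inS: "x + a *\<^sub>R v + b *\<^sub>R w \<in> S" if "0 \<le> a" "a \<le> t" "0 \<le> b" "b \<le> t" "t < d" for a b t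
    using near[OF that] r(2) by (auto simp: dist_commute)
  show ?thesis
  proof (intro exI[of _ d] conjI d allI impI)
    fix t assume t: "0 < t" "t < d"
    define g where "g = (\<lambda>s. f (x + s *\<^sub>R v + t *\<^sub>R w) - f (x + s *\<^sub>R v + 0 *\<^sub>R w))"
    have dg: "(g has_real_derivative (?fv (x + s *\<^sub>R v + t *\<^sub>R w) - ?fv (x + s *\<^sub>R v + 0 *\<^sub>R w))) (at s)"
      if s: "0 \<le> s" "s \<le> t" for s
    proof -
      have D: "((\<lambda>s. f (x + s *\<^sub>R v + b *\<^sub>R w)) has_derivative (\<lambda>h. h * ?fv (x + s *\<^sub>R v + b *\<^sub>R w))) (at s)"
        if b: "0 \<le> b" "b \<le> t" for b
      proof -
        have fd: "(f has_derivative frechet_derivative f (at (x + s *\<^sub>R v + b *\<^sub>R w))) (at (x + s *\<^sub>R v + b *\<^sub>R w))"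
          by (rule Ck_on_has_derivative[OF f' inS[OF s b t(2)]])
        have "((\<lambda>s. x + s *\<^sub>R v + b *\<^sub>R w) has_derivative (\<lambda>h. h *\<^sub>R v)) (at s)"
          by (auto intro!: derivative_eq_intros)
        from has_derivative_compose[OF this fd] show ?thesis
          using linear_cmul[OF has_derivative_linear[OF fd]] by simp
      qed
      have "(g has_derivative (\<lambda>h. h * ?fv (x + s *\<^sub>R v + t *\<^sub>R w) - h * ?fv (x + s *\<^sub>R v + 0 *\<^sub>R w))) (at s)"
        unfolding g_def by (rule has_derivative_diff[OF D D]) (use t in auto)
      then show ?thesis
        unfolding has_field_derivative_def
        by (rule has_derivative_eq_rhs) (simp add: fun_eq_iff algebra_simps)
    qed
    obtain s where s: "0 < s" "s < t" "g t - g 0 = (t - 0) * (?fv (x + s *\<^sub>R v + t *\<^sub>R w) - ?fv (x + s *\<^sub>R v + 0 *\<^sub>R w))"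
      using MVT2[OF t(1), of g "\<lambda>s. ?fv (x + s *\<^sub>R v + t *\<^sub>R w) - ?fv (x + s *\<^sub>R v + 0 *\<^sub>R w)"] dg by auto
    have dk: "((\<lambda>b. ?fv (x + s *\<^sub>R v + b *\<^sub>R w)) has_real_derivative ?H (x + s *\<^sub>R v + b *\<^sub>R w)) (at b)"
      if b: "0 \<le> b" "b \<le> t" for b
    proof -
      have fd: "(?fv has_derivative frechet_derivative ?fv (at (x + s *\<^sub>R v + b *\<^sub>R w))) (at (x + s *\<^sub>R v + b *\<^sub>R w))"
        by (rule Ck_on_has_derivative[OF fv inS[OF _ _ b t(2)]]) (use s in auto)
      have "((\<lambda>b. x + s *\<^sub>R v + b *\<^sub>R w) has_derivative (\<lambda>h. h *\<^sub>R w)) (at b)"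
        by (auto intro!: derivative_eq_intros)
      from has_derivative_compose[OF this fd] show ?thesis
        using linear_cmul[OF has_derivative_linear[OF fd]] by (simp add: has_field_derivative_def mult_commute_abs)
    qed
    obtain b where b: "0 < b" "b < t" "?fv (x + s *\<^sub>R v + t *\<^sub>R w) - ?fv (x + s *\<^sub>R v + 0 *\<^sub>R w) = (t - 0) * ?H (x + s *\<^sub>R v + b *\<^sub>R w)"
      using MVT2[OF t(1), of "\<lambda>b. ?fv (x + s *\<^sub>R v + b *\<^sub>R w)" "\<lambda>b. ?H (x + s *\<^sub>R v + b *\<^sub>R w)"] dk by auto
    have "g t - g 0 = t\<^sup>2 * ?H (x + s *\<^sub>R v + b *\<^sub>R w)" using s b by (simp add: power2_eq_square)
    moreover have "g t - g 0 = f (x + t *\<^sub>R v + t *\<^sub>R w) - f (x + t *\<^sub>R v) - f (x + t *\<^sub>R w) + f x"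
      by (simp add: g_def)
    moreover have "dist (?H (x + s *\<^sub>R v + b *\<^sub>R w)) (?H x) < e"
      by (rule r2(2)) (use near[of s t b] inS[of s t b] s b t in auto)
    ultimately show "\<bar>(f (x + t *\<^sub>R v + t *\<^sub>R w) - f (x + t *\<^sub>R v) - f (x + t *\<^sub>R w) + f x) / t\<^sup>2 - ?H x\<bar> < e"
      using t by (simp add: dist_real_def)
  qed
qed

text \<open>The mixed second difference does not change when v and w are exchanged, and both
  iterated derivatives are limits of the same quotient.\<close>

lemma second_derivative_symmetric:
  fixes f :: "'a::real_normed_vector \<Rightarrow> real"
  assumes S: "open S" and x: "x \<in> S" and f: "Ck_on 2 S f"
  shows "frechet_derivative (\<lambda>y. frechet_derivative f (at y) v) (at x) w =
         frechet_derivative (\<lambda>y. frechet_derivative f (at y) w) (at x) v" (is "?a = ?b")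
proof (rule ccontr)
  assume "?a \<noteq> ?b"
  then have e: "\<bar>?a - ?b\<bar> / 2 > 0" by simp
  obtain d1 where d1: "d1 > 0" "\<forall>t. 0 < t \<longrightarrow> t < d1 \<longrightarrow>
    \<bar>(f (x + t *\<^sub>R v + t *\<^sub>R w) - f (x + t *\<^sub>R v) - f (x + t *\<^sub>R w) + f x) / t\<^sup>2 - ?a\<bar> < \<bar>?a - ?b\<bar> / 2"
    using second_difference_tendsto[OF S x f e] by blast
  obtain d2 where d2: "d2 > 0" "\<forall>t. 0 < t \<longrightarrow> t < d2 \<longrightarrow>
    \<bar>(f (x + t *\<^sub>R w + t *\<^sub>R v) - f (x + t *\<^sub>R w) - f (x + t *\<^sub>R v) + f x) / t\<^sup>2 - ?b\<bar> < \<bar>?a - ?b\<bar> / 2"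
    using second_difference_tendsto[OF S x f e] by blast
  define t where "t = min d1 d2 / 2"
  have t: "0 < t" "t < d1" "t < d2" using d1 d2 by (auto simp: t_def)
  have eq: "(f (x + t *\<^sub>R w + t *\<^sub>R v) - f (x + t *\<^sub>R w) - f (x + t *\<^sub>R v) + f x) =
      (f (x + t *\<^sub>R v + t *\<^sub>R w) - f (x + t *\<^sub>R v) - f (x + t *\<^sub>R w) + f x)"
    by (simp add: algebra_simps)
  have a: "\<bar>(f (x + t *\<^sub>R v + t *\<^sub>R w) - f (x + t *\<^sub>R v) - f (x + t *\<^sub>R w) + f x) / t\<^sup>2 - ?a\<bar> < \<bar>?a - ?b\<bar> / 2"
    using d1(2)[rule_format, OF t(1,2)] .
  have b: "\<bar>(f (x + t *\<^sub>R v + t *\<^sub>R w) - f (x + t *\<^sub>R v) - f (x + t *\<^sub>R w) + f x) / t\<^sup>2 - ?b\<bar> < \<bar>?a - ?b\<bar> / 2"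
    using d2(2)[rule_format, OF t(1,3)] unfolding eq .
  have "\<And>q a b :: real. \<bar>q - a\<bar> < \<bar>a - b\<bar> / 2 \<Longrightarrow> \<bar>q - b\<bar> < \<bar>a - b\<bar> / 2 \<Longrightarrow> False"
    by (smt (verit) field_sum_of_halves)
  from this[OF a b] show False .
qed

lemma smooth_second_derivative_symmetric:
  fixes f :: "'a::real_normed_vector \<Rightarrow> 'b::euclidean_space"
  assumes S: "open S" and x: "x \<in> S" and f: "smooth_on S f"
  shows "frechet_derivative (\<lambda>y. frechet_derivative f (at y) v) (at x) w =
         frechet_derivative (\<lambda>y. frechet_derivative f (at y) w) (at x) v"
proof (rule euclidean_eqI)
  fix b :: 'b
  have fb: "smooth_on S (\<lambda>y. f y \<bullet> b)"
    by (rule smooth_on_bounded_linear[OF bounded_linear_inner_left S f])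
  have D1: "frechet_derivative (\<lambda>y. g y \<bullet> b) (at y) u = frechet_derivative g (at y) u \<bullet> b"
    if "smooth_on S g" "y \<in> S" for g :: "'a \<Rightarrow> 'b" and y u
    using frechet_derivative_at[OF bounded_linear.has_derivative[OF bounded_linear_inner_left smooth_on_has_derivative[OF that]], of b]
    by (simp add: fun_eq_iff)
  have D2: "frechet_derivative (\<lambda>y. frechet_derivative f (at y) u) (at x) u' \<bullet> b =
     frechet_derivative (\<lambda>y. frechet_derivative (\<lambda>y. f y \<bullet> b) (at y) u) (at x) u'" for u u'
  proof -
    have "frechet_derivative (\<lambda>y. frechet_derivative f (at y) u) (at x) u' \<bullet> b =
      frechet_derivative (\<lambda>y. frechet_derivative f (at y) u \<bullet> b) (at x) u'"
      using D1[OF smooth_on_frechet[OF f] x] by simp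
    also have "frechet_derivative (\<lambda>y. frechet_derivative f (at y) u \<bullet> b) (at x) =
      frechet_derivative (\<lambda>y. frechet_derivative (\<lambda>y. f y \<bullet> b) (at y) u) (at x)"
      by (rule frechet_derivative_transform_within_open[OF _ S x])
        (use D1[OF f] smooth_on_differentiable[OF smooth_on_bounded_linear[OF bounded_linear_inner_left S smooth_on_frechet[OF f]] x] in auto)
    finally show ?thesis .
  qed
  show "frechet_derivative (\<lambda>y. frechet_derivative f (at y) v) (at x) w \<bullet> b =
     frechet_derivative (\<lambda>y. frechet_derivative f (at y) w) (at x) v \<bullet> b"
    unfolding D2
    by (rule second_derivative_symmetric[OF S x]) (use fb smooth_on_def in blast)
qed

section \<open>Ordinary differential equations with parameters\<close>

lemma vector_derivative_bound:
  fixes f :: "real \<Rightarrow> 'b::real_normed_vector"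
  assumes "convex S" "\<And>t. t \<in> S \<Longrightarrow> (f has_vector_derivative f' t) (at t within S)"
    "\<And>t. t \<in> S \<Longrightarrow> norm (f' t) \<le> B" "a \<in> S" "b \<in> S"
  shows "norm (f a - f b) \<le> B * \<bar>a - b\<bar>"
proof -
  have "norm (f a - f b) \<le> B * norm (a - b)"
  proof (rule differentiable_bound[OF assms(1) _ _ assms(4,5)])
    fix x assume x: "x \<in> S"
    show "(f has_derivative (\<lambda>h. h *\<^sub>R f' x)) (at x within S)"
      using assms(2)[OF x] by (simp add: has_vector_derivative_def)
    show "onorm (\<lambda>h. h *\<^sub>R f' x) \<le> B"
      using assms(3)[OF x] by (intro onorm_le) (simp add: mult.commute[of B] mult_left_mono)
  qed
  then show ?thesis by simp
qed

text \<open>A substitute for the Gronwall inequality on short intervals. If N is the maximum of the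
  norm of f over S, the mean value bound gives N \<le> b + c a + (c k) N. Since c k \<le> 3/4, the
  last term is absorbed on the left, at the price of the factor 4.\<close>

lemma differential_inequality_bound:
  fixes f :: "real \<Rightarrow> 'b::real_normed_vector"
  assumes S: "compact S" "convex S" "0 \<in> S" "\<And>t. t \<in> S \<Longrightarrow> \<bar>t\<bar> \<le> c"
    and f: "\<And>t. t \<in> S \<Longrightarrow> (f has_vector_derivative f' t) (at t within S)"
    and f': "\<And>t. t \<in> S \<Longrightarrow> norm (f' t) \<le> a + k * norm (f t)"
    and "norm (f 0) \<le> b" "0 \<le> a" "0 \<le> k" "c * k \<le> 3/4" "t \<in> S"
  shows "norm (f t) \<le> 4 * (b + c * a)"
proof -
  have "continuous_on S f"
    using f by (meson has_vector_derivative_continuous continuous_on_eq_continuous_within)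
  then have "continuous_on S (\<lambda>t. norm (f t))" by (intro continuous_intros)
  then obtain t0 where t0: "t0 \<in> S" "\<And>t. t \<in> S \<Longrightarrow> norm (f t) \<le> norm (f t0)"
    using continuous_attains_sup[OF S(1)] S(3) by (metis emptyE)
  let ?N = "norm (f t0)"
  have c: "0 \<le> c" using S(3) S(4) by force
  have "norm (f' t) \<le> a + k * ?N" if "t \<in> S" for t
    using f'[OF that] t0(2)[OF that] \<open>0 \<le> k\<close> by (smt (verit) mult_left_mono)
  then have "norm (f t0 - f 0) \<le> (a + k * ?N) * \<bar>t0 - 0\<bar>"
    using vector_derivative_bound[OF S(2) f _ t0(1) S(3)] by blast
  also have "\<dots> \<le> (a + k * ?N) * c"
    using S(4)[OF t0(1)] assms by (intro mult_left_mono) auto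
  finally have "?N \<le> b + (a + k * ?N) * c"
    using \<open>norm (f 0) \<le> b\<close> norm_triangle_ineq2[of "f t0" "f 0"] by linarith
  also have "\<dots> = b + c * a + (c * k) * ?N" by (simp add: algebra_simps)
  also have "\<dots> \<le> b + c * a + 3/4 * ?N"
    using \<open>c * k \<le> 3/4\<close> by (intro add_left_mono mult_right_mono) auto
  finally have "?N \<le> 4 * (b + c * a)" by (simp add: algebra_simps)
  then show ?thesis using t0(2)[OF \<open>t \<in> S\<close>] by linarith
qed

text \<open>The difference of u and v satisfies the preceding inequality with a = b = 0. Only
  derivatives along the two curves are compared, so a solution can be identified with an explicit
  curve whose derivative is computed directly.\<close>

lemma ode_unique:
  fixes u v :: "real \<Rightarrow> 'b::real_normed_vector"
  assumes S: "compact S" "convex S" "0 \<in> S" "\<And>t. t \<in> S \<Longrightarrow> \<bar>t\<bar> \<le> c"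
    and u: "\<And>t. t \<in> S \<Longrightarrow> (u has_vector_derivative u' t) (at t within S)"
    and v: "\<And>t. t \<in> S \<Longrightarrow> (v has_vector_derivative v' t) (at t within S)"
    and "\<And>t. t \<in> S \<Longrightarrow> norm (u' t - v' t) \<le> k * norm (u t - v t)"
    and "u 0 = v 0" "0 \<le> k" "c * k \<le> 3/4" "t \<in> S"
  shows "u t = v t"
proof -
  have "norm (u t - v t) \<le> 4 * (0 + c * 0)"
    by (rule differential_inequality_bound[of S c "\<lambda>t. u t - v t" "\<lambda>t. u' t - v' t" 0 k])
      (use assms in \<open>auto intro!: has_vector_derivative_diff\<close>)
  then show ?thesis by simp
qed

text \<open>The rescaled integral is the integral of g from 0 to t. Written over the fixed interval
  [0,1] it makes sense for both signs of t, and its continuity in parameters is that of an integral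
  over a fixed box.\<close>

lemma integral_rescaled:
  fixes g :: "real \<Rightarrow> 'b::banach"
  assumes "continuous_on UNIV g"
  obtains H where "\<And>t. \<bar>t\<bar> \<le> T \<Longrightarrow> t *\<^sub>R integral {0..1} (\<lambda>s. g (s * t)) = H t - H 0"
    "\<And>t. \<bar>t\<bar> < T \<Longrightarrow> (H has_vector_derivative g t) (at t)"
proof -
  obtain H where H: "\<And>x. x \<in> {-T..T} \<Longrightarrow> (H has_vector_derivative g x) (at x within {-T..T})"
    using antiderivative_continuous[OF continuous_on_subset[OF assms subset_UNIV]] by blast
  have "t *\<^sub>R integral {0..1} (\<lambda>s. g (s * t)) = H t - H 0" if t: "\<bar>t\<bar> \<le> T" for t
  proof -
    have "((\<lambda>s. H (s * t)) has_vector_derivative t *\<^sub>R g (s * t)) (at s within {0..1})" if s: "s \<in> {0..1}" for s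
    proof -
      have st: "\<bar>s * t\<bar> \<le> T" if "s \<in> {0..1}" for s
        using that t by (simp add: abs_mult) (smt (verit) mult_left_le_one_le abs_ge_zero)
      then have im: "(\<lambda>s. s * t) ` {0..1} \<subseteq> {-T..T}" by (force simp: abs_le_iff)
      have "s * t \<in> {-T..T}" using st[OF s] by auto
      then have "(H has_vector_derivative g (s * t)) (at (s * t) within (\<lambda>s. s * t) ` {0..1})"
        using H im has_vector_derivative_within_subset by blast
      moreover have "((\<lambda>s. s * t) has_vector_derivative t) (at s within {0..1})"
        by (auto intro!: derivative_eq_intros simp: has_vector_derivative_def)
      ultimately show ?thesis
        using vector_diff_chain_within[of "\<lambda>s. s * t" t s "{0..1}" H "g (s * t)"] by (simp add: o_def)
    qed
    then have "((\<lambda>s. t *\<^sub>R g (s * t)) has_integral (H (1 * t) - H (0 * t))) {0..1}"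
      by (intro fundamental_theorem_of_calculus) auto
    then have "integral {0..1} (\<lambda>s. t *\<^sub>R g (s * t)) = H (1 * t) - H (0 * t)"
      by (rule integral_unique)
    then show ?thesis by simp
  qed
  moreover have "(H has_vector_derivative g t) (at t)" if "\<bar>t\<bar> < T" for t
    using H[of t] that at_within_interior[of t "{-T..T}"] by (auto simp: abs_less_iff)
  ultimately show ?thesis using that by blast
qed

text \<open>
  Banach's theorem is applied in the space of bounded continuous functions of time and parameter
  simultaneously, so that the solution is jointly continuous.
\<close>

lemma ode_exists:
  fixes F :: "real \<times> 'x::metric_space \<times> 'y::banach \<Rightarrow> 'y"
  assumes F: "continuous_on UNIV F" and B: "\<And>s x. norm (F (s, x, 0)) \<le> B"
    and K: "\<And>s x y z. norm (F (s, x, y) - F (s, x, z)) \<le> K * norm (y - z)"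
    and T: "0 < T" "T * K \<le> 1/2" "0 \<le> K"
  obtains u where "continuous_on UNIV u" "\<And>x. u (0, x) = 0"
    "\<And>t x. \<bar>t\<bar> < T \<Longrightarrow> ((\<lambda>t. u (t, x)) has_vector_derivative F (t, x, u (t, x))) (at t)"
proof -
  \<comment> \<open>Time is clamped to [-T, T], so that the Picard operator acts on bounded
    continuous functions on all of the product space, which is complete. For small times the
    clamping changes nothing.\<close>
  define c where "c = (\<lambda>t::real. max (-T) (min T t))"
  define I where "I = (\<lambda>(w::real \<times> 'x \<Rightarrow> 'y) p. c (fst p) *\<^sub>R integral {0..1} (\<lambda>s. F (s * c (fst p), snd p, w (s * c (fst p), snd p))))"
  have cont_c: "continuous_on UNIV c" unfolding c_def by (intro continuous_intros)
  have c_bound: "\<bar>c t\<bar> \<le> T" for t using T(1) by (auto simp: c_def)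
  have cont_F: "continuous_on S (\<lambda>s. F (f s, g s, h s))"
    if "continuous_on S f" "continuous_on S g" "continuous_on S h" for f g h and S :: "'q::topological_space set"
    by (rule continuous_on_compose2[OF F]) (use that in \<open>auto intro!: continuous_intros\<close>)
  have cont_I: "continuous_on UNIV (I (apply_bcontfun w))" for w :: "(real \<times> 'x) \<Rightarrow>\<^sub>C 'y"
  proof -
    have cw: "continuous_on S (\<lambda>s. w (f s, g s))"
      if "continuous_on S f" "continuous_on S g" for f g and S :: "'q::topological_space set"
      by (rule continuous_on_compose2[OF continuous_on_apply_bcontfun[of UNIV]]) (use that in \<open>auto intro!: continuous_intros\<close>)
    note cc = continuous_on_compose2[OF cont_c]
    have "continuous_on UNIV (\<lambda>p. integral (cbox 0 1) (\<lambda>s::real. F (s * c (fst p), snd p, w (s * c (fst p), snd p))))"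
      unfolding split_def
      by (rule integral_continuous_on_param) (auto simp: split_def intro!: cont_F cw cc continuous_intros)
    then show ?thesis unfolding I_def
      by (intro continuous_on_scaleR cc) (auto intro!: continuous_intros simp: cbox_interval)
  qed
  have w_bound: "norm (apply_bcontfun w p) \<le> norm w" for w :: "(real \<times> 'x) \<Rightarrow>\<^sub>C 'y" and p
    by (rule norm_bounded)
  have cont1: "continuous_on {0..1} (\<lambda>s. F (s * c (fst p), snd p, w (s * c (fst p), snd p)))"
    for w :: "(real \<times> 'x) \<Rightarrow>\<^sub>C 'y" and p
    by (intro cont_F continuous_intros continuous_on_compose2[OF continuous_on_apply_bcontfun[of UNIV w]]) auto
  have I_bcont: "I (apply_bcontfun w) \<in> bcontfun" for w :: "(real \<times> 'x) \<Rightarrow>\<^sub>C 'y"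
  proof (rule bcontfun_normI[OF cont_I])
    fix p
    have "norm (F (s, x, y)) \<le> B + K * norm y" for s x y
      using B[of s x] K[of s x y 0] norm_triangle_ineq2[of "F (s, x, y)" "F (s, x, 0)"] by simp
    then have "norm (F (s, x, w q)) \<le> B + K * norm w" for s x q
      using w_bound[of w q] T(3) by (smt (verit) mult_left_mono)
    then have "norm (integral {0..1} (\<lambda>s. F (s * c (fst p), snd p, w (s * c (fst p), snd p)))) \<le> (B + K * norm w) * (1 - 0)"
      by (intro integral_bound cont1) auto
    then show "norm (I (apply_bcontfun w) p) \<le> T * (B + K * norm w)"
      unfolding I_def using c_bound[of "fst p"] T(1) by (simp add: mult_mono)
  qed
  define \<Phi> where "\<Phi> = (\<lambda>w. Bcontfun (I (apply_bcontfun w)))"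
  have \<Phi>: "apply_bcontfun (\<Phi> w) = I (apply_bcontfun w)" for w
    unfolding \<Phi>_def by (rule Bcontfun_inverse[OF I_bcont])
  \<comment> \<open>The factor 1/2 is the product of the Lipschitz constant K and the bound T on the
    clamped time.\<close>
  have "dist (\<Phi> w) (\<Phi> z) \<le> 1/2 * dist w z" for w z
  proof (rule dist_bound)
    fix p
    let ?f = "\<lambda>w s. F (s * c (fst p), snd p, apply_bcontfun w (s * c (fst p), snd p))"
    have "norm (?f w s - ?f z s) \<le> K * dist w z" for s
      using K[of "s * c (fst p)" "snd p" "w (s * c (fst p), snd p)" "z (s * c (fst p), snd p)"]
        dist_bounded[of w "(s * c (fst p), snd p)" z] T(3)
      by (smt (verit) dist_norm mult_left_mono)
    then have "norm (integral {0..1} (\<lambda>s. ?f w s - ?f z s)) \<le> (K * dist w z) * (1 - 0)"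
      by (intro integral_bound continuous_on_diff cont1) auto
    moreover have "integral {0..1} (\<lambda>s. ?f w s - ?f z s) = integral {0..1} (?f w) - integral {0..1} (?f z)"
      by (intro integral_diff integrable_continuous_real cont1)
    ultimately have "norm (I w p - I z p) \<le> \<bar>c (fst p)\<bar> * (K * dist w z)"
      unfolding I_def by (simp flip: scaleR_diff_right) (simp add: mult_left_mono)
    also have "\<dots> \<le> T * (K * dist w z)"
      using c_bound T(3) by (intro mult_right_mono) auto
    also have "\<dots> = (T * K) * dist w z" by simp
    also have "\<dots> \<le> 1/2 * dist w z" using T(2) by (intro mult_right_mono) auto
    finally show "dist (\<Phi> w p) (\<Phi> z p) \<le> 1/2 * dist w z" by (simp add: \<Phi> dist_norm)
  qed
  then obtain w where w: "\<Phi> w = w" using banach_fix_type[of "1/2" \<Phi>] by auto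
  define u where "u = apply_bcontfun w"
  have u: "u = I u" unfolding u_def using \<Phi>[of w] w by simp
  have cont_u: "continuous_on UNIV u" by (simp add: u_def)
  show ?thesis
  proof (rule that[OF cont_u])
    fix x
    show "u (0, x) = 0" using T(1) by (subst u) (simp add: I_def c_def)
    fix t assume t: "\<bar>t\<bar> < T"
    have "continuous_on UNIV (\<lambda>s. F (s, x, u (s, x)))"
      by (intro cont_F continuous_intros continuous_on_compose2[OF cont_u]) auto
    then obtain H where H: "\<And>t. \<bar>t\<bar> \<le> T \<Longrightarrow> t *\<^sub>R integral {0..1} (\<lambda>s. F (s * t, x, u (s * t, x))) = H t - H 0"
      "\<And>t. \<bar>t\<bar> < T \<Longrightarrow> (H has_vector_derivative F (t, x, u (t, x))) (at t)"
      by (rule integral_rescaled[of "\<lambda>s. F (s, x, u (s, x))" T]) blast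
    have uH: "u (s, x) = H s - H 0" if "\<bar>s\<bar> < T" for s
    proof -
      have "c s = s" using that by (auto simp: c_def)
      then show ?thesis using H(1)[of s] that by (subst u) (simp add: I_def)
    qed
    have "((\<lambda>t. H t - H 0) has_vector_derivative F (t, x, u (t, x))) (at t)"
      using has_vector_derivative_diff[OF H(2)[OF t] has_vector_derivative_const] by simp
    then show "((\<lambda>t. u (t, x)) has_vector_derivative F (t, x, u (t, x))) (at t)"
    proof (rule has_vector_derivative_transform_within_open[where S = "{-T<..<T}"])
      show "t \<in> {-T<..<T}" using t by auto
    next
      fix s assume "s \<in> {-T<..<T}"
      then show "H s - H 0 = u (s, x)" using uH[of s] by auto
    qed auto
  qed
qed

text \<open>The remainder of the linearization is estimated with one radius d for all base points z
  in C. This follows from uniform continuity of F' on a compact neighbourhood of C inside Q.\<close>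

lemma uniform_linearization:
  fixes F :: "'a::euclidean_space \<Rightarrow> 'c::real_normed_vector" and F' :: "'a \<Rightarrow> 'a \<Rightarrow>\<^sub>L 'c"
  assumes Q: "open Q" and F: "\<And>z. z \<in> Q \<Longrightarrow> (F has_derivative F' z) (at z)"
    and F': "continuous_on Q F'" and C: "compact C" "C \<subseteq> Q" and e: "e > 0"
  obtains d where "d > 0"
    "\<And>(z::'a) (k::'a). z \<in> C \<Longrightarrow> norm k < d \<Longrightarrow> z + k \<in> Q \<and> norm (F (z + k) - F z - blinfun_apply (F' z) k) \<le> e * norm k"
proof -
  obtain r where r: "r > 0" "(\<Union>x\<in>C. cball x r) \<subseteq> Q"
    using compact_subset_open_imp_cball_epsilon_subset[OF C(1) Q C(2)] by blast
  let ?N = "(\<Union>x\<in>C. \<Union>y\<in>cball 0 r. {x + y})"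
  have N: "compact ?N" by (rule compact_sums'[OF C(1) compact_cball])
  have NQ: "?N \<subseteq> Q" using r(2) by (auto simp: subset_iff dist_norm) (metis add_diff_cancel_left' norm_minus_commute)
  have "uniformly_continuous_on ?N F'"
    by (rule compact_uniformly_continuous[OF continuous_on_subset[OF F' NQ] N])
  then obtain d where d: "d > 0" "\<And>x y. x \<in> ?N \<Longrightarrow> y \<in> ?N \<Longrightarrow> dist y x < d \<Longrightarrow> dist (F' y) (F' x) < e"
    unfolding uniformly_continuous_on_def using e by metis
  show ?thesis
  proof (rule that[of "min d r"])
    show "min d r > 0" using d r by simp
    fix z k :: 'a assume z: "z \<in> C" and k: "norm k < min d r"
    let ?S = "ball z (min d r)"
    have SN: "?S \<subseteq> ?N"
    proof
      fix y assume "y \<in> ?S"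
      then have "y = z + (y - z)" "y - z \<in> cball 0 r" by (auto simp: dist_norm norm_minus_commute)
      then show "y \<in> ?N" using z by blast
    qed
    have zS: "z \<in> ?S" using d r by simp
    have kS: "z + k \<in> ?S" using k by (simp add: dist_norm)
    have "norm (F (z + k) - F z - F' z (z + k - z)) \<le> norm (z + k - z) * e"
    proof (rule differentiable_bound_linearization[of z "z + k" ?S])
      fix t :: real assume "t \<in> {0..1}"
      then have "norm (t *\<^sub>R k) \<le> norm k" by (simp add: mult_left_le_one_le)
      then show "z + t *\<^sub>R (z + k - z) \<in> ?S" using k by (simp add: dist_norm)
    next
      fix x assume x: "x \<in> ?S"
      then have "x \<in> Q" using SN NQ by blast
      then show "(F has_derivative F' x) (at x within ?S)" using F has_derivative_at_withinI by blast
      have "x \<in> ?N" "z \<in> ?N" using SN x zS by blast+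
      then have "dist (F' x) (F' z) < e" by (intro d(2)) (use x in \<open>simp_all add: dist_commute\<close>)
      then have "onorm (blinfun_apply (F' x - F' z)) \<le> e" by (simp add: dist_norm norm_blinfun.rep_eq)
      then show "onorm (blinfun_apply (F' x) - blinfun_apply (F' z)) \<le> e"
        by (simp only: minus_blinfun.rep_eq fun_diff_def)
    qed (rule zS)
    moreover have "z + k \<in> Q" using kS SN NQ by blast
    ultimately show "z + k \<in> Q \<and> norm (F (z + k) - F z - F' z k) \<le> e * norm k"
      by (simp add: mult.commute)
  qed
qed

lemma continuous_on_compact_norm_bound:
  fixes f :: "'a::topological_space \<Rightarrow> 'b::real_normed_vector"
  assumes "compact C" "continuous_on C f"
  shows "\<exists>B. \<forall>p\<in>C. norm (f p) \<le> B"
  using compact_imp_bounded[OF compact_continuous_image[OF assms(2,1)]]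
  by (auto simp: bounded_iff)

lemma ode_C1_local:
  fixes F :: "real \<times> 'x::euclidean_space \<times> 'y::euclidean_space \<Rightarrow> 'y" and u :: "real \<times> 'x \<Rightarrow> 'y"
  assumes Q: "open Q" and F: "Ck_on 1 Q F" and G: "open G" and u0: "Ck_on 1 G u0"
    and K: "0 \<le> K" "T * K \<le> 1/2"
    and DF: "\<And>q v. q \<in> Q \<Longrightarrow> norm (frechet_derivative F (at q) (0, 0, v)) \<le> K * norm v"
    and u: "continuous_on ({-T<..<T} \<times> G) u"
    and inQ: "\<And>t x. \<bar>t\<bar> < T \<Longrightarrow> x \<in> G \<Longrightarrow> (t, x, u (t, x)) \<in> Q"
    and init: "\<And>x. x \<in> G \<Longrightarrow> u (0, x) = u0 x"
    and ode: "\<And>t x. \<bar>t\<bar> < T \<Longrightarrow> x \<in> G \<Longrightarrow> ((\<lambda>t. u (t, x)) has_vector_derivative F (t, x, u (t, x))) (at t)"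
    and T2: "0 < T2" "T2 < T" and x0: "x0 \<in> G"
  obtains r V where "r > 0" "ball x0 r \<subseteq> G"
    "\<And>e. continuous_on ({-T2<..<T2} \<times> ball x0 r) (\<lambda>p. blinfun_apply (V p) e)"
    "\<And>x e. x \<in> ball x0 r \<Longrightarrow> blinfun_apply (V (0, x)) e = frechet_derivative u0 (at x) e"
    "\<And>t x e. \<bar>t\<bar> < T2 \<Longrightarrow> x \<in> ball x0 r \<Longrightarrow> ((\<lambda>t. blinfun_apply (V (t, x)) e) has_vector_derivative
        frechet_derivative F (at (t, x, u (t, x))) (0, e, blinfun_apply (V (t, x)) e)) (at t)"
    "\<And>t x. \<bar>t\<bar> < T2 \<Longrightarrow> x \<in> ball x0 r \<Longrightarrow>
        (u has_derivative (\<lambda>(dt, e). dt *\<^sub>R F (t, x, u (t, x)) + blinfun_apply (V (t, x)) e)) (at (t, x))"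
proof -
  \<comment> \<open>An intermediate time: the uniform estimates need a compact cylinder that lies in
    the domain of u and contains the smaller open one of the conclusion.\<close>
  define T1 where "T1 = (T2 + T) / 2"
  have T1: "0 < T1" "T2 < T1" "T1 < T" "T1 * K \<le> 1/2"
  proof -
    show "0 < T1" "T2 < T1" "T1 < T" using T2 by (auto simp: T1_def)
    then have "T1 * K \<le> T * K" using K by (intro mult_right_mono) auto
    then show "T1 * K \<le> 1/2" using K by linarith
  qed
  obtain r where r: "r > 0" "cball x0 r \<subseteq> G" using G x0 open_contains_cball by blast
  define C where "C = {-T1..T1} \<times> cball x0 r"
  have C: "compact C" "convex C" "closed C" "C \<noteq> {}" and CP: "C \<subseteq> {-T<..<T} \<times> G"
  proof -
    show "compact C" unfolding C_def by (intro compact_Times) auto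
    then show "closed C" by (rule compact_imp_closed)
    show "convex C" unfolding C_def by (intro convex_Times) auto
    show "C \<noteq> {}" using r T1 by (auto simp: C_def)
    show "C \<subseteq> {-T<..<T} \<times> G" using r T1 by (auto simp: C_def)
  qed
  define F' where "F' = (\<lambda>q. Blinfun (frechet_derivative F (at q)))"
  have F'_deriv: "(F has_derivative blinfun_apply (F' q)) (at q)" and F'_eq: "blinfun_apply (F' q) = frechet_derivative F (at q)"
    if "q \<in> Q" for q
  proof -
    have "(F has_derivative frechet_derivative F (at q)) (at q)"
      using Ck_on_has_derivative[of 0 Q F q] F that by simp
    then show "blinfun_apply (F' q) = frechet_derivative F (at q)" "(F has_derivative blinfun_apply (F' q)) (at q)"
      by (simp_all add: F'_def bounded_linear_Blinfun_apply has_derivative_bounded_linear)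
  qed
  have F'_cont: "continuous_on Q F'"
  proof -
    have "Ck_on 0 Q F'"
    proof (rule Ck_on_blinfun[OF Q])
      fix b :: "real \<times> 'x \<times> 'y"
      have "Ck_on 0 Q (\<lambda>q. frechet_derivative F (at q) b)" using F by (simp del: split_paired_All)
      then show "Ck_on 0 Q (\<lambda>q. F' q b)" by (rule Ck_on_cong[OF Q, rotated]) (simp add: F'_eq)
    qed
    then show ?thesis by simp
  qed
  define D0 where "D0 = (\<lambda>x. Blinfun (frechet_derivative u0 (at x)))"
  have D0_deriv: "(u0 has_derivative blinfun_apply (D0 x)) (at x)" and D0_eq: "blinfun_apply (D0 x) = frechet_derivative u0 (at x)"
    if "x \<in> G" for x
  proof -
    have "(u0 has_derivative frechet_derivative u0 (at x)) (at x)"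
      using Ck_on_has_derivative[of 0 G u0 x] u0 that by simp
    then show "blinfun_apply (D0 x) = frechet_derivative u0 (at x)" "(u0 has_derivative blinfun_apply (D0 x)) (at x)"
      by (simp_all add: D0_def bounded_linear_Blinfun_apply has_derivative_bounded_linear)
  qed
  have D0_cont: "continuous_on G D0"
  proof -
    have "Ck_on 0 G D0"
    proof (rule Ck_on_blinfun[OF G])
      fix b :: "'x"
      have "Ck_on 0 G (\<lambda>q. frechet_derivative u0 (at q) b)" using u0 by (simp del: split_paired_All)
      then show "Ck_on 0 G (\<lambda>q. D0 q b)" by (rule Ck_on_cong[OF G, rotated]) (simp add: D0_eq)
    qed
    then show ?thesis by simp
  qed
  define ix :: "'x \<Rightarrow>\<^sub>L (real \<times> 'x \<times> 'y)" where "ix = Blinfun (\<lambda>e. (0, e, 0))"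
  define iy :: "'y \<Rightarrow>\<^sub>L (real \<times> 'x \<times> 'y)" where "iy = Blinfun (\<lambda>v. (0, 0, v))"
  have ix: "blinfun_apply ix e = (0, e, 0)" for e
    unfolding ix_def by (subst bounded_linear_Blinfun_apply) (auto intro!: bounded_linear_intros)
  have iy: "blinfun_apply iy e = (0, 0, e)" for e
    unfolding iy_def by (subst bounded_linear_Blinfun_apply) (auto intro!: bounded_linear_intros)
  define g where "g = (\<lambda>p. (fst p, snd p, u p))"
  have g_cont: "continuous_on ({-T<..<T} \<times> G) g"
    unfolding g_def by (intro continuous_intros u)
  have gQ: "g p \<in> Q" if "p \<in> {-T<..<T} \<times> G" for p
    using inQ[of "fst p" "snd p"] that by (auto simp: g_def abs_less_iff)
  define a where "a = (\<lambda>p. F' (g p) o\<^sub>L iy)"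
  define b where "b = (\<lambda>p. F' (g p) o\<^sub>L ix)"
  have F'g: "continuous_on C (\<lambda>p. F' (g p))"
    by (rule continuous_on_compose2[OF F'_cont continuous_on_subset[OF g_cont CP]]) (use gQ CP in auto)
  have a_cont: "continuous_on C a" and b_cont: "continuous_on C b"
    unfolding a_def b_def by (intro continuous_intros F'g bounded_bilinear.continuous_on[OF bounded_bilinear_blinfun_compose])+
  have D0C: "continuous_on C (\<lambda>p. D0 (snd p))"
    by (rule continuous_on_compose2[OF D0_cont]) (use CP in \<open>auto intro!: continuous_intros\<close>)
  have a_norm: "norm (a p) \<le> K" if "p \<in> C" for p
  proof (rule norm_blinfun_bound[OF K(1)])
    fix v
    have "g p \<in> Q" using that gQ CP by blast
    then show "norm (a p v) \<le> K * norm v"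
      using DF by (simp add: a_def iy F'_eq del: split_paired_All)
  qed
  \<comment> \<open>A continuous retraction onto the convex set C extends the coefficients a, b and
    D0 from C to the whole space, as \<open>ode_exists\<close> requires.\<close>
  define cl where "cl = closest_point C"
  have cl: "cl p \<in> C" for p unfolding cl_def using closest_point_in_set C by blast
  have cl_id: "cl p = p" if "p \<in> C" for p unfolding cl_def using that by (rule closest_point_self)
  have cl_cont: "continuous_on S cl" for S
    unfolding cl_def by (rule continuous_on_subset[OF continuous_on_closest_point]) (use C in auto)
  have cl_comp: "continuous_on S (\<lambda>z. f (cl (h z)))" if "continuous_on C f" "continuous_on S h"
    for f :: "real \<times> 'x \<Rightarrow> 'q::real_normed_vector" and h :: "'s::topological_space \<Rightarrow> real \<times> 'x" and S
    by (rule continuous_on_compose2[OF that(1)], rule continuous_on_compose2[OF cl_cont[of UNIV] that(2)]) (use cl in blast)+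
  \<comment> \<open>The solutions provided by \<open>ode_exists\<close> start at 0, so the equation
    is written for W = V - D0 instead of V.\<close>
  define FW where "FW = (\<lambda>(s::real, x::'x, W::'x \<Rightarrow>\<^sub>L 'y). b (cl (s, x)) + (a (cl (s, x)) o\<^sub>L (D0 (snd (cl (s, x))) + W)))"
  have "continuous_on C (\<lambda>p. b p + (a p o\<^sub>L D0 (snd p)))"
    by (intro continuous_intros a_cont b_cont D0C bounded_bilinear.continuous_on[OF bounded_bilinear_blinfun_compose])
  from continuous_on_compact_norm_bound[OF C(1) this] obtain B where
    B: "\<forall>p\<in>C. norm (b p + (a p o\<^sub>L D0 (snd p))) \<le> B" by blast
  have FW_cont: "continuous_on UNIV FW"
    unfolding FW_def split_def
    by (intro continuous_intros bounded_bilinear.continuous_on[OF bounded_bilinear_blinfun_compose]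
       cl_comp a_cont b_cont D0C)
  have FW_B: "norm (FW (s, x, 0)) \<le> B" for s x
    using bspec[OF B cl] by (simp add: FW_def)
  have FW_K: "norm (FW (s, x, y) - FW (s, x, z)) \<le> K * norm (y - z)" for s x y z
  proof -
    have "FW (s, x, y) - FW (s, x, z) = a (cl (s, x)) o\<^sub>L (y - z)"
      by (simp add: FW_def bounded_bilinear.diff_right[OF bounded_bilinear_blinfun_compose]
          bounded_bilinear.add_right[OF bounded_bilinear_blinfun_compose])
    also have "norm \<dots> \<le> norm (a (cl (s, x))) * norm (y - z)" by (rule norm_blinfun_compose)
    also have "\<dots> \<le> K * norm (y - z)" by (intro mult_right_mono a_norm cl) auto
    finally show ?thesis .
  qed
  obtain W where W: "continuous_on UNIV W" "\<And>x. W (0, x) = 0"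
    "\<And>t x. \<bar>t\<bar> < T1 \<Longrightarrow> ((\<lambda>t. W (t, x)) has_vector_derivative FW (t, x, W (t, x))) (at t)"
    by (rule ode_exists[OF FW_cont FW_B FW_K T1(1) T1(4) K(1)]) blast
  define V where "V = (\<lambda>p. D0 (snd p) + W p)"
  have V_cont: "continuous_on C V"
    unfolding V_def by (intro continuous_intros D0C continuous_on_subset[OF W(1)]) auto
  have V0: "V (0, x) = D0 x" for x by (simp add: V_def W)
  have inC: "(t, x) \<in> C" if "\<bar>t\<bar> \<le> T1" "x \<in> cball x0 r" for t x using that by (auto simp: C_def)
  have xG: "x \<in> G" if "x \<in> cball x0 r" for x using that r by blast
  have V_ode: "((\<lambda>t. V (t, x)) has_vector_derivative b (t, x) + (a (t, x) o\<^sub>L V (t, x))) (at t)"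
    if "\<bar>t\<bar> < T1" "x \<in> cball x0 r" for t x
  proof -
    have "cl (t, x) = (t, x)" using that by (intro cl_id inC) auto
    then have "FW (t, x, W (t, x)) = b (t, x) + (a (t, x) o\<^sub>L V (t, x))"
      by (simp add: FW_def V_def)
    then show ?thesis
      using has_vector_derivative_add[OF has_vector_derivative_const[of "D0 x"] W(3)[OF that(1), of x]]
      by (simp add: V_def)
  qed
  have V_ode_e: "((\<lambda>t. V (t, x) e) has_vector_derivative F' (g (t, x)) (0, e, V (t, x) e)) (at t)"
    if "\<bar>t\<bar> < T1" "x \<in> cball x0 r" for t x e
  proof -
    have "((\<lambda>t. V (t, x) e) has_vector_derivative (b (t, x) + (a (t, x) o\<^sub>L V (t, x))) e) (at t)"
      by (rule bounded_linear.has_vector_derivative[OF blinfun.bounded_linear_left V_ode[OF that]])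
    moreover have "(b (t, x) + (a (t, x) o\<^sub>L V (t, x))) e = F' (g (t, x)) (0, e, V (t, x) e)"
      by (simp add: a_def b_def ix iy blinfun.add_left flip: blinfun.add_right)
    ultimately show ?thesis by simp
  qed
  have der_x: "((\<lambda>y. u (t, y)) has_derivative V (t, x)) (at x)" if t: "\<bar>t\<bar> < T1" and x: "x \<in> ball x0 r" for t x
  proof -
    let ?S = "{-\<bar>t\<bar>..\<bar>t\<bar>}"
    have xc: "x \<in> cball x0 r" using x by auto
    have S_C: "?S \<times> {x} \<subseteq> C" using t xc by (auto simp: C_def)
    from continuous_on_compact_norm_bound[OF C(1) V_cont] obtain M where
      M: "\<forall>p\<in>C. norm (V p) \<le> M" by blast
    have M0: "0 \<le> M"
    proof -
      obtain p where "p \<in> C" using C(4) by blast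
      with M have "norm (V p) \<le> M" by blast
      then show ?thesis using norm_ge_zero order_trans by blast
    qed
    have lim: "\<exists>d>0. \<forall>h. norm h < d \<longrightarrow> norm (u (t, x + h) - u (t, x) - V (t, x) h) \<le> \<epsilon> * norm h"
      if eps: "\<epsilon> > 0" for \<epsilon>
    proof -
      \<comment> \<open>The first bound gives T1 \<eta> \<le> 1/4, so that T1 (K + \<eta>) \<le> 3/4
        as the differential inequality demands. The second makes the resulting constant 4 (\<eta> +
        T1 \<eta> (1 + M)) at most \<epsilon>.\<close>
      define \<eta> where "\<eta> = min (1 / (4 * T1)) (\<epsilon> / (4 * (1 + T1 * (1 + M))))"
      have pos: "0 < 1 + T1 * (1 + M)" using T1(1) M0 by (simp add: add_pos_nonneg)
      have \<eta>: "\<eta> > 0" using eps T1 pos by (simp add: \<eta>_def)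
      have \<eta>1: "T1 * \<eta> \<le> 1/4"
      proof -
        have "T1 * \<eta> \<le> T1 * (1 / (4 * T1))" using T1 by (intro mult_left_mono) (auto simp: \<eta>_def)
        then show ?thesis using T1 by simp
      qed
      have \<eta>2: "4 * (\<eta> + T1 * (\<eta> * (1 + M))) \<le> \<epsilon>"
      proof -
        have "4 * (1 + T1 * (1 + M)) * \<eta> \<le> 4 * (1 + T1 * (1 + M)) * (\<epsilon> / (4 * (1 + T1 * (1 + M))))"
          using pos by (intro mult_left_mono) (auto simp: \<eta>_def)
        also have "\<dots> = \<epsilon>" using pos by simp
        finally show ?thesis by (simp add: algebra_simps)
      qed
      have gC: "compact (g ` C)" "g ` C \<subseteq> Q"
        using compact_continuous_image[OF continuous_on_subset[OF g_cont CP] C(1)] gQ CP by auto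
      obtain d1 where d1: "d1 > 0" "\<And>z k. z \<in> g ` C \<Longrightarrow> norm k < d1 \<Longrightarrow>
          z + k \<in> Q \<and> norm (F (z + k) - F z - F' z k) \<le> \<eta> * norm k"
        by (rule uniform_linearization[OF Q F'_deriv F'_cont gC \<eta>]) (assumption, blast)
      have "uniformly_continuous_on C u"
        by (rule compact_uniformly_continuous[OF continuous_on_subset[OF u CP] C(1)])
      then obtain d2 where d2: "d2 > 0" "\<And>p q. p \<in> C \<Longrightarrow> q \<in> C \<Longrightarrow> dist q p < d2 \<Longrightarrow> dist (u q) (u p) < d1 / 2"
        unfolding uniformly_continuous_on_def using d1(1) by (metis half_gt_zero)
      obtain d3 where d3: "d3 > 0" "\<And>y. norm (y - x) < d3 \<Longrightarrow> norm (u0 y - u0 x - D0 x (y - x)) \<le> \<eta> * norm (y - x)"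
        using D0_deriv[OF xG[OF xc]] \<eta> unfolding has_derivative_at_alt by blast
      obtain d4 where d4: "d4 > 0" "ball x d4 \<subseteq> ball x0 r" using x open_contains_ball open_ball by blast
      \<comment> \<open>The increment of the argument of F consists of h and of the difference
        \<Delta> of two solutions. Each is kept below d1/2, so the uniform linearization applies to
        the pair.\<close>
      define d where "d = Min {d1 / 2, d2, d3, d4}"
      show ?thesis
      proof (intro exI[of _ d] conjI allI impI)
        show "d > 0" using d1 d2 d3 d4 by (simp add: d_def)
        fix h :: 'x assume "norm h < d"
        then have h: "norm h < d1 / 2" "norm h < d2" "norm h < d3" "norm h < d4" by (auto simp: d_def)
        have "x + h \<in> ball x d4" using h(4) by (simp add: dist_norm)
        then have xh: "x + h \<in> cball x0 r" using d4(2) by (meson ball_subset_cball subsetD)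
        define \<Delta> where "\<Delta> = (\<lambda>s. u (s, x + h) - u (s, x))"
        define \<delta> where "\<delta> = (\<lambda>s. \<Delta> s - V (s, x) h)"
        define \<delta>' where "\<delta>' = (\<lambda>s. F (s, x + h, u (s, x + h)) - F (s, x, u (s, x)) - F' (g (s, x)) (0, h, V (s, x) h))"
        have sT: "\<bar>s\<bar> < T1" if "s \<in> ?S" for s using that t by auto
        have "norm (\<delta> t) \<le> 4 * (\<eta> * norm h + T1 * (\<eta> * (1 + M) * norm h))"
        proof (rule differential_inequality_bound[where S = ?S and f' = \<delta>' and k = "K + \<eta>"])
          fix s assume s: "s \<in> ?S"
          show "\<bar>s\<bar> \<le> T1" using sT[OF s] by simp
          have sT': "\<bar>s\<bar> < T" using sT[OF s] T1 by simp
          have "(\<delta> has_vector_derivative \<delta>' s) (at s)"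
            unfolding \<delta>_def \<Delta>_def \<delta>'_def
            by (intro has_vector_derivative_diff ode sT' V_ode_e xc xG xh sT s)
          then show "(\<delta> has_vector_derivative \<delta>' s) (at s within ?S)"
            by (rule has_vector_derivative_at_within)
          have p: "(s, x) \<in> C" "(s, x + h) \<in> C" using sT[OF s] xc xh by (auto intro!: inC)
          have "dist (s, x + h) (s, x) < d2" using h by (simp add: dist_Pair_Pair dist_norm)
          from d2(2)[OF p this] have D: "norm (\<Delta> s) < d1 / 2" by (simp add: \<Delta>_def dist_norm)
          let ?k = "(0, h, \<Delta> s) :: real \<times> 'x \<times> 'y"
          have nk: "norm ?k \<le> norm h + norm (\<Delta> s)"
            using norm_Pair_le[of 0 "(h, \<Delta> s)"] norm_Pair_le[of h "\<Delta> s"] by simp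
          have k: "norm ?k < d1" using nk D h by linarith
          have gk: "g (s, x) + ?k = (s, x + h, u (s, x + h))" by (simp add: g_def \<Delta>_def)
          have R: "norm (F (s, x + h, u (s, x + h)) - F (s, x, u (s, x)) - F' (g (s, x)) ?k) \<le> \<eta> * norm ?k"
            using d1(2)[OF imageI[OF p(1)] k] unfolding gk by (simp add: g_def)
          have "F' (g (s, x)) ?k = F' (g (s, x)) (0, h, V (s, x) h) + a (s, x) (\<delta> s)"
            by (simp add: a_def iy \<delta>_def flip: blinfun.add_right)
          \<comment> \<open>The derivative of the error is the linearization remainder of F at the
            true increment (0, h, \<Delta>) plus a(s, x) applied to the error itself: replacing V h
            by \<Delta> in the linear term costs exactly this.\<close>
          then have "\<delta>' s = (F (s, x + h, u (s, x + h)) - F (s, x, u (s, x)) - F' (g (s, x)) ?k) + a (s, x) (\<delta> s)"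
            by (simp add: \<delta>'_def)
          then have "norm (\<delta>' s) \<le> \<eta> * norm ?k + norm (a (s, x) (\<delta> s))"
            by (simp only:) (rule norm_triangle_le[OF add_right_mono[OF R]])
          moreover have "norm (a (s, x) (\<delta> s)) \<le> K * norm (\<delta> s)"
            using norm_blinfun[of "a (s, x)" "\<delta> s"] a_norm[OF p(1)] by (smt (verit) mult_right_mono norm_ge_zero)
          moreover have "\<eta> * norm ?k \<le> \<eta> * (norm h + (norm (\<delta> s) + M * norm h))"
          proof -
            have "norm (V (s, x) h) \<le> M * norm h"
              using norm_blinfun[of "V (s, x)" h] bspec[OF M p(1)] by (smt (verit) mult_right_mono norm_ge_zero)
            then have "norm (\<Delta> s) \<le> norm (\<delta> s) + M * norm h"
              using norm_triangle_ineq[of "\<delta> s" "V (s, x) h"] by (simp add: \<delta>_def)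
            then show ?thesis using nk \<eta> by (intro mult_left_mono) auto
          qed
          ultimately have "norm (\<delta>' s) \<le> \<eta> * (norm h + (norm (\<delta> s) + M * norm h)) + K * norm (\<delta> s)" by linarith
          then show "norm (\<delta>' s) \<le> \<eta> * (1 + M) * norm h + (K + \<eta>) * norm (\<delta> s)" by (simp add: algebra_simps)
        next
          have "\<delta> 0 = u0 (x + h) - u0 x - D0 x h"
            using xc xh by (simp add: \<delta>_def \<Delta>_def init xG V0)
          then show "norm (\<delta> 0) \<le> \<eta> * norm h" using d3(2)[of "x + h"] h by simp
          show "T1 * (K + \<eta>) \<le> 3/4" using \<eta>1 T1(4) by (simp add: algebra_simps)
        qed (use \<eta> K M0 in auto)
        also have "\<dots> = 4 * (\<eta> + T1 * (\<eta> * (1 + M))) * norm h" by (simp add: algebra_simps)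
        also have "\<dots> \<le> \<epsilon> * norm h" by (intro mult_right_mono \<eta>2) auto
        finally show "norm (u (t, x + h) - u (t, x) - V (t, x) h) \<le> \<epsilon> * norm h"
          by (simp add: \<delta>_def \<Delta>_def)
      qed
    qed
    show ?thesis
      unfolding has_derivative_at_alt
    proof (intro conjI allI impI)
      show "bounded_linear (blinfun_apply (V (t, x)))" by (rule blinfun.bounded_linear_right)
      fix e :: real assume "e > 0"
      from lim[OF this] obtain d where d: "d > 0" "\<And>h. norm h < d \<Longrightarrow> norm (u (t, x + h) - u (t, x) - V (t, x) h) \<le> e * norm h"
        by blast
      show "\<exists>d>0. \<forall>y. norm (y - x) < d \<longrightarrow> norm (u (t, y) - u (t, x) - V (t, x) (y - x)) \<le> e * norm (y - x)"
        using d(1) d(2)[of "y - x" for y] by auto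
    qed
  qed
  show ?thesis
  proof (rule that[of r V])
    show "r > 0" "ball x0 r \<subseteq> G" using r by auto
    show "continuous_on ({-T2<..<T2} \<times> ball x0 r) (\<lambda>p. V p e)" for e
      by (rule bounded_linear.continuous_on[OF blinfun.bounded_linear_left continuous_on_subset[OF V_cont]])
        (use T1 in \<open>auto simp: C_def\<close>)
    show "V (0, x) e = frechet_derivative u0 (at x) e" if "x \<in> ball x0 r" for x e
      using D0_eq[OF xG[of x]] that by (simp add: V0)
    show "((\<lambda>t. V (t, x) e) has_vector_derivative frechet_derivative F (at (t, x, u (t, x))) (0, e, V (t, x) e)) (at t)"
      if t: "\<bar>t\<bar> < T2" and x: "x \<in> ball x0 r" for t x e
    proof -
      have "g (t, x) \<in> Q" by (rule gQ) (use t x xG[of x] T2 in \<open>auto simp: abs_less_iff\<close>)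
      from F'_eq[OF this] show ?thesis
        using V_ode_e[of t x e] t x T1 by (simp add: g_def)
    qed
    show "(u has_derivative (\<lambda>(dt, e). dt *\<^sub>R F (t, x, u (t, x)) + V (t, x) e)) (at (t, x))"
      if t: "\<bar>t\<bar> < T2" and x: "x \<in> ball x0 r" for t x
    proof -
      let ?X = "{-T2<..<T2}" and ?Y = "ball x0 r"
      have "((\<lambda>(t, x). u (t, x)) has_derivative (\<lambda>(dt, e). dt *\<^sub>R F (t, x, u (t, x)) + V (t, x) e)) (at (t, x) within ?X \<times> ?Y)"
      \<comment> \<open>The partial derivative in t exists at the point and the one in x is
        continuous around it, which yields the total derivative.\<close>
      proof (rule has_derivative_partialsI)
        show "((\<lambda>t. u (t, x)) has_derivative (\<lambda>h. h *\<^sub>R F (t, x, u (t, x)))) (at t within ?X)"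
          using ode[of t x] t x T2 xG[of x] by (auto simp: has_vector_derivative_def intro: has_derivative_at_withinI)
        show "((\<lambda>y. u (s, y)) has_derivative V (s, y)) (at y within ?Y)" if "s \<in> ?X" "y \<in> ?Y" for s y
          using der_x[of s y] that T1 by (auto intro: has_derivative_at_withinI)
        have "continuous_on (?X \<times> ?Y) V"
          by (rule continuous_on_subset[OF V_cont]) (use T1 in \<open>auto simp: C_def\<close>)
        then show "continuous (at (t, x) within ?X \<times> ?Y) (\<lambda>(t, x). V (t, x))"
          using t x by (auto simp: continuous_on_eq_continuous_within abs_less_iff)
      qed (use x in auto)
      moreover have "at (t, x) within ?X \<times> ?Y = at (t, x)"
        by (rule at_within_open) (use t x in \<open>auto intro!: open_Times\<close>)
      ultimately show ?thesis by simp
    qed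
  qed
qed

text \<open>Globalizes the local result: wherever a local V exists, V e is the derivative of u in
  the direction (0, e), hence independent of the choices made, and the local statements fit together
  on the whole domain.\<close>

lemma ode_variation:
  fixes F :: "real \<times> 'x::euclidean_space \<times> 'y::euclidean_space \<Rightarrow> 'y" and u :: "real \<times> 'x \<Rightarrow> 'y"
  defines "v \<equiv> \<lambda>e p. frechet_derivative u (at p) (0, e)"
  assumes Q: "open Q" and F1: "Ck_on 1 Q F" and G: "open G" and u01: "Ck_on 1 G u0"
    and T: "0 < T" and K: "0 \<le> K" "T * K \<le> 1/2"
    and DF: "\<And>q v. q \<in> Q \<Longrightarrow> norm (frechet_derivative F (at q) (0, 0, v)) \<le> K * norm v"
    and u: "continuous_on ({-T<..<T} \<times> G) u"
    and inQ: "\<And>t x. \<bar>t\<bar> < T \<Longrightarrow> x \<in> G \<Longrightarrow> (t, x, u (t, x)) \<in> Q"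
    and init: "\<And>x. x \<in> G \<Longrightarrow> u (0, x) = u0 x"
    and ode: "\<And>t x. \<bar>t\<bar> < T \<Longrightarrow> x \<in> G \<Longrightarrow> ((\<lambda>t. u (t, x)) has_vector_derivative F (t, x, u (t, x))) (at t)"
  shows "\<And>e. continuous_on ({-T<..<T} \<times> G) (v e)"
    and "\<And>x e. x \<in> G \<Longrightarrow> v e (0, x) = frechet_derivative u0 (at x) e"
    and "\<And>t x e. \<bar>t\<bar> < T \<Longrightarrow> x \<in> G \<Longrightarrow> ((\<lambda>t. v e (t, x)) has_vector_derivative
        frechet_derivative F (at (t, x, u (t, x))) (0, e, v e (t, x))) (at t)"
    and "\<And>t x. \<bar>t\<bar> < T \<Longrightarrow> x \<in> G \<Longrightarrow>
        (u has_derivative (\<lambda>(dt, e). dt *\<^sub>R F (t, x, u (t, x)) + v e (t, x))) (at (t, x))"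
proof -
  have loc: "\<exists>N. open N \<and> (t, x) \<in> N \<and> (\<forall>e. continuous_on N (v e)) \<and> (\<forall>e. v e (0, x) = frechet_derivative u0 (at x) e) \<and>
      (\<forall>e. ((\<lambda>t. v e (t, x)) has_vector_derivative frechet_derivative F (at (t, x, u (t, x))) (0, e, v e (t, x))) (at t)) \<and>
      (u has_derivative (\<lambda>(dt, e). dt *\<^sub>R F (t, x, u (t, x)) + v e (t, x))) (at (t, x))"
    if tx: "\<bar>t\<bar> < T" "x \<in> G" for t x
  proof -
    define T2 where "T2 = (\<bar>t\<bar> + T) / 2"
    have T2: "0 < T2" "\<bar>t\<bar> < T2" "T2 < T" using tx by (auto simp: T2_def)
    obtain r V where V: "r > 0" "ball x r \<subseteq> G"
      "\<And>e. continuous_on ({-T2<..<T2} \<times> ball x r) (\<lambda>p. blinfun_apply (V p) e)"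
      "\<And>y e. y \<in> ball x r \<Longrightarrow> blinfun_apply (V (0, y)) e = frechet_derivative u0 (at y) e"
      "\<And>t y e. \<bar>t\<bar> < T2 \<Longrightarrow> y \<in> ball x r \<Longrightarrow> ((\<lambda>t. blinfun_apply (V (t, y)) e) has_vector_derivative
          frechet_derivative F (at (t, y, u (t, y))) (0, e, blinfun_apply (V (t, y)) e)) (at t)"
      "\<And>t y e. \<bar>t\<bar> < T2 \<Longrightarrow> y \<in> ball x r \<Longrightarrow>
          (u has_derivative (\<lambda>(dt, e). dt *\<^sub>R F (t, y, u (t, y)) + blinfun_apply (V (t, y)) e)) (at (t, y))"
      by (rule ode_C1_local[OF Q F1 G u01 K DF u inQ init ode T2(1,3) tx(2)]) (assumption | blast)+
    let ?N = "{-T2<..<T2} \<times> ball x r"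
    have vV: "v e (s, y) = V (s, y) e" if "(s, y) \<in> ?N" for s y e
      using frechet_derivative_at[OF V(6)[of s y], symmetric] that by (auto simp: v_def abs_less_iff)
    have x: "x \<in> ball x r" using V(1) by simp
    have "open ?N" by (intro open_Times) auto
    moreover have "continuous_on ?N (v e)" for e
      using V(3)[of e] by (rule continuous_on_eq) (use vV in auto)
    moreover have "v e (0, x) = frechet_derivative u0 (at x) e" for e
      using vV[of 0 x e] V(4)[OF x] T2 x by simp
    moreover have "((\<lambda>t. v e (t, x)) has_vector_derivative frechet_derivative F (at (t, x, u (t, x))) (0, e, v e (t, x))) (at t)" for e
    proof (rule has_vector_derivative_transform_within_open[where S = "{-T2<..<T2}"])
      show "((\<lambda>t. V (t, x) e) has_vector_derivative frechet_derivative F (at (t, x, u (t, x))) (0, e, v e (t, x))) (at t)"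
        using V(5)[OF T2(2) x, of e] vV[of t x e] T2 x by (auto simp: abs_less_iff)
    qed (use vV x T2 in \<open>auto simp: abs_less_iff\<close>)
    moreover have "(u has_derivative (\<lambda>(dt, e). dt *\<^sub>R F (t, x, u (t, x)) + v e (t, x))) (at (t, x))"
      using V(6)[OF T2(2) x] vV[of t x] T2 x by (auto simp: abs_less_iff)
    moreover have "(t, x) \<in> ?N" using T2 x by (auto simp: abs_less_iff)
    ultimately show ?thesis by (intro exI[of _ ?N]) blast
  qed
  show "continuous_on ({-T<..<T} \<times> G) (v e)" for e
  proof -
    have "Ck_on 0 ({-T<..<T} \<times> G) (v e)"
    proof (rule Ck_on_local)
      fix p assume "p \<in> {-T<..<T} \<times> G"
      then obtain t x where "p = (t, x)" "\<bar>t\<bar> < T" "x \<in> G" by (cases p) auto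
      then show "\<exists>N. open N \<and> p \<in> N \<and> Ck_on 0 N (v e)" using loc[of t x] by auto
    qed
    then show ?thesis by simp
  qed
  show "v e (0, x) = frechet_derivative u0 (at x) e" if "x \<in> G" for x e
    using loc[of 0 x] that T by auto
  show "((\<lambda>t. v e (t, x)) has_vector_derivative
      frechet_derivative F (at (t, x, u (t, x))) (0, e, v e (t, x))) (at t)"
    if "\<bar>t\<bar> < T" "x \<in> G" for t x e
    using loc[OF that] by blast
  show "(u has_derivative (\<lambda>(dt, e). dt *\<^sub>R F (t, x, u (t, x)) + v e (t, x))) (at (t, x))"
    if "\<bar>t\<bar> < T" "x \<in> G" for t x
    using loc[OF that] by blast
qed

lemma ode_Ck:
  fixes F :: "real \<times> 'x::euclidean_space \<times> 'y::euclidean_space \<Rightarrow> 'y" and u :: "real \<times> 'x \<Rightarrow> 'y"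
  assumes G: "open G" and T: "0 < T" and K: "0 \<le> K" "T * K \<le> 1/2"
    and "open Q" "Ck_on k Q F" "Ck_on k G u0"
    and "\<And>q D v. q \<in> Q \<Longrightarrow> (F has_derivative D) (at q) \<Longrightarrow> norm (D (0, 0, v)) \<le> K * norm v"
    and "continuous_on ({-T<..<T} \<times> G) u"
    and "\<And>t x. \<bar>t\<bar> < T \<Longrightarrow> x \<in> G \<Longrightarrow> (t, x, u (t, x)) \<in> Q"
    and "\<And>x. x \<in> G \<Longrightarrow> u (0, x) = u0 x"
    and "\<And>t x. \<bar>t\<bar> < T \<Longrightarrow> x \<in> G \<Longrightarrow> ((\<lambda>t. u (t, x)) has_vector_derivative F (t, x, u (t, x))) (at t)"
  shows "Ck_on k ({-T<..<T} \<times> G) u"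
  using assms(5-)
proof (induction k arbitrary: Q F u0 u)
  case 0
  then show ?case by simp
next
  case (Suc k)
  note Q = Suc.prems(1) and F = Suc.prems(2) and u0 = Suc.prems(3) and DF = Suc.prems(4)
    and u = Suc.prems(5) and inQ = Suc.prems(6) and init = Suc.prems(7) and ode = Suc.prems(8)
  define P where "P = {-T<..<T} \<times> G"
  have P: "open P" unfolding P_def by (intro open_Times G open_greaterThanLessThan)
  have mem_P: "(t, x) \<in> P \<longleftrightarrow> \<bar>t\<bar> < T \<and> x \<in> G" for t x by (auto simp: P_def abs_less_iff)
  have F1: "Ck_on 1 Q F" and u01: "Ck_on 1 G u0"
    using F u0 by (induction k) (auto dest: Ck_on_SucD simp del: Ck_on.simps)
  have F_deriv: "(F has_derivative frechet_derivative F (at q)) (at q)" if "q \<in> Q" for q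
    by (rule Ck_on_has_derivative[OF F that])
  define v where "v e p = frechet_derivative u (at p) (0, e)" for e p
  note variation = ode_variation[OF Q F1 G u01 T K DF[OF _ F_deriv] u inQ init ode, folded v_def]
  have uk: "Ck_on k P u"
    unfolding P_def by (rule Suc.IH[OF Q Ck_on_SucD[OF F] Ck_on_SucD[OF u0]]) (fact DF u inQ init ode)+
  define g where "g = (\<lambda>p. (fst p, snd p, u p))"
  have gk: "Ck_on k P g"
    unfolding g_def
    by (intro Ck_on_Pair P uk Ck_on_bounded_linear[OF bounded_linear_fst] Ck_on_bounded_linear[OF bounded_linear_snd])
      (use smooth_on_ident smooth_on_def in blast)+
  have gQ: "g ` P \<subseteq> Q" using inQ mem_P by (auto simp: g_def)
  \<comment> \<open>The last component is unrestricted, because the variational equation is affine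
    in its unknown.\<close>
  define Q2 where "Q2 = {q::real \<times> 'x \<times> 'y. (fst q, fst (snd q)) \<in> P}"
  have Q2: "open Q2"
  proof -
    have "Q2 = (\<lambda>q. (fst q, fst (snd q))) -` P" by (auto simp: Q2_def)
    also have "open \<dots>" by (rule open_vimage[OF P]) (intro continuous_intros)
    finally show ?thesis .
  qed
  have vk: "Ck_on k P (v e)" for e
    unfolding P_def
  proof (rule Suc.IH[OF Q2, of "\<lambda>q. frechet_derivative F (at (g (fst q, fst (snd q)))) (0, e, snd (snd q))" "\<lambda>x. frechet_derivative u0 (at x) e"])
    show "Ck_on k Q2 (\<lambda>q. frechet_derivative F (at (g (fst q, fst (snd q)))) (0, e, snd (snd q)))"
    proof (rule Ck_on_cong[OF Q2])
      have pr: "Ck_on k Q2 (\<lambda>q. (fst q, fst (snd q)))"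
        by (intro Ck_on_Pair Q2 Ck_on_bounded_linear[OF bounded_linear_fst] Ck_on_bounded_linear[OF bounded_linear_snd])
          (use smooth_on_ident smooth_on_def in blast)+
      have "Ck_on k Q2 (\<lambda>q. g (fst q, fst (snd q)))"
        by (rule Ck_on_compose[OF P Q2 gk pr]) (auto simp: Q2_def)
      then have c: "Ck_on k Q2 (\<lambda>q. frechet_derivative F (at (g (fst q, fst (snd q)))) w)" for w
        by (rule Ck_on_compose[OF Q Q2, rotated]) (use F gQ in \<open>auto simp: Q2_def simp del: split_paired_All\<close>)
      show "Ck_on k Q2 (\<lambda>q. frechet_derivative F (at (g (fst q, fst (snd q)))) (0, e, 0) +
          (\<Sum>b\<in>Basis. (snd (snd q) \<bullet> b) *\<^sub>R frechet_derivative F (at (g (fst q, fst (snd q)))) (0, 0, b)))"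
        by (intro Ck_on_add Ck_on_sum Q2 c Ck_on_bilinear[OF bounded_bilinear_scaleR]
            Ck_on_bounded_linear[OF bounded_linear_inner_left] Ck_on_bounded_linear[OF bounded_linear_snd])
          (use smooth_on_ident smooth_on_def in blast)
    next
      fix q assume "q \<in> Q2"
      then have "g (fst q, fst (snd q)) \<in> Q" using gQ by (auto simp: Q2_def)
      then interpret L: linear "frechet_derivative F (at (g (fst q, fst (snd q))))"
        using F_deriv has_derivative_linear by blast
      have "linear (\<lambda>w. frechet_derivative F (at (g (fst q, fst (snd q)))) (0, 0, w))"
        by (rule linearI) (simp_all flip: L.add L.scaleR)
      from bounded_linear_sum_Basis[OF this, of "snd (snd q)"]
      show "frechet_derivative F (at (g (fst q, fst (snd q)))) (0, e, 0) +
          (\<Sum>b\<in>Basis. (snd (snd q) \<bullet> b) *\<^sub>R frechet_derivative F (at (g (fst q, fst (snd q)))) (0, 0, b)) =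
          frechet_derivative F (at (g (fst q, fst (snd q)))) (0, e, snd (snd q))"
        using L.add[of "(0, e, 0)" "(0, 0, snd (snd q))"] by simp
    qed
    show "Ck_on k G (\<lambda>x. frechet_derivative u0 (at x) e)" using u0 by simp
    show "norm (D (0, 0, w)) \<le> K * norm w" if q: "q \<in> Q2"
      and D: "((\<lambda>q. frechet_derivative F (at (g (fst q, fst (snd q)))) (0, e, snd (snd q))) has_derivative D) (at q)" for q D w
    proof -
      obtain t x y where qq: "q = (t, x, y)" by (cases q)
      have gq: "g (t, x) \<in> Q" using q gQ by (auto simp: Q2_def qq)
      have "((\<lambda>y. (t, x, y)) has_derivative (\<lambda>w. (0, 0, w))) (at y)"
        by (auto intro!: derivative_eq_intros)
      from has_derivative_compose[OF this, of "\<lambda>q. frechet_derivative F (at (g (fst q, fst (snd q)))) (0, e, snd (snd q))" D] D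
      have 1: "((\<lambda>y. frechet_derivative F (at (g (t, x))) (0, e, y)) has_derivative (\<lambda>w. D (0, 0, w))) (at y)"
        by (simp add: qq)
      have "((\<lambda>y. (0, e, y)) has_derivative (\<lambda>w. (0, 0, w))) (at y)"
        by (auto intro!: derivative_eq_intros)
      from bounded_linear.has_derivative[OF has_derivative_bounded_linear[OF F_deriv[OF gq]] this]
      have 2: "((\<lambda>y. frechet_derivative F (at (g (t, x))) (0, e, y)) has_derivative (\<lambda>w. frechet_derivative F (at (g (t, x))) (0, 0, w))) (at y)" .
      show ?thesis
        using fun_cong[OF has_derivative_unique[OF 1 2], of w] DF[OF gq F_deriv[OF gq], of w] by simp
    qed
    show "continuous_on ({-T<..<T} \<times> G) (v e)" by (rule variation(1))
    show "(t, x, v e (t, x)) \<in> Q2" if "\<bar>t\<bar> < T" "x \<in> G" for t x using that by (simp add: Q2_def mem_P)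
    show "v e (0, x) = frechet_derivative u0 (at x) e" if x: "x \<in> G" for x
      by (rule variation(2)) (assumption | rule x)+
    show "((\<lambda>t. v e (t, x)) has_vector_derivative
        frechet_derivative F (at (g (fst (t, x, v e (t, x)), fst (snd (t, x, v e (t, x)))))) (0, e, snd (snd (t, x, v e (t, x))))) (at t)"
      if "\<bar>t\<bar> < T" "x \<in> G" for t x
    proof -
      have "((\<lambda>t. v e (t, x)) has_vector_derivative frechet_derivative F (at (t, x, u (t, x))) (0, e, v e (t, x))) (at t)"
        by (rule variation(3)) (assumption | rule that)+
      then show ?thesis by (simp add: g_def)
    qed
  qed
  show ?case
    unfolding P_def[symmetric]
  proof (rule Ck_on_SucI[OF P])
    fix p assume "p \<in> P"
    then have p: "\<bar>fst p\<bar> < T" "snd p \<in> G" using mem_P[of "fst p" "snd p"] by simp_all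
    have "(u has_derivative (\<lambda>(dt, e). dt *\<^sub>R F (fst p, snd p, u (fst p, snd p)) + v e (fst p, snd p))) (at (fst p, snd p))"
      by (rule variation(4)) (assumption | rule p)+
    then show "(u has_derivative (\<lambda>h. fst h *\<^sub>R F (g p) + v (snd h) p)) (at p)"
      by (simp add: g_def split_def)
  next
    fix h :: "real \<times> 'x"
    show "Ck_on k P (\<lambda>p. fst h *\<^sub>R F (g p) + v (snd h) p)"
      by (intro Ck_on_add P vk Ck_on_bounded_linear[OF bounded_linear_scaleR_right]
          Ck_on_compose[OF Q P Ck_on_SucD[OF F] gk gQ])
  qed
qed

section \<open>The Frobenius theorem\<close>

text \<open>
  The distribution is the graph of \<open>\<alpha>\<close> over the range of a projection, spanned by the fields
  \<open>w + \<alpha>(y)w\<close> with \<open>w\<close> in that range. \<open>Y (t, w, y)\<close> is the flow of such a field from \<open>y\<close>.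
\<close>

lemma graph_flow:
  fixes \<alpha> :: "'b::euclidean_space \<Rightarrow> 'b \<Rightarrow>\<^sub>L 'b"
  assumes U: "open U" "x0 \<in> U" and \<alpha>: "smooth_on U \<alpha>"
  obtains r R L \<beta> and Y :: "real \<times> 'b \<times> 'b \<Rightarrow> 'b" where "r > 0" "R > 0" "ball x0 R \<subseteq> U" "0 \<le> L" "L * r \<le> 1/4"
    "\<forall>y\<in>ball x0 R. \<beta> y = \<alpha> y" "range \<beta> \<subseteq> \<alpha> ` U"
    "\<forall>a b. norm (\<beta> a - \<beta> b) \<le> L * norm (a - b)"
    "\<forall>y\<in>ball x0 R. \<forall>v. norm (frechet_derivative \<alpha> (at y) v) \<le> L * norm v"
    "\<forall>w y. Y (0, w, y) = y"
    "\<forall>t w y. \<bar>t\<bar> < 2 \<longrightarrow> norm w < r \<longrightarrow> ((\<lambda>t. Y (t, w, y)) has_vector_derivative w + \<beta> (Y (t, w, y)) w) (at t)"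
    "\<forall>t w y. \<bar>t\<bar> < 2 \<longrightarrow> norm w < r \<longrightarrow> y \<in> ball x0 (R/2) \<longrightarrow> Y (t, w, y) \<in> ball x0 R"
    "smooth_on ({-2<..<2} \<times> ball 0 r \<times> ball x0 (R/2)) Y"
    "\<forall>w y e. norm w < r \<longrightarrow> y \<in> ball x0 (R/2) \<longrightarrow> frechet_derivative Y (at (0, w, y)) (0, e, 0) = 0"
    "\<forall>t w y e. \<bar>t\<bar> < 2 \<longrightarrow> norm w < r \<longrightarrow> y \<in> ball x0 (R/2) \<longrightarrow>
      ((\<lambda>t. frechet_derivative Y (at (t, w, y)) (0, e, 0)) has_vector_derivative
        e + \<alpha> (Y (t, w, y)) e + frechet_derivative \<alpha> (at (Y (t, w, y))) (frechet_derivative Y (at (t, w, y)) (0, e, 0)) w) (at t)"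
proof -
  obtain R where R: "R > 0" "cball x0 R \<subseteq> U" using U open_contains_cball by blast
  have cb: "compact (cball x0 R)" "closed (cball x0 R)" "convex (cball x0 R)" "cball x0 R \<noteq> {}" using R(1) by auto
  obtain M where M: "\<forall>y\<in>cball x0 R. norm (\<alpha> y) \<le> M"
    using continuous_on_compact_norm_bound[OF cb(1) continuous_on_subset[OF smooth_on_continuous[OF \<alpha>] R(2)]] by blast
  have M0: "0 \<le> M" using M R(1) norm_ge_zero order_trans centre_in_cball by (metis less_imp_le)
  have D: "(\<alpha> has_derivative frechet_derivative \<alpha> (at y)) (at y)" if "y \<in> U" for y
    using smooth_on_has_derivative[OF \<alpha> that] .
  have "continuous_on (cball x0 R) (\<lambda>y. Blinfun (frechet_derivative \<alpha> (at y)))"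
    by (rule continuous_on_subset[OF smooth_on_continuous[OF smooth_on_Blinfun_frechet[OF U(1) \<alpha>]] R(2)])
  from continuous_on_compact_norm_bound[OF cb(1) this] obtain L0 where
    L0: "\<forall>y\<in>cball x0 R. norm (Blinfun (frechet_derivative \<alpha> (at y))) \<le> L0" by blast
  define L where "L = max L0 0"
  have L: "0 \<le> L" by (simp add: L_def)
  have DL: "norm (frechet_derivative \<alpha> (at y) v) \<le> L * norm v" if y: "y \<in> cball x0 R" for y v
  proof -
    have "frechet_derivative \<alpha> (at y) v = Blinfun (frechet_derivative \<alpha> (at y)) v"
      using has_derivative_bounded_linear[OF D] y R(2) by (subst bounded_linear_Blinfun_apply) auto
    also have "norm \<dots> \<le> norm (Blinfun (frechet_derivative \<alpha> (at y))) * norm v" by (rule norm_blinfun)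
    also have "\<dots> \<le> L * norm v" using bspec[OF L0 y] by (intro mult_right_mono) (auto simp: L_def)
    finally show ?thesis .
  qed
  have lip: "norm (\<alpha> a - \<alpha> b) \<le> L * norm (a - b)" if "a \<in> cball x0 R" "b \<in> cball x0 R" for a b
  proof (rule differentiable_bound[OF cb(3) _ _ that, of \<alpha> "\<lambda>y. frechet_derivative \<alpha> (at y)"])
    fix y assume y: "y \<in> cball x0 R"
    show "(\<alpha> has_derivative frechet_derivative \<alpha> (at y)) (at y within cball x0 R)"
      by (rule has_derivative_at_withinI, rule D) (use y R(2) in blast)
    show "onorm (frechet_derivative \<alpha> (at y)) \<le> L" by (rule onorm_le) (rule DL[OF y])
  qed
  \<comment> \<open>Projection onto a ball has Lipschitz constant 1, so composing with it extends
    \<alpha> to the whole space without increasing the constant L.\<close>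
  define c where "c = closest_point (cball x0 R)"
  have c: "c y \<in> cball x0 R" for y unfolding c_def by (rule closest_point_in_set[OF cb(2,4)])
  have c_id: "c y = y" if "y \<in> ball x0 R" for y unfolding c_def by (rule closest_point_self) (use that in auto)
  have c_lip: "dist (c a) (c b) \<le> dist a b" for a b
    unfolding c_def by (rule closest_point_lipschitz[OF cb(3,2,4)])
  define \<beta> where "\<beta> = (\<lambda>y. \<alpha> (c y))"
  have \<beta>_lip: "norm (\<beta> a - \<beta> b) \<le> L * norm (a - b)" for a b
  proof -
    have "norm (\<beta> a - \<beta> b) \<le> L * norm (c a - c b)" unfolding \<beta>_def by (rule lip[OF c c])
    also have "\<dots> \<le> L * norm (a - b)" using c_lip[of a b] L by (intro mult_left_mono) (auto simp: dist_norm)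
    finally show ?thesis .
  qed
  have \<beta>_M: "norm (\<beta> y) \<le> M" for y using M c by (simp add: \<beta>_def)
  have \<beta>_cont: "continuous_on UNIV \<beta>"
    unfolding \<beta>_def
    by (rule continuous_on_compose2[OF continuous_on_subset[OF smooth_on_continuous[OF \<alpha>] R(2)]])
      (use c in \<open>auto simp: c_def intro!: continuous_on_closest_point[OF cb(3,2,4)]\<close>)
  \<comment> \<open>The first bound gives L r \<le> 1/4, hence 2 (L r) \<le> 1/2: solutions exist
    for times in (-2, 2), with time 1 in the interior. The second gives speed at most R/8, so up to
    time 2 a point of the ball of radius R/2 moves by at most R/4 and stays in the ball of radius
    R.\<close>
  define r where "r = min (1 / (4 * (L + 1))) (R / (8 * (1 + M)))"
  have r: "r > 0" using L M0 R(1) by (simp add: r_def)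
  have Lr: "L * r \<le> 1/4"
  proof -
    have "L * r \<le> (L + 1) * (1 / (4 * (L + 1)))" using L r by (intro mult_mono) (auto simp: r_def)
    also have "\<dots> = 1/4" using L by (simp add: divide_simps)
    finally show ?thesis .
  qed
  have Mr: "(1 + M) * r \<le> R / 8"
  proof -
    have "(1 + M) * r \<le> (1 + M) * (R / (8 * (1 + M)))" using M0 by (intro mult_left_mono) (auto simp: r_def)
    also have "\<dots> = R / 8" using M0 by (simp add: divide_simps)
    finally show ?thesis .
  qed
  have cr: "convex (cball (0::'b) r)" "closed (cball (0::'b) r)" "cball (0::'b) r \<noteq> {}" using r by auto
  \<comment> \<open>The direction w is clamped as well, which makes the right side bounded and
    uniformly Lipschitz for all parameters.\<close>
  define k where "k = closest_point (cball (0::'b) r)"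
  have k: "norm (k w) \<le> r" for w using closest_point_in_set[OF cr(2,3)] by (auto simp: k_def)
  have k_id: "k w = w" if "norm w < r" for w unfolding k_def by (rule closest_point_self) (use that in auto)
  have k_cont: "continuous_on S k" for S
    unfolding k_def by (rule continuous_on_subset[OF continuous_on_closest_point[OF cr]]) auto
  define F0 where "F0 = (\<lambda>(s::real, wy::'b \<times> 'b, V::'b). k (fst wy) + \<beta> (snd wy + V) (k (fst wy)))"
  have bM: "norm (k w + \<beta> y (k w)) \<le> (1 + M) * r" for w y
  proof -
    have "norm (\<beta> y (k w)) \<le> M * r"
      using norm_blinfun[of "\<beta> y" "k w"] \<beta>_M[of y] k[of w] M0 by (smt (verit) mult_mono norm_ge_zero)
    then show ?thesis using norm_triangle_ineq[of "k w" "\<beta> y (k w)"] k[of w] by (simp add: algebra_simps)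
  qed
  have F0_cont: "continuous_on UNIV F0"
    unfolding F0_def split_def
    by (intro continuous_intros continuous_on_compose2[OF k_cont[of UNIV]] continuous_on_compose2[OF \<beta>_cont]) auto
  have F0_B: "norm (F0 (s, x, 0)) \<le> (1 + M) * r" for s x by (simp add: F0_def bM)
  have F0_K: "norm (F0 (s, x, y) - F0 (s, x, z)) \<le> (L * r) * norm (y - z)" for s x y z
  proof -
    have "norm (F0 (s, x, y) - F0 (s, x, z)) = norm ((\<beta> (snd x + y) - \<beta> (snd x + z)) (k (fst x)))"
      by (simp add: F0_def blinfun.diff_left)
    also have "\<dots> \<le> norm (\<beta> (snd x + y) - \<beta> (snd x + z)) * norm (k (fst x))" by (rule norm_blinfun)
    also have "\<dots> \<le> (L * norm (y - z)) * r"
      using \<beta>_lip[of "snd x + y" "snd x + z"] k L by (intro mult_mono) auto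
    finally show ?thesis by (simp add: mult_ac)
  qed
  have "2 * (L * r) \<le> 1/2" "0 \<le> L * r" using Lr L r by auto
  then obtain V :: "real \<times> 'b \<times> 'b \<Rightarrow> 'b" where V: "continuous_on UNIV V" "\<And>x. V (0, x) = 0"
    "\<And>t x. \<bar>t\<bar> < 2 \<Longrightarrow> ((\<lambda>t. V (t, x)) has_vector_derivative F0 (t, x, V (t, x))) (at t)"
    by (rule ode_exists[OF F0_cont F0_B F0_K zero_less_numeral]) blast
  \<comment> \<open>V is the displacement from the starting point y, as the solutions constructed
    above vanish at time 0.\<close>
  define Y where "Y = (\<lambda>p. snd (snd p) + V p)"
  have Y0: "Y (0, w, y) = y" for w y by (simp add: Y_def V)
  have Y_ode: "((\<lambda>t. Y (t, w, y)) has_vector_derivative w + \<beta> (Y (t, w, y)) w) (at t)"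
    if "\<bar>t\<bar> < 2" "norm w < r" for t w y
    using has_vector_derivative_add[OF has_vector_derivative_const[of y] V(3)[OF that(1), of "(w, y)"]]
    by (simp add: Y_def F0_def k_id[OF that(2)])
  have Y_in: "Y (t, w, y) \<in> ball x0 R" if "\<bar>t\<bar> < 2" "norm w < r" "y \<in> ball x0 (R/2)" for t w y
  proof -
    have "norm (Y (t, w, y) - Y (0, w, y)) \<le> ((1 + M) * r) * \<bar>t - 0\<bar>"
    proof (rule vector_derivative_bound[where S = "{-\<bar>t\<bar>..\<bar>t\<bar>}"])
      fix s assume "s \<in> {-\<bar>t\<bar>..\<bar>t\<bar>}"
      then have "\<bar>s\<bar> < 2" using that(1) by auto
      then show "((\<lambda>t. Y (t, w, y)) has_vector_derivative w + \<beta> (Y (s, w, y)) w) (at s within {-\<bar>t\<bar>..\<bar>t\<bar>})"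
        using Y_ode that(2) has_vector_derivative_at_within by blast
      show "norm (w + \<beta> (Y (s, w, y)) w) \<le> (1 + M) * r" using bM[of w] k_id[OF that(2)] by simp
    qed auto
    also have "\<dots> \<le> (R / 8) * 2" using Mr that(1) R(1) by (intro mult_mono) auto
    finally have "norm (Y (t, w, y) - y) \<le> R / 4" by (simp add: Y0)
    moreover have "norm (x0 - y) < R / 2" using that(3) by (simp add: dist_norm)
    ultimately show ?thesis
      using norm_triangle_ineq4[of "x0 - y" "Y (t, w, y) - y"] R(1) by (simp add: dist_norm)
  qed
  define G where "G = ball (0::'b) r \<times> ball x0 (R/2)"
  have G: "open G" unfolding G_def by (intro open_Times) auto
  define Q :: "(real \<times> ('b \<times> 'b) \<times> 'b) set" where "Q = UNIV \<times> (ball 0 r \<times> UNIV) \<times> ball x0 R"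
  have Q: "open Q" unfolding Q_def by (intro open_Times) auto
  define F where "F = (\<lambda>q::real \<times> ('b \<times> 'b) \<times> 'b. fst (fst (snd q)) + \<alpha> (snd (snd q)) (fst (fst (snd q))))"
  have bl: "bounded_linear (\<lambda>q::real \<times> ('b \<times> 'b) \<times> 'b. fst (fst (snd q)))"
    "bounded_linear (\<lambda>q::real \<times> ('b \<times> 'b) \<times> 'b. snd (snd q))"
    by (intro bounded_linear_compose[OF bounded_linear_fst] bounded_linear_compose[OF bounded_linear_snd]
        bounded_linear_fst bounded_linear_snd)+
  have "smooth_on Q F"
    unfolding F_def
    by (intro smooth_on_add Q smooth_on_bilinear[OF bounded_bilinear_blinfun_apply] smooth_on_linear[OF bl(1)]
        smooth_on_compose[OF U(1) Q \<alpha> smooth_on_linear[OF bl(2)]])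
      (use R in \<open>auto simp: Q_def\<close>)
  then have Fk: "Ck_on k Q F" for k by (simp add: smooth_on_def)
  have F_deriv: "(F has_derivative (\<lambda>d. fst (fst (snd d)) + (\<alpha> (snd (snd q)) (fst (fst (snd d))) +
      frechet_derivative \<alpha> (at (snd (snd q))) (snd (snd d)) (fst (fst (snd q)))))) (at q)" if q: "q \<in> Q" for q
  proof -
    have "snd (snd q) \<in> U" using q R(2) by (auto simp: Q_def)
    from has_derivative_compose[OF bounded_linear_imp_has_derivative[OF bl(2)] D[OF this]]
    have "((\<lambda>q. \<alpha> (snd (snd q))) has_derivative (\<lambda>d. frechet_derivative \<alpha> (at (snd (snd q))) (snd (snd d)))) (at q)" .
    from has_derivative_add[OF bounded_linear_imp_has_derivative[OF bl(1)]
        bounded_bilinear.FDERIV[OF bounded_bilinear_blinfun_apply this bounded_linear_imp_has_derivative[OF bl(1)]]]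
    show ?thesis unfolding F_def .
  qed
  have F_frechet: "frechet_derivative F (at q) = (\<lambda>d. fst (fst (snd d)) + (\<alpha> (snd (snd q)) (fst (fst (snd d))) +
      frechet_derivative \<alpha> (at (snd (snd q))) (snd (snd d)) (fst (fst (snd q)))))" if "q \<in> Q" for q
    using frechet_derivative_at[OF F_deriv[OF that]] by simp
  have u0: "Ck_on k G snd" for k
    using smooth_on_linear[OF bounded_linear_snd, of G] by (simp add: smooth_on_def)
  have K: "0 \<le> L * r" "2 * (L * r) \<le> 1/2" using Lr L r by auto
  have DF: "norm (frechet_derivative F (at q) (0, 0, v)) \<le> (L * r) * norm v" if "q \<in> Q" for q v
  proof -
    have q: "snd (snd q) \<in> cball x0 R" "norm (fst (fst (snd q))) \<le> r" using that by (auto simp: Q_def)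
    have "norm (frechet_derivative F (at q) (0, 0, v)) = norm (frechet_derivative \<alpha> (at (snd (snd q))) v (fst (fst (snd q))))"
      by (simp add: F_frechet[OF that])
    also have "\<dots> \<le> norm (frechet_derivative \<alpha> (at (snd (snd q))) v) * norm (fst (fst (snd q)))" by (rule norm_blinfun)
    also have "\<dots> \<le> (L * norm v) * r" using DL[OF q(1)] q(2) L by (intro mult_mono) auto
    finally show ?thesis by (simp add: mult_ac)
  qed
  have Y_cont: "continuous_on ({-2<..<2} \<times> G) Y"
    unfolding Y_def by (intro continuous_intros continuous_on_subset[OF V(1)]) auto
  have inQ: "(t, x, Y (t, x)) \<in> Q" if "\<bar>t\<bar> < 2" "x \<in> G" for t x
    using Y_in[of t "fst x" "snd x"] that by (auto simp: Q_def G_def)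
  have init: "Y (0, x) = snd x" for x using Y0[of "fst x" "snd x"] by simp
  have ode: "((\<lambda>t. Y (t, x)) has_vector_derivative F (t, x, Y (t, x))) (at t)" if "\<bar>t\<bar> < 2" "x \<in> G" for t x
  proof -
    have "norm (fst x) < r" "snd x \<in> ball x0 (R/2)" using that by (auto simp: G_def)
    then show ?thesis
      using Y_ode[of t "fst x" "snd x"] Y_in[of t "fst x" "snd x"] that by (simp add: F_def \<beta>_def c_id)
  qed
  have smooth: "smooth_on ({-2<..<2} \<times> G) Y"
    unfolding smooth_on_def
  proof
    fix k
    show "Ck_on k ({-2<..<2} \<times> G) Y"
    proof (rule ode_Ck[OF G zero_less_numeral K Q Fk u0])
      fix q E v assume "q \<in> Q" and E: "(F has_derivative E) (at q)"
      then show "norm (E (0, 0, v)) \<le> L * r * norm v"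
        using DF[OF \<open>q \<in> Q\<close>, of v] frechet_derivative_at[OF E] by simp
    qed (assumption | rule Y_cont inQ init ode)+
  qed
  have v0: "frechet_derivative Y (at (0, x)) (0, e) = frechet_derivative snd (at x) e" if "x \<in> G" for x e
    by (rule ode_variation(2)[OF Q Fk G u0 zero_less_numeral K]) (assumption | rule DF Y_cont inQ init ode that)+
  have v': "((\<lambda>t. frechet_derivative Y (at (t, x)) (0, e)) has_vector_derivative
      frechet_derivative F (at (t, x, Y (t, x))) (0, e, frechet_derivative Y (at (t, x)) (0, e))) (at t)"
    if "\<bar>t\<bar> < 2" "x \<in> G" for t x e
    by (rule ode_variation(3)[OF Q Fk G u0 zero_less_numeral K]) (assumption | rule DF Y_cont inQ init ode that)+
  have sndD: "frechet_derivative snd (at x) = snd" for x :: "'b \<times> 'b"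
    by (rule frechet_derivative_at[OF bounded_linear_imp_has_derivative[OF bounded_linear_snd], symmetric])
  show ?thesis
  proof (rule that[of r R L \<beta> Y])
    show "\<forall>w y e. norm w < r \<longrightarrow> y \<in> ball x0 (R/2) \<longrightarrow> frechet_derivative Y (at (0, w, y)) (0, e, 0) = 0"
      using v0 by (simp add: sndD G_def)
    show "\<forall>t w y e. \<bar>t\<bar> < 2 \<longrightarrow> norm w < r \<longrightarrow> y \<in> ball x0 (R/2) \<longrightarrow>
      ((\<lambda>t. frechet_derivative Y (at (t, w, y)) (0, e, 0)) has_vector_derivative
        e + \<alpha> (Y (t, w, y)) e + frechet_derivative \<alpha> (at (Y (t, w, y))) (frechet_derivative Y (at (t, w, y)) (0, e, 0)) w) (at t)"
    proof (intro allI impI)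
      fix t :: real and w y e :: 'b assume a: "\<bar>t\<bar> < 2" "norm w < r" "y \<in> ball x0 (R/2)"
      then have x: "(w, y) \<in> G" by (simp add: G_def)
      show "((\<lambda>t. frechet_derivative Y (at (t, w, y)) (0, e, 0)) has_vector_derivative
        e + \<alpha> (Y (t, w, y)) e + frechet_derivative \<alpha> (at (Y (t, w, y))) (frechet_derivative Y (at (t, w, y)) (0, e, 0)) w) (at t)"
        using v'[OF a(1) x, of "(e, 0)"] by (simp add: F_frechet[OF inQ[OF a(1) x]] add.assoc)
    qed
    show "smooth_on ({-2<..<2} \<times> ball 0 r \<times> ball x0 (R/2)) Y" using smooth by (simp add: G_def)
    show "ball x0 R \<subseteq> U" using R(2) by auto
    show "range \<beta> \<subseteq> \<alpha> ` U" using subsetD[OF R(2) c] unfolding \<beta>_def by blast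
  qed (use r R L Lr \<beta>_lip DL Y0 Y_ode Y_in in \<open>auto simp: \<beta>_def c_id\<close>)
qed

text \<open>\<open>integrable\<close> says that the fields e + \<alpha>e and w + \<alpha>w commute.
  Let p x be the P-part of x - x0. The map \<kappa> slides x for time 1 along the field of -p x into
  the slice p = 0 and then adds p x; \<psi> undoes this, flowing from z - p z along the field of p
  z. Since D\<psi> e = e + \<alpha>e for e in the range of P, the distribution becomes constant in
  the new coordinates.\<close>

theorem frobenius:
  fixes \<alpha> :: "'b::euclidean_space \<Rightarrow> 'b \<Rightarrow>\<^sub>L 'b"
  assumes U: "open U" "x0 \<in> U" and \<alpha>: "smooth_on U \<alpha>"
    and P: "bounded_linear P" "\<And>x. P (P x) = P x"
    and \<alpha>P: "\<And>y v. y \<in> U \<Longrightarrow> P (\<alpha> y v) = 0" "\<And>y v. y \<in> U \<Longrightarrow> \<alpha> y (P v) = \<alpha> y v"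
    and integrable: "\<And>y e w. y \<in> U \<Longrightarrow> P e = e \<Longrightarrow> P w = w \<Longrightarrow>
      frechet_derivative \<alpha> (at y) (e + \<alpha> y e) w = frechet_derivative \<alpha> (at y) (w + \<alpha> y w) e"
  obtains U1 U2 \<kappa> \<psi> where "open U1" "x0 \<in> U1" "U1 \<subseteq> U" "open U2" "smooth_on U1 \<kappa>" "smooth_on U2 \<psi>"
    "\<kappa> ` U1 = U2" "\<psi> ` U2 = U1" "\<forall>x\<in>U1. \<psi> (\<kappa> x) = x" "\<forall>z\<in>U2. \<kappa> (\<psi> z) = z"
    "\<forall>x\<in>U1. \<forall>v. P (frechet_derivative \<kappa> (at x) v) = frechet_derivative \<kappa> (at x) v \<longleftrightarrow> v = P v + \<alpha> x v"
proof -
  interpret P: bounded_linear P by fact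
  obtain r R L \<beta> and Y :: "real \<times> 'b \<times> 'b \<Rightarrow> 'b" where r: "r > 0" and R: "R > 0" "ball x0 R \<subseteq> U" and L: "0 \<le> L" "L * r \<le> 1/4"
    and \<beta>: "\<forall>y\<in>ball x0 R. \<beta> y = \<alpha> y" "range \<beta> \<subseteq> \<alpha> ` U"
      "\<forall>a b. norm (\<beta> a - \<beta> b) \<le> L * norm (a - b)"
    and DL: "\<forall>y\<in>ball x0 R. \<forall>v. norm (frechet_derivative \<alpha> (at y) v) \<le> L * norm v"
    and Y0: "\<forall>w y. Y (0, w, y) = y"
    and Y': "\<forall>t w y. \<bar>t\<bar> < 2 \<longrightarrow> norm w < r \<longrightarrow> ((\<lambda>t. Y (t, w, y)) has_vector_derivative w + \<beta> (Y (t, w, y)) w) (at t)"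
    and Y_in: "\<forall>t w y. \<bar>t\<bar> < 2 \<longrightarrow> norm w < r \<longrightarrow> y \<in> ball x0 (R/2) \<longrightarrow> Y (t, w, y) \<in> ball x0 R"
    and Y_smooth: "smooth_on ({-2<..<2} \<times> ball 0 r \<times> ball x0 (R/2)) Y"
    and v0: "\<forall>w y e. norm w < r \<longrightarrow> y \<in> ball x0 (R/2) \<longrightarrow> frechet_derivative Y (at (0, w, y)) (0, e, 0) = 0"
    and v': "\<forall>t w y e. \<bar>t\<bar> < 2 \<longrightarrow> norm w < r \<longrightarrow> y \<in> ball x0 (R/2) \<longrightarrow>
      ((\<lambda>t. frechet_derivative Y (at (t, w, y)) (0, e, 0)) has_vector_derivative
        e + \<alpha> (Y (t, w, y)) e + frechet_derivative \<alpha> (at (Y (t, w, y))) (frechet_derivative Y (at (t, w, y)) (0, e, 0)) w) (at t)"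
    by (rule graph_flow[OF U \<alpha>]) blast
  define \<Theta> where "\<Theta> = (\<lambda>w y. Y (1, w, y))"
  have T1: "\<bar>t\<bar> < 2" if "t \<in> {0..1}" for t :: real using that by auto
  have P\<beta>: "P (\<beta> y v) = 0" for y v using \<beta>(2) \<alpha>P(1) by (metis image_iff rangeI subsetD)
  have P\<Theta>: "P (\<Theta> w y) = P y + w" if w: "norm w < r" "P w = w" for w y
  proof -
    \<comment> \<open>As P annihilates the values of \<beta>, the P-part of the flow moves with
      constant velocity w.\<close>
    have "P (Y (1, w, y)) = P y + 1 *\<^sub>R w"
    proof (rule ode_unique[of "{0..1}" 1 "\<lambda>t. P (Y (t, w, y))" "\<lambda>t. w" "\<lambda>t. P y + t *\<^sub>R w" "\<lambda>t. w" 0])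
      fix t :: real assume "t \<in> {0..1}"
      then have "((\<lambda>t. P (Y (t, w, y))) has_vector_derivative P (w + \<beta> (Y (t, w, y)) w)) (at t)"
        using P.has_vector_derivative Y' T1 w(1) by blast
      then show "((\<lambda>t. P (Y (t, w, y))) has_vector_derivative w) (at t within {0..1})"
        by (simp add: P.add P\<beta> w(2) has_vector_derivative_at_within)
      show "((\<lambda>t. P y + t *\<^sub>R w) has_vector_derivative w) (at t within {0..1})"
        by (auto intro!: derivative_eq_intros)
    qed (use Y0 in auto)
    then show ?thesis by (simp add: \<Theta>_def)
  qed
  have \<Theta>_inv: "\<Theta> (- w) (\<Theta> w y) = y" if w: "norm w < r" for w y
  proof -
    \<comment> \<open>Time reversal: the curve run backwards, from time 1 to time 0, solves the
      equation for -w with initial value \<Theta> w y.\<close>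
    have "Y (1, - w, \<Theta> w y) = Y (1 - 1, w, y)"
    proof (rule ode_unique[of "{0..1}" 1 "\<lambda>t. Y (t, - w, \<Theta> w y)" "\<lambda>t. - w + \<beta> (Y (t, - w, \<Theta> w y)) (- w)"
          "\<lambda>t. Y (1 - t, w, y)" "\<lambda>t. - (w + \<beta> (Y (1 - t, w, y)) w)" "L * r"])
      fix t :: real assume t: "t \<in> {0..1}"
      show "((\<lambda>t. Y (t, - w, \<Theta> w y)) has_vector_derivative - w + \<beta> (Y (t, - w, \<Theta> w y)) (- w)) (at t within {0..1})"
        by (rule has_vector_derivative_at_within) (use Y'[rule_format, OF T1[OF t], of "- w" "\<Theta> w y"] w in simp)
      have "((\<lambda>t. Y (t, w, y)) has_vector_derivative w + \<beta> (Y (1 - t, w, y)) w) (at (1 - t))"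
        using Y'[rule_format, OF T1[of "1 - t"] w] t by simp
      moreover have "((\<lambda>t. 1 - t) has_vector_derivative - 1) (at t)"
        by (auto intro!: derivative_eq_intros)
      ultimately have "(((\<lambda>t. Y (t, w, y)) \<circ> (\<lambda>t. 1 - t)) has_vector_derivative (- 1) *\<^sub>R (w + \<beta> (Y (1 - t, w, y)) w)) (at t)"
        by (rule vector_diff_chain_at[rotated])
      then show "((\<lambda>t. Y (1 - t, w, y)) has_vector_derivative - (w + \<beta> (Y (1 - t, w, y)) w)) (at t within {0..1})"
        by (simp add: o_def has_vector_derivative_at_within)
      let ?a = "\<beta> (Y (t, - w, \<Theta> w y))" and ?b = "\<beta> (Y (1 - t, w, y))"
      have "norm (- w + ?a (- w) - - (w + ?b w)) = norm ((?b - ?a) w)"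
        by (simp add: blinfun.minus_right blinfun.diff_left)
      also have "\<dots> \<le> norm (?b - ?a) * norm w" by (rule norm_blinfun)
      also have "\<dots> \<le> (L * norm (Y (1 - t, w, y) - Y (t, - w, \<Theta> w y))) * r"
        using \<beta>(3) w L(1) by (intro mult_mono) auto
      finally show "norm (- w + ?a (- w) - - (w + ?b w)) \<le> L * r * norm (Y (t, - w, \<Theta> w y) - Y (1 - t, w, y))"
        by (simp add: mult_ac norm_minus_commute)
    qed (use Y0 L r in \<open>auto simp: \<Theta>_def\<close>)
    then show ?thesis using Y0 by (simp add: \<Theta>_def)
  qed
  define p where "p = (\<lambda>x. P (x - x0))"
  define \<kappa> where "\<kappa> = (\<lambda>x. p x + \<Theta> (- p x) x)"
  define \<psi> where "\<psi> = (\<lambda>z. \<Theta> (p z) (z - p z))"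
  have Pp: "P (p x) = p x" for x by (simp add: p_def P)
  have pP: "P x = p x + P x0" for x by (simp add: p_def P.diff)
  have p\<kappa>: "p (\<kappa> x) = p x" if "norm (p x) < r" for x
    using P\<Theta>[of "- p x" x] that pP[of "\<kappa> x"] pP[of x] by (simp add: \<kappa>_def P.add linear_neg[OF bounded_linear.linear[OF P(1)]] Pp)
  have p\<psi>: "p (\<psi> z) = p z" if "norm (p z) < r" for z
    using P\<Theta>[of "p z" "z - p z"] that pP[of "\<psi> z"] pP[of z] by (simp add: \<psi>_def P.diff Pp)
  have \<psi>\<kappa>: "\<psi> (\<kappa> x) = x" if "norm (p x) < r" for x
    using \<Theta>_inv[of "- p x" x] that p\<kappa>[OF that] by (simp add: \<psi>_def) (simp add: \<kappa>_def)
  have \<kappa>\<psi>: "\<kappa> (\<psi> z) = z" if "norm (p z) < r" for z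
    using \<Theta>_inv[of "p z" "z - p z"] that p\<psi>[OF that] by (simp add: \<kappa>_def) (simp add: \<psi>_def)
  define N1 where "N1 = {x. norm (p x) < r \<and> x \<in> ball x0 (R/2)}"
  define N2 where "N2 = {z. norm (p z) < r \<and> z - p z \<in> ball x0 (R/2)}"
  have p_cont: "continuous_on S p" for S
    unfolding p_def by (intro P.continuous_on continuous_intros)
  have N1: "open N1" and N2: "open N2"
  proof -
    have "N1 = {x. norm (p x) < r} \<inter> ball x0 (R/2)" by (auto simp: N1_def)
    moreover have "N2 = {z. norm (p z) < r} \<inter> {z. dist x0 (z - p z) < R/2}" by (auto simp: N2_def)
    ultimately show "open N1" "open N2"
      by (auto intro!: open_Int open_Collect_less continuous_intros p_cont)
  qed
  have smooth_p: "smooth_on S p" if "open S" for S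
    unfolding p_def by (intro smooth_on_bounded_linear[OF P.bounded_linear that] smooth_on_diff that smooth_on_ident smooth_on_const)
  define Dom where "Dom = {-2<..<2::real} \<times> ball (0::'b) r \<times> ball x0 (R/2)"
  have Dom: "open Dom" unfolding Dom_def by (intro open_Times) auto
  have Pair: "smooth_on S (\<lambda>x. (f x, g x))" if "open S" "smooth_on S f" "smooth_on S g"
    for S :: "'b set" and f :: "'b \<Rightarrow> 'c::euclidean_space" and g :: "'b \<Rightarrow> 'd::euclidean_space"
    using that by (simp add: smooth_on_def Ck_on_Pair)
  have smooth_\<Theta>: "smooth_on S (\<lambda>x. \<Theta> (f x) (g x))"
    if "open S" "smooth_on S f" "smooth_on S g" "\<And>x. x \<in> S \<Longrightarrow> norm (f x) < r \<and> g x \<in> ball x0 (R/2)"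
    for S :: "'b set" and f g :: "'b \<Rightarrow> 'b"
    unfolding \<Theta>_def
    by (rule smooth_on_compose[OF Dom that(1) Y_smooth[folded Dom_def]])
      (use that in \<open>auto simp: Dom_def intro!: Pair smooth_on_const\<close>)
  have s\<kappa>: "smooth_on N1 \<kappa>"
    unfolding \<kappa>_def
    using smooth_on_bounded_linear[OF bounded_linear_minus[OF bounded_linear_ident] N1 smooth_p[OF N1]]
    by (intro smooth_on_add smooth_\<Theta> N1 smooth_p smooth_on_ident) (auto simp: N1_def)
  have s\<psi>: "smooth_on N2 \<psi>"
    unfolding \<psi>_def by (intro smooth_\<Theta> N2 smooth_p smooth_on_diff smooth_on_ident) (auto simp: N2_def)
  \<comment> \<open>The two domains are cut down to the points that the other map can bring back, so
    that \<kappa> and \<psi> become mutually inverse bijections.\<close>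
  define U1 where "U1 = N1 \<inter> \<kappa> -` N2"
  define U2 where "U2 = N2 \<inter> \<psi> -` N1"
  have U1: "open U1" unfolding U1_def by (rule continuous_open_preimage[OF smooth_on_continuous[OF s\<kappa>] N1 N2])
  have U2: "open U2" unfolding U2_def by (rule continuous_open_preimage[OF smooth_on_continuous[OF s\<psi>] N2 N1])
  have rN1: "norm (p x) < r" if "x \<in> N1" for x using that by (simp add: N1_def)
  have rN2: "norm (p x) < r" if "x \<in> N2" for x using that by (simp add: N2_def)
  have im1: "\<kappa> ` U1 = U2"
  proof (intro equalityI subsetI)
    fix z assume "z \<in> \<kappa> ` U1"
    then show "z \<in> U2" using \<psi>\<kappa>[OF rN1] by (auto simp: U1_def U2_def)
  next
    fix z assume z: "z \<in> U2"
    then have "z = \<kappa> (\<psi> z)" "\<psi> z \<in> U1" using \<kappa>\<psi>[OF rN2] by (auto simp: U1_def U2_def)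
    then show "z \<in> \<kappa> ` U1" by blast
  qed
  have U1r: "\<psi> (\<kappa> x) = x" if "x \<in> U1" for x using that \<psi>\<kappa> rN1 by (auto simp: U1_def)
  have U2r: "\<kappa> (\<psi> z) = z" if "z \<in> U2" for z using that \<kappa>\<psi> rN2 by (auto simp: U2_def)
  have im2: "\<psi> ` U2 = U1"
    using im1 U1r by (force simp: image_iff)
  have x0: "x0 \<in> U1"
  proof -
    have p0: "p x0 = 0" by (simp add: p_def)
    have "Y (1, 0, x0) = x0"
      by (rule ode_unique[of "{0..1}" 1 "\<lambda>t. Y (t, 0, x0)" "\<lambda>t. 0" "\<lambda>t. x0" "\<lambda>t. 0" 0])
        (use Y'[rule_format, OF T1, of _ 0 x0] r Y0 in \<open>simp_all add: has_vector_derivative_at_within\<close>)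
    then have "\<kappa> x0 = x0" by (simp add: \<kappa>_def p0 \<Theta>_def)
    then show ?thesis using r R by (simp add: U1_def N1_def N2_def p0)
  qed
  have U1U: "x \<in> ball x0 R" if "x \<in> U1" for x using that R(1) by (auto simp: U1_def N1_def)
  text \<open>
    \<open>t (e + \<alpha>(Y)e)\<close> solves the variational equation for the derivative of \<open>Y\<close> in the direction \<open>e\<close>
    of the parameter \<open>w\<close>; this is where integrability enters.
  \<close>
  have D\<psi>: "frechet_derivative \<psi> (at z) e = e + \<alpha> (\<psi> z) e" if z: "z \<in> U2" and e: "P e = e" for z e
  proof -
    let ?w = "p z" and ?y = "z - p z"
    have w: "norm ?w < r" "?y \<in> ball x0 (R/2)" "P ?w = ?w" using z by (auto simp: U2_def N2_def Pp)
    define v where "v = (\<lambda>t. frechet_derivative Y (at (t, ?w, ?y)) (0, e, 0))"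
    have "v 1 = 1 *\<^sub>R (e + \<alpha> (Y (1, ?w, ?y)) e)"
    proof (rule ode_unique[of "{0..1}" 1 v "\<lambda>t. e + \<alpha> (Y (t, ?w, ?y)) e + frechet_derivative \<alpha> (at (Y (t, ?w, ?y))) (v t) ?w"
          "\<lambda>t. t *\<^sub>R (e + \<alpha> (Y (t, ?w, ?y)) e)"
          "\<lambda>t. e + \<alpha> (Y (t, ?w, ?y)) e + frechet_derivative \<alpha> (at (Y (t, ?w, ?y))) (t *\<^sub>R (e + \<alpha> (Y (t, ?w, ?y)) e)) ?w" "L * r"])
      fix t :: real assume t: "t \<in> {0..1}"
      let ?Y = "Y (t, ?w, ?y)"
      have YR: "?Y \<in> ball x0 R" using Y_in T1[OF t] w by blast
      then have YU: "?Y \<in> U" using R by blast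
      have D: "(\<alpha> has_derivative frechet_derivative \<alpha> (at ?Y)) (at ?Y)" by (rule smooth_on_has_derivative[OF \<alpha> YU])
      interpret D: bounded_linear "frechet_derivative \<alpha> (at ?Y)" using has_derivative_bounded_linear[OF D] .
      show "(v has_vector_derivative e + \<alpha> ?Y e + frechet_derivative \<alpha> (at ?Y) (v t) ?w) (at t within {0..1})"
        unfolding v_def by (rule has_vector_derivative_at_within) (use v' T1[OF t] w in blast)
      have Yd: "((\<lambda>t. Y (t, ?w, ?y)) has_vector_derivative ?w + \<alpha> ?Y ?w) (at t)"
        using Y'[rule_format, OF T1[OF t] w(1), of ?y] \<beta>(1) YR by simp
      have "((\<lambda>t. \<alpha> (Y (t, ?w, ?y))) has_vector_derivative frechet_derivative \<alpha> (at ?Y) (?w + \<alpha> ?Y ?w)) (at t)"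
        using has_derivative_compose[OF Yd[unfolded has_vector_derivative_def] D]
        by (simp add: has_vector_derivative_def D.scaleR)
      then have "((\<lambda>t. e + \<alpha> (Y (t, ?w, ?y)) e) has_vector_derivative frechet_derivative \<alpha> (at ?Y) (?w + \<alpha> ?Y ?w) e) (at t)"
        using has_vector_derivative_add[OF has_vector_derivative_const[of e] bounded_linear.has_vector_derivative[OF blinfun.bounded_linear_left]]
        by fastforce
      from has_vector_derivative_scaleR[OF DERIV_ident this]
      have A: "((\<lambda>t. t *\<^sub>R (e + \<alpha> (Y (t, ?w, ?y)) e)) has_vector_derivative
          t *\<^sub>R frechet_derivative \<alpha> (at ?Y) (?w + \<alpha> ?Y ?w) e + 1 *\<^sub>R (e + \<alpha> ?Y e)) (at t)" .
      have B: "t *\<^sub>R frechet_derivative \<alpha> (at ?Y) (?w + \<alpha> ?Y ?w) e + 1 *\<^sub>R (e + \<alpha> ?Y e) =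
          e + \<alpha> ?Y e + frechet_derivative \<alpha> (at ?Y) (t *\<^sub>R (e + \<alpha> ?Y e)) ?w"
        using integrable[OF YU e w(3)] by (simp add: D.scaleR blinfun.scaleR_left)
      show "((\<lambda>t. t *\<^sub>R (e + \<alpha> (Y (t, ?w, ?y)) e)) has_vector_derivative
          e + \<alpha> ?Y e + frechet_derivative \<alpha> (at ?Y) (t *\<^sub>R (e + \<alpha> ?Y e)) ?w) (at t within {0..1})"
        by (rule has_vector_derivative_at_within[OF A[unfolded B]])
      have "norm (e + \<alpha> ?Y e + frechet_derivative \<alpha> (at ?Y) (v t) ?w -
          (e + \<alpha> ?Y e + frechet_derivative \<alpha> (at ?Y) (t *\<^sub>R (e + \<alpha> ?Y e)) ?w)) =
          norm (frechet_derivative \<alpha> (at ?Y) (v t - t *\<^sub>R (e + \<alpha> ?Y e)) ?w)"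
        by (simp add: D.diff blinfun.diff_left)
      also have "\<dots> \<le> norm (frechet_derivative \<alpha> (at ?Y) (v t - t *\<^sub>R (e + \<alpha> ?Y e))) * norm ?w" by (rule norm_blinfun)
      also have "\<dots> \<le> (L * norm (v t - t *\<^sub>R (e + \<alpha> ?Y e))) * r"
        using DL YR w L by (intro mult_mono) auto
      finally show "norm (e + \<alpha> ?Y e + frechet_derivative \<alpha> (at ?Y) (v t) ?w -
          (e + \<alpha> ?Y e + frechet_derivative \<alpha> (at ?Y) (t *\<^sub>R (e + \<alpha> ?Y e)) ?w)) \<le> L * r * norm (v t - t *\<^sub>R (e + \<alpha> ?Y e))"
        by (simp add: mult_ac)
    qed (use L r v0 w in \<open>auto simp: v_def\<close>)
    then have v1: "v 1 = e + \<alpha> (\<psi> z) e" by (simp add: \<psi>_def \<Theta>_def)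
    have YD: "(Y has_derivative frechet_derivative Y (at (1, ?w, ?y))) (at (1, ?w, ?y))"
      by (rule smooth_on_has_derivative[OF Y_smooth]) (use w in simp)
    have pd: "(p has_derivative P) (at z)"
      unfolding p_def by (rule P.has_derivative[THEN has_derivative_eq_rhs]) (auto intro!: derivative_eq_intros)
    have "((\<lambda>z. (1::real, p z, z - p z)) has_derivative (\<lambda>h. (0, P h, h - P h))) (at z)"
      by (intro has_derivative_Pair has_derivative_const pd has_derivative_diff has_derivative_ident)
    from has_derivative_compose[OF this YD]
    have "(\<psi> has_derivative (\<lambda>h. frechet_derivative Y (at (1, ?w, ?y)) (0, P h, h - P h))) (at z)"
      by (simp add: \<psi>_def \<Theta>_def)
    from frechet_derivative_at[OF this, symmetric] show ?thesis using v1 e by (simp add: v_def)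
  qed
  have inv: "frechet_derivative \<psi> (at (\<kappa> x)) (frechet_derivative \<kappa> (at x) v) = v"
    and inv2: "frechet_derivative \<kappa> (at x) (frechet_derivative \<psi> (at (\<kappa> x)) v) = v" if x: "x \<in> U1" for x v
  proof -
    have dx: "(\<kappa> has_derivative frechet_derivative \<kappa> (at x)) (at x)"
      by (rule smooth_on_has_derivative[OF s\<kappa>]) (use x in \<open>simp add: U1_def\<close>)
    have zU: "\<kappa> x \<in> U2" using x im1 by blast
    have dz: "(\<psi> has_derivative frechet_derivative \<psi> (at (\<kappa> x))) (at (\<kappa> x))"
      by (rule smooth_on_has_derivative[OF s\<psi>]) (use zU in \<open>simp add: U2_def\<close>)
    have "((\<lambda>x. \<psi> (\<kappa> x)) has_derivative (\<lambda>v. v)) (at x)"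
      by (rule has_derivative_transform_within_open[OF has_derivative_ident U1 x]) (simp add: U1r)
    from has_derivative_unique[OF has_derivative_compose[OF dx dz] this]
    show "frechet_derivative \<psi> (at (\<kappa> x)) (frechet_derivative \<kappa> (at x) v) = v" by meson
    have A: "((\<lambda>z. \<kappa> (\<psi> z)) has_derivative (\<lambda>v. v)) (at (\<kappa> x))"
      by (rule has_derivative_transform_within_open[OF has_derivative_ident U2 zU]) (simp add: U2r)
    have "((\<lambda>z. \<kappa> (\<psi> z)) has_derivative (\<lambda>v. frechet_derivative \<kappa> (at x) (frechet_derivative \<psi> (at (\<kappa> x)) v))) (at (\<kappa> x))"
      by (rule has_derivative_compose[OF dz]) (use dx U1r[OF x] in simp)
    from has_derivative_unique[OF this A]
    show "frechet_derivative \<kappa> (at x) (frechet_derivative \<psi> (at (\<kappa> x)) v) = v" by meson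
  qed
  show ?thesis
  proof (rule that[OF U1 x0 _ U2 _ _ im1 im2])
    show "U1 \<subseteq> U" using U1U R by blast
    show "smooth_on U1 \<kappa>" by (rule smooth_on_subset[OF s\<kappa>]) (simp add: U1_def)
    show "smooth_on U2 \<psi>" by (rule smooth_on_subset[OF s\<psi>]) (simp add: U2_def)
    show "\<forall>x\<in>U1. \<forall>v. P (frechet_derivative \<kappa> (at x) v) = frechet_derivative \<kappa> (at x) v \<longleftrightarrow> v = P v + \<alpha> x v"
    \<comment> \<open>Both directions use that v = P v + \<alpha> x v means v = D\<psi>(P v), and
      that D\<kappa> and D\<psi> are inverse to each other.\<close>
    proof (intro ballI allI iffI)
      fix x v assume x: "x \<in> U1"
      have xU: "x \<in> U" using U1U[OF x] R by blast
      have zU: "\<kappa> x \<in> U2" using x im1 by blast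
      { assume "P (frechet_derivative \<kappa> (at x) v) = frechet_derivative \<kappa> (at x) v"
        then have v: "v = frechet_derivative \<kappa> (at x) v + \<alpha> x (frechet_derivative \<kappa> (at x) v)" (is "v = ?e + _")
          using D\<psi>[OF zU] inv[OF x, of v] U1r[OF x] by simp
        then have Pv: "P v = ?e"
          using \<alpha>P(1)[OF xU] \<open>P ?e = ?e\<close> P.add by (metis add.right_neutral)
        then show "v = P v + \<alpha> x v" using v \<alpha>P(2)[OF xU, of v] by simp }
      { assume v: "v = P v + \<alpha> x v"
        then have "frechet_derivative \<psi> (at (\<kappa> x)) (P v) = v"
          using D\<psi>[OF zU P(2)] U1r[OF x] \<alpha>P(2)[OF xU, of v] by simp
        then have "frechet_derivative \<kappa> (at x) v = P v" using inv2[OF x, of "P v"] by simp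
        then show "P (frechet_derivative \<kappa> (at x) v) = frechet_derivative \<kappa> (at x) v" by (simp add: P(2)) }
    qed
  qed (use U1r U2r in auto)
qed

section \<open>Lagrangian subspaces\<close>

text \<open>Identifies the dual space with V, so that dimension and orthogonality arguments for
  Lagrangian subspaces can be carried out in V \<times> V.\<close>

definition riesz :: "('b::euclidean_space \<Rightarrow>\<^sub>L real) \<Rightarrow> 'b" where
  "riesz \<xi> = (\<Sum>b\<in>Basis. blinfun_apply \<xi> b *\<^sub>R b)"

lemma inner_riesz: "riesz \<xi> \<bullet> v = blinfun_apply \<xi> v"
proof -
  have "riesz \<xi> \<bullet> v = (\<Sum>b\<in>Basis. (v \<bullet> b) *\<^sub>R blinfun_apply \<xi> b)"
    by (simp add: riesz_def inner_sum_left mult.commute inner_commute[of v])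
  also have "\<dots> = blinfun_apply \<xi> v"
    by (rule bounded_linear_sum_Basis[symmetric]) (simp add: blinfun.bounded_linear_right bounded_linear.linear)
  finally show ?thesis .
qed

lemma bounded_linear_riesz: "bounded_linear riesz"
  unfolding riesz_def
  by (intro bounded_linear_sum bounded_linear_compose[OF bounded_linear_scaleR_left] blinfun.bounded_linear_left)

lemma riesz_inner_left [simp]: "riesz (blinfun_inner_left w) = w"
  by (rule euclidean_eqI) (simp add: inner_riesz inner_commute[of w])

lemma inner_left_riesz [simp]: "blinfun_inner_left (riesz \<xi>) = \<xi>"
  by (rule blinfun_eqI) (simp add: inner_riesz inner_commute[of _ "riesz \<xi>"])

lemma riesz_eq_0_iff: "riesz \<xi> = 0 \<longleftrightarrow> \<xi> = 0"
  using inner_left_riesz[of \<xi>] linear_0[OF bounded_linear.linear[OF bounded_linear_riesz]]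
  by (metis inner_riesz inner_zero_left blinfun_eqI zero_blinfun.rep_eq)

lemma dim_gen:
  fixes L :: "'b::euclidean_space gen set"
  shows "dim L = dim ((\<lambda>(v, \<xi>). (v, riesz \<xi>)) ` L)"
proof -
  let ?g = "\<lambda>(v::'b, w::'b). (v, blinfun_inner_left w)"
  have "bounded_linear (\<lambda>p. (fst p, blinfun_inner_left (snd p)) :: 'b gen)"
    by (intro bounded_linear_Pair bounded_linear_fst bounded_linear_compose[OF bounded_linear_blinfun_inner_left] bounded_linear_snd)
  then have "linear ?g" by (simp add: bounded_linear.linear split_def)
  moreover have "inj ?g"
    by (rule injI) (auto, metis riesz_inner_left)
  ultimately have "dim (?g ` ((\<lambda>(v, \<xi>). (v, riesz \<xi>)) ` L)) = dim ((\<lambda>(v, \<xi>). (v, riesz \<xi>)) ` L)"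
    using dim_image_eq inj_on_subset subset_UNIV by blast
  moreover have "?g ` ((\<lambda>(v, \<xi>). (v, riesz \<xi>)) ` L) = L" by (force simp: image_image split_def)
  ultimately show ?thesis by simp
qed

lemma lagrangian_subspace: "lagrangian L \<Longrightarrow> subspace L"
  by (simp add: lagrangian_def)

lemma lagrangian_isotropic:
  "lagrangian L \<Longrightarrow> (v, \<xi>) \<in> L \<Longrightarrow> (w, \<eta>) \<in> L \<Longrightarrow> blinfun_apply \<xi> w + blinfun_apply \<eta> v = 0"
  by (fastforce simp: lagrangian_def gen_inner_def)

text \<open>In V \<times> V, exchanging the two components turns the pairing into the Euclidean
  inner product. Isotropy then puts the exchanged copy of L inside the orthogonal complement of L.
  Both have dimension n inside a space of dimension 2n, so they coincide.\<close>

lemma lagrangian_maximal: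
  fixes L :: "'b::euclidean_space gen set"
  assumes L: "lagrangian L" and x: "\<And>w \<eta>. (w, \<eta>) \<in> L \<Longrightarrow> blinfun_apply \<xi> w + blinfun_apply \<eta> v = 0"
  shows "(v, \<xi>) \<in> L"
proof -
  let ?S = "\<lambda>(v, \<xi>). (v, riesz \<xi>) :: 'b \<times> 'b" and ?W = "\<lambda>(a, b). (b, a) :: 'b \<times> 'b"
  have "linear (\<lambda>p. (fst p, riesz (snd p)) :: 'b \<times> 'b)"
    by (intro bounded_linear.linear bounded_linear_Pair bounded_linear_fst bounded_linear_compose[OF bounded_linear_riesz] bounded_linear_snd)
  then have S: "linear ?S" by (simp add: split_def)
  have "linear (\<lambda>p. (snd p, fst p) :: 'b \<times> 'b)"
    by (intro bounded_linear.linear bounded_linear_Pair bounded_linear_fst bounded_linear_snd)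
  then have W: "linear ?W" by (simp add: split_def)
  have injW: "inj ?W" by (auto intro: injI)
  define A where "A = ?S ` L"
  have A: "subspace A" unfolding A_def by (intro linear_subspace_image S lagrangian_subspace L)
  have dA: "dim A = DIM('b)" using L dim_gen[of L] by (simp add: A_def lagrangian_def)
  have WA: "subspace (?W ` A)" by (intro linear_subspace_image W A)
  have dWA: "dim (?W ` A) = DIM('b)"
    using dim_image_eq[OF W inj_on_subset[OF injW subset_UNIV]] dA by simp
  define C where "C = {y \<in> UNIV. \<forall>x\<in>A. orthogonal x y}"
  have dC: "dim C = DIM('b)"
    using dim_subspace_orthogonal_to_vectors[OF A subspace_UNIV] dA by (simp add: C_def)
  have C: "subspace C" unfolding C_def using subspace_orthogonal_to_vectors by simp
  have "?W ` A \<subseteq> C"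
    using lagrangian_isotropic[OF L] by (fastforce simp: C_def A_def orthogonal_def inner_riesz inner_commute[of _ "riesz _"])
  then have "?W ` A = C" using subspace_dim_equal[OF WA C] dWA dC by simp
  moreover have "(riesz \<xi>, v) \<in> C"
    using x by (auto simp: C_def A_def orthogonal_def inner_riesz inner_commute[of _ "riesz \<xi>"] add.commute)
  ultimately have "(v, riesz \<xi>) \<in> A" by auto
  then obtain \<xi>' where "(v, \<xi>') \<in> L" "riesz \<xi>' = riesz \<xi>" by (auto simp: A_def)
  then show ?thesis by (metis inner_left_riesz)
qed

lemma lagrangian_Pair_0_iff:
  assumes "lagrangian L" shows "(v, 0) \<in> L \<longleftrightarrow> (\<forall>\<eta>\<in>snd ` L. blinfun_apply \<eta> v = 0)"
  using lagrangian_isotropic[OF assms, of v 0] lagrangian_maximal[OF assms, of 0 v] by force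

lemma lagrangian_0_Pair_iff:
  assumes "lagrangian L" shows "(0, \<xi>) \<in> L \<longleftrightarrow> \<xi> \<in> annihilator (fst ` L)"
  using lagrangian_isotropic[OF assms, of 0 \<xi>] lagrangian_maximal[OF assms, of \<xi> 0]
  by (force simp: annihilator_def)

lemma lagrangian_diff: "lagrangian L \<Longrightarrow> x \<in> L \<Longrightarrow> y \<in> L \<Longrightarrow> x - y \<in> L"
  using lagrangian_subspace subspace_diff by blast

text \<open>By maximality the kernel is the orthogonal complement of the covector parts of L. Taking
  the complement twice recovers these covectors as the annihilator of the kernel.\<close>

lemma lagrangian_snd_image:
  fixes L :: "'b::euclidean_space gen set"
  assumes L: "lagrangian L" shows "snd ` L = annihilator {v. (v, 0) \<in> L}"
proof (intro equalityI subsetI)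
  fix \<xi> assume "\<xi> \<in> snd ` L"
  then show "\<xi> \<in> annihilator {v. (v, 0) \<in> L}"
    using lagrangian_Pair_0_iff[OF L] by (auto simp: annihilator_def)
next
  fix \<xi> assume \<xi>: "\<xi> \<in> annihilator {v. (v, 0) \<in> L}"
  let ?W = "riesz ` (snd ` L)"
  have "linear (snd :: 'b gen \<Rightarrow> _)" by (rule bounded_linear.linear[OF bounded_linear_snd])
  then have W: "subspace ?W"
    by (intro linear_subspace_image lagrangian_subspace L bounded_linear.linear[OF bounded_linear_riesz])
  have K: "{v. (v, 0) \<in> L} = ?W\<^sup>\<bottom>"
    using lagrangian_Pair_0_iff[OF L] by (auto simp: orthogonal_comp_def orthogonal_def inner_riesz)
  have "riesz \<xi> \<in> (?W\<^sup>\<bottom>)\<^sup>\<bottom>"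
    using \<xi> unfolding K annihilator_def orthogonal_comp_def[of "?W\<^sup>\<bottom>"]
    by (auto simp: orthogonal_def inner_riesz inner_commute[of _ "riesz \<xi>"])
  then have "riesz \<xi> \<in> ?W" by (simp add: orthogonal_comp_self[OF W])
  then show "\<xi> \<in> snd ` L" by (metis (no_types, lifting) image_iff inner_left_riesz)
qed

text \<open>The choice does not matter on the image of L: two covectors paired with the same v
  differ by an element of L with zero vector part, which annihilates the image by isotropy.\<close>

definition lag_form :: "'b::euclidean_space gen set \<Rightarrow> 'b \<Rightarrow> 'b \<Rightarrow> real" where
  "lag_form L v w = blinfun_apply (SOME \<xi>. (v, \<xi>) \<in> L) w"

definition lag_bivector :: "'b::euclidean_space gen set \<Rightarrow> ('b \<Rightarrow>\<^sub>L real) \<Rightarrow> ('b \<Rightarrow>\<^sub>L real) \<Rightarrow> real" where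
  "lag_bivector L \<xi> \<eta> = blinfun_apply \<eta> (SOME v. (v, \<xi>) \<in> L)"

lemma lag_form_eq:
  assumes L: "lagrangian L" and "(v, \<xi>) \<in> L" "w \<in> fst ` L"
  shows "lag_form L v w = blinfun_apply \<xi> w"
proof -
  let ?\<xi> = "SOME \<xi>. (v, \<xi>) \<in> L"
  have "(v, ?\<xi>) \<in> L" using assms(2) by (rule someI)
  from lagrangian_diff[OF L this assms(2)] have "(0, ?\<xi> - \<xi>) \<in> L" by simp
  then show ?thesis
    using assms(3) by (auto simp: lagrangian_0_Pair_iff[OF L] annihilator_def lag_form_def blinfun.diff_left)
qed

lemma lag_bivector_eq:
  assumes L: "lagrangian L" and "(v, \<xi>) \<in> L" "\<eta> \<in> snd ` L"
  shows "lag_bivector L \<xi> \<eta> = blinfun_apply \<eta> v"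
proof -
  let ?v = "SOME v. (v, \<xi>) \<in> L"
  have "(?v, \<xi>) \<in> L" using assms(2) by (rule someI)
  from lagrangian_diff[OF L this assms(2)] have "(?v - v, 0) \<in> L" by simp
  then show ?thesis
    using assms(3) by (auto simp: lagrangian_Pair_0_iff[OF L] lag_bivector_def blinfun.diff_right)
qed

lemma subspace_comb: "subspace L \<Longrightarrow> x \<in> L \<Longrightarrow> y \<in> L \<Longrightarrow> a *\<^sub>R x + b *\<^sub>R y \<in> L"
  by (simp add: subspace_add subspace_scale)

lemma alternating_lag_form:
  assumes L: "lagrangian L" shows "alternating_on (fst ` L) (lag_form L)"
proof -
  have eq: "\<exists>\<xi>. (v, \<xi>) \<in> L \<and> (\<forall>w\<in>fst ` L. lag_form L v w = blinfun_apply \<xi> w)" if "v \<in> fst ` L" for v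
    using that lag_form_eq[OF L] by force
  show ?thesis
    unfolding alternating_on_def
  proof (intro conjI ballI allI)
    fix u v w a b assume "u \<in> fst ` L" "v \<in> fst ` L" "w \<in> fst ` L"
    then obtain \<xi> \<eta> \<zeta> where x: "(u, \<xi>) \<in> L" "(v, \<eta>) \<in> L" "(w, \<zeta>) \<in> L" by force
    have c: "(a *\<^sub>R u + b *\<^sub>R v, a *\<^sub>R \<xi> + b *\<^sub>R \<eta>) \<in> L"
      using subspace_comb[OF lagrangian_subspace[OF L] x(1,2), of a b] by simp
    have f: "u \<in> fst ` L" "v \<in> fst ` L" "w \<in> fst ` L" "a *\<^sub>R u + b *\<^sub>R v \<in> fst ` L" using x c by force+
    show "lag_form L (a *\<^sub>R u + b *\<^sub>R v) w = a * lag_form L u w + b * lag_form L v w"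
      using lag_form_eq[OF L c f(3)] lag_form_eq[OF L x(1) f(3)] lag_form_eq[OF L x(2) f(3)]
      by (simp add: blinfun.add_left blinfun.scaleR_left)
    show "lag_form L w (a *\<^sub>R u + b *\<^sub>R v) = a * lag_form L w u + b * lag_form L w v"
      using lag_form_eq[OF L x(3) f(4)] lag_form_eq[OF L x(3) f(1)] lag_form_eq[OF L x(3) f(2)]
      by (simp add: blinfun.add_right blinfun.scaleR_right)
  next
    fix v assume "v \<in> fst ` L"
    then obtain \<xi> where x: "(v, \<xi>) \<in> L" by force
    then have "v \<in> fst ` L" by force
    then show "lag_form L v v = 0" using lag_form_eq[OF L x] lagrangian_isotropic[OF L x x] by simp
  qed
qed

lemma alternating_lag_bivector:
  assumes L: "lagrangian L" shows "alternating_on (snd ` L) (lag_bivector L)"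
  unfolding alternating_on_def
proof (intro conjI ballI allI)
  fix u v w a b assume "u \<in> snd ` L" "v \<in> snd ` L" "w \<in> snd ` L"
  then obtain \<xi> \<eta> \<zeta> where x: "(\<xi>, u) \<in> L" "(\<eta>, v) \<in> L" "(\<zeta>, w) \<in> L" by force
  have c: "(a *\<^sub>R \<xi> + b *\<^sub>R \<eta>, a *\<^sub>R u + b *\<^sub>R v) \<in> L"
    using subspace_comb[OF lagrangian_subspace[OF L] x(1,2), of a b] by simp
  have f: "u \<in> snd ` L" "v \<in> snd ` L" "w \<in> snd ` L" "a *\<^sub>R u + b *\<^sub>R v \<in> snd ` L" using x c by force+
  show "lag_bivector L (a *\<^sub>R u + b *\<^sub>R v) w = a * lag_bivector L u w + b * lag_bivector L v w"
    using lag_bivector_eq[OF L c f(3)] lag_bivector_eq[OF L x(1) f(3)] lag_bivector_eq[OF L x(2) f(3)]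
    by (simp add: blinfun.add_right blinfun.scaleR_right)
  show "lag_bivector L w (a *\<^sub>R u + b *\<^sub>R v) = a * lag_bivector L w u + b * lag_bivector L w v"
    using lag_bivector_eq[OF L x(3) f(4)] lag_bivector_eq[OF L x(3) f(1)] lag_bivector_eq[OF L x(3) f(2)]
    by (simp add: blinfun.add_left blinfun.scaleR_left)
next
  fix v assume "v \<in> snd ` L"
  then obtain \<xi> where x: "(\<xi>, v) \<in> L" by force
  then have "v \<in> snd ` L" by force
  then show "lag_bivector L v v = 0" using lag_bivector_eq[OF L x] lagrangian_isotropic[OF L x x] by simp
qed

text \<open>Two covectors with the same restriction to the image differ by one that annihilates the
  image, and such a covector belongs to L by maximality.\<close>

lemma lag_of_form_lag_form:
  assumes L: "lagrangian L" shows "lag_of_form (fst ` L) (lag_form L) = L"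
proof (intro equalityI subrelI)
  fix v \<xi> assume "(v, \<xi>) \<in> lag_of_form (fst ` L) (lag_form L)"
  then have a: "v \<in> fst ` L" "\<forall>w\<in>fst ` L. blinfun_apply \<xi> w = lag_form L v w" by (auto simp: lag_of_form_def)
  then obtain \<eta> where \<eta>: "(v, \<eta>) \<in> L" by force
  have "\<xi> - \<eta> \<in> annihilator (fst ` L)"
    using a(2) lag_form_eq[OF L \<eta>] by (auto simp: annihilator_def blinfun.diff_left)
  then have "(0, \<xi> - \<eta>) \<in> L" by (simp add: lagrangian_0_Pair_iff[OF L])
  from subspace_add[OF lagrangian_subspace[OF L] \<eta> this] show "(v, \<xi>) \<in> L" by simp
next
  fix v \<xi> assume "(v, \<xi>) \<in> L"
  then show "(v, \<xi>) \<in> lag_of_form (fst ` L) (lag_form L)"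
    using lag_form_eq[OF L] by (force simp: lag_of_form_def)
qed

lemma lag_of_bivector_lag_bivector:
  assumes L: "lagrangian L" shows "lag_of_bivector (snd ` L) (lag_bivector L) = L"
proof (intro equalityI subrelI)
  fix v \<xi> assume "(v, \<xi>) \<in> lag_of_bivector (snd ` L) (lag_bivector L)"
  then have a: "\<xi> \<in> snd ` L" "\<forall>\<eta>\<in>snd ` L. blinfun_apply \<eta> v = lag_bivector L \<xi> \<eta>" by (auto simp: lag_of_bivector_def)
  then obtain w where w: "(w, \<xi>) \<in> L" by force
  have "\<forall>\<eta>\<in>snd ` L. blinfun_apply \<eta> (v - w) = 0"
    using a(2) lag_bivector_eq[OF L w] by (auto simp: blinfun.diff_right)
  then have "(v - w, 0) \<in> L" by (simp add: lagrangian_Pair_0_iff[OF L])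
  from subspace_add[OF lagrangian_subspace[OF L] w this] show "(v, \<xi>) \<in> L" by simp
next
  fix v \<xi> assume "(v, \<xi>) \<in> L"
  then show "(v, \<xi>) \<in> lag_of_bivector (snd ` L) (lag_bivector L)"
    using lag_bivector_eq[OF L] by (force simp: lag_of_bivector_def)
qed

section \<open>Image, kernel and type of a Lagrangian subspace\<close>

abbreviation lag_kernel :: "'b::euclidean_space gen set \<Rightarrow> 'b set" where
  "lag_kernel L \<equiv> {v. (v, 0) \<in> L}"

lemma subspace_lag_kernel: "lagrangian L \<Longrightarrow> subspace (lag_kernel L)"
  using lagrangian_subspace[of L] unfolding subspace_def
  by (auto simp: zero_prod_def) (metis add_Pair add.right_neutral, metis scaleR_Pair scaleR_zero_right)

lemma subspace_lag_image: "lagrangian L \<Longrightarrow> subspace (fst ` L)"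
  by (intro linear_subspace_image lagrangian_subspace) (simp_all add: bounded_linear.linear bounded_linear_fst)

text \<open>The covectors contained in L form the annihilator of the image, whose dimension is
  complementary to that of the image.\<close>

lemma lag_type_eq:
  fixes L :: "'b::euclidean_space gen set"
  assumes L: "lagrangian L"
  shows "lag_type L = (dim (lag_kernel L), DIM('b) - dim (fst ` L))"
proof -
  have 1: "dim (L \<inter> UNIV \<times> {0}) = dim (lag_kernel L)"
  proof -
    have "linear (\<lambda>v::'b. (v, 0 :: 'b \<Rightarrow>\<^sub>L real))"
      by (intro bounded_linear.linear bounded_linear_Pair bounded_linear_ident bounded_linear_zero)
    then have "dim ((\<lambda>v::'b. (v, 0 :: 'b \<Rightarrow>\<^sub>L real)) ` lag_kernel L) = dim (lag_kernel L)"
      by (rule dim_image_eq) (auto intro: inj_onI)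
    moreover have "(\<lambda>v::'b. (v, 0 :: 'b \<Rightarrow>\<^sub>L real)) ` lag_kernel L = L \<inter> UNIV \<times> {0}" by auto
    ultimately show ?thesis by simp
  qed
  have 2: "dim (L \<inter> {0} \<times> UNIV) = DIM('b) - dim (fst ` L)"
  proof -
    let ?N = "{y \<in> UNIV. \<forall>x\<in>fst ` L. orthogonal x y}"
    have "linear (\<lambda>w::'b. (0::'b, blinfun_inner_left w))"
      by (intro bounded_linear.linear bounded_linear_Pair bounded_linear_zero bounded_linear_blinfun_inner_left)
    then have "dim ((\<lambda>w::'b. (0::'b, blinfun_inner_left w)) ` ?N) = dim ?N"
      by (rule dim_image_eq) (auto intro!: inj_onI, metis riesz_inner_left)
    moreover have "(\<lambda>w::'b. (0::'b, blinfun_inner_left w)) ` ?N = L \<inter> {0} \<times> UNIV"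
    proof (intro equalityI subrelI)
      fix v \<xi> assume "(v, \<xi>) \<in> (\<lambda>w::'b. (0::'b, blinfun_inner_left w)) ` ?N"
      then obtain w where w: "v = 0" "\<xi> = blinfun_inner_left w" "\<forall>x\<in>fst ` L. orthogonal x w" by auto
      then have "\<xi> \<in> annihilator (fst ` L)" by (simp add: annihilator_def orthogonal_def)
      then show "(v, \<xi>) \<in> L \<inter> {0} \<times> UNIV" using w(1) lagrangian_0_Pair_iff[OF L] by simp
    next
      fix v \<xi> assume "(v, \<xi>) \<in> L \<inter> {0} \<times> UNIV"
      then have v: "v = 0" "\<xi> \<in> annihilator (fst ` L)" using lagrangian_0_Pair_iff[OF L] by auto
      then have "riesz \<xi> \<in> ?N"
        by (auto simp: annihilator_def orthogonal_def inner_riesz inner_commute[of _ "riesz \<xi>"])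
      then show "(v, \<xi>) \<in> (\<lambda>w::'b. (0::'b, blinfun_inner_left w)) ` ?N"
        using v(1) by (intro image_eqI[of _ _ "riesz \<xi>"]) simp_all
    qed
    moreover have "dim ?N + dim (fst ` L) = DIM('b)"
      using dim_subspace_orthogonal_to_vectors[OF subspace_lag_image[OF L] subspace_UNIV] by simp
    ultimately show ?thesis by simp
  qed
  show ?thesis by (simp add: lag_type_def 1 2)
qed

text \<open>An alternating form on a line vanishes, so the vectors of the image lie in L by
  themselves.\<close>

lemma lag_kernel_of_dim_image_1:
  assumes L: "lagrangian L" and d: "dim (fst ` L) = 1"
  shows "dim (lag_kernel L) = 1"
proof -
  have "\<exists>v0. fst ` L = span {v0}"
  proof -
    obtain B where B: "B \<subseteq> fst ` L" "fst ` L \<subseteq> span B" "card B = 1"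
      using basis_exists[of "fst ` L"] d by metis
    then obtain v0 where "B = {v0}" using card_1_singletonE by blast
    then show ?thesis using B span_minimal[OF _ subspace_lag_image[OF L], of B] by blast
  qed
  then obtain v0 where v0: "fst ` L = span {v0}" by blast
  have "v0 \<in> fst ` L" by (simp add: v0 span_base)
  then obtain \<xi> where \<xi>: "(v0, \<xi>) \<in> L" by force
  have "blinfun_apply \<xi> v0 = 0" using lagrangian_isotropic[OF L \<xi> \<xi>] by simp
  then have "\<xi> \<in> annihilator (fst ` L)" by (auto simp: annihilator_def v0 span_singleton blinfun.scaleR_right)
  then have "(0, \<xi>) \<in> L" by (simp add: lagrangian_0_Pair_iff[OF L])
  from lagrangian_diff[OF L \<xi> this] have "v0 \<in> lag_kernel L" by simp
  then have "fst ` L \<subseteq> lag_kernel L" using v0 span_minimal[OF _ subspace_lag_kernel[OF L], of "{v0}"] by simp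
  moreover have "lag_kernel L \<subseteq> fst ` L" by force
  ultimately show ?thesis using d by (simp add: subset_antisym)
qed

section \<open>Lagrangian subspaces near a given one\<close>

lemma orthogonal_projection_exists:
  fixes F :: "'b::euclidean_space set"
  assumes "subspace F"
  obtains P where "bounded_linear P" "\<And>x. P x \<in> F" "\<And>x. x \<in> F \<Longrightarrow> P x = x" "\<And>x. P (P x) = P x" "\<And>x y. P x \<bullet> y = x \<bullet> P y"
proof -
  obtain B where B: "B \<subseteq> F" "pairwise orthogonal B" "\<And>x. x \<in> B \<Longrightarrow> norm x = 1" "independent B" "span B = F"
    using orthonormal_basis_subspace[OF assms] by metis
  have fin: "finite B" using B(4) independent_imp_finite by blast
  define P where "P = (\<lambda>x. \<Sum>b\<in>B. (x \<bullet> b) *\<^sub>R b)"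
  have P: "bounded_linear P" unfolding P_def
    by (intro bounded_linear_sum bounded_linear_compose[OF bounded_linear_scaleR_left] bounded_linear_inner_left)
  have PF: "P x \<in> F" for x
    unfolding P_def B(5)[symmetric] by (intro span_sum span_scale span_base)
  have Pb: "P b = b" if "b \<in> B" for b
  proof -
    have "P b = (\<Sum>c\<in>B. if c = b then b else 0)"
      unfolding P_def using B(2,3) that
      by (intro sum.cong) (auto simp: pairwise_def orthogonal_def norm_eq_1)
    then show ?thesis using fin that by simp
  qed
  have PF_id: "P x = x" if "x \<in> F" for x
  proof -
    have "x \<in> span B" using that B(5) by simp
    then show ?thesis
      using linear_eq_on[OF bounded_linear.linear[OF P] linear_ident, of x B] Pb by blast
  qed
  have "P x \<bullet> y = x \<bullet> P y" for x y
    by (simp add: P_def inner_sum_left inner_sum_right inner_commute mult.commute)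
  then show ?thesis using that[OF P PF PF_id PF_id[OF PF]] by blast
qed

text \<open>
  Read off with \<open>proj_map P\<close>, the coordinates on a Lagrangian \<open>L\<close> near \<open>L\<^sub>0\<close> are the part of the vector along
  \<open>F\<close> and the part of the covector orthogonal to \<open>F\<close>, where \<open>F\<close> is either the image or the
  kernel of \<open>L\<^sub>0\<close>, and \<open>P\<close> is the orthogonal projection onto \<open>F\<close>.
\<close>

definition proj_map :: "('b \<Rightarrow> 'b) \<Rightarrow> 'b::euclidean_space gen \<Rightarrow> 'b" where
  "proj_map P x = P (fst x) + (riesz (snd x) - P (riesz (snd x)))"

lemma bounded_linear_proj_map:
  assumes "bounded_linear P" shows "bounded_linear (proj_map P)"
  unfolding proj_map_def[abs_def]
  by (intro bounded_linear_add bounded_linear_sub bounded_linear_compose[OF assms] bounded_linear_compose[OF bounded_linear_riesz]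
      bounded_linear_fst bounded_linear_snd)

locale orth_proj =
  fixes P :: "'b::euclidean_space \<Rightarrow> 'b"
  assumes linP: "bounded_linear P" and idem: "P (P x) = P x" and self_adj: "P x \<bullet> y = x \<bullet> P y"
begin

sublocale P: bounded_linear P by (rule linP)

lemma P_proj_map: "P (proj_map P x) = P (fst x)"
  by (simp add: proj_map_def P.add P.diff idem)

lemma proj_map_eq_0:
  assumes "proj_map P x = 0"
  shows "P (fst x) = 0" "P (riesz (snd x)) = riesz (snd x)"
proof -
  show "P (fst x) = 0" using P_proj_map[of x] assms by (simp add: P.zero)
  then show "P (riesz (snd x)) = riesz (snd x)" using assms by (simp add: proj_map_def)
qed

text \<open>Both orthogonal parts of the coordinate vanish. The vector part lies in F and has zero
  projection, so it is 0. The covector then annihilates F while its Riesz vector lies in F, so that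
  vector is orthogonal to itself.\<close>

lemma proj_map_inj_image:
  assumes L: "lagrangian L" and F: "fst ` L = {v. P v = v}" and x: "x \<in> L" "proj_map P x = 0"
  shows "x = 0"
proof -
  have "P (fst x) = fst x" using F x(1) by blast
  then have v: "fst x = 0" using proj_map_eq_0[OF x(2)] by simp
  then have "snd x \<in> annihilator (fst ` L)" using lagrangian_0_Pair_iff[OF L, of "snd x"] x(1) by (cases x) simp
  moreover have "riesz (snd x) \<in> fst ` L" using F proj_map_eq_0[OF x(2)] by simp
  ultimately have "riesz (snd x) \<bullet> riesz (snd x) = 0" by (auto simp: annihilator_def inner_riesz)
  then show ?thesis using v by (simp add: riesz_eq_0_iff prod_eq_iff)
qed

text \<open>The Riesz vector of the covector lies in F, but covectors of L annihilate the kernel F,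
  so it is orthogonal to itself. What remains is a vector of F with zero projection.\<close>

lemma proj_map_inj_kernel:
  assumes L: "lagrangian L" and F: "lag_kernel L = {v. P v = v}" and x: "x \<in> L" "proj_map P x = 0"
  shows "x = 0"
proof -
  have "riesz (snd x) \<in> lag_kernel L" using F proj_map_eq_0[OF x(2)] by blast
  then have "blinfun_apply (snd x) (riesz (snd x)) = 0"
    using lagrangian_Pair_0_iff[OF L] x(1) by blast
  then have "riesz (snd x) \<bullet> riesz (snd x) = 0" by (simp add: inner_riesz)
  then have s: "snd x = 0" by (simp add: riesz_eq_0_iff)
  then have "fst x \<in> lag_kernel L" using x(1) by (cases x) simp
  then have "fst x = 0" using F proj_map_eq_0[OF x(2)] by simp
  then show ?thesis using s by (simp add: prod_eq_iff)
qed

text \<open>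
  The distribution \<open>D\<close> is the image of \<open>L\<close>, if it has corank at most one, or the kernel of \<open>L\<close>, if it has
  rank at most one. The isotropy of \<open>L\<close> makes the components transversal to \<open>D\<close> vanish.
\<close>

lemma fst_eq_0_if_corank_le_1:
  assumes one: "\<And>a b. P a = 0 \<Longrightarrow> P b = 0 \<Longrightarrow> a \<bullet> b = 0 \<Longrightarrow> a = 0 \<or> b = 0"
    and L: "lagrangian L" and inj: "\<And>x. x \<in> L \<Longrightarrow> proj_map P x = 0 \<Longrightarrow> x = 0"
    and x: "x \<in> L" "P (proj_map P x) = 0"
  shows "fst x = 0"
proof -
  have v: "P (fst x) = 0" using P_proj_map x(2) by simp
  have "blinfun_apply (snd x) (fst x) = 0"
    using lagrangian_isotropic[OF L, of "fst x" "snd x" "fst x" "snd x"] x(1) by simp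
  then have "riesz (snd x) \<bullet> fst x = 0" by (simp add: inner_riesz)
  moreover have "P (riesz (snd x)) \<bullet> fst x = 0" using v by (simp add: self_adj)
  ultimately have "proj_map P x \<bullet> fst x = 0" using v by (simp add: proj_map_def inner_diff_left)
  \<comment> \<open>Both vectors lie in the kernel of P, where orthogonal vectors cannot both be
    nonzero. If the coordinate is 0, injectivity makes all of x vanish.\<close>
  then have "proj_map P x = 0 \<or> fst x = 0" using one x(2) v by blast
  then show ?thesis using inj[OF x(1)] by auto
qed

lemma snd_eq_0_if_rank_le_1:
  assumes one: "\<And>a b. P a = a \<Longrightarrow> P b = b \<Longrightarrow> a \<bullet> b = 0 \<Longrightarrow> a = 0 \<or> b = 0"
    and L: "lagrangian L" and inj: "\<And>x. x \<in> L \<Longrightarrow> proj_map P x = 0 \<Longrightarrow> x = 0"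
    and x: "x \<in> L" "P (proj_map P x) = proj_map P x"
  shows "snd x = 0"
proof -
  have e: "proj_map P x = P (fst x)" using P_proj_map[of x] x(2) by simp
  then have r: "P (riesz (snd x)) = riesz (snd x)" by (simp add: proj_map_def)
  have "blinfun_apply (snd x) (fst x) = 0"
    using lagrangian_isotropic[OF L, of "fst x" "snd x" "fst x" "snd x"] x(1) by simp
  then have "P (riesz (snd x)) \<bullet> fst x = 0" by (simp add: inner_riesz r)
  then have "riesz (snd x) \<bullet> proj_map P x = 0" by (simp add: self_adj e)
  \<comment> \<open>Here both vectors lie in the range of P, and isotropy has made them
    orthogonal.\<close>
  then have "riesz (snd x) = 0 \<or> proj_map P x = 0" using one r x(2) by blast
  then show ?thesis using inj[OF x(1)] by (auto simp: riesz_eq_0_iff)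
qed

text \<open>The kernel of the self-adjoint P is orthogonal to its range, and two nonzero orthogonal
  vectors in it would be independent.\<close>

lemma corank_le_1:
  assumes "DIM('b) \<le> dim {v. P v = v} + 1" "P a = 0" "P b = 0" "a \<bullet> b = 0"
  shows "a = 0 \<or> b = 0"
proof (rule ccontr)
  assume "\<not> (a = 0 \<or> b = 0)"
  then have ab: "a \<noteq> 0" "b \<noteq> 0" "a \<noteq> b" using assms(4) by auto
  have F: "subspace {v. P v = v}"
    by (auto simp: subspace_def P.add P.scaleR P.zero)
  have "independent {a, b}"
    by (rule pairwise_orthogonal_independent) (use ab assms(4) in \<open>auto simp: pairwise_def orthogonal_def inner_commute\<close>)
  moreover have "{a, b} \<subseteq> {y \<in> UNIV. \<forall>x\<in>{v. P v = v}. orthogonal x y}"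
    using assms(2,3) self_adj by (auto simp: orthogonal_def) (metis inner_zero_right)+
  ultimately have "card {a, b} \<le> dim {y \<in> UNIV. \<forall>x\<in>{v. P v = v}. orthogonal x y}"
    by (rule independent_card_le_dim[rotated])
  then show False
    using dim_subspace_orthogonal_to_vectors[OF F subspace_UNIV] assms(1) ab by simp
qed

lemma rank_le_1:
  assumes "dim {v. P v = v} \<le> 1" "P a = a" "P b = b" "a \<bullet> b = 0"
  shows "a = 0 \<or> b = 0"
proof (rule ccontr)
  assume "\<not> (a = 0 \<or> b = 0)"
  then have ab: "a \<noteq> 0" "b \<noteq> 0" "a \<noteq> b" using assms(4) by auto
  have "independent {a, b}"
    by (rule pairwise_orthogonal_independent) (use ab assms(4) in \<open>auto simp: pairwise_def orthogonal_def inner_commute\<close>)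
  then have "card {a, b} \<le> dim {v. P v = v}"
    by (rule independent_card_le_dim[rotated]) (use assms in auto)
  then show False using assms(1) ab by simp
qed

end

section \<open>Coordinate representations\<close>

lemma smooth_atlas_transition:
  "smooth_atlas B \<Longrightarrow> c \<in> B \<Longrightarrow> d \<in> B \<Longrightarrow> smooth_on (snd c ` (fst c \<inter> fst d)) (snd d \<circ> chart_inv c)"
  by (simp add: smooth_atlas_def)

locale smooth_manifold =
  fixes A :: "('a::topological_space, 'b::euclidean_space) chart set"
  assumes atlas: "smooth_atlas A"
begin

abbreviation chart_deriv :: "('a, 'b) chart \<Rightarrow> 'a \<Rightarrow> 'b \<Rightarrow> 'b" where
  "chart_deriv c p \<equiv> mderiv A (snd c) p"

lemma compatible_chart_mem: "c \<in> A \<Longrightarrow> compatible_chart A c"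
  by (simp add: compatible_chart_def insert_absorb atlas)

lemma chart_at: "chart_at A p \<in> A" "p \<in> fst (chart_at A p)"
proof -
  have "p \<in> (\<Union>c\<in>A. fst c)" using atlas by (simp add: smooth_atlas_def)
  then have "\<exists>c. c \<in> A \<and> p \<in> fst c" by blast
  from someI_ex[OF this] show "chart_at A p \<in> A" "p \<in> fst (chart_at A p)"
    by (simp_all add: chart_at_def)
qed

context
  fixes c :: "('a, 'b) chart"
  assumes c: "compatible_chart A c"
begin

lemma chart_homeomorphism: "homeomorphism (fst c) (snd c ` fst c) (snd c) (chart_inv c)"
  and chart_open: "open (fst c)" and chart_open_image: "open (snd c ` fst c)"
proof -
  have "open (fst c) \<and> open (snd c ` fst c) \<and> homeomorphism (fst c) (snd c ` fst c) (snd c) (chart_inv c)"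
    using c unfolding compatible_chart_def smooth_atlas_def by blast
  then show "homeomorphism (fst c) (snd c ` fst c) (snd c) (chart_inv c)" "open (fst c)" "open (snd c ` fst c)"
    by blast+
qed

lemma chart_inv_chart:
  assumes "p \<in> fst c" shows "chart_inv c (snd c p) = p"
  using homeomorphism_apply1[OF chart_homeomorphism assms] .

lemma chart_chart_inv: "y \<in> snd c ` fst c \<Longrightarrow> snd c (chart_inv c y) = y"
  by (rule homeomorphism_apply2[OF chart_homeomorphism])

lemma chart_inv_mem: "y \<in> snd c ` W \<Longrightarrow> W \<subseteq> fst c \<Longrightarrow> chart_inv c y \<in> W"
  using chart_inv_chart by auto

lemma chart_image_open: "open W \<Longrightarrow> open (snd c ` (fst c \<inter> W))"
proof -
  assume W: "open W"
  have "snd c ` (fst c \<inter> W) = (snd c ` fst c) \<inter> chart_inv c -` W"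
    using chart_inv_chart by auto
  moreover have "open \<dots>"
    by (rule continuous_open_preimage[OF homeomorphism_cont2[OF chart_homeomorphism] chart_open_image W])
  ultimately show ?thesis by simp
qed

lemma chart_image_open': "open W \<Longrightarrow> W \<subseteq> fst c \<Longrightarrow> open (snd c ` W)"
  using chart_image_open[of W] by (simp add: Int_absorb1)

lemma transition_to:
  "d \<in> A \<Longrightarrow> smooth_on (snd c ` (fst c \<inter> fst d)) (snd d \<circ> chart_inv c)"
  using c unfolding compatible_chart_def by (intro smooth_atlas_transition) blast+

lemma transition_from:
  "d \<in> A \<Longrightarrow> smooth_on (snd d ` (fst d \<inter> fst c)) (snd c \<circ> chart_inv d)"
  using c unfolding compatible_chart_def by (intro smooth_atlas_transition) blast+

end

lemma transition_mem:
  assumes "compatible_chart A c" "p \<in> fst c" shows "(snd d \<circ> chart_inv c) (snd c p) = snd d p"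
  by (simp add: chart_inv_chart[OF assms])

lemma transition_deriv_to:
  assumes c: "compatible_chart A c" and d: "d \<in> A" and p: "p \<in> fst c" "p \<in> fst d"
  shows "((snd d \<circ> chart_inv c) has_derivative frechet_derivative (snd d \<circ> chart_inv c) (at (snd c p))) (at (snd c p))"
  by (rule smooth_on_has_derivative[OF transition_to[OF c d]]) (use p in auto)

lemma transition_deriv_from:
  assumes c: "compatible_chart A c" and d: "d \<in> A" and p: "p \<in> fst c" "p \<in> fst d"
  shows "((snd c \<circ> chart_inv d) has_derivative frechet_derivative (snd c \<circ> chart_inv d) (at (snd d p))) (at (snd d p))"
  by (rule smooth_on_has_derivative[OF transition_from[OF c d]]) (use p in auto)

lemma mderiv_chart_at:
  "mderiv A f p = frechet_derivative (f \<circ> chart_inv (chart_at A p)) (at (snd (chart_at A p) p))"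
  by (simp add: mderiv_def Let_def)

lemma change_of_chart_deriv:
  assumes c: "compatible_chart A c" and d: "d \<in> A" and p: "p \<in> fst c" "p \<in> fst d"
    and f: "((f \<circ> chart_inv c) has_derivative D) (at (snd c p))"
  shows "((f \<circ> chart_inv d) has_derivative (\<lambda>v. D (frechet_derivative (snd c \<circ> chart_inv d) (at (snd d p)) v))) (at (snd d p))"
proof -
  have d': "compatible_chart A d" by (rule compatible_chart_mem[OF d])
  have "((\<lambda>y. (f \<circ> chart_inv c) ((snd c \<circ> chart_inv d) y)) has_derivative
     (\<lambda>v. D (frechet_derivative (snd c \<circ> chart_inv d) (at (snd d p)) v))) (at (snd d p))"
    by (rule has_derivative_compose[OF transition_deriv_from[OF c d p]]) (simp only: transition_mem[OF d' p(2)] f)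
  then show ?thesis
  proof (rule has_derivative_transform_within_open)
    show "open (snd d ` (fst d \<inter> fst c))" by (rule chart_image_open[OF d' chart_open[OF c]])
    show "snd d p \<in> snd d ` (fst d \<inter> fst c)" using p by blast
    fix y assume "y \<in> snd d ` (fst d \<inter> fst c)"
    then show "(f \<circ> chart_inv c) ((snd c \<circ> chart_inv d) y) = (f \<circ> chart_inv d) y"
      using chart_inv_chart[OF d'] chart_inv_chart[OF c] by auto
  qed
qed

text \<open>\<open>mderiv\<close> is defined through the chosen chart at p. This rule, the chain
  rule for the transition map, allows any compatible chart to be used instead.\<close>

lemma mderiv_chart:
  assumes c: "compatible_chart A c" and p: "p \<in> fst c"
    and f: "((f \<circ> chart_inv c) has_derivative D) (at (snd c p))"
  shows "mderiv A f p v = D (chart_deriv c p v)"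
  using frechet_derivative_at[OF change_of_chart_deriv[OF c chart_at(1) p chart_at(2) f], symmetric]
  by (simp add: mderiv_chart_at)

text \<open>The inverse of \<open>chart_deriv c p\<close>: it turns coordinates with respect to c
  into the tangent vector itself.\<close>

definition chart_coderiv :: "('a, 'b) chart \<Rightarrow> 'a \<Rightarrow> 'b \<Rightarrow> 'b" where
  "chart_coderiv c p = frechet_derivative (snd (chart_at A p) \<circ> chart_inv c) (at (snd c p))"

context
  fixes c :: "('a, 'b) chart" and p :: 'a
  assumes c: "compatible_chart A c" and p: "p \<in> fst c"
begin

lemma bounded_linear_chart_deriv: "bounded_linear (chart_deriv c p)"
  unfolding mderiv_chart_at
  using transition_deriv_from[OF c chart_at(1) p chart_at(2)] has_derivative_bounded_linear by blast

lemma bounded_linear_chart_coderiv: "bounded_linear (chart_coderiv c p)"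
  unfolding chart_coderiv_def
  using transition_deriv_to[OF c chart_at(1) p chart_at(2)] has_derivative_bounded_linear by blast

lemma chart_coderiv_deriv: "chart_coderiv c p (chart_deriv c p v) = v"
proof -
  let ?d = "chart_at A p"
  have d: "compatible_chart A ?d" by (rule compatible_chart_mem[OF chart_at(1)])
  have 1: "((snd ?d \<circ> chart_inv ?d) has_derivative (\<lambda>v. chart_coderiv c p (chart_deriv c p v))) (at (snd ?d p))"
    using change_of_chart_deriv[OF c chart_at(1) p chart_at(2) transition_deriv_to[OF c chart_at(1) p chart_at(2)]]
    by (simp add: mderiv_chart_at chart_coderiv_def)
  have 2: "((snd ?d \<circ> chart_inv ?d) has_derivative (\<lambda>v. v)) (at (snd ?d p))"
    by (rule has_derivative_transform_within_open[OF has_derivative_ident chart_open_image[OF d]])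
      (use chart_at(2) chart_chart_inv[OF d] in auto)
  show ?thesis using has_derivative_unique[OF 1 2] by meson
qed

lemma chart_deriv_coderiv: "chart_deriv c p (chart_coderiv c p v) = v"
proof -
  have "inj (chart_deriv c p)" using chart_coderiv_deriv by (metis injI)
  then have "surj (chart_deriv c p)"
    using bounded_linear_chart_deriv bounded_linear.linear linear_injective_imp_surjective by blast
  then obtain w where "chart_deriv c p w = v" by (metis surjE)
  then show ?thesis using chart_coderiv_deriv by metis
qed

lemma inv_chart_deriv: "inv (chart_deriv c p) = chart_coderiv c p"
  using chart_coderiv_deriv chart_deriv_coderiv by (intro inv_equality) auto

lemma vec_rep_chart: "vec_rep A c X (snd c p) = chart_deriv c p (X p)"
  by (simp add: vec_rep_def Let_def chart_inv_chart[OF c p])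

lemma covec_rep_chart: "blinfun_apply (covec_rep A c \<xi> (snd c p)) v = blinfun_apply (\<xi> p) (chart_coderiv c p v)"
  unfolding covec_rep_def Let_def chart_inv_chart[OF c p] inv_chart_deriv
  by (subst bounded_linear_Blinfun_apply)
    (auto intro: bounded_linear_compose[OF blinfun.bounded_linear_right bounded_linear_chart_coderiv])

lemma covec_rep_chart_deriv: "blinfun_apply (covec_rep A c \<xi> (snd c p)) (chart_deriv c p v) = blinfun_apply (\<xi> p) v"
  by (simp add: covec_rep_chart chart_coderiv_deriv)

end

lemma covec_rep_vec_rep:
  assumes c: "compatible_chart A c" and y: "y \<in> snd c ` fst c"
  shows "blinfun_apply (covec_rep A c \<xi> y) (vec_rep A c X y) = blinfun_apply (\<xi> (chart_inv c y)) (X (chart_inv c y))"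
proof -
  obtain p where p: "p \<in> fst c" "y = snd c p" using y by blast
  show ?thesis by (simp add: p(2) vec_rep_chart[OF c p(1)] covec_rep_chart_deriv[OF c p(1)] chart_inv_chart[OF c p(1)])
qed

lemma chart_deriv_chart_at: "chart_deriv (chart_at A p) p v = v"
proof -
  let ?d = "chart_at A p"
  have d: "compatible_chart A ?d" by (rule compatible_chart_mem[OF chart_at(1)])
  have 2: "((snd ?d \<circ> chart_inv ?d) has_derivative (\<lambda>v. v)) (at (snd ?d p))"
    by (rule has_derivative_transform_within_open[OF has_derivative_ident chart_open_image[OF d]])
      (use chart_at(2) chart_chart_inv[OF d] in auto)
  then show ?thesis by (simp add: mderiv_chart_at frechet_derivative_at[OF 2, symmetric])
qed

lemma chart_coderiv_chart_at: "chart_coderiv (chart_at A p) p v = v"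
  using chart_coderiv_deriv[OF compatible_chart_mem[OF chart_at(1)] chart_at(2), of p v] chart_deriv_chart_at by simp

lemma chart_deriv_transition:
  assumes c: "compatible_chart A c" and d: "d \<in> A" and p: "p \<in> fst c" "p \<in> fst d"
  shows "chart_deriv d p v = frechet_derivative (snd d \<circ> chart_inv c) (at (snd c p)) (chart_deriv c p v)"
  by (rule mderiv_chart[OF c p(1) transition_deriv_to[OF c d p]])

lemma chart_deriv_transition':
  assumes c: "compatible_chart A c" and d: "d \<in> A" and p: "p \<in> fst c" "p \<in> fst d"
  shows "chart_deriv c p v = frechet_derivative (snd c \<circ> chart_inv d) (at (snd d p)) (chart_deriv d p v)"
  by (rule mderiv_chart[OF compatible_chart_mem[OF d] p(2) transition_deriv_from[OF c d p]])

section \<open>Smooth functions and fields\<close>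

text \<open>Smoothness demands all charts of the atlas; one chart around each point is enough, as
  transition maps are smooth.\<close>

lemma smooth_fun_chartI:
  assumes W: "open W" and ex: "\<And>p. p \<in> W \<Longrightarrow> \<exists>c N. c \<in> A \<and> open N \<and> p \<in> N \<and> N \<subseteq> fst c \<inter> W \<and> smooth_on (snd c ` N) (f \<circ> chart_inv c)"
  shows "smooth_fun A W f"
  unfolding smooth_fun_def
proof
  fix d assume d: "d \<in> A"
  have d': "compatible_chart A d" by (rule compatible_chart_mem[OF d])
  show "smooth_on (snd d ` (fst d \<inter> W)) (f \<circ> chart_inv d)"
  proof (rule smooth_on_local)
    fix z assume "z \<in> snd d ` (fst d \<inter> W)"
    then obtain p where p: "p \<in> fst d" "p \<in> W" "z = snd d p" by blast
    obtain c N where c: "c \<in> A" and N: "open N" "p \<in> N" "N \<subseteq> fst c \<inter> W" and s: "smooth_on (snd c ` N) (f \<circ> chart_inv c)"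
      using ex[OF p(2)] by blast
    have c': "compatible_chart A c" by (rule compatible_chart_mem[OF c])
    let ?T = "snd d ` (fst d \<inter> N)"
    have T: "open ?T" by (rule chart_image_open[OF d' N(1)])
    have 1: "smooth_on ?T (snd c \<circ> chart_inv d)"
      by (rule smooth_on_subset[OF transition_to[OF d' c]]) (use N in auto)
    have "smooth_on ?T (\<lambda>y. (f \<circ> chart_inv c) ((snd c \<circ> chart_inv d) y))"
      by (rule smooth_on_compose[OF chart_image_open'[OF c' N(1)] T s 1]) (use N chart_inv_chart[OF d'] in auto)
    then have "smooth_on ?T (f \<circ> chart_inv d)"
      by (rule smooth_on_cong[OF T, rotated]) (use N chart_inv_chart[OF d'] chart_inv_chart[OF c'] in auto)
    then show "\<exists>T. open T \<and> z \<in> T \<and> smooth_on T (f \<circ> chart_inv d)"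
      using T p N by blast
  qed
qed

lemma vec_rep_transition:
  assumes c: "c \<in> A" and d: "d \<in> A" and p: "p \<in> fst c" "p \<in> fst d"
  shows "vec_rep A d X (snd d p) = frechet_derivative (snd d \<circ> chart_inv c) (at (snd c p)) (vec_rep A c X (snd c p))"
  using chart_deriv_transition[OF compatible_chart_mem[OF c] d p] p
  by (simp add: vec_rep_chart compatible_chart_mem c d)

lemma covec_rep_transition:
  assumes c: "c \<in> A" and d: "d \<in> A" and p: "p \<in> fst c" "p \<in> fst d"
  shows "blinfun_apply (covec_rep A d \<xi> (snd d p)) v = blinfun_apply (covec_rep A c \<xi> (snd c p)) (frechet_derivative (snd c \<circ> chart_inv d) (at (snd d p)) v)"
proof -
  have "chart_deriv c p (chart_coderiv d p v) = frechet_derivative (snd c \<circ> chart_inv d) (at (snd d p)) v"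
    using chart_deriv_transition[OF compatible_chart_mem[OF d] c p(2,1), of "chart_coderiv d p v"]
      chart_deriv_coderiv[OF compatible_chart_mem[OF d] p(2)] by simp
  then show ?thesis
    using covec_rep_chart[OF compatible_chart_mem[OF d] p(2), of \<xi> v]
      covec_rep_chart_deriv[OF compatible_chart_mem[OF c] p(1), of \<xi> "chart_coderiv d p v"] by simp
qed

lemma smooth_vec_chartI:
  assumes W: "open W" and ex: "\<And>p. p \<in> W \<Longrightarrow> \<exists>c N. c \<in> A \<and> open N \<and> p \<in> N \<and> N \<subseteq> fst c \<inter> W \<and> smooth_on (snd c ` N) (vec_rep A c X)"
  shows "smooth_vec A W X"
  unfolding smooth_vec_def
proof
  fix d assume d: "d \<in> A"
  have d': "compatible_chart A d" by (rule compatible_chart_mem[OF d])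
  show "smooth_on (snd d ` (fst d \<inter> W)) (vec_rep A d X)"
  proof (rule smooth_on_local)
    fix z assume "z \<in> snd d ` (fst d \<inter> W)"
    then obtain p where p: "p \<in> fst d" "p \<in> W" "z = snd d p" by blast
    obtain c N where c: "c \<in> A" and N: "open N" "p \<in> N" "N \<subseteq> fst c \<inter> W" and s: "smooth_on (snd c ` N) (vec_rep A c X)"
      using ex[OF p(2)] by blast
    have c': "compatible_chart A c" by (rule compatible_chart_mem[OF c])
    let ?T = "snd d ` (fst d \<inter> N)" and ?\<tau> = "snd c \<circ> chart_inv d" and ?\<sigma> = "snd d \<circ> chart_inv c"
    have T: "open ?T" by (rule chart_image_open[OF d' N(1)])
    have 1: "smooth_on ?T ?\<tau>"
      by (rule smooth_on_subset[OF transition_to[OF d' c]]) (use N in auto)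
    have im: "?\<tau> ` ?T \<subseteq> snd c ` N" using N chart_inv_chart[OF d'] by auto
    have oN: "open (snd c ` N)" using chart_image_open'[OF c' N(1)] N(3) by auto
    have 2: "smooth_on ?T (\<lambda>y. vec_rep A c X (?\<tau> y))"
      by (rule smooth_on_compose[OF oN T s 1 im])
    have im': "?\<tau> ` ?T \<subseteq> snd c ` (fst c \<inter> fst d)" using N chart_inv_chart[OF d'] by auto
    \<comment> \<open>The derivative of the transition map acts on the varying vector of the field,
      so it is expanded over the basis and treated for fixed b.\<close>
    have 3: "smooth_on ?T (\<lambda>y. frechet_derivative ?\<sigma> (at (?\<tau> y)) b)" for b
      by (rule smooth_on_compose[OF chart_image_open[OF c' chart_open[OF d']] T smooth_on_frechet[OF transition_to[OF c' d]] 1 im'])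
    have "smooth_on ?T (\<lambda>y. \<Sum>b\<in>Basis. (vec_rep A c X (?\<tau> y) \<bullet> b) *\<^sub>R frechet_derivative ?\<sigma> (at (?\<tau> y)) b)"
      by (intro smooth_on_sum T smooth_on_bilinear[OF bounded_bilinear_scaleR] 3 smooth_on_bounded_linear[OF bounded_linear_inner_left] 2)
    then have "smooth_on ?T (vec_rep A d X)"
    proof (rule smooth_on_cong[OF T, rotated])
      fix y assume "y \<in> ?T"
      then obtain q where q: "q \<in> fst d" "q \<in> N" "y = snd d q" by blast
      have qc: "q \<in> fst c" using q N by blast
      have lin: "linear (frechet_derivative ?\<sigma> (at (snd c q)))"
        using transition_deriv_to[OF c' d qc q(1)] has_derivative_linear by blast
      show "(\<Sum>b\<in>Basis. (vec_rep A c X (?\<tau> y) \<bullet> b) *\<^sub>R frechet_derivative ?\<sigma> (at (?\<tau> y)) b) = vec_rep A d X y"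
        using vec_rep_transition[OF c d qc q(1), of X] bounded_linear_sum_Basis[OF lin, of "vec_rep A c X (snd c q)"] chart_inv_chart[OF d' q(1)] q(3)
        by simp
    qed
    then show "\<exists>T. open T \<and> z \<in> T \<and> smooth_on T (vec_rep A d X)"
      using T p N by blast
  qed
qed

lemma smooth_covec_chartI:
  assumes W: "open W" and ex: "\<And>p. p \<in> W \<Longrightarrow> \<exists>c N. c \<in> A \<and> open N \<and> p \<in> N \<and> N \<subseteq> fst c \<inter> W \<and> smooth_on (snd c ` N) (covec_rep A c \<xi>)"
  shows "smooth_covec A W \<xi>"
  unfolding smooth_covec_def
proof
  fix d assume d: "d \<in> A"
  have d': "compatible_chart A d" by (rule compatible_chart_mem[OF d])
  show "smooth_on (snd d ` (fst d \<inter> W)) (covec_rep A d \<xi>)"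
  proof (rule smooth_on_local)
    fix z assume "z \<in> snd d ` (fst d \<inter> W)"
    then obtain p where p: "p \<in> fst d" "p \<in> W" "z = snd d p" by blast
    obtain c N where c: "c \<in> A" and N: "open N" "p \<in> N" "N \<subseteq> fst c \<inter> W" and s: "smooth_on (snd c ` N) (covec_rep A c \<xi>)"
      using ex[OF p(2)] by blast
    have c': "compatible_chart A c" by (rule compatible_chart_mem[OF c])
    let ?T = "snd d ` (fst d \<inter> N)" and ?\<tau> = "snd c \<circ> chart_inv d"
    have T: "open ?T" by (rule chart_image_open[OF d' N(1)])
    have 0: "?T \<subseteq> snd d ` (fst d \<inter> fst c)" using N by auto
    have 1: "smooth_on ?T ?\<tau>" by (rule smooth_on_subset[OF transition_to[OF d' c] 0])
    have im: "?\<tau> ` ?T \<subseteq> snd c ` N" using N chart_inv_chart[OF d'] by auto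
    have oN: "open (snd c ` N)" using chart_image_open'[OF c' N(1)] N(3) by auto
    have 2: "smooth_on ?T (\<lambda>y. covec_rep A c \<xi> (?\<tau> y))"
      by (rule smooth_on_compose[OF oN T s 1 im])
    have 3: "smooth_on ?T (\<lambda>y. frechet_derivative ?\<tau> (at y) b)" for b
      by (rule smooth_on_subset[OF smooth_on_frechet[OF transition_to[OF d' c]] 0])
    have "smooth_on ?T (covec_rep A d \<xi>)"
    proof (rule smooth_on_blinfun[OF T])
      fix b :: 'b
      have "smooth_on ?T (\<lambda>y. covec_rep A c \<xi> (?\<tau> y) (frechet_derivative ?\<tau> (at y) b))"
        by (intro smooth_on_bilinear[OF bounded_bilinear_blinfun_apply] T 2 3)
      then show "smooth_on ?T (\<lambda>y. covec_rep A d \<xi> y b)"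
      proof (rule smooth_on_cong[OF T, rotated])
        fix y assume "y \<in> ?T"
        then obtain q where q: "q \<in> fst d" "q \<in> N" "y = snd d q" by blast
        have qc: "q \<in> fst c" using q N by blast
        show "covec_rep A c \<xi> (?\<tau> y) (frechet_derivative ?\<tau> (at y) b) = covec_rep A d \<xi> y b"
          using covec_rep_transition[OF c d qc q(1), of \<xi> b] chart_inv_chart[OF d' q(1)] q(3) by simp
      qed
    qed
    then show "\<exists>T. open T \<and> z \<in> T \<and> smooth_on T (covec_rep A d \<xi>)"
      using T p N by blast
  qed
qed

lemma smooth_fun_subset: "smooth_fun A W f \<Longrightarrow> V \<subseteq> W \<Longrightarrow> smooth_fun A V f"
  unfolding smooth_fun_def by (meson Int_mono image_mono order_refl smooth_on_subset)

lemma smooth_vec_subset: "smooth_vec A W f \<Longrightarrow> V \<subseteq> W \<Longrightarrow> smooth_vec A V f"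
  unfolding smooth_vec_def by (meson Int_mono image_mono order_refl smooth_on_subset)

lemma smooth_covec_subset: "smooth_covec A W f \<Longrightarrow> V \<subseteq> W \<Longrightarrow> smooth_covec A V f"
  unfolding smooth_covec_def by (meson Int_mono image_mono order_refl smooth_on_subset)

lemma smooth_fun_cong:
  assumes W: "open W" and eq: "\<And>p. p \<in> W \<Longrightarrow> f p = g p" and f: "smooth_fun A W f"
  shows "smooth_fun A W g"
  unfolding smooth_fun_def
proof
  fix c assume c: "c \<in> A"
  note c' = compatible_chart_mem[OF c]
  show "smooth_on (snd c ` (fst c \<inter> W)) (g \<circ> chart_inv c)"
    by (rule smooth_on_cong[OF chart_image_open[OF c' W], of "f \<circ> chart_inv c"])
      (use f c eq chart_inv_chart[OF c'] in \<open>auto simp: smooth_fun_def\<close>)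
qed

lemma smooth_fun_local:
  assumes W: "open W" and ex: "\<And>p. p \<in> W \<Longrightarrow> \<exists>N. open N \<and> p \<in> N \<and> N \<subseteq> W \<and> smooth_fun A N f"
  shows "smooth_fun A W f"
proof (rule smooth_fun_chartI[OF W])
  fix p assume "p \<in> W"
  then obtain N where N: "open N" "p \<in> N" "N \<subseteq> W" "smooth_fun A N f" using ex by blast
  let ?c = "chart_at A p"
  have "smooth_on (snd ?c ` (fst ?c \<inter> N)) (f \<circ> chart_inv ?c)" using N(4) chart_at(1) by (simp add: smooth_fun_def)
  moreover have "open (fst ?c \<inter> N)" by (intro open_Int N chart_open compatible_chart_mem chart_at)
  ultimately show "\<exists>c N. c \<in> A \<and> open N \<and> p \<in> N \<and> N \<subseteq> fst c \<inter> W \<and> smooth_on (snd c ` N) (f \<circ> chart_inv c)"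
    using N chart_at by (intro exI[of _ ?c] exI[of _ "fst ?c \<inter> N"]) auto
qed

lemma smooth_fun_pairing:
  assumes W: "open W" and \<xi>: "smooth_covec A W \<xi>" and X: "smooth_vec A W X"
  shows "smooth_fun A W (\<lambda>p. blinfun_apply (\<xi> p) (X p))"
  unfolding smooth_fun_def
proof
  fix c assume c: "c \<in> A"
  note c' = compatible_chart_mem[OF c]
  have O: "open (snd c ` (fst c \<inter> W))" by (rule chart_image_open[OF c' W])
  have "smooth_on (snd c ` (fst c \<inter> W)) (\<lambda>y. covec_rep A c \<xi> y (vec_rep A c X y))"
    using \<xi> X c by (intro smooth_on_bilinear[OF bounded_bilinear_blinfun_apply] O) (auto simp: smooth_covec_def smooth_vec_def)
  then show "smooth_on (snd c ` (fst c \<inter> W)) ((\<lambda>p. blinfun_apply (\<xi> p) (X p)) \<circ> chart_inv c)"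
    by (rule smooth_on_cong[OF O, rotated]) (use covec_rep_vec_rep[OF c'] in auto)
qed

lemma smooth_fun_has_derivative:
  assumes f: "smooth_fun A W f" and p: "p \<in> W" and c: "c \<in> A" "p \<in> fst c"
  shows "((f \<circ> chart_inv c) has_derivative frechet_derivative (f \<circ> chart_inv c) (at (snd c p))) (at (snd c p))"
  by (rule smooth_on_has_derivative[of "snd c ` (fst c \<inter> W)"]) (use assms in \<open>auto simp: smooth_fun_def\<close>)

lemma mderiv_has_derivative:
  assumes f: "smooth_fun A W f" and p: "p \<in> W"
  shows "((f \<circ> chart_inv (chart_at A p)) has_derivative mderiv A f p) (at (snd (chart_at A p) p))"
  unfolding mderiv_chart_at by (rule smooth_fun_has_derivative[OF f p chart_at])

lemma dfun_apply:
  assumes f: "smooth_fun A W f" and p: "p \<in> W"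
  shows "blinfun_apply (dfun A f p) v = mderiv A f p v"
  unfolding dfun_def
  by (subst bounded_linear_Blinfun_apply) (use has_derivative_bounded_linear[OF mderiv_has_derivative[OF f p]] in auto)

lemma mderiv_cong:
  assumes W: "open W" "p \<in> W" and eq: "\<And>q. q \<in> W \<Longrightarrow> f q = g q" and f: "smooth_fun A W f"
  shows "mderiv A f p = mderiv A g p"
proof -
  let ?c = "chart_at A p"
  have c: "compatible_chart A ?c" by (rule compatible_chart_mem[OF chart_at(1)])
  have "((g \<circ> chart_inv ?c) has_derivative mderiv A f p) (at (snd ?c p))"
    by (rule has_derivative_transform_within_open[OF mderiv_has_derivative[OF f W(2)] chart_image_open[OF c W(1)]])
      (use W chart_at eq chart_inv_chart[OF c] in auto)
  from frechet_derivative_at[OF this] show ?thesis by (simp add: mderiv_chart_at)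
qed

lemma covec_rep_dfun:
  assumes f: "smooth_fun A W f" and c: "c \<in> A" and y: "y \<in> snd c ` (fst c \<inter> W)"
  shows "blinfun_apply (covec_rep A c (dfun A f) y) v = frechet_derivative (f \<circ> chart_inv c) (at y) v"
proof -
  obtain p where p: "p \<in> fst c" "p \<in> W" "y = snd c p" using y by blast
  note c' = compatible_chart_mem[OF c]
  show ?thesis
    using mderiv_chart[OF c' p(1) smooth_fun_has_derivative[OF f p(2) c p(1)], of "chart_coderiv c p v"]
    by (simp add: p(3) covec_rep_chart[OF c' p(1)] dfun_apply[OF f p(2)] chart_deriv_coderiv[OF c' p(1)])
qed

lemma smooth_covec_dfun:
  assumes W: "open W" and f: "smooth_fun A W f" shows "smooth_covec A W (dfun A f)"
  unfolding smooth_covec_def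
proof
  fix c assume c: "c \<in> A"
  have O: "open (snd c ` (fst c \<inter> W))" by (rule chart_image_open[OF compatible_chart_mem[OF c] W])
  show "smooth_on (snd c ` (fst c \<inter> W)) (covec_rep A c (dfun A f))"
  proof (rule smooth_on_blinfun[OF O])
    fix b :: 'b
    have "smooth_on (snd c ` (fst c \<inter> W)) (\<lambda>y. frechet_derivative (f \<circ> chart_inv c) (at y) b)"
      using f c by (intro smooth_on_frechet) (simp add: smooth_fun_def)
    then show "smooth_on (snd c ` (fst c \<inter> W)) (\<lambda>y. covec_rep A c (dfun A f) y b)"
      by (rule smooth_on_cong[OF O, rotated]) (simp add: covec_rep_dfun[OF f c])
  qed
qed

end

section \<open>The Courant bracket on sections of a Dirac structure\<close>

text \<open>The product rule for D\<tau>(y) applied to f(y). The first summand contains the second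
  derivative of \<tau>, the term that later cancels by symmetry.\<close>

lemma has_derivative_frechet_apply:
  fixes \<tau> :: "'a::euclidean_space \<Rightarrow> 'c::real_normed_vector"
  assumes S: "open S" "z \<in> S" and \<tau>: "smooth_on S \<tau>" and f: "(f has_derivative f') (at z)"
  shows "((\<lambda>y. frechet_derivative \<tau> (at y) (f y)) has_derivative
    (\<lambda>u. frechet_derivative (\<lambda>y. frechet_derivative \<tau> (at y) (f z)) (at z) u + frechet_derivative \<tau> (at z) (f' u))) (at z)"
proof -
  let ?B = "\<lambda>y. Blinfun (frechet_derivative \<tau> (at y))"
  have B: "blinfun_apply (?B y) = frechet_derivative \<tau> (at y)" if "y \<in> S" for y
    using bounded_linear_Blinfun_apply has_derivative_bounded_linear[OF smooth_on_has_derivative[OF \<tau> that]] by blast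
  have DB: "(?B has_derivative frechet_derivative ?B (at z)) (at z)"
    by (rule smooth_on_has_derivative[OF smooth_on_Blinfun_frechet[OF S(1) \<tau>] S(2)])
  have "((\<lambda>y. blinfun_apply (?B y) (f y)) has_derivative (\<lambda>u. blinfun_apply (?B z) (f' u) + blinfun_apply (frechet_derivative ?B (at z) u) (f z))) (at z)"
    by (rule bounded_bilinear.FDERIV[OF bounded_bilinear_blinfun_apply DB f])
  then have 1: "((\<lambda>y. frechet_derivative \<tau> (at y) (f y)) has_derivative
      (\<lambda>u. blinfun_apply (?B z) (f' u) + blinfun_apply (frechet_derivative ?B (at z) u) (f z))) (at z)"
    by (rule has_derivative_transform_within_open[OF _ S]) (simp add: B)
  have "((\<lambda>y. blinfun_apply (?B y) (f z)) has_derivative (\<lambda>u. blinfun_apply (frechet_derivative ?B (at z) u) (f z))) (at z)"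
    by (rule bounded_linear.has_derivative[OF blinfun.bounded_linear_left DB])
  then have "((\<lambda>y. frechet_derivative \<tau> (at y) (f z)) has_derivative (\<lambda>u. blinfun_apply (frechet_derivative ?B (at z) u) (f z))) (at z)"
    by (rule has_derivative_transform_within_open[OF _ S]) (simp add: B)
  from fun_cong[OF frechet_derivative_at[OF this]] 1 show ?thesis
    by (simp add: B[OF S(2)] add.commute)
qed

context smooth_manifold
begin

lemma smooth_vec_chart: "smooth_vec A W X \<Longrightarrow> c \<in> A \<Longrightarrow> smooth_on (snd c ` (fst c \<inter> W)) (vec_rep A c X)"
  by (simp add: smooth_vec_def)

lemma smooth_covec_chart: "smooth_covec A W \<xi> \<Longrightarrow> c \<in> A \<Longrightarrow> smooth_on (snd c ` (fst c \<inter> W)) (covec_rep A c \<xi>)"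
  by (simp add: smooth_covec_def)

text \<open>The coordinate formula is valid in every chart of the atlas: a change of chart adds
  second derivatives of the transition map, evaluated at the pair X, Y, and these are symmetric and
  cancel in the difference.\<close>

lemma lie_bracket_chart:
  assumes W: "open W" and X: "smooth_vec A W X" and Y: "smooth_vec A W Y"
    and c: "c \<in> A" and p: "p \<in> fst c" "p \<in> W"
  shows "chart_deriv c p (lie_bracket A X Y p) =
    frechet_derivative (vec_rep A c Y) (at (snd c p)) (vec_rep A c X (snd c p)) -
    frechet_derivative (vec_rep A c X) (at (snd c p)) (vec_rep A c Y (snd c p))"
proof -
  let ?d = "chart_at A p"
  have d: "?d \<in> A" "p \<in> fst ?d" by (rule chart_at)+
  note c' = compatible_chart_mem[OF c] and d' = compatible_chart_mem[OF d(1)]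
  let ?\<tau> = "snd c \<circ> chart_inv ?d" and ?z = "snd ?d p"
  define S where "S = snd ?d ` (fst ?d \<inter> (fst c \<inter> W))"
  have S: "open S" "?z \<in> S"
    unfolding S_def using chart_image_open[OF d' open_Int[OF chart_open[OF c'] W]] p d(2) by auto
  have \<tau>: "smooth_on S ?\<tau>"
    by (rule smooth_on_subset[OF transition_from[OF c' d(1)]]) (auto simp: S_def)
  have lin: "linear (frechet_derivative ?\<tau> (at ?z))"
    using has_derivative_linear[OF smooth_on_has_derivative[OF \<tau> S(2)]] .
  have \<tau>z: "?\<tau> ?z = snd c p" using chart_inv_chart[OF d' d(2)] by simp
  have tr: "vec_rep A c X (?\<tau> y) = frechet_derivative ?\<tau> (at y) (vec_rep A ?d X y)" if y: "y \<in> S" for X y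
  proof -
    obtain q where q: "q \<in> fst ?d" "q \<in> fst c" "y = snd ?d q" using y unfolding S_def by blast
    show ?thesis using vec_rep_transition[OF d(1) c q(1,2), of X] q(3) chart_inv_chart[OF d' q(1)] by simp
  qed
  have key: "frechet_derivative (vec_rep A c X) (at (snd c p)) (frechet_derivative ?\<tau> (at ?z) u) =
      frechet_derivative (\<lambda>y. frechet_derivative ?\<tau> (at y) (vec_rep A ?d X ?z)) (at ?z) u +
      frechet_derivative ?\<tau> (at ?z) (frechet_derivative (vec_rep A ?d X) (at ?z) u)"
    if X: "smooth_vec A W X" for X u
  proof -
    have "(vec_rep A c X has_derivative frechet_derivative (vec_rep A c X) (at (?\<tau> ?z))) (at (?\<tau> ?z))"
      by (rule smooth_on_has_derivative[OF smooth_vec_chart[OF X c]]) (use \<tau>z p in auto)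
    from has_derivative_compose[OF smooth_on_has_derivative[OF \<tau> S(2)] this]
    have 1: "((\<lambda>y. vec_rep A c X (?\<tau> y)) has_derivative
        (\<lambda>u. frechet_derivative (vec_rep A c X) (at (?\<tau> ?z)) (frechet_derivative ?\<tau> (at ?z) u))) (at ?z)" .
    have "(vec_rep A ?d X has_derivative frechet_derivative (vec_rep A ?d X) (at ?z)) (at ?z)"
      by (rule smooth_on_has_derivative[OF smooth_vec_chart[OF X d(1)]]) (use d p in auto)
    from has_derivative_transform_within_open[OF has_derivative_frechet_apply[OF S \<tau> this] S, of "\<lambda>y. vec_rep A c X (?\<tau> y)"]
    have 2: "((\<lambda>y. vec_rep A c X (?\<tau> y)) has_derivative
       (\<lambda>u. frechet_derivative (\<lambda>y. frechet_derivative ?\<tau> (at y) (vec_rep A ?d X ?z)) (at ?z) u +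
      frechet_derivative ?\<tau> (at ?z) (frechet_derivative (vec_rep A ?d X) (at ?z) u))) (at ?z)"
      using tr by simp
    show ?thesis using fun_cong[OF has_derivative_unique[OF 1 2], of u] \<tau>z by simp
  qed
  have rep: "vec_rep A c X (snd c p) = frechet_derivative ?\<tau> (at ?z) (vec_rep A ?d X ?z)" for X
    using tr[OF S(2), of X] \<tau>z by simp
  have sym: "frechet_derivative (\<lambda>y. frechet_derivative ?\<tau> (at y) u) (at ?z) v = frechet_derivative (\<lambda>y. frechet_derivative ?\<tau> (at y) v) (at ?z) u" for u v
    by (rule smooth_second_derivative_symmetric[OF S \<tau>])
  have "chart_deriv c p (lie_bracket A X Y p) = frechet_derivative ?\<tau> (at ?z) (lie_bracket A X Y p)"
    using chart_deriv_chart_at[of p] chart_deriv_transition'[OF c' d(1) p(1) d(2)] by simp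
  then show ?thesis
    unfolding rep key[OF X] key[OF Y]
    by (simp add: lie_bracket_def Let_def linear_diff[OF lin] sym[of "vec_rep A ?d X ?z"])
qed

lemma mderiv_pairing:
  assumes W: "open W" and \<xi>: "smooth_covec A W \<xi>" and Y: "smooth_vec A W Y" and p: "p \<in> W"
  defines "d \<equiv> chart_at A p"
  shows "mderiv A (\<lambda>q. blinfun_apply (\<xi> q) (Y q)) p v =
    blinfun_apply (frechet_derivative (covec_rep A d \<xi>) (at (snd d p)) v) (Y p) +
    blinfun_apply (\<xi> p) (frechet_derivative (vec_rep A d Y) (at (snd d p)) v)"
proof -
  have d: "d \<in> A" "p \<in> fst d" unfolding d_def by (rule chart_at)+
  note d' = compatible_chart_mem[OF d(1)]
  let ?S = "snd d ` (fst d \<inter> W)" and ?z = "snd d p"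
  have S: "open ?S" "?z \<in> ?S" using chart_image_open[OF d' W] p d by auto
  have "((\<lambda>y. blinfun_apply (covec_rep A d \<xi> y) (vec_rep A d Y y)) has_derivative
      (\<lambda>v. blinfun_apply (covec_rep A d \<xi> ?z) (frechet_derivative (vec_rep A d Y) (at ?z) v) +
        blinfun_apply (frechet_derivative (covec_rep A d \<xi>) (at ?z) v) (vec_rep A d Y ?z))) (at ?z)"
    by (rule bounded_bilinear.FDERIV[OF bounded_bilinear_blinfun_apply
          smooth_on_has_derivative[OF smooth_covec_chart[OF \<xi> d(1)] S(2)] smooth_on_has_derivative[OF smooth_vec_chart[OF Y d(1)] S(2)]])
  then have "(((\<lambda>q. blinfun_apply (\<xi> q) (Y q)) \<circ> chart_inv d) has_derivative
      (\<lambda>v. blinfun_apply (covec_rep A d \<xi> ?z) (frechet_derivative (vec_rep A d Y) (at ?z) v) +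
        blinfun_apply (frechet_derivative (covec_rep A d \<xi>) (at ?z) v) (vec_rep A d Y ?z))) (at ?z)"
    by (rule has_derivative_transform_within_open[OF _ S]) (use covec_rep_vec_rep[OF d'] in auto)
  from mderiv_chart[OF d' d(2) this, of v] show ?thesis
    by (simp add: d_def chart_deriv_chart_at covec_rep_chart[OF compatible_chart_mem[OF chart_at(1)] chart_at(2)]
       vec_rep_chart[OF compatible_chart_mem[OF chart_at(1)] chart_at(2)] chart_coderiv_chart_at)
qed

text \<open>The identity [X, Y]f = X(Yf) - Y(Xf), where Yf is written as df(Y). The second
  derivatives of f cancel by symmetry.\<close>

lemma mderiv_lie_bracket:
  assumes W: "open W" and f: "smooth_fun A W f" and X: "smooth_vec A W X" and Y: "smooth_vec A W Y" and p: "p \<in> W"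
  shows "mderiv A f p (lie_bracket A X Y p) =
    mderiv A (\<lambda>q. blinfun_apply (dfun A f q) (Y q)) p (X p) - mderiv A (\<lambda>q. blinfun_apply (dfun A f q) (X q)) p (Y p)"
proof -
  let ?d = "chart_at A p"
  have d: "?d \<in> A" "p \<in> fst ?d" by (rule chart_at)+
  note d' = compatible_chart_mem[OF d(1)]
  let ?S = "snd ?d ` (fst ?d \<inter> W)" and ?z = "snd ?d p" and ?f = "f \<circ> chart_inv ?d"
  have S: "open ?S" "?z \<in> ?S" using chart_image_open[OF d' W] p d by auto
  have sf: "smooth_on ?S ?f" using f d by (simp add: smooth_fun_def)
  have rep: "vec_rep A ?d X ?z = X p" for X using vec_rep_chart[OF d' d(2)] chart_deriv_chart_at by simp
  have D: "mderiv A (\<lambda>q. blinfun_apply (dfun A f q) (Y q)) p v =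
     frechet_derivative (\<lambda>y. frechet_derivative ?f (at y) (Y p)) (at ?z) v + frechet_derivative ?f (at ?z) (frechet_derivative (vec_rep A ?d Y) (at ?z) v)"
    if Y: "smooth_vec A W Y" for Y v
  proof -
    have "((\<lambda>y. frechet_derivative ?f (at y) (vec_rep A ?d Y y)) has_derivative
      (\<lambda>v. frechet_derivative (\<lambda>y. frechet_derivative ?f (at y) (vec_rep A ?d Y ?z)) (at ?z) v + frechet_derivative ?f (at ?z) (frechet_derivative (vec_rep A ?d Y) (at ?z) v))) (at ?z)"
      by (rule has_derivative_frechet_apply[OF S sf smooth_on_has_derivative[OF smooth_vec_chart[OF Y d(1)] S(2)]])
    then have "(((\<lambda>q. blinfun_apply (dfun A f q) (Y q)) \<circ> chart_inv ?d) has_derivative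
      (\<lambda>v. frechet_derivative (\<lambda>y. frechet_derivative ?f (at y) (vec_rep A ?d Y ?z)) (at ?z) v + frechet_derivative ?f (at ?z) (frechet_derivative (vec_rep A ?d Y) (at ?z) v))) (at ?z)"
    proof (rule has_derivative_transform_within_open[OF _ S])
      fix y assume y: "y \<in> ?S"
      then show "frechet_derivative ?f (at y) (vec_rep A ?d Y y) = ((\<lambda>q. blinfun_apply (dfun A f q) (Y q)) \<circ> chart_inv ?d) y"
        using covec_rep_dfun[OF f d(1) y] covec_rep_vec_rep[OF d', of y "dfun A f" Y] by auto
    qed
    from mderiv_chart[OF d' d(2) this, of v] show ?thesis by (simp add: chart_deriv_chart_at rep)
  qed
  have lin: "linear (frechet_derivative ?f (at ?z))" using has_derivative_linear[OF smooth_on_has_derivative[OF sf S(2)]] .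
  have "mderiv A f p (lie_bracket A X Y p) = frechet_derivative ?f (at ?z)
      (frechet_derivative (vec_rep A ?d Y) (at ?z) (X p) - frechet_derivative (vec_rep A ?d X) (at ?z) (Y p))"
    by (simp add: mderiv_chart_at lie_bracket_def Let_def rep)
  then show ?thesis
    unfolding D[OF X] D[OF Y]
    using smooth_second_derivative_symmetric[OF S sf, of "X p" "Y p"] by (simp add: linear_diff[OF lin])
qed

text \<open>In the chosen chart at p the coordinate expressions take the values X p and \<xi> p at
  p, so the Courant bracket becomes an expression in first derivatives of components.\<close>

lemma courant_apply:
  assumes W: "open W" and x: "smooth_gen A W x" and y: "smooth_gen A W y" and p: "p \<in> W"
  defines "d \<equiv> chart_at A p"
  shows "fst (courant A x y p) = lie_bracket A (fst \<circ> x) (fst \<circ> y) p"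
    and "blinfun_apply (snd (courant A x y p)) v =
      blinfun_apply (frechet_derivative (covec_rep A d (snd \<circ> y)) (at (snd d p)) (fst (x p))) v +
      blinfun_apply (snd (y p)) (frechet_derivative (vec_rep A d (fst \<circ> x)) (at (snd d p)) v) -
      (blinfun_apply (frechet_derivative (covec_rep A d (snd \<circ> x)) (at (snd d p)) (fst (y p))) v +
      blinfun_apply (snd (x p)) (frechet_derivative (vec_rep A d (fst \<circ> y)) (at (snd d p)) v)) -
      1/2 * mderiv A (\<lambda>q. blinfun_apply (snd (y q)) (fst (x q)) - blinfun_apply (snd (x q)) (fst (y q))) p v"
proof -
  have d: "d \<in> A" "p \<in> fst d" unfolding d_def by (rule chart_at)+
  note d' = compatible_chart_mem[OF d(1)]
  let ?S = "snd d ` (fst d \<inter> W)" and ?z = "snd d p"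
  have S: "open ?S" "?z \<in> ?S" using chart_image_open[OF d' W] p d by auto
  show "fst (courant A x y p) = lie_bracket A (fst \<circ> x) (fst \<circ> y) p" by (simp add: courant_def Let_def)
  have sX: "smooth_vec A W (fst \<circ> x)" "smooth_covec A W (snd \<circ> x)" "smooth_vec A W (fst \<circ> y)" "smooth_covec A W (snd \<circ> y)"
    using x y by (auto simp: smooth_gen_def)
  have rep: "vec_rep A d X ?z = X p" and crep: "covec_rep A d \<xi> ?z = \<xi> p" for X \<xi>
    using chart_deriv_chart_at chart_coderiv_chart_at vec_rep_chart[OF d' d(2)] covec_rep_chart[OF d' d(2)]
    by (auto simp: d_def intro: blinfun_eqI)
  have ld: "blinfun_apply (lie_deriv A X \<eta> p) v = blinfun_apply (frechet_derivative (covec_rep A d \<eta>) (at ?z) (X p)) v +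
      blinfun_apply (\<eta> p) (frechet_derivative (vec_rep A d X) (at ?z) v)" if "smooth_vec A W X" for X \<eta> v
  proof -
    have "bounded_linear (frechet_derivative (vec_rep A d X) (at ?z))"
      by (rule has_derivative_bounded_linear[OF smooth_on_has_derivative[OF smooth_vec_chart[OF that d(1)] S(2)]])
    then have "bounded_linear (\<lambda>v. blinfun_apply (frechet_derivative (covec_rep A d \<eta>) (at ?z) (X p)) v +
      blinfun_apply (\<eta> p) (frechet_derivative (vec_rep A d X) (at ?z) v))"
      by (intro bounded_linear_add blinfun.bounded_linear_right bounded_linear_compose[OF blinfun.bounded_linear_right])
    from bounded_linear_Blinfun_apply[OF this] show ?thesis
      by (simp add: lie_deriv_def Let_def rep crep flip: d_def)
  qed
  have "smooth_fun A W (\<lambda>q. blinfun_apply (snd (y q)) (fst (x q)) - blinfun_apply (snd (x q)) (fst (y q)))"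
    unfolding smooth_fun_def
  proof
    fix c assume c: "c \<in> A"
    have "smooth_on (snd c ` (fst c \<inter> W)) (\<lambda>y'. ((\<lambda>q. blinfun_apply (snd (y q)) (fst (x q))) \<circ> chart_inv c) y' - ((\<lambda>q. blinfun_apply (snd (x q)) (fst (y q))) \<circ> chart_inv c) y')"
      using smooth_fun_pairing[OF W sX(4) sX(1)] smooth_fun_pairing[OF W sX(2) sX(3)] c
      by (intro smooth_on_diff chart_image_open[OF compatible_chart_mem[OF c] W]) (auto simp: smooth_fun_def o_def)
    then show "smooth_on (snd c ` (fst c \<inter> W)) ((\<lambda>q. blinfun_apply (snd (y q)) (fst (x q)) - blinfun_apply (snd (x q)) (fst (y q))) \<circ> chart_inv c)"
      by (simp add: o_def)
  qed
  from dfun_apply[OF this p]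
  show "blinfun_apply (snd (courant A x y p)) v =
      blinfun_apply (frechet_derivative (covec_rep A d (snd \<circ> y)) (at (snd d p)) (fst (x p))) v +
      blinfun_apply (snd (y p)) (frechet_derivative (vec_rep A d (fst \<circ> x)) (at (snd d p)) v) -
      (blinfun_apply (frechet_derivative (covec_rep A d (snd \<circ> x)) (at (snd d p)) (fst (y p))) v +
      blinfun_apply (snd (x p)) (frechet_derivative (vec_rep A d (fst \<circ> y)) (at (snd d p)) v)) -
      1/2 * mderiv A (\<lambda>q. blinfun_apply (snd (y q)) (fst (x q)) - blinfun_apply (snd (x q)) (fst (y q))) p v"
    by (simp add: courant_def Let_def blinfun.diff_left blinfun.scaleR_left ld[OF sX(1)] ld[OF sX(3)])
qed

end

locale dirac_manifold = smooth_manifold A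
  for A :: "('a::topological_space, 'b::euclidean_space) chart set" +
  fixes E :: "'a \<Rightarrow> 'b gen set"
  assumes dirac: "dirac_structure A E"
begin

lemma lagrangian_fiber: "lagrangian (E p)"
  using dirac by (simp add: dirac_structure_def lagrangian_subbundle_def)

lemma involutive:
  assumes "open W" "smooth_gen A W x" "smooth_gen A W y" "\<And>q. q \<in> W \<Longrightarrow> x q \<in> E q" "\<And>q. q \<in> W \<Longrightarrow> y q \<in> E q" "p \<in> W"
  shows "courant A x y p \<in> E p"
  using dirac assms unfolding dirac_structure_def by blast

lemma dirac_lie_bracket_mem:
  assumes W: "open W" "p \<in> W"
    and x: "smooth_vec A W X" "smooth_covec A W \<xi>" "\<And>q. q \<in> W \<Longrightarrow> (X q, \<xi> q) \<in> E q"
    and y: "smooth_vec A W Y" "smooth_covec A W \<eta>" "\<And>q. q \<in> W \<Longrightarrow> (Y q, \<eta> q) \<in> E q"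
  shows "lie_bracket A X Y p \<in> fst ` E p"
proof -
  let ?x = "\<lambda>q. (X q, \<xi> q)" and ?y = "\<lambda>q. (Y q, \<eta> q)"
  have s: "smooth_gen A W ?x" "smooth_gen A W ?y" using x y by (simp_all add: smooth_gen_def o_def)
  have "courant A ?x ?y p \<in> E p" by (rule involutive[OF W(1) s x(3) y(3) W(2)])
  then show ?thesis using courant_apply(1)[OF W(1) s W(2)] by (force simp: o_def)
qed

text \<open>The bracket of the first two sections pairs to zero with the third. Derivatives of
  components are then collected into derivatives of pairings, and what is left over are the Lie
  brackets, so the identity takes a chart-free form.\<close>

lemma dirac_identity:
  assumes W: "open W" "p \<in> W"
    and x: "smooth_vec A W X" "smooth_covec A W \<xi>" "\<And>q. q \<in> W \<Longrightarrow> (X q, \<xi> q) \<in> E q"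
    and y: "smooth_vec A W Y" "smooth_covec A W \<eta>" "\<And>q. q \<in> W \<Longrightarrow> (Y q, \<eta> q) \<in> E q"
    and z: "smooth_vec A W Z" "smooth_covec A W \<zeta>" "\<And>q. q \<in> W \<Longrightarrow> (Z q, \<zeta> q) \<in> E q"
  shows "mderiv A (\<lambda>q. blinfun_apply (\<eta> q) (Z q)) p (X p) - mderiv A (\<lambda>q. blinfun_apply (\<xi> q) (Z q)) p (Y p)
    + mderiv A (\<lambda>q. blinfun_apply (\<xi> q) (Y q)) p (Z p)
    + blinfun_apply (\<zeta> p) (lie_bracket A X Y p) - blinfun_apply (\<eta> p) (lie_bracket A X Z p)
    + blinfun_apply (\<xi> p) (lie_bracket A Y Z p) = 0"
proof -
  let ?x = "\<lambda>q. (X q, \<xi> q)" and ?y = "\<lambda>q. (Y q, \<eta> q)"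
  let ?d = "chart_at A p"
  let ?D = "\<lambda>X. frechet_derivative (vec_rep A ?d X) (at (snd ?d p))"
  let ?C = "\<lambda>\<xi>. frechet_derivative (covec_rep A ?d \<xi>) (at (snd ?d p))"
  have d: "?d \<in> A" "p \<in> fst ?d" by (rule chart_at)+
  note d' = compatible_chart_mem[OF d(1)]
  have rep: "vec_rep A ?d X (snd ?d p) = X p" for X using vec_rep_chart[OF d' d(2)] chart_deriv_chart_at by simp
  have s: "smooth_gen A W ?x" "smooth_gen A W ?y" using x y by (simp_all add: smooth_gen_def o_def)
  have "courant A ?x ?y p \<in> E p" by (rule involutive[OF W(1) s x(3) y(3) W(2)])
  then have "blinfun_apply (snd (courant A ?x ?y p)) (Z p) + blinfun_apply (\<zeta> p) (lie_bracket A X Y p) = 0"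
    using lagrangian_isotropic[OF lagrangian_fiber _ z(3)[OF W(2)], of "fst (courant A ?x ?y p)" "snd (courant A ?x ?y p)"]
      courant_apply(1)[OF W(1) s W(2)] unfolding prod.collapse o_def fst_conv by metis
  then have eq: "blinfun_apply (?C \<eta> (X p)) (Z p) + blinfun_apply (\<eta> p) (?D X (Z p)) -
      (blinfun_apply (?C \<xi> (Y p)) (Z p) + blinfun_apply (\<xi> p) (?D Y (Z p))) -
      1/2 * mderiv A (\<lambda>q. blinfun_apply (\<eta> q) (X q) - blinfun_apply (\<xi> q) (Y q)) p (Z p)
      + blinfun_apply (\<zeta> p) (lie_bracket A X Y p) = 0"
    using courant_apply(2)[OF W(1) s W(2), of "Z p"] by (simp add: o_def)
  have sp: "smooth_fun A W (\<lambda>q. blinfun_apply (\<xi> q) (Y q))" by (rule smooth_fun_pairing[OF W(1) x(2) y(1)])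
  \<comment> \<open>Isotropy gives \<eta>(X) = -\<xi>(Y) on W, so the exact term of the Courant
    bracket, with its factor -1/2, becomes d(\<xi>(Y)).\<close>
  have "mderiv A (\<lambda>q. blinfun_apply (\<eta> q) (X q) - blinfun_apply (\<xi> q) (Y q)) p = (\<lambda>v. - 2 * mderiv A (\<lambda>q. blinfun_apply (\<xi> q) (Y q)) p v)"
  proof -
    have iso: "blinfun_apply (\<eta> q) (X q) = - blinfun_apply (\<xi> q) (Y q)" if "q \<in> W" for q
      using lagrangian_isotropic[OF lagrangian_fiber x(3)[OF that] y(3)[OF that]] by simp
    have S: "open (snd ?d ` (fst ?d \<inter> W))" "snd ?d p \<in> snd ?d ` (fst ?d \<inter> W)"
      using chart_image_open[OF d' W(1)] W(2) d by auto
    have "((\<lambda>y'. - 2 * ((\<lambda>q. blinfun_apply (\<xi> q) (Y q)) \<circ> chart_inv ?d) y') has_derivative (\<lambda>v. - 2 * mderiv A (\<lambda>q. blinfun_apply (\<xi> q) (Y q)) p v)) (at (snd ?d p))"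
      by (rule has_derivative_mult_right[OF mderiv_has_derivative[OF sp W(2)]])
    then have "(((\<lambda>q. blinfun_apply (\<eta> q) (X q) - blinfun_apply (\<xi> q) (Y q)) \<circ> chart_inv ?d) has_derivative (\<lambda>v. - 2 * mderiv A (\<lambda>q. blinfun_apply (\<xi> q) (Y q)) p v)) (at (snd ?d p))"
      by (rule has_derivative_transform_within_open[OF _ S]) (use iso chart_inv_chart[OF d'] in auto)
    from frechet_derivative_at[OF this] show ?thesis by (simp add: mderiv_chart_at[of "\<lambda>q. blinfun_apply (\<eta> q) (X q) - blinfun_apply (\<xi> q) (Y q)"])
  qed
  then have "blinfun_apply (?C \<eta> (X p)) (Z p) + blinfun_apply (\<eta> p) (?D X (Z p)) -
      (blinfun_apply (?C \<xi> (Y p)) (Z p) + blinfun_apply (\<xi> p) (?D Y (Z p))) +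
      mderiv A (\<lambda>q. blinfun_apply (\<xi> q) (Y q)) p (Z p) + blinfun_apply (\<zeta> p) (lie_bracket A X Y p) = 0"
    using eq by simp
  then show ?thesis
    using mderiv_pairing[OF W(1) y(2) z(1) W(2), of "X p"] mderiv_pairing[OF W(1) x(2) z(1) W(2), of "Y p"]
      mderiv_pairing[OF W(1) x(2) y(1) W(2), of "Z p"]
    by (simp add: lie_bracket_def Let_def rep blinfun.diff_right)
qed

text \<open>With \<open>\<zeta> = dh\<close> this is the Jacobi identity; with \<open>\<zeta> = 0\<close> it says that \<open>{f, g}\<close> is constant along \<open>Z\<close>.\<close>

lemma dirac_identity_exact:
  assumes W: "open W" "p \<in> W" and f: "smooth_fun A W f" and g: "smooth_fun A W g"
    and x: "smooth_vec A W X" "\<And>q. q \<in> W \<Longrightarrow> (X q, dfun A f q) \<in> E q"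
    and y: "smooth_vec A W Y" "\<And>q. q \<in> W \<Longrightarrow> (Y q, dfun A g q) \<in> E q"
    and z: "smooth_vec A W Z" "smooth_covec A W \<zeta>" "\<And>q. q \<in> W \<Longrightarrow> (Z q, \<zeta> q) \<in> E q"
  shows "mderiv A (\<lambda>q. blinfun_apply (dfun A g q) (X q)) p (Z p) + blinfun_apply (\<zeta> p) (lie_bracket A X Y p) = 0"
  using dirac_identity[OF W x(1) smooth_covec_dfun[OF W(1) f] x(2) y(1) smooth_covec_dfun[OF W(1) g] y(2) z]
    mderiv_lie_bracket[OF W(1) g x(1) z(1) W(2)] mderiv_lie_bracket[OF W(1) f y(1) z(1) W(2)]
  by (simp add: dfun_apply[OF f W(2)] dfun_apply[OF g W(2)])

end

section \<open>Admissible functions\<close>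

context smooth_manifold
begin

text \<open>Along a tangent curve h has zero derivative, and a leaf consists of chains of such
  curves. The chart chosen at \<gamma>(t) contains \<gamma>(s) only for s near t, which is enough to
  differentiate at t.\<close>

lemma constant_on_leaf:
  assumes W: "open W" and h: "smooth_fun A W h" and D: "\<And>q v. q \<in> W \<Longrightarrow> v \<in> D q \<Longrightarrow> mderiv A h q v = 0"
    and q: "q \<in> leaf A D W p"
  shows "h q = h p"
proof -
  have step: "h (\<gamma> 1) = h (\<gamma> 0)" if \<gamma>: "tangent_curve A D W \<gamma>" for \<gamma>
  proof -
    have cont: "continuous_on {0..1} \<gamma>" and im: "\<gamma> ` {0..1} \<subseteq> W" using \<gamma> by (auto simp: tangent_curve_def)
    have "((\<lambda>t. h (\<gamma> t)) has_derivative (\<lambda>s. 0)) (at t within {0..1})" if t: "t \<in> {0..1}" for t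
    proof -
      let ?d = "chart_at A (\<gamma> t)"
      note d' = compatible_chart_mem[OF chart_at(1)[of "\<gamma> t"]]
      obtain v where v: "v \<in> D (\<gamma> t)" "((snd ?d \<circ> \<gamma>) has_vector_derivative v) (at t within {0..1})"
        using \<gamma> t unfolding tangent_curve_def by blast
      have tW: "\<gamma> t \<in> W" using im t by blast
      from has_derivative_compose[OF v(2)[unfolded has_vector_derivative_def], of "h \<circ> chart_inv ?d"] mderiv_has_derivative[OF h tW]
      have "((\<lambda>s. (h \<circ> chart_inv ?d) ((snd ?d \<circ> \<gamma>) s)) has_derivative (\<lambda>s. mderiv A h (\<gamma> t) (s *\<^sub>R v))) (at t within {0..1})"
        by simp
      moreover have "mderiv A h (\<gamma> t) (s *\<^sub>R v) = 0" for s
        using D[OF tW v(1)] linear_cmul[OF has_derivative_linear[OF mderiv_has_derivative[OF h tW]]] by simp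
      ultimately have 1: "((\<lambda>s. (h \<circ> chart_inv ?d) ((snd ?d \<circ> \<gamma>) s)) has_derivative (\<lambda>s. 0)) (at t within {0..1})" by simp
      have "\<forall>\<^sub>F s in at t within {0..1}. \<gamma> s \<in> fst ?d"
        using cont t chart_open[OF d'] chart_at(2)[of "\<gamma> t"] topological_tendstoD unfolding continuous_on_def by metis
      then have "\<forall>\<^sub>F s in at t within {0..1}. (h \<circ> chart_inv ?d) ((snd ?d \<circ> \<gamma>) s) = h (\<gamma> s)"
        by eventually_elim (simp add: chart_inv_chart[OF d'])
      then show ?thesis
        by (rule has_derivative_transform_eventually[OF 1]) (use t chart_inv_chart[OF d' chart_at(2)] in auto)
    qed
    then have "\<exists>c. \<forall>t\<in>{0..1}. h (\<gamma> t) = c"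
      by (intro has_derivative_zero_constant) auto
    then show ?thesis by auto
  qed
  have "(\<lambda>a b. \<exists>\<gamma>. tangent_curve A D W \<gamma> \<and> \<gamma> 0 = a \<and> \<gamma> 1 = b)\<^sup>*\<^sup>* p q" using q by (simp add: leaf_def)
  then show ?thesis by (induction rule: rtranclp_induct) (use step in auto)
qed

text \<open>In a flat chart the straight segment in the direction of v stays in the leaf, and f is
  constant along it.\<close>

lemma mderiv_admissible:
  assumes fol: "regular_foliation_on A U D" and W: "open W" "W \<subseteq> U" and f: "f \<in> admissible A D W"
    and p: "p \<in> W" and v: "v \<in> D p"
  shows "mderiv A f p v = 0"
proof -
  have sf: "smooth_fun A W f" and leaf: "\<And>p q. p \<in> W \<Longrightarrow> q \<in> leaf A D W p \<Longrightarrow> f q = f p"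
    using f by (auto simp: admissible_def)
  obtain c F where c: "compatible_chart A c" and pc: "p \<in> fst c" and F: "subspace F"
    and D: "\<forall>q\<in>fst c. D q = {v. chart_deriv c q v \<in> F}"
    using fol p W(2) unfolding regular_foliation_on_def by blast
  let ?w = "chart_deriv c p v" and ?y = "snd c p"
  have w: "?w \<in> F" using v D pc by blast
  have O: "open (snd c ` (fst c \<inter> W))" "?y \<in> snd c ` (fst c \<inter> W)" using chart_image_open[OF c W(1)] pc p by auto
  then obtain r where r: "r > 0" "ball ?y r \<subseteq> snd c ` (fst c \<inter> W)" using open_contains_ball by blast
  \<comment> \<open>Segments with parameter below e have length less than r and stay in the image of
    W.\<close>
  define e where "e = r / (1 + norm ?w)"
  have npos: "1 + norm ?w > 0" by (smt (verit) norm_ge_zero)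
  have e: "e > 0" using r npos by (simp add: e_def)
  have const: "f (chart_inv c (?y + s *\<^sub>R ?w)) = f p" if s: "\<bar>s\<bar> < e" for s
  proof -
    define \<gamma> where "\<gamma> = (\<lambda>t. chart_inv c (?y + (t * s) *\<^sub>R ?w))"
    have line: "?y + (t * s) *\<^sub>R ?w \<in> ball ?y r" if t: "t \<in> {0..1}" for t
    proof -
      have "\<bar>t * s\<bar> \<le> \<bar>s\<bar>" using t by (simp add: abs_mult mult_left_le_one_le)
      then have "norm ((t * s) *\<^sub>R ?w) \<le> \<bar>s\<bar> * (1 + norm ?w)"
        by (simp only: norm_scaleR) (intro mult_mono, auto)
      also have "\<dots> < e * (1 + norm ?w)" using s npos by (intro mult_strict_right_mono) auto
      also have "\<dots> = r" using npos by (simp add: e_def)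
      finally show ?thesis by (simp add: dist_norm)
    qed
    have lineS: "?y + (t * s) *\<^sub>R ?w \<in> snd c ` (fst c \<inter> W)" if "t \<in> {0..1}" for t using line[OF that] r by blast
    have mem: "\<gamma> t \<in> fst c \<inter> W" if "t \<in> {0..1}" for t
      unfolding \<gamma>_def by (rule chart_inv_mem[OF c lineS[OF that]]) simp
    have snd\<gamma>: "snd c (\<gamma> t) = ?y + (t * s) *\<^sub>R ?w" if "t \<in> {0..1}" for t
      unfolding \<gamma>_def by (rule chart_chart_inv[OF c]) (use lineS[OF that] in blast)
    have "tangent_curve A D W \<gamma>"
      unfolding tangent_curve_def
    proof (intro conjI ballI)
      show "continuous_on {0..1} \<gamma>"
        unfolding \<gamma>_def
      proof (rule continuous_on_compose2[OF homeomorphism_cont2[OF chart_homeomorphism[OF c]]])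
        show "(\<lambda>t. ?y + (t * s) *\<^sub>R ?w) ` {0..1} \<subseteq> snd c ` fst c" using lineS by blast
      qed (intro continuous_intros)
      show "\<gamma> ` {0..1} \<subseteq> W" using mem by blast
      fix t :: real assume t: "t \<in> {0..1}"
      let ?d = "chart_at A (\<gamma> t)"
      have \<gamma>t: "\<gamma> t \<in> fst c" using mem[OF t] by blast
      have 1: "((\<lambda>t. ?y + (t * s) *\<^sub>R ?w) has_derivative (\<lambda>h. (h * s) *\<^sub>R ?w)) (at t within {0..1})"
        by (auto intro!: derivative_eq_intros)
      have 2: "((snd ?d \<circ> chart_inv c) has_derivative chart_coderiv c (\<gamma> t)) (at (?y + (t * s) *\<^sub>R ?w))"
        using transition_deriv_to[OF c chart_at(1) \<gamma>t chart_at(2)] snd\<gamma>[OF t] by (simp add: chart_coderiv_def)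
      have lin: "linear (chart_coderiv c (\<gamma> t))" using bounded_linear_chart_coderiv[OF c \<gamma>t] bounded_linear.linear by blast
      have e1: "snd c' \<circ> \<gamma> = (\<lambda>t. (snd c' \<circ> chart_inv c) (?y + (t * s) *\<^sub>R ?w))" for c' :: "('a, 'b) chart"
        by (simp add: \<gamma>_def fun_eq_iff)
      have "((\<lambda>t. (snd ?d \<circ> chart_inv c) (?y + (t * s) *\<^sub>R ?w)) has_derivative (\<lambda>h. chart_coderiv c (\<gamma> t) ((h * s) *\<^sub>R ?w))) (at t within {0..1})"
        by (rule has_derivative_compose[OF 1 2])
      then have "((snd ?d \<circ> \<gamma>) has_vector_derivative chart_coderiv c (\<gamma> t) (s *\<^sub>R ?w)) (at t within {0..1})"
        unfolding has_vector_derivative_def e1 by (simp add: linear_cmul[OF lin])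
      moreover have "chart_coderiv c (\<gamma> t) (s *\<^sub>R ?w) \<in> D (\<gamma> t)"
        using D \<gamma>t chart_deriv_coderiv[OF c \<gamma>t] subspace_scale[OF F w] by simp
      ultimately show "\<exists>v\<in>D (\<gamma> t). ((snd ?d \<circ> \<gamma>) has_vector_derivative v) (at t within {0..1})" by blast
    qed
    moreover have "\<gamma> 0 = p" using chart_inv_chart[OF c pc] by (simp add: \<gamma>_def)
    ultimately have "\<gamma> 1 \<in> leaf A D W p" unfolding leaf_def by blast
    from leaf[OF p this] show ?thesis by (simp add: \<gamma>_def)
  qed
  have fd: "((f \<circ> chart_inv c) has_derivative (\<lambda>u. mderiv A f p (chart_coderiv c p u))) (at ?y)"
  proof -
    have "((\<lambda>y. (f \<circ> chart_inv (chart_at A p)) ((snd (chart_at A p) \<circ> chart_inv c) y)) has_derivative (\<lambda>u. mderiv A f p (chart_coderiv c p u))) (at ?y)"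
      unfolding chart_coderiv_def
      by (rule has_derivative_compose[OF transition_deriv_to[OF c chart_at(1) pc chart_at(2)]])
        (simp only: transition_mem[OF c pc] mderiv_has_derivative[OF sf p])
    then show ?thesis
    proof (rule has_derivative_transform_within_open)
      show "open (snd c ` (fst c \<inter> fst (chart_at A p)))"
        by (rule chart_image_open[OF c chart_open[OF compatible_chart_mem[OF chart_at(1)]]])
      show "?y \<in> snd c ` (fst c \<inter> fst (chart_at A p))" using pc chart_at(2) by blast
      fix y assume "y \<in> snd c ` (fst c \<inter> fst (chart_at A p))"
      then show "(f \<circ> chart_inv (chart_at A p)) ((snd (chart_at A p) \<circ> chart_inv c) y) = (f \<circ> chart_inv c) y"
        using chart_inv_chart[OF c] chart_inv_chart[OF compatible_chart_mem[OF chart_at(1)]] by auto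
    qed
  qed
  have "((\<lambda>s. ?y + s *\<^sub>R ?w) has_derivative (\<lambda>s. s *\<^sub>R ?w)) (at 0)"
    by (auto intro!: derivative_eq_intros)
  from has_derivative_compose[OF this, of "f \<circ> chart_inv c"] fd
  have 1: "((\<lambda>s. (f \<circ> chart_inv c) (?y + s *\<^sub>R ?w)) has_derivative (\<lambda>s. mderiv A f p (chart_coderiv c p (s *\<^sub>R ?w)))) (at 0)"
    by simp
  have 2: "((\<lambda>s. (f \<circ> chart_inv c) (?y + s *\<^sub>R ?w)) has_derivative (\<lambda>s. 0)) (at 0)"
    by (rule has_derivative_transform_within_open[of "\<lambda>s. f p" _ _ _ "{-e<..<e}"])
      (use e const in \<open>auto simp: abs_less_iff\<close>)
  show ?thesis
    using fun_cong[OF has_derivative_unique[OF 1 2], of 1] chart_coderiv_deriv[OF c pc] by simp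
qed

end

section \<open>Adapted local sections\<close>

lemma dim_image_gen:
  fixes f :: "'b::euclidean_space gen \<Rightarrow> 'c::real_vector"
  assumes f: "linear f" and inj: "inj_on f L" and L: "subspace L"
  shows "dim (f ` L) = dim L"
proof -
  let ?s = "\<lambda>(v::'b, \<xi>). (v, riesz \<xi>)" and ?g = "\<lambda>p::'b \<times> 'b. (fst p, blinfun_inner_left (snd p)) :: 'b gen"
  have g: "linear ?g"
    by (intro bounded_linear.linear bounded_linear_Pair bounded_linear_fst bounded_linear_compose[OF bounded_linear_blinfun_inner_left] bounded_linear_snd)
  have s: "linear ?s"
    using bounded_linear.linear[OF bounded_linear_Pair[OF bounded_linear_fst bounded_linear_compose[OF bounded_linear_riesz bounded_linear_snd]]]
    by (simp add: split_def)
  have gs: "?g (?s x) = x" for x by (cases x) simp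
  have sub: "subspace (?s ` L)" by (rule linear_subspace_image[OF s L])
  have "inj_on (\<lambda>p. f (?g p)) (?s ` L)"
    using inj gs by (auto intro!: inj_onI dest: inj_onD)
  then have "dim ((\<lambda>p. f (?g p)) ` (?s ` L)) = dim (?s ` L)"
    using linear_compose[OF g f] unfolding o_def
    by (intro dim_image_eq) (simp_all only: span_eq_iff[THEN iffD2, OF sub])
  moreover have "(\<lambda>p. f (?g p)) ` (?s ` L) = f ` L" by (simp add: image_image gs)
  ultimately show ?thesis using dim_gen[of L] by simp
qed

lemma span_range_eq:
  fixes f :: "'n::finite \<Rightarrow> 'v::real_vector"
  assumes "x \<in> span (range f)"
  obtains a :: "real ^ 'n" where "x = (\<Sum>j\<in>UNIV. a $ j *\<^sub>R f j)"
proof -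
  let ?R = "range (\<lambda>a::real ^ 'n. \<Sum>j\<in>UNIV. a $ j *\<^sub>R f j)"
  have "linear (\<lambda>a::real ^ 'n. \<Sum>j\<in>UNIV. a $ j *\<^sub>R f j)"
    by (rule linearI) (simp_all add: scaleR_add_left sum.distrib scaleR_sum_right)
  then have "subspace ?R" using linear_subspace_image subspace_UNIV by blast
  moreover have "range f \<subseteq> ?R"
  proof
    fix y assume "y \<in> range f"
    then obtain i where i: "y = f i" by blast
    have "(\<Sum>j\<in>UNIV. (axis i 1 :: real ^ 'n) $ j *\<^sub>R f j) = (\<Sum>j\<in>UNIV. if j = i then f j else 0)"
      by (intro sum.cong) (auto simp: axis_def)
    then have "(\<Sum>j\<in>UNIV. (axis i 1 :: real ^ 'n) $ j *\<^sub>R f j) = y" by (simp add: i)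
    from this[symmetric] show "y \<in> ?R" by (rule range_eqI)
  qed
  ultimately have "x \<in> ?R" using assms span_minimal by blast
  then show thesis using that by blast
qed

lemma smooth_on_det:
  fixes M :: "'a::real_normed_vector \<Rightarrow> real ^ 'n ^ 'n"
  assumes S: "open S" and M: "\<And>i j. smooth_on S (\<lambda>y. M y $ i $ j)"
  shows "smooth_on S (\<lambda>y. det (M y))"
  unfolding det_def
  by (intro smooth_on_sum smooth_on_bilinear[OF bounded_bilinear_mult] smooth_on_const smooth_on_prod S M)

section \<open>Generalized tangent vectors in the coordinates of a chart\<close>

context smooth_manifold
begin

definition gen_rep :: "('a, 'b) chart \<Rightarrow> 'a \<Rightarrow> 'b gen \<Rightarrow> 'b gen" where
  "gen_rep c p x = (chart_deriv c p (fst x), Blinfun (\<lambda>v. blinfun_apply (snd x) (chart_coderiv c p v)))"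

context
  fixes c :: "('a, 'b) chart" and p :: 'a
  assumes c: "c \<in> A" and p: "p \<in> fst c"
begin

lemma chart_compatible: "compatible_chart A c" by (rule compatible_chart_mem[OF c])

lemma fst_gen_rep: "fst (gen_rep c p x) = chart_deriv c p (fst x)"
  by (simp add: gen_rep_def)

lemma snd_gen_rep: "blinfun_apply (snd (gen_rep c p x)) v = blinfun_apply (snd x) (chart_coderiv c p v)"
  unfolding gen_rep_def snd_conv
  by (subst bounded_linear_Blinfun_apply)
    (auto intro: bounded_linear_compose[OF blinfun.bounded_linear_right bounded_linear_chart_coderiv[OF chart_compatible p]])

lemma chart_deriv_linear: "linear (chart_deriv c p)"
  using bounded_linear_chart_deriv[OF chart_compatible p] bounded_linear.linear by blast

lemma linear_gen_rep: "linear (gen_rep c p)"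
  by (rule linearI)
    (auto intro!: prod_eqI blinfun_eqI
      simp: fst_gen_rep snd_gen_rep linear_add[OF chart_deriv_linear] linear_cmul[OF chart_deriv_linear]
        blinfun.add_left blinfun.scaleR_left)

lemma chart_deriv_inj: "chart_deriv c p v = chart_deriv c p w \<longleftrightarrow> v = w"
  using chart_coderiv_deriv[OF chart_compatible p] by metis

lemma gen_rep_inj: "gen_rep c p x = gen_rep c p y \<longleftrightarrow> x = y"
proof
  assume eq: "gen_rep c p x = gen_rep c p y"
  have 1: "fst x = fst y" using eq fst_gen_rep chart_deriv_inj by metis
  have "blinfun_apply (snd x) v = blinfun_apply (snd y) v" for v
    using snd_gen_rep[of x "chart_deriv c p v"] snd_gen_rep[of y "chart_deriv c p v"] eq chart_coderiv_deriv[OF chart_compatible p] by simp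
  then show "x = y" using 1 by (auto intro: prod_eqI blinfun_eqI)
qed simp

lemma gen_rep_section: "gen_rep c p (x p) = (vec_rep A c (fst \<circ> x) (snd c p), covec_rep A c (snd \<circ> x) (snd c p))"
  by (auto intro!: prod_eqI blinfun_eqI simp: fst_gen_rep snd_gen_rep vec_rep_chart[OF chart_compatible p] covec_rep_chart[OF chart_compatible p])

lemma gen_rep_pairing:
  "blinfun_apply (snd (gen_rep c p x)) (fst (gen_rep c p y)) = blinfun_apply (snd x) (fst y)"
  by (simp add: snd_gen_rep fst_gen_rep chart_coderiv_deriv[OF chart_compatible p])

lemma lagrangian_gen_rep:
  assumes L: "lagrangian L" shows "lagrangian (gen_rep c p ` L)"
  unfolding lagrangian_def
proof (intro conjI)
  show "subspace (gen_rep c p ` L)" by (rule linear_subspace_image[OF linear_gen_rep lagrangian_subspace[OF L]])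
  have "dim (gen_rep c p ` L) = dim L"
    by (rule dim_image_gen[OF linear_gen_rep _ lagrangian_subspace[OF L]]) (simp add: inj_on_def gen_rep_inj)
  then show "dim (gen_rep c p ` L) = DIM('b)" using L by (simp add: lagrangian_def)
  show "\<forall>x\<in>gen_rep c p ` L. \<forall>y\<in>gen_rep c p ` L. gen_inner x y = 0"
    using L by (auto simp: lagrangian_def gen_inner_def gen_rep_pairing)
qed

lemma fst_gen_rep_image: "fst ` gen_rep c p ` L = chart_deriv c p ` fst ` L"
  by (simp add: image_image fst_gen_rep)

lemma gen_rep_vec: "gen_rep c p (v, 0) = (chart_deriv c p v, 0)"
  by (auto intro!: prod_eqI blinfun_eqI simp: fst_gen_rep snd_gen_rep)

lemma lag_kernel_gen_rep: "lag_kernel (gen_rep c p ` L) = chart_deriv c p ` lag_kernel L"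
proof (intro equalityI subsetI)
  fix v assume "v \<in> lag_kernel (gen_rep c p ` L)"
  then obtain x where x: "x \<in> L" "gen_rep c p x = (v, 0)" by force
  then have "gen_rep c p x = gen_rep c p (chart_coderiv c p v, 0)"
    by (simp add: gen_rep_vec chart_deriv_coderiv[OF chart_compatible p])
  then have "x = (chart_coderiv c p v, 0)" by (simp add: gen_rep_inj)
  then show "v \<in> chart_deriv c p ` lag_kernel L"
    using x(1) chart_deriv_coderiv[OF chart_compatible p, of v] by force
next
  fix v assume "v \<in> chart_deriv c p ` lag_kernel L"
  then obtain w where w: "(w, 0) \<in> L" "v = chart_deriv c p w" by blast
  have "gen_rep c p (w, 0) \<in> gen_rep c p ` L" by (rule imageI[OF w(1)])
  then show "v \<in> lag_kernel (gen_rep c p ` L)" by (simp add: gen_rep_vec w(2))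
qed

lemma dim_chart_deriv_image: "dim (chart_deriv c p ` V) = dim V"
  by (rule dim_image_eq[OF chart_deriv_linear]) (simp add: inj_on_def chart_deriv_inj)

end

end

text \<open>Injectivity of the coordinate map T on the fibre over p0 means that the matrix of a
  local frame of E has nonzero determinant there, hence also nearby. Cramer's rule then gives the
  section with prescribed coordinates, with smooth coefficients.\<close>

lemma adapted_sections:
  fixes A :: "('a::topological_space, real ^ 'n) chart set"
  assumes "smooth_manifold A" and sub: "lagrangian_subbundle A E" and c: "c \<in> A" and p0: "p0 \<in> fst c"
    and T: "bounded_linear T" and inj: "\<And>x. x \<in> E p0 \<Longrightarrow> T (smooth_manifold.gen_rep A c p0 x) = 0 \<Longrightarrow> x = 0"
  obtains N and S :: "'a \<Rightarrow> real ^ 'n \<Rightarrow> (real ^ 'n) gen" where "open N" "p0 \<in> N" "N \<subseteq> fst c"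
    "\<forall>q\<in>N. \<forall>x\<in>E q. T (smooth_manifold.gen_rep A c q x) = 0 \<longrightarrow> x = 0"
    "\<forall>q\<in>N. \<forall>e. S q e \<in> E q \<and> T (smooth_manifold.gen_rep A c q (S q e)) = e"
    "\<forall>N' t. open N' \<longrightarrow> N' \<subseteq> N \<longrightarrow> smooth_on (snd c ` N') t \<longrightarrow> smooth_gen A N' (\<lambda>q. S q (t (snd c q)))"
proof -
  interpret smooth_manifold A by fact
  interpret T: bounded_linear T by fact
  note c' = compatible_chart_mem[OF c]
  have lag: "lagrangian (E q)" for q using sub by (simp add: lagrangian_subbundle_def)
  obtain W f where W: "open W" "p0 \<in> W" and f: "\<forall>i<DIM(real ^ 'n). smooth_gen A W (f i)"
    and fE: "\<forall>q\<in>W. span ((\<lambda>i. f i q) ` {..<DIM(real ^ 'n)}) = E q"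
    using sub unfolding lagrangian_subbundle_def by blast
  \<comment> \<open>The frame is reindexed by the index type of the model space, so that its
    coordinates form a square matrix.\<close>
  obtain h :: "'n \<Rightarrow> nat" where h: "bij_betw h UNIV {..<CARD('n)}"
    using ex_bij_betw_finite_nat[of "UNIV :: 'n set"] by (auto simp: atLeast0LessThan)
  define e where "e = (\<lambda>j q. f (h j) q)"
  have e_smooth: "smooth_gen A W (e j)" for j
    using f h by (auto simp: e_def bij_betw_def)
  have eE: "span (range (\<lambda>j. e j q)) = E q" if "q \<in> W" for q
  proof -
    have "range (\<lambda>j. e j q) = (\<lambda>i. f i q) ` (range h)" by (simp add: e_def image_image)
    then show ?thesis using fE that h by (simp add: bij_betw_def)
  qed
  define M where "M = (\<lambda>y. \<chi> i j. T (vec_rep A c (fst \<circ> e j) y, covec_rep A c (snd \<circ> e j) y) $ i)"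
  define M' where "M' = (\<lambda>q. M (snd c q))"
  define V where "V = snd c ` (fst c \<inter> W)"
  have V: "open V" unfolding V_def by (rule chart_image_open[OF c' W(1)])
  have sm: "smooth_on V (vec_rep A c (fst \<circ> e j))" "smooth_on V (covec_rep A c (snd \<circ> e j))" for j
    using e_smooth[of j] c by (simp_all add: smooth_gen_def smooth_vec_def smooth_covec_def V_def)
  have M_smooth: "smooth_on V (\<lambda>y. M y $ i $ j)" for i j
  proof -
    have "smooth_on V (\<lambda>y. (vec_rep A c (fst \<circ> e j) y, covec_rep A c (snd \<circ> e j) y))"
      using sm[of j] V by (simp add: smooth_on_def Ck_on_Pair)
    then have "smooth_on V (\<lambda>y. T (vec_rep A c (fst \<circ> e j) y, covec_rep A c (snd \<circ> e j) y) $ i)"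
      by (intro smooth_on_bounded_linear[OF bounded_linear_vec_nth] smooth_on_bounded_linear[OF T] V)
    then show ?thesis by (simp add: M_def)
  qed
  have Me: "M' q *v a = T (gen_rep c q (\<Sum>j\<in>UNIV. a $ j *\<^sub>R e j q))" if "q \<in> fst c" for q a
  proof -
    have "T (gen_rep c q (\<Sum>j\<in>UNIV. a $ j *\<^sub>R e j q)) = (\<Sum>j\<in>UNIV. a $ j *\<^sub>R T (gen_rep c q (e j q)))"
      by (simp add: linear_sum[OF linear_gen_rep[OF c that]] linear_cmul[OF linear_gen_rep[OF c that]] T.sum T.scaleR)
    moreover have "T (gen_rep c q (e j q)) = (\<chi> i. M' q $ i $ j)" for j
      by (simp add: M_def M'_def gen_rep_section[OF c that, of "e j"] vec_eq_iff)
    ultimately show ?thesis by (simp add: vec_eq_iff matrix_vector_mult_def mult.commute)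
  qed
  have det0: "det (M' p0) \<noteq> 0"
  proof -
    have "inj_on (\<lambda>x. T (gen_rep c p0 x)) (E p0)"
    proof (rule inj_onI)
      fix x y assume xy: "x \<in> E p0" "y \<in> E p0" "T (gen_rep c p0 x) = T (gen_rep c p0 y)"
      have "T (gen_rep c p0 (x - y)) = 0"
        using xy(3) by (simp add: linear_diff[OF linear_gen_rep[OF c p0]] T.diff)
      then show "x = y" using inj[OF lagrangian_diff[OF lag xy(1,2)]] by simp
    qed
    moreover have lin: "linear (\<lambda>x. T (gen_rep c p0 x))"
      using linear_compose[OF linear_gen_rep[OF c p0] bounded_linear.linear[OF T]] by (simp add: o_def)
    ultimately have "dim ((\<lambda>x. T (gen_rep c p0 x)) ` E p0) = DIM(real ^ 'n)"
      using dim_image_gen[of "\<lambda>x. T (gen_rep c p0 x)" "E p0"] lagrangian_subspace[OF lag] lag[of p0] by (simp add: lagrangian_def)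
    then have "(\<lambda>x. T (gen_rep c p0 x)) ` E p0 = UNIV"
      using subspace_dim_equal[OF linear_subspace_image[OF lin lagrangian_subspace[OF lag]] subspace_UNIV] by simp
    then have "surj ((*v) (M' p0))"
    proof -
      assume surj: "(\<lambda>x. T (gen_rep c p0 x)) ` E p0 = UNIV"
      have "\<exists>a. M' p0 *v a = y" for y
      proof -
        obtain x where x: "x \<in> E p0" "y = T (gen_rep c p0 x)" using surj by blast
        obtain a :: "real ^ 'n" where "x = (\<Sum>j\<in>UNIV. a $ j *\<^sub>R e j p0)"
          using span_range_eq[of x "\<lambda>j. e j p0"] x(1) eE[OF W(2)] by blast
        then show ?thesis using Me[OF p0, of a] x(2) by auto
      qed
      then show ?thesis by (metis surjI)
    qed
    then show ?thesis
      using invertible_det_nz matrix_right_invertible_surjective invertible_right_inverse by blast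
  qed
  define N where "N = {q \<in> fst c \<inter> W. det (M' q) \<noteq> 0}"
  have N: "open N"
  proof -
    have "continuous_on V (\<lambda>y. det (M y))" by (rule smooth_on_continuous[OF smooth_on_det[OF V M_smooth]])
    moreover have "continuous_on (fst c \<inter> W) (snd c)"
      using homeomorphism_cont1[OF chart_homeomorphism[OF c']] continuous_on_subset by blast
    ultimately have "continuous_on (fst c \<inter> W) (\<lambda>q. det (M' q))"
      unfolding M'_def by (rule continuous_on_compose2) (simp add: V_def)
    from continuous_open_preimage[OF this open_Int[OF chart_open[OF c'] W(1)], of "- {0}"]
    have "open ((fst c \<inter> W) \<inter> (\<lambda>q. det (M' q)) -` (- {0}))" by auto
    moreover have "(fst c \<inter> W) \<inter> (\<lambda>q. det (M' q)) -` (- {0}) = N" by (auto simp: N_def)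
    ultimately show ?thesis by simp
  qed
  \<comment> \<open>Cramer's rule: the k-th coefficient is the determinant with column k replaced by
    b, divided by the determinant of the frame.\<close>
  define S where "S = (\<lambda>q b. \<Sum>k\<in>UNIV. (det (\<chi> i j. if j = k then b $ i else M' q $ i $ j) / det (M' q)) *\<^sub>R e k q)"
  show ?thesis
  proof (rule that[OF N])
    show "p0 \<in> N" using p0 W det0 by (simp add: N_def)
    show "N \<subseteq> fst c" by (auto simp: N_def)
    show "\<forall>q\<in>N. \<forall>x\<in>E q. T (gen_rep c q x) = 0 \<longrightarrow> x = 0"
    proof (intro ballI impI)
      fix q x assume q: "q \<in> N" and x: "x \<in> E q" "T (gen_rep c q x) = 0"
      have q': "q \<in> W" "q \<in> fst c" "det (M' q) \<noteq> 0" using q by (auto simp: N_def)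
      obtain a :: "real ^ 'n" where a: "x = (\<Sum>j\<in>UNIV. a $ j *\<^sub>R e j q)"
        using span_range_eq[of x "\<lambda>j. e j q"] x(1) eE[OF q'(1)] by blast
      then have "M' q *v a = 0" using Me[OF q'(2), of a] x(2) by simp
      then have "a = 0" using q'(3) by (metis invertible_det_nz invertible_left_inverse matrix_left_invertible_ker)
      then show "x = 0" using a by simp
    qed
    show "\<forall>q\<in>N. \<forall>b. S q b \<in> E q \<and> T (gen_rep c q (S q b)) = b"
    proof (intro ballI allI conjI)
      fix q b assume q: "q \<in> N"
      have q': "q \<in> W" "q \<in> fst c" "det (M' q) \<noteq> 0" using q by (auto simp: N_def)
      show "S q b \<in> E q"
        unfolding S_def eE[OF q'(1), symmetric] by (intro span_sum span_scale span_base) blast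
      show "T (gen_rep c q (S q b)) = b"
        using Me[OF q'(2), of "\<chi> k. det (\<chi> i j. if j = k then b $ i else M' q $ i $ j) / det (M' q)", symmetric]
          cramer[OF q'(3), THEN iffD2, OF refl, of b] unfolding S_def vec_lambda_beta by metis
    qed
    show "\<forall>N' t. open N' \<longrightarrow> N' \<subseteq> N \<longrightarrow> smooth_on (snd c ` N') t \<longrightarrow> smooth_gen A N' (\<lambda>q. S q (t (snd c q)))"
    proof (intro allI impI)
      fix N' and t :: "real ^ 'n \<Rightarrow> real ^ 'n" assume N': "open N'" "N' \<subseteq> N" and t: "smooth_on (snd c ` N') t"
      have N'c: "N' \<subseteq> fst c" using N' by (auto simp: N_def)
      have N'V: "snd c ` N' \<subseteq> V" using N' by (auto simp: N_def V_def)
      have O: "open (snd c ` N')" by (rule chart_image_open'[OF c' N'(1) N'c])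
      define a where "a = (\<lambda>k y. det (\<chi> i j. if j = k then t y $ i else M y $ i $ j) * inverse (det (M y)))"
      have a_smooth: "smooth_on (snd c ` N') (a k)" for k
        unfolding a_def
      proof (intro smooth_on_bilinear[OF bounded_bilinear_mult] smooth_on_inverse O smooth_on_det)
        fix i j
        show "smooth_on (snd c ` N') (\<lambda>y. M y $ i $ j)" by (rule smooth_on_subset[OF M_smooth N'V])
        then show "smooth_on (snd c ` N') (\<lambda>y. (\<chi> i j. if j = k then t y $ i else M y $ i $ j) $ i $ j)"
          using smooth_on_bounded_linear[OF bounded_linear_vec_nth O t, of i] by (cases "j = k") simp_all
      next
        fix y assume "y \<in> snd c ` N'"
        then show "det (M y) \<noteq> 0" using N' by (auto simp: N_def M'_def)
      qed
      let ?x = "\<lambda>q. S q (t (snd c q))"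
      have rep: "gen_rep c q (?x q) = (\<Sum>k\<in>UNIV. a k (snd c q) *\<^sub>R gen_rep c q (e k q))" if "q \<in> N'" for q
      proof -
        have "q \<in> fst c" using that N'c by blast
        note lin = linear_gen_rep[OF c this]
        show ?thesis
          unfolding S_def a_def M'_def by (simp add: linear_sum[OF lin] linear_cmul[OF lin] divide_inverse)
      qed
      have "smooth_on (snd c ` N') (vec_rep A c (fst \<circ> ?x))"
      proof (rule smooth_on_cong[OF O])
        show "smooth_on (snd c ` N') (\<lambda>y. \<Sum>k\<in>UNIV. a k y *\<^sub>R vec_rep A c (fst \<circ> e k) y)"
          by (intro smooth_on_sum smooth_on_bilinear[OF bounded_bilinear_scaleR] O a_smooth smooth_on_subset[OF sm(1) N'V])
        fix y assume "y \<in> snd c ` N'"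
        then obtain q where q: "q \<in> N'" "y = snd c q" by blast
        have qc: "q \<in> fst c" using q N'c by blast
        show "(\<Sum>k\<in>UNIV. a k y *\<^sub>R vec_rep A c (fst \<circ> e k) y) = vec_rep A c (fst \<circ> ?x) y"
          using arg_cong[OF rep[OF q(1)], of fst] q(2)
          by (simp add: gen_rep_section[OF c qc, of ?x] gen_rep_section[OF c qc, of "e _"] fst_sum)
      qed
      moreover have "smooth_on (snd c ` N') (covec_rep A c (snd \<circ> ?x))"
      proof (rule smooth_on_cong[OF O])
        show "smooth_on (snd c ` N') (\<lambda>y. \<Sum>k\<in>UNIV. a k y *\<^sub>R covec_rep A c (snd \<circ> e k) y)"
          by (intro smooth_on_sum smooth_on_bilinear[OF bounded_bilinear_scaleR] O a_smooth smooth_on_subset[OF sm(2) N'V])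
        fix y assume "y \<in> snd c ` N'"
        then obtain q where q: "q \<in> N'" "y = snd c q" by blast
        have qc: "q \<in> fst c" using q N'c by blast
        show "(\<Sum>k\<in>UNIV. a k y *\<^sub>R covec_rep A c (snd \<circ> e k) y) = covec_rep A c (snd \<circ> ?x) y"
          using arg_cong[OF rep[OF q(1)], of snd] q(2)
          by (simp add: gen_rep_section[OF c qc, of ?x] gen_rep_section[OF c qc, of "e _"] snd_sum)
      qed
      ultimately show "smooth_gen A N' ?x"
        unfolding smooth_gen_def
        by (intro conjI smooth_vec_chartI[OF N'(1)] smooth_covec_chartI[OF N'(1)])
          (use N' N'c c in blast)+
    qed
  qed
qed

section \<open>Foliation charts\<close>

context smooth_manifold
begin

text \<open>The required chart is c followed by the coordinate change \<kappa> of the Frobenius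
  theorem, where D becomes the range of P. Smoothness of both \<kappa> and its inverse makes it
  compatible with the atlas.\<close>

lemma foliation_chart:
  assumes c: "c \<in> A" and N: "open N" "p0 \<in> N" "N \<subseteq> fst c" "N \<subseteq> U"
    and P: "bounded_linear P" "\<And>x. P (P x) = P x" and \<alpha>: "smooth_on (snd c ` N) \<alpha>"
    and \<alpha>P: "\<And>y v. y \<in> snd c ` N \<Longrightarrow> P (blinfun_apply (\<alpha> y) v) = 0" "\<And>y v. y \<in> snd c ` N \<Longrightarrow> blinfun_apply (\<alpha> y) (P v) = blinfun_apply (\<alpha> y) v"
    and integrable: "\<And>y e w. y \<in> snd c ` N \<Longrightarrow> P e = e \<Longrightarrow> P w = w \<Longrightarrow>
      blinfun_apply (frechet_derivative \<alpha> (at y) (e + blinfun_apply (\<alpha> y) e)) w = blinfun_apply (frechet_derivative \<alpha> (at y) (w + blinfun_apply (\<alpha> y) w)) e"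
    and D: "\<And>q. q \<in> N \<Longrightarrow> D q = {v. chart_deriv c q v = P (chart_deriv c q v) + blinfun_apply (\<alpha> (snd c q)) (chart_deriv c q v)}"
  shows "\<exists>c' F. compatible_chart A c' \<and> p0 \<in> fst c' \<and> fst c' \<subseteq> U \<and> subspace F \<and> dim F = dim {v. P v = v} \<and>
    (\<forall>q\<in>fst c'. D q = {v. mderiv A (snd c') q v \<in> F})"
proof -
  note c' = compatible_chart_mem[OF c]
  have O: "open (snd c ` N)" "snd c p0 \<in> snd c ` N" using chart_image_open'[OF c' N(1,3)] N(2) by auto
  obtain U1 U2 \<kappa> \<psi> where U1: "open U1" "snd c p0 \<in> U1" "U1 \<subseteq> snd c ` N" and U2: "open U2"
    and \<kappa>: "smooth_on U1 \<kappa>" and \<psi>: "smooth_on U2 \<psi>" and im: "\<kappa> ` U1 = U2" "\<psi> ` U2 = U1"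
    and inv: "\<forall>x\<in>U1. \<psi> (\<kappa> x) = x" "\<forall>z\<in>U2. \<kappa> (\<psi> z) = z"
    and dist: "\<forall>x\<in>U1. \<forall>v. P (frechet_derivative \<kappa> (at x) v) = frechet_derivative \<kappa> (at x) v \<longleftrightarrow> v = P v + blinfun_apply (\<alpha> x) v"
    by (rule frobenius[OF O \<alpha> P \<alpha>P integrable]) blast
  define W where "W = fst c \<inter> snd c -` U1"
  have cont: "continuous_on (fst c) (snd c)" "continuous_on (snd c ` fst c) (chart_inv c)"
    using homeomorphism_cont1 homeomorphism_cont2 chart_homeomorphism[OF c'] by blast+
  have W: "open W" unfolding W_def by (rule continuous_open_preimage[OF cont(1) chart_open[OF c'] U1(1)])
  have WN: "W \<subseteq> N"
  proof
    fix q assume "q \<in> W"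
    then have q: "q \<in> fst c" "snd c q \<in> snd c ` N" using U1(3) by (auto simp: W_def)
    then show "q \<in> N" using chart_inv_chart[OF c'] N(3) by (metis chart_inv_mem[OF c'])
  qed
  have cW: "snd c ` W = U1"
    using U1(3) N(3) unfolding W_def by blast
  define d where "d = (W, \<lambda>q. \<kappa> (snd c q))"
  have fd: "fst d = W" and sd: "snd d q = \<kappa> (snd c q)" for q by (simp_all add: d_def)
  have dW: "snd d ` fst d = U2" using cW im(1) by (auto simp: fd sd image_image[symmetric])
  have inv_d: "chart_inv d z = chart_inv c (\<psi> z)" if z: "z \<in> U2" for z
  proof -
    have "\<psi> z \<in> U1" using z im by blast
    then obtain q where q: "q \<in> W" "\<psi> z = snd c q" using cW by blast
    have inj: "inj_on (snd d) (fst d)"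
    proof (rule inj_onI)
      fix a b assume ab: "a \<in> fst d" "b \<in> fst d" "snd d a = snd d b"
      then have "snd c a \<in> U1" "snd c b \<in> U1" "\<kappa> (snd c a) = \<kappa> (snd c b)" by (auto simp: fd sd W_def)
      then have "snd c a = snd c b" using inv(1) by metis
      then show "a = b" using ab chart_inv_chart[OF c'] by (metis IntD1 W_def fd)
    qed
    have "snd d q = z" using inv(2) z q(2) by (metis sd)
    then have "chart_inv d z = q" unfolding chart_inv_def using inv_into_f_f[OF inj] q(1) fd by blast
    moreover have "chart_inv c (\<psi> z) = q" using q chart_inv_chart[OF c'] by (simp add: W_def)
    ultimately show ?thesis by simp
  qed
  have cont_\<kappa>: "continuous_on W (\<lambda>q. \<kappa> (snd c q))"
    by (rule continuous_on_compose2[OF smooth_on_continuous[OF \<kappa>] continuous_on_subset[OF cont(1)]]) (use cW in \<open>auto simp: W_def\<close>)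
  have "continuous_on U2 (\<lambda>z. chart_inv c (\<psi> z))"
    by (rule continuous_on_compose2[OF cont(2) smooth_on_continuous[OF \<psi>]]) (use im cW in \<open>auto simp: W_def\<close>)
  then have cont_inv: "continuous_on U2 (chart_inv d)"
    by (rule continuous_on_eq) (simp add: inv_d)
  have left: "chart_inv d (snd d q) = q" if "q \<in> W" for q
  proof -
    have "snd c q \<in> U1" using that by (simp add: W_def)
    then show ?thesis using inv_d[of "snd d q"] im inv(1) chart_inv_chart[OF c'] that by (auto simp: sd W_def)
  qed
  have right: "snd d (chart_inv d z) = z" if "z \<in> U2" for z
  proof -
    have "z \<in> snd d ` W" using dW fd that by simp
    then show ?thesis using left by auto
  qed
  have hom: "homeomorphism (fst d) (snd d ` fst d) (snd d) (chart_inv d)"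
    unfolding dW unfolding homeomorphism_def
  proof (intro conjI ballI)
    show "chart_inv d ` U2 = fst d" using left dW by (force simp: fd image_iff)
    show "continuous_on (fst d) (snd d)" using cont_\<kappa> by (simp add: fd sd[abs_def])
  qed (use left right dW cont_inv in \<open>simp_all add: fd\<close>)
  have trans1: "smooth_on (snd d ` (fst d \<inter> fst b)) (snd b \<circ> chart_inv d)" if b: "b \<in> A" for b
  proof -
    let ?V = "snd d ` (fst d \<inter> fst b)"
    have V: "open ?V"
    proof -
      have "?V = U2 \<inter> chart_inv d -` fst b" using left right dW by (auto simp: fd)
      then show ?thesis
        using continuous_open_preimage[OF cont_inv U2 chart_open[OF compatible_chart_mem[OF b]]] by simp
    qed
    have VU: "?V \<subseteq> U2" using dW by blast
    have "smooth_on ?V (\<lambda>z. (snd b \<circ> chart_inv c) (\<psi> z))"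
    proof (rule smooth_on_compose[OF chart_image_open[OF c' chart_open[OF compatible_chart_mem[OF b]]] V transition_to[OF c' b] smooth_on_subset[OF \<psi> VU]])
      show "\<psi> ` ?V \<subseteq> snd c ` (fst c \<inter> fst b)"
        using inv(1) by (auto simp: fd sd W_def)
    qed
    then show ?thesis
      by (rule smooth_on_cong[OF V, rotated]) (use VU inv_d in auto)
  qed
  have trans2: "smooth_on (snd b ` (fst b \<inter> fst d)) (snd d \<circ> chart_inv b)" if b: "b \<in> A" for b
  proof -
    note b' = compatible_chart_mem[OF b]
    let ?V = "snd b ` (fst b \<inter> W)"
    have V: "open ?V" by (rule chart_image_open[OF b' W])
    have "smooth_on ?V (\<lambda>z. \<kappa> ((snd c \<circ> chart_inv b) z))"
    proof (rule smooth_on_compose[OF U1(1) V \<kappa>])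
      show "smooth_on ?V (snd c \<circ> chart_inv b)"
        by (rule smooth_on_subset[OF transition_from[OF c' b]]) (auto simp: W_def)
      show "(snd c \<circ> chart_inv b) ` ?V \<subseteq> U1"
        using chart_inv_chart[OF b'] by (auto simp: W_def)
    qed
    then show ?thesis by (simp add: fd sd[abs_def] o_def)
  qed
  have trans3: "smooth_on (snd d ` (fst d \<inter> fst d)) (snd d \<circ> chart_inv d)"
    by (rule smooth_on_cong[OF _ _ smooth_on_ident]) (use dW U2 right in auto)
  have comp: "compatible_chart A d"
    unfolding compatible_chart_def smooth_atlas_def
  proof (intro conjI ballI)
    have "(\<Union>c\<in>A. fst c) = UNIV" using atlas by (simp add: smooth_atlas_def)
    then show "(\<Union>c\<in>insert d A. fst c) = UNIV" by auto
    fix a assume a: "a \<in> insert d A"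
    have "open (fst a) \<and> open (snd a ` fst a) \<and> homeomorphism (fst a) (snd a ` fst a) (snd a) (chart_inv a)"
    proof (cases "a = d")
      case True
      then show ?thesis using W U2 dW hom by (simp add: fd)
    next
      case False
      then have "compatible_chart A a" using a compatible_chart_mem by blast
      then show ?thesis using chart_open chart_open_image chart_homeomorphism by blast
    qed
    then show "open (fst a)" "open (snd a ` fst a)" "homeomorphism (fst a) (snd a ` fst a) (snd a) (chart_inv a)"
      by blast+
    fix b assume b: "b \<in> insert d A"
    show "smooth_on (snd a ` (fst a \<inter> fst b)) (snd b \<circ> chart_inv a)"
      using a b trans1 trans2 trans3 smooth_atlas_transition[OF atlas] by blast
  qed
  have md: "mderiv A (snd d) q v = frechet_derivative \<kappa> (at (snd c q)) (chart_deriv c q v)" if q: "q \<in> W" for q v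
  proof (rule mderiv_chart[OF c'])
    show qc: "q \<in> fst c" using q by (simp add: W_def)
    have cq: "snd c q \<in> U1" using q by (simp add: W_def)
    have U1c: "U1 \<subseteq> snd c ` fst c" using U1(3) N(3) by blast
    show "((snd d \<circ> chart_inv c) has_derivative frechet_derivative \<kappa> (at (snd c q))) (at (snd c q))"
      by (rule has_derivative_transform_within_open[OF smooth_on_has_derivative[OF \<kappa> cq] U1(1) cq])
        (use chart_chart_inv[OF c' subsetD[OF U1c]] in \<open>simp add: sd\<close>)
  qed
  interpret P: bounded_linear P by fact
  have "D q = {v. mderiv A (snd d) q v \<in> {v. P v = v}}" if q: "q \<in> W" for q
  proof -
    have "snd c q \<in> U1" "q \<in> N" using q WN by (auto simp: W_def)
    then show ?thesis using D[of q] dist md[OF q] by auto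
  qed
  moreover have "subspace {v. P v = v}" by (auto simp: subspace_def P.add P.scaleR P.zero)
  moreover have "p0 \<in> W" using N U1(2) by (auto simp: W_def)
  ultimately show ?thesis
    using comp WN N(4) by (intro exI[of _ d] exI[of _ "{v. P v = v}"]) (auto simp: fd)
qed

end

section \<open>Distributions of corank or rank at most one\<close>

text \<open>P maps the graph of \<alpha> bijectively onto its range, with inverse v \<mapsto> v +
  \<alpha>v.\<close>

lemma (in orth_proj) dim_graph:
  assumes \<alpha>: "linear \<alpha>" "\<And>v. P (\<alpha> v) = 0" "\<And>v. \<alpha> (P v) = \<alpha> v"
  shows "dim {u. u = P u + \<alpha> u} = dim {v. P v = v}"
proof -
  have sub: "subspace {u. u = P u + \<alpha> u}"
    unfolding subspace_def
  proof (intro conjI ballI allI)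
    fix x y and r :: real assume "x \<in> {u. u = P u + \<alpha> u}" "y \<in> {u. u = P u + \<alpha> u}"
    then have xy: "x = P x + \<alpha> x" "y = P y + \<alpha> y" by auto
    have "P (x + y) + \<alpha> (x + y) = (P x + \<alpha> x) + (P y + \<alpha> y)" by (simp add: P.add linear_add[OF \<alpha>(1)])
    then show "x + y \<in> {u. u = P u + \<alpha> u}" using xy by simp
    have "P (r *\<^sub>R x) + \<alpha> (r *\<^sub>R x) = r *\<^sub>R (P x + \<alpha> x)" by (simp add: P.scaleR linear_cmul[OF \<alpha>(1)] scaleR_add_right)
    then show "r *\<^sub>R x \<in> {u. u = P u + \<alpha> u}" using xy by simp
  qed (simp add: P.zero linear_0[OF \<alpha>(1)])
  have "dim (P ` {u. u = P u + \<alpha> u}) = dim {u. u = P u + \<alpha> u}"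
  proof (rule dim_image_eq)
    show "linear P" by (rule bounded_linear.linear[OF linP])
    have "x = y" if "x = P x + \<alpha> x" "y = P y + \<alpha> y" "P x = P y" for x y
      using that \<alpha>(3)[of x] \<alpha>(3)[of y] by simp
    then show "inj_on P (span {u. u = P u + \<alpha> u})"
      unfolding span_eq_iff[THEN iffD2, OF sub] by (auto intro: inj_onI)
  qed
  moreover have "P ` {u. u = P u + \<alpha> u} = {v. P v = v}"
  proof (intro equalityI subsetI)
    fix v assume "v \<in> P ` {u. u = P u + \<alpha> u}"
    then show "v \<in> {v. P v = v}" by (auto simp: idem)
  next
    fix v assume "v \<in> {v. P v = v}"
    then have v: "P v = v" by simp
    have "P (v + \<alpha> v) = v" using v by (simp add: P.add \<alpha>(2))
    moreover have "\<alpha> (v + \<alpha> v) = \<alpha> v" using \<alpha>(3)[of "v + \<alpha> v"] v by (simp add: P.add \<alpha>(2))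
    ultimately show "v \<in> P ` {u. u = P u + \<alpha> u}" by (intro image_eqI[of _ _ "v + \<alpha> v"]) simp_all
  qed
  ultimately show ?thesis by simp
qed

text \<open>S q e is the element of E q with coordinate e, and \<alpha> records the part transversal
  to F of the vector component of S q (P v). Its graph is the candidate for the image or the kernel
  of E q.\<close>

locale adapted_chart = dirac_manifold A E + orth_proj P
  for A :: "('a::topological_space, real ^ 'n) chart set" and E P +
  fixes c :: "('a, real ^ 'n) chart" and N and S :: "'a \<Rightarrow> real ^ 'n \<Rightarrow> (real ^ 'n) gen" and \<alpha> :: "real ^ 'n \<Rightarrow> (real ^ 'n) \<Rightarrow>\<^sub>L (real ^ 'n)"
  assumes c: "c \<in> A" and N: "open N" "N \<subseteq> fst c"
    and inj: "\<And>q x. q \<in> N \<Longrightarrow> x \<in> E q \<Longrightarrow> proj_map P (gen_rep c q x) = 0 \<Longrightarrow> x = 0"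
    and S_mem: "\<And>q e. q \<in> N \<Longrightarrow> S q e \<in> E q"
    and proj_S: "\<And>q e. q \<in> N \<Longrightarrow> proj_map P (gen_rep c q (S q e)) = e"
    and S_smooth: "\<And>N' t. open N' \<Longrightarrow> N' \<subseteq> N \<Longrightarrow> smooth_on (snd c ` N') t \<Longrightarrow> smooth_gen A N' (\<lambda>q. S q (t (snd c q)))"
    and \<alpha>_def: "\<And>q v. q \<in> N \<Longrightarrow> blinfun_apply (\<alpha> (snd c q)) v = chart_deriv c q (fst (S q (P v))) - P v"
    and \<alpha>_smooth: "smooth_on (snd c ` N) \<alpha>"
begin

lemma cc: "compatible_chart A c" by (rule compatible_chart_mem[OF c])

lemma N_fst: "q \<in> N \<Longrightarrow> q \<in> fst c" using N by blast

lemma S_unique: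
  assumes q: "q \<in> N" and x: "x \<in> E q" shows "x = S q (proj_map P (gen_rep c q x))"
proof -
  let ?y = "S q (proj_map P (gen_rep c q x))"
  have "proj_map P (gen_rep c q (x - ?y)) = 0"
    using linear_diff[OF linear_gen_rep[OF c N_fst[OF q]], of x ?y]
      linear_diff[OF bounded_linear.linear[OF bounded_linear_proj_map[OF linP]], of "gen_rep c q x" "gen_rep c q ?y"] proj_S[OF q] by simp
  then have "x - ?y = 0" using inj[OF q lagrangian_diff[OF lagrangian_fiber x S_mem[OF q]]] by simp
  then show ?thesis by simp
qed

lemma S_add: assumes q: "q \<in> N" shows "S q (e + w) = S q e + S q w"
proof -
  have "S q e + S q w \<in> E q" using subspace_add[OF lagrangian_subspace[OF lagrangian_fiber]] S_mem[OF q] by blast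
  from S_unique[OF q this] show ?thesis
    by (simp add: linear_add[OF linear_gen_rep[OF c N_fst[OF q]]] linear_add[OF bounded_linear.linear[OF bounded_linear_proj_map[OF linP]]] proj_S[OF q])
qed

lemma S_smooth_const: "smooth_gen A N (\<lambda>q. S q e)"
  using S_smooth[OF N(1) order_refl smooth_on_const[of _ e]] .

lemma chart_deriv_S: "q \<in> N \<Longrightarrow> chart_deriv c q (fst (S q (P v))) = P v + blinfun_apply (\<alpha> (snd c q)) v"
  by (simp add: \<alpha>_def)

lemma P_\<alpha>: "y \<in> snd c ` N \<Longrightarrow> P (blinfun_apply (\<alpha> y) v) = 0"
proof -
  assume "y \<in> snd c ` N"
  then obtain q where q: "q \<in> N" "y = snd c q" by blast
  have "P (chart_deriv c q (fst (S q (P v)))) = P (P v)"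
    using P_proj_map[of "gen_rep c q (S q (P v))"] proj_S[OF q(1)] fst_gen_rep[OF c N_fst[OF q(1)], of "S q (P v)"] by simp
  then show ?thesis by (simp add: q(2) \<alpha>_def[OF q(1)] P.diff)
qed

lemma \<alpha>_P: "y \<in> snd c ` N \<Longrightarrow> blinfun_apply (\<alpha> y) (P v) = blinfun_apply (\<alpha> y) v"
  using \<alpha>_def by (auto simp: idem)

lemma rep_lagrangian: "q \<in> N \<Longrightarrow> lagrangian (gen_rep c q ` E q)"
  by (rule lagrangian_gen_rep[OF c N_fst lagrangian_fiber])

lemma rep_inj: "q \<in> N \<Longrightarrow> x \<in> gen_rep c q ` E q \<Longrightarrow> proj_map P x = 0 \<Longrightarrow> x = 0"
  using inj linear_0[OF linear_gen_rep[OF c N_fst]] by blast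

definition graph :: "'a \<Rightarrow> (real ^ 'n) set" where
  "graph q = {v. chart_deriv c q v = P (chart_deriv c q v) + blinfun_apply (\<alpha> (snd c q)) (chart_deriv c q v)}"

lemma dim_graph_fiber: assumes q: "q \<in> N" shows "dim (graph q) = dim {v. P v = v}"
proof -
  let ?G = "{u. u = P u + blinfun_apply (\<alpha> (snd c q)) u}"
  have "chart_deriv c q ` graph q = ?G"
  proof (intro equalityI subsetI)
    fix u assume "u \<in> ?G"
    then show "u \<in> chart_deriv c q ` graph q"
      using chart_deriv_coderiv[OF cc N_fst[OF q]] by (intro image_eqI[of _ _ "chart_coderiv c q u"]) (auto simp: graph_def)
  qed (auto simp: graph_def)
  moreover have "dim ?G = dim {v. P v = v}"
    using P_\<alpha> \<alpha>_P q by (intro dim_graph) (auto intro: bounded_linear.linear blinfun.bounded_linear_right)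
  ultimately show ?thesis using dim_chart_deriv_image[OF c N_fst[OF q], of "graph q"] by simp
qed

lemma graph_iff:
  assumes q: "q \<in> N" shows "v \<in> graph q \<longleftrightarrow> v = fst (S q (P (chart_deriv c q v)))"
  unfolding graph_def mem_Collect_eq chart_deriv_S[OF q, symmetric] chart_deriv_inj[OF c N_fst[OF q]] ..

lemma smooth_P_vec:
  assumes N': "N' \<subseteq> N" "open N'" and V: "smooth_vec A N' V" shows "smooth_on (snd c ` N') (\<lambda>y. P (vec_rep A c V y))"
proof -
  have "fst c \<inter> N' = N'" using N N' by blast
  then have "smooth_on (snd c ` N') (vec_rep A c V)" using smooth_vec_chart[OF V c] by simp
  then show ?thesis using chart_image_open'[OF cc N'(2)] N N' by (intro smooth_on_bounded_linear[OF linP]) auto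
qed

lemma section_through:
  assumes q: "q \<in> N" and V: "V \<in> graph q"
  shows "S q (P (chart_deriv c q V)) = (V, snd (S q (P (chart_deriv c q V))))"
  using graph_iff[OF q, of V] V by (metis prod.collapse)

end

section \<open>The image of E where its corank is at most one\<close>

locale image_chart = adapted_chart +
  assumes corank: "\<And>a b. P a = 0 \<Longrightarrow> P b = 0 \<Longrightarrow> a \<bullet> b = 0 \<Longrightarrow> a = 0 \<or> b = 0"
begin

lemma fst_S_eq_0: assumes q: "q \<in> N" and w: "P w = 0" shows "fst (S q w) = 0"
proof -
  have "fst (gen_rep c q (S q w)) = 0"
    by (rule fst_eq_0_if_corank_le_1[OF corank rep_lagrangian[OF q] rep_inj[OF q]])
      (use S_mem[OF q] proj_S[OF q] w in auto)
  then have "chart_deriv c q (fst (S q w)) = chart_deriv c q 0"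
    using fst_gen_rep[OF c N_fst[OF q]] linear_0[OF chart_deriv_linear[OF c N_fst[OF q]]] by simp
  then show ?thesis using chart_deriv_inj[OF c N_fst[OF q]] by simp
qed

text \<open>The coordinate of an element of E q splits into its part along F and the rest. By
  isotropy the rest contributes no vector component, so the vector component is that of the
  graph.\<close>

lemma image_eq_graph: assumes q: "q \<in> N" shows "fst ` E q = graph q"
proof (intro equalityI subsetI)
  fix v assume "v \<in> graph q"
  then show "v \<in> fst ` E q" using graph_iff[OF q] S_mem[OF q] by (metis image_eqI)
next
  fix v assume "v \<in> fst ` E q"
  then obtain x where x: "x \<in> E q" "v = fst x" by blast
  let ?e = "proj_map P (gen_rep c q x)"
  have Pe: "P ?e = P (chart_deriv c q v)" by (simp add: P_proj_map fst_gen_rep[OF c N_fst[OF q]] x(2))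
  have "x = S q (P ?e) + S q (?e - P ?e)" using S_unique[OF q x(1)] S_add[OF q, of "P ?e" "?e - P ?e"] by simp
  moreover have "fst (S q (?e - P ?e)) = 0" by (rule fst_S_eq_0[OF q]) (simp add: P.diff idem)
  ultimately have "v = fst (S q (P ?e))" using x(2) by (metis add.right_neutral fst_add)
  then show "v \<in> graph q" by (simp add: graph_iff[OF q] Pe)
qed

text \<open>The element of E q with coordinate P V has vector component V, and its covector depends
  smoothly on the point. This makes involutivity of E available for fields in the image.\<close>

lemma image_lift:
  assumes N': "open N'" "N' \<subseteq> N" and V: "smooth_vec A N' V" "\<And>q. q \<in> N' \<Longrightarrow> V q \<in> fst ` E q"
  shows "\<exists>\<xi>. smooth_covec A N' \<xi> \<and> (\<forall>q\<in>N'. (V q, \<xi> q) \<in> E q)"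
proof -
  let ?x = "\<lambda>q. S q (P (vec_rep A c V (snd c q)))"
  have "smooth_gen A N' ?x" using S_smooth[OF N' smooth_P_vec[OF N'(2,1) V(1)]] .
  moreover have "(V q, snd (?x q)) \<in> E q" if q: "q \<in> N'" for q
  proof -
    have qN: "q \<in> N" using q N' by blast
    have "V q \<in> graph q" using V(2)[OF q] image_eq_graph[OF qN] by simp
    then show ?thesis
      using section_through[OF qN] S_mem[OF qN] vec_rep_chart[OF cc N_fst[OF qN]] by metis
  qed
  ultimately show ?thesis by (intro exI[of _ "snd \<circ> ?x"]) (simp add: smooth_gen_def)
qed

text \<open>By involutivity the bracket of two graph fields lies in the image, hence in the graph.
  Its P-part is 0, since the P-parts of the fields are constant, and a vector of the graph with zero
  P-part is 0. So the fields commute.\<close>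

lemma image_integrable:
  assumes y: "y \<in> snd c ` N" and e: "P e = e" and w: "P w = w"
  shows "blinfun_apply (frechet_derivative \<alpha> (at y) (e + blinfun_apply (\<alpha> y) e)) w = blinfun_apply (frechet_derivative \<alpha> (at y) (w + blinfun_apply (\<alpha> y) w)) e"
proof -
  obtain q where q: "q \<in> N" "y = snd c q" using y by blast
  have O: "open (snd c ` N)" by (rule chart_image_open'[OF cc N])
  define X where "X = (\<lambda>e q. fst (S q e))"
  have sX: "smooth_vec A N (X e)" "smooth_covec A N (\<lambda>q. snd (S q e))" for e
    using S_smooth_const[of e] by (simp_all add: smooth_gen_def X_def o_def)
  have rep: "vec_rep A c (X e) z = e + blinfun_apply (\<alpha> z) e" if z: "z \<in> snd c ` N" and e: "P e = e" for z e
  proof -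
    obtain r where r: "r \<in> N" "z = snd c r" using z by blast
    then show ?thesis using chart_deriv_S[OF r(1), of e] vec_rep_chart[OF cc N_fst[OF r(1)]] e by (simp add: X_def)
  qed
  have D\<alpha>: "(\<alpha> has_derivative frechet_derivative \<alpha> (at y)) (at y)" by (rule smooth_on_has_derivative[OF \<alpha>_smooth y])
  have D: "frechet_derivative (vec_rep A c (X e)) (at y) = (\<lambda>v. blinfun_apply (frechet_derivative \<alpha> (at y) v) e)" if e: "P e = e" for e
  proof -
    have "((\<lambda>z. e + blinfun_apply (\<alpha> z) e) has_derivative (\<lambda>v. 0 + blinfun_apply (frechet_derivative \<alpha> (at y) v) e)) (at y)"
      by (intro has_derivative_add has_derivative_const bounded_linear.has_derivative[OF blinfun.bounded_linear_left D\<alpha>])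
    then have "(vec_rep A c (X e) has_derivative (\<lambda>v. 0 + blinfun_apply (frechet_derivative \<alpha> (at y) v) e)) (at y)"
      by (rule has_derivative_transform_within_open[OF _ O y]) (simp add: rep e)
    from frechet_derivative_at[OF this] show ?thesis by simp
  qed
  have PD: "P (blinfun_apply (frechet_derivative \<alpha> (at y) v) e) = 0" for v e
  proof -
    have 1: "((\<lambda>z. P (blinfun_apply (\<alpha> z) e)) has_derivative (\<lambda>v. P (blinfun_apply (frechet_derivative \<alpha> (at y) v) e))) (at y)"
      by (intro P.has_derivative bounded_linear.has_derivative[OF blinfun.bounded_linear_left D\<alpha>])
    have 2: "((\<lambda>z. P (blinfun_apply (\<alpha> z) e)) has_derivative (\<lambda>v. 0)) (at y)"
      by (rule has_derivative_transform_within_open[OF has_derivative_const O y]) (simp add: P_\<alpha>)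
    show ?thesis using fun_cong[OF has_derivative_unique[OF 1 2]] .
  qed
  let ?l = "lie_bracket A (X e) (X w) q"
  have "?l \<in> fst ` E q"
    using dirac_lie_bracket_mem[OF N(1) q(1) sX[of e] _ sX[of w]] S_mem by (simp add: X_def)
  then have "?l \<in> graph q" by (simp add: image_eq_graph[OF q(1)])
  then have g: "chart_deriv c q ?l = P (chart_deriv c q ?l) + blinfun_apply (\<alpha> y) (chart_deriv c q ?l)"
    by (simp add: graph_def q(2))
  have l: "chart_deriv c q ?l = blinfun_apply (frechet_derivative \<alpha> (at y) (e + blinfun_apply (\<alpha> y) e)) w - blinfun_apply (frechet_derivative \<alpha> (at y) (w + blinfun_apply (\<alpha> y) w)) e"
    using lie_bracket_chart[OF N(1) sX(1) sX(1) c N_fst[OF q(1)] q(1), of e w] D[OF e] D[OF w] rep[OF y e] rep[OF y w] q(2) by simp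
  have "P (chart_deriv c q ?l) = 0" unfolding l by (simp add: P.diff PD)
  then have "chart_deriv c q ?l = 0" using g \<alpha>_P[OF y, of "chart_deriv c q ?l"] by (metis add.left_neutral blinfun.zero_right)
  then show ?thesis using l by simp
qed

end

section \<open>The kernel of E where its rank is at most one\<close>

locale kernel_chart = adapted_chart +
  assumes rank: "\<And>a b. P a = a \<Longrightarrow> P b = b \<Longrightarrow> a \<bullet> b = 0 \<Longrightarrow> a = 0 \<or> b = 0"
begin

lemma snd_S_eq_0: assumes q: "q \<in> N" and w: "P w = w" shows "snd (S q w) = 0"
proof -
  have 0: "snd (gen_rep c q (S q w)) = 0"
    by (rule snd_eq_0_if_rank_le_1[OF rank rep_lagrangian[OF q] rep_inj[OF q]])
      (use S_mem[OF q] proj_S[OF q] w in auto)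
  have "blinfun_apply (snd (S q w)) v = 0" for v
    using snd_gen_rep[OF c N_fst[OF q], of "S q w" "chart_deriv c q v"] 0 chart_coderiv_deriv[OF cc N_fst[OF q]] by simp
  then show ?thesis by (auto intro: blinfun_eqI)
qed

text \<open>Elements of E q with coordinate in F have zero covector. Conversely, the coordinate of a
  kernel vector has no part transversal to F.\<close>

lemma kernel_eq_graph: assumes q: "q \<in> N" shows "lag_kernel (E q) = graph q"
proof (intro equalityI subsetI)
  fix v assume v: "v \<in> graph q"
  have "S q (P (chart_deriv c q v)) = (v, 0)"
    using section_through[OF q v] snd_S_eq_0[OF q idem] by simp
  then show "v \<in> lag_kernel (E q)" using S_mem[OF q] by (metis mem_Collect_eq)
next
  fix v assume "v \<in> lag_kernel (E q)"
  then have v: "(v, 0) \<in> E q" by simp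
  have "proj_map P (gen_rep c q (v, 0)) = P (chart_deriv c q v)"
    by (simp add: gen_rep_vec[OF c N_fst[OF q]] proj_map_def riesz_eq_0_iff[THEN iffD2] P.zero)
  then have "v = fst (S q (P (chart_deriv c q v)))" using S_unique[OF q v] by (metis fst_conv)
  then show "v \<in> graph q" by (simp add: graph_iff[OF q])
qed

lemma kernel_section:
  assumes q: "q \<in> N" and v: "v \<in> lag_kernel (E q)"
  shows "\<exists>Z. smooth_vec A N Z \<and> (\<forall>q\<in>N. (Z q, 0) \<in> E q) \<and> Z q = v"
proof -
  let ?x = "\<lambda>r. S r (P (chart_deriv c q v))"
  have "(fst (?x r), 0) \<in> E r" if "r \<in> N" for r
    using S_mem[OF that] snd_S_eq_0[OF that idem] by (metis prod.collapse)
  moreover have "smooth_vec A N (fst \<circ> ?x)" using S_smooth_const by (simp add: smooth_gen_def)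
  moreover have "fst (?x q) = v" using v kernel_eq_graph[OF q] graph_iff[OF q] by simp
  ultimately show ?thesis by (intro exI[of _ "fst \<circ> ?x"]) simp
qed

text \<open>The coordinate t is the part of \<eta> orthogonal to F. An element of E q with covector
  \<eta> has this coordinate plus one in F, and the latter changes only the vector, so S q applied
  to t already has covector \<eta>.\<close>

lemma kernel_lift:
  assumes N': "open N'" "N' \<subseteq> N" and \<eta>: "smooth_covec A N' \<eta>" "\<And>q. q \<in> N' \<Longrightarrow> \<eta> q \<in> snd ` E q"
  shows "\<exists>X. smooth_vec A N' X \<and> (\<forall>q\<in>N'. (X q, \<eta> q) \<in> E q)"
proof -
  define t where "t = (\<lambda>y. riesz (covec_rep A c \<eta> y) - P (riesz (covec_rep A c \<eta> y)))"
  have O: "open (snd c ` N')" using chart_image_open'[OF cc N'(1)] N N' by blast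
  have "fst c \<inter> N' = N'" using N N' by blast
  then have "smooth_on (snd c ` N') (covec_rep A c \<eta>)" using smooth_covec_chart[OF \<eta>(1) c] by simp
  then have t: "smooth_on (snd c ` N') t"
    unfolding t_def by (intro smooth_on_diff O smooth_on_bounded_linear[OF linP O] smooth_on_bounded_linear[OF bounded_linear_riesz O])
  let ?x = "\<lambda>q. S q (t (snd c q))"
  have "smooth_gen A N' ?x" by (rule S_smooth[OF N' t])
  moreover have "(fst (?x q), \<eta> q) \<in> E q" if q: "q \<in> N'" for q
  proof -
    have qN: "q \<in> N" using q N' by blast
    obtain v where v: "(v, \<eta> q) \<in> E q" using \<eta>(2)[OF q] by force
    have "snd (gen_rep c q (v, \<eta> q)) = covec_rep A c \<eta> (snd c q)"
      using gen_rep_section[OF c N_fst[OF qN], of "\<lambda>r. (v, \<eta> r)"] by (simp add: o_def)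
    then have "proj_map P (gen_rep c q (v, \<eta> q)) = P (chart_deriv c q v) + t (snd c q)"
      by (simp add: proj_map_def t_def fst_gen_rep[OF c N_fst[OF qN]])
    then have "(v, \<eta> q) = S q (P (chart_deriv c q v)) + ?x q" using S_unique[OF qN v] S_add[OF qN] by simp
    then have "\<eta> q = snd (?x q)" using snd_S_eq_0[OF qN idem] by (metis add.left_neutral snd_add snd_conv)
    then show ?thesis using S_mem[OF qN] by simp
  qed
  ultimately show ?thesis by (intro exI[of _ "fst \<circ> ?x"]) (simp add: smooth_gen_def)
qed

text \<open>The bracket condition is automatic here: e and w lie on one line, and the two sides
  agree when w is a multiple of e.\<close>

lemma kernel_integrable:
  assumes y: "y \<in> snd c ` N" and e: "P e = e" and w: "P w = w"
  shows "blinfun_apply (frechet_derivative \<alpha> (at y) (e + blinfun_apply (\<alpha> y) e)) w = blinfun_apply (frechet_derivative \<alpha> (at y) (w + blinfun_apply (\<alpha> y) w)) e"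
proof (cases "e = 0")
  case True
  have "linear (frechet_derivative \<alpha> (at y))"
    using has_derivative_linear[OF smooth_on_has_derivative[OF \<alpha>_smooth y]] .
  then show ?thesis using True by (simp add: blinfun.zero_right linear_0)
next
  case False
  interpret D: linear "frechet_derivative \<alpha> (at y)"
    using has_derivative_linear[OF smooth_on_has_derivative[OF \<alpha>_smooth y]] .
  \<comment> \<open>With this k the vector w - k e is orthogonal to e, hence 0 by the rank
    condition.\<close>
  define k where "k = (w \<bullet> e) / (e \<bullet> e)"
  have "P (w - k *\<^sub>R e) = w - k *\<^sub>R e" by (simp add: P.diff P.scaleR e w)
  moreover have "e \<bullet> (w - k *\<^sub>R e) = 0" using False by (simp add: k_def inner_diff_right inner_commute)
  ultimately have "w - k *\<^sub>R e = 0" using rank[OF e] False by blast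
  then have w: "w = k *\<^sub>R e" by simp
  show ?thesis
    unfolding w by (simp add: blinfun.scaleR_right blinfun.scaleR_left D.scaleR flip: scaleR_add_right)
qed

end

context smooth_manifold
begin

lemma gen_rep_0: "c \<in> A \<Longrightarrow> p \<in> fst c \<Longrightarrow> gen_rep c p 0 = 0"
  by (rule linear_0[OF linear_gen_rep])

end

lemma adapted_chart_exists:
  fixes A :: "('a::topological_space, real ^ 'n) chart set"
  assumes dm: "dirac_manifold A E" and P: "orth_proj P" and c: "c \<in> A" and p0: "p0 \<in> fst c"
    and inj: "\<And>x. x \<in> E p0 \<Longrightarrow> proj_map P (smooth_manifold.gen_rep A c p0 x) = 0 \<Longrightarrow> x = 0"
  shows "\<exists>N S \<alpha>. p0 \<in> N \<and> adapted_chart A E P c N S \<alpha>"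
proof -
  interpret dirac_manifold A E by fact
  interpret orth_proj P by fact
  note c' = compatible_chart_mem[OF c]
  have T: "bounded_linear (proj_map P)" by (rule bounded_linear_proj_map[OF linP])
  have sub: "lagrangian_subbundle A E" using dirac by (simp add: dirac_structure_def)
  obtain N S where N: "open N" "p0 \<in> N" "N \<subseteq> fst c"
    and i: "\<forall>q\<in>N. \<forall>x\<in>E q. proj_map P (gen_rep c q x) = 0 \<longrightarrow> x = 0"
    and S: "\<forall>q\<in>N. \<forall>e. S q e \<in> E q \<and> proj_map P (gen_rep c q (S q e)) = e"
    and sm: "\<forall>N' t. open N' \<longrightarrow> N' \<subseteq> N \<longrightarrow> smooth_on (snd c ` N') t \<longrightarrow> smooth_gen A N' (\<lambda>q. S q (t (snd c q)))"
    by (rule adapted_sections[OF smooth_manifold_axioms sub c p0 T inj]) blast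
  have O: "open (snd c ` N)" by (rule chart_image_open'[OF c' N(1,3)])
  \<comment> \<open>S q inverts an injective linear map on the subspace E q, so it is linear; this
    is what makes the values of \<alpha> linear maps.\<close>
  have lin_S: "linear (S q)" if q: "q \<in> N" for q
  proof -
    have qc: "q \<in> fst c" using q N by blast
    have lin: "linear (\<lambda>x. proj_map P (gen_rep c q x))"
      using linear_compose[OF linear_gen_rep[OF c qc] bounded_linear.linear[OF T]] by (simp add: o_def)
    have u: "x = S q e" if "x \<in> E q" "proj_map P (gen_rep c q x) = e" for x e
    proof -
      have "S q e \<in> E q" "proj_map P (gen_rep c q (S q e)) = e" using S q by blast+
      then have "proj_map P (gen_rep c q (x - S q e)) = 0" using linear_diff[OF lin, of x "S q e"] that by simp
      moreover have "x - S q e \<in> E q" using lagrangian_diff[OF lagrangian_fiber that(1)] S q by blast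
      ultimately have "x - S q e = 0" using i q by blast
      then show ?thesis by simp
    qed
    note sub = lagrangian_subspace[OF lagrangian_fiber[of q]]
    show ?thesis
    proof (rule linearI)
      fix e w
      have "S q e + S q w \<in> E q" using subspace_add[OF sub] S q by blast
      moreover have "proj_map P (gen_rep c q (S q e + S q w)) = e + w" using linear_add[OF lin] S q by metis
      ultimately show "S q (e + w) = S q e + S q w" by (rule u[symmetric])
    next
      fix k e
      have "k *\<^sub>R S q e \<in> E q" using subspace_scale[OF sub] S q by blast
      moreover have "proj_map P (gen_rep c q (k *\<^sub>R S q e)) = k *\<^sub>R e" using linear_cmul[OF lin] S q by metis
      ultimately show "S q (k *\<^sub>R e) = k *\<^sub>R S q e" by (rule u[symmetric])
    qed
  qed
  define \<alpha> where "\<alpha> = (\<lambda>y. Blinfun (\<lambda>v. chart_deriv c (chart_inv c y) (fst (S (chart_inv c y) (P v))) - P v))"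
  have \<alpha>: "blinfun_apply (\<alpha> (snd c q)) v = chart_deriv c q (fst (S q (P v))) - P v" if q: "q \<in> N" for q v
  proof -
    have qc: "q \<in> fst c" using q N by blast
    have "linear (\<lambda>v. chart_deriv c q (fst (S q (P v))) - P v)"
      using lin_S[OF q] by (intro linearI)
        (simp_all add: P.add P.scaleR linear_add linear_cmul linear_add[OF chart_deriv_linear[OF c qc]] linear_cmul[OF chart_deriv_linear[OF c qc]] scaleR_diff_right)
    then show ?thesis
      unfolding \<alpha>_def chart_inv_chart[OF c' qc] by (simp add: bounded_linear_Blinfun_apply linear_conv_bounded_linear)
  qed
  have "smooth_on (snd c ` N) \<alpha>"
  proof (rule smooth_on_blinfun[OF O])
    fix b :: "real ^ 'n"
    let ?X = "\<lambda>q. fst (S q (P b))"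
    have "smooth_gen A N (\<lambda>q. S q (P b))" using sm N(1) smooth_on_const[of "snd c ` N" "P b"] by blast
    then have "smooth_vec A N ?X" by (simp add: smooth_gen_def o_def)
    moreover have "fst c \<inter> N = N" using N by blast
    ultimately have "smooth_on (snd c ` N) (vec_rep A c ?X)" using smooth_vec_chart[OF _ c, of N ?X] by simp
    then have "smooth_on (snd c ` N) (\<lambda>y. vec_rep A c ?X y - P b)" by (intro smooth_on_diff O smooth_on_const)
    then show "smooth_on (snd c ` N) (\<lambda>y. blinfun_apply (\<alpha> y) b)"
    proof (rule smooth_on_cong[OF O, rotated])
      fix y assume "y \<in> snd c ` N"
      then obtain q where q: "q \<in> N" "y = snd c q" by blast
      have "q \<in> fst c" using q N by blast
      then show "vec_rep A c ?X y - P b = blinfun_apply (\<alpha> y) b" using \<alpha>[OF q(1)] q(2) vec_rep_chart[OF c'] by simp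
    qed
  qed
  note s = this
  have i': "x = 0" if "q \<in> N" "x \<in> E q" "proj_map P (gen_rep c q x) = 0" for q x using i that by blast
  have S': "S q e \<in> E q" "proj_map P (gen_rep c q (S q e)) = e" if "q \<in> N" for q e using S that by blast+
  have sm': "smooth_gen A N' (\<lambda>q. S q (t (snd c q)))" if "open N'" "N' \<subseteq> N" "smooth_on (snd c ` N') t" for N' t
    using sm that by blast
  have "adapted_chart A E P c N S \<alpha>"
    by (intro adapted_chart.intro adapted_chart_axioms.intro) (fact dm P c N i' S' sm' \<alpha> s)+
  then show ?thesis using N(2) by blast
qed

lemma image_chart_exists:
  fixes A :: "('a::topological_space, real ^ 'n) chart set"
  assumes dm: "dirac_manifold A E" and d: "CARD('n) \<le> dim (fst ` E p) + 1"
  shows "\<exists>P c N S \<alpha>. p \<in> N \<and> image_chart A E P c N S \<alpha> \<and> dim {v. P v = v} = dim (fst ` E p)"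
proof -
  interpret dirac_manifold A E by fact
  let ?c = "chart_at A p"
  have c: "?c \<in> A" "p \<in> fst ?c" by (rule chart_at)+
  let ?L = "gen_rep ?c p ` E p"
  have L: "lagrangian ?L" by (rule lagrangian_gen_rep[OF c lagrangian_fiber])
  obtain P where P: "bounded_linear P" "\<And>x. P x \<in> fst ` ?L" "\<And>x. x \<in> fst ` ?L \<Longrightarrow> P x = x" "\<And>x. P (P x) = P x" "\<And>x y. P x \<bullet> y = x \<bullet> P y"
    using orthogonal_projection_exists[OF subspace_lag_image[OF L]] by blast
  interpret orth_proj P by (rule orth_proj.intro) (fact P(1) P(4) P(5))+
  have F: "fst ` ?L = {v. P v = v}"
  proof (intro equalityI subsetI)
    fix v assume "v \<in> fst ` ?L"
    then have "P v = v" by (rule P(3))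
    then show "v \<in> {v. P v = v}" by simp
  next
    fix v assume "v \<in> {v. P v = v}"
    then have "P v = v" by simp
    then show "v \<in> fst ` ?L" using P(2)[of v] by (simp only:)
  qed
  have dF: "dim {v. P v = v} = dim (fst ` E p)"
    using dim_chart_deriv_image[OF c, of "fst ` E p"] fst_gen_rep_image[OF c, of "E p"] F by simp
  have "x = 0" if "x \<in> E p" "proj_map P (gen_rep ?c p x) = 0" for x
    using proj_map_inj_image[OF L F imageI[OF that(1)] that(2)] gen_rep_0[OF c] gen_rep_inj[OF c] by metis
  from adapted_chart_exists[OF dm orth_proj_axioms c this]
  obtain N S \<alpha> where pN: "p \<in> N" and "adapted_chart A E P ?c N S \<alpha>" by blast
  interpret adapted_chart A E P ?c N S \<alpha> by fact
  have ch: "image_chart A E P ?c N S \<alpha>"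
    by unfold_locales (rule corank_le_1, use d dF in simp_all)
  show ?thesis by (rule exI[of _ P], rule exI[of _ ?c], rule exI[of _ N], rule exI[of _ S], rule exI[of _ \<alpha>])
      (intro conjI pN ch dF)
qed

lemma kernel_chart_exists:
  fixes A :: "('a::topological_space, real ^ 'n) chart set"
  assumes dm: "dirac_manifold A E" and d: "dim (lag_kernel (E p)) \<le> 1"
  shows "\<exists>P c N S \<alpha>. p \<in> N \<and> kernel_chart A E P c N S \<alpha> \<and> dim {v. P v = v} = dim (lag_kernel (E p))"
proof -
  interpret dirac_manifold A E by fact
  let ?c = "chart_at A p"
  have c: "?c \<in> A" "p \<in> fst ?c" by (rule chart_at)+
  let ?L = "gen_rep ?c p ` E p"
  have L: "lagrangian ?L" by (rule lagrangian_gen_rep[OF c lagrangian_fiber])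
  obtain P where P: "bounded_linear P" "\<And>x. P x \<in> lag_kernel ?L" "\<And>x. x \<in> lag_kernel ?L \<Longrightarrow> P x = x" "\<And>x. P (P x) = P x" "\<And>x y. P x \<bullet> y = x \<bullet> P y"
    using orthogonal_projection_exists[OF subspace_lag_kernel[OF L]] by blast
  interpret orth_proj P by (rule orth_proj.intro) (fact P(1) P(4) P(5))+
  have F: "lag_kernel ?L = {v. P v = v}"
  proof (intro equalityI subsetI)
    fix v assume "v \<in> lag_kernel ?L"
    then have "P v = v" by (rule P(3))
    then show "v \<in> {v. P v = v}" by simp
  next
    fix v assume "v \<in> {v. P v = v}"
    then have "P v = v" by simp
    then show "v \<in> lag_kernel ?L" using P(2)[of v] by (simp only:)
  qed
  have dF: "dim {v. P v = v} = dim (lag_kernel (E p))"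
    using dim_chart_deriv_image[OF c, of "lag_kernel (E p)"] lag_kernel_gen_rep[OF c, of "E p"] F by simp
  have "x = 0" if "x \<in> E p" "proj_map P (gen_rep ?c p x) = 0" for x
    using proj_map_inj_kernel[OF L F imageI[OF that(1)] that(2)] gen_rep_0[OF c] gen_rep_inj[OF c] by metis
  from adapted_chart_exists[OF dm orth_proj_axioms c this]
  obtain N S \<alpha> where pN: "p \<in> N" and "adapted_chart A E P ?c N S \<alpha>" by blast
  interpret adapted_chart A E P ?c N S \<alpha> by fact
  have ch: "kernel_chart A E P ?c N S \<alpha>"
    by unfold_locales (rule rank_le_1, use d dF in simp_all)
  show ?thesis by (rule exI[of _ P], rule exI[of _ ?c], rule exI[of _ N], rule exI[of _ S], rule exI[of _ \<alpha>])
      (intro conjI pN ch dF)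
qed

section \<open>Foliated presymplectic and foliated Poisson structures\<close>

locale dirac_manifold_vec = dirac_manifold A E
  for A :: "('a::topological_space, real ^ 'n) chart set" and E
begin

lemma image_lift_local:
  assumes d: "CARD('n) \<le> dim (fst ` E p) + 1"
  shows "\<exists>N. open N \<and> p \<in> N \<and> (\<forall>N' V. open N' \<longrightarrow> N' \<subseteq> N \<longrightarrow> smooth_vec A N' V \<longrightarrow> (\<forall>q\<in>N'. V q \<in> fst ` E q) \<longrightarrow>
    (\<exists>\<xi>. smooth_covec A N' \<xi> \<and> (\<forall>q\<in>N'. (V q, \<xi> q) \<in> E q)))"
proof -
  obtain P c N S \<alpha> where N: "p \<in> N" "image_chart A E P c N S \<alpha>"
    using image_chart_exists[OF dirac_manifold_axioms d] by blast
  interpret ch: image_chart A E P c N S \<alpha> by (rule N(2))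
  show ?thesis
    by (intro exI[of _ N] conjI allI impI ch.N(1) N(1), rule ch.image_lift) (assumption | simp)+
qed

lemma kernel_lift_local:
  assumes d: "dim (lag_kernel (E p)) \<le> 1"
  shows "\<exists>N. open N \<and> p \<in> N \<and> (\<forall>N' \<eta>. open N' \<longrightarrow> N' \<subseteq> N \<longrightarrow> smooth_covec A N' \<eta> \<longrightarrow> (\<forall>q\<in>N'. \<eta> q \<in> snd ` E q) \<longrightarrow>
    (\<exists>X. smooth_vec A N' X \<and> (\<forall>q\<in>N'. (X q, \<eta> q) \<in> E q)))"
proof -
  obtain P c N S \<alpha> where N: "p \<in> N" "kernel_chart A E P c N S \<alpha>"
    using kernel_chart_exists[OF dirac_manifold_axioms d] by blast
  interpret ch: kernel_chart A E P c N S \<alpha> by (rule N(2))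
  show ?thesis
    by (intro exI[of _ N] conjI allI impI ch.N(1) N(1), rule ch.kernel_lift) (assumption | simp)+
qed

lemma kernel_section_local:
  assumes d: "dim (lag_kernel (E p)) \<le> 1" and v: "v \<in> lag_kernel (E p)"
  shows "\<exists>N Z. open N \<and> p \<in> N \<and> smooth_vec A N Z \<and> (\<forall>q\<in>N. (Z q, 0) \<in> E q) \<and> Z p = v"
proof -
  obtain P c N S \<alpha> where N: "p \<in> N" "kernel_chart A E P c N S \<alpha>"
    using kernel_chart_exists[OF dirac_manifold_axioms d] by blast
  interpret ch: kernel_chart A E P c N S \<alpha> by (rule N(2))
  obtain Z where "smooth_vec A N Z" "\<forall>q\<in>N. (Z q, 0) \<in> E q" "Z p = v"
    using ch.kernel_section[OF N(1) v] by blast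
  then show ?thesis using ch.N(1) N(1) by (intro exI[of _ N] exI[of _ Z] conjI)
qed

text \<open>Near each point of U the image is a graph over a fixed k-dimensional space, so its
  dimension is locally constant; the foliation then comes from the Frobenius theorem.\<close>

lemma image_region:
  assumes k: "CARD('n) \<le> k + 1"
  defines "U \<equiv> {p. dim (fst ` E p) = k}"
  shows "open U" and "regular_foliation_on A U (\<lambda>p. fst ` E p)"
proof -
  have loc: "\<exists>P c N S \<alpha>. p \<in> N \<and> N \<subseteq> U \<and> image_chart A E P c N S \<alpha> \<and> dim {v. P v = v} = k" if p: "p \<in> U" for p
  proof -
    have "CARD('n) \<le> dim (fst ` E p) + 1" using p k by (simp add: U_def)
    then obtain P c N S \<alpha> where N: "p \<in> N" "image_chart A E P c N S \<alpha>" "dim {v. P v = v} = dim (fst ` E p)"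
      using image_chart_exists[OF dirac_manifold_axioms] by blast
    interpret ch: image_chart A E P c N S \<alpha> by (rule N(2))
    have dk: "dim {v. P v = v} = k" using N(3) p by (simp add: U_def)
    have "N \<subseteq> U" using ch.image_eq_graph ch.dim_graph_fiber dk by (auto simp: U_def)
    show ?thesis
      by (rule exI[of _ P], rule exI[of _ c], rule exI[of _ N], rule exI[of _ S], rule exI[of _ \<alpha>])
        (intro conjI N(1,2) dk \<open>N \<subseteq> U\<close>)
  qed
  show "open U"
  proof (subst open_subopen, intro ballI)
    fix p assume "p \<in> U"
    from loc[OF this] obtain P c N S \<alpha> where N: "p \<in> N" "N \<subseteq> U" "image_chart A E P c N S \<alpha>" by blast
    interpret ch: image_chart A E P c N S \<alpha> by (rule N(3))
    show "\<exists>T. open T \<and> p \<in> T \<and> T \<subseteq> U" using ch.N(1) N(1,2) by blast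
  qed
  show "regular_foliation_on A U (\<lambda>p. fst ` E p)"
    unfolding regular_foliation_on_def
  proof (intro exI[of _ k] ballI)
    fix p assume "p \<in> U"
    from loc[OF this] obtain P c N S \<alpha> where N: "p \<in> N" "N \<subseteq> U" "image_chart A E P c N S \<alpha>" "dim {v. P v = v} = k" by blast
    interpret ch: image_chart A E P c N S \<alpha> by (rule N(3))
    have D: "fst ` E q = {v. chart_deriv c q v = P (chart_deriv c q v) + blinfun_apply (\<alpha> (snd c q)) (chart_deriv c q v)}" if "q \<in> N" for q
      using ch.image_eq_graph[OF that] by (simp add: ch.graph_def)
    have "\<exists>c F. compatible_chart A c \<and> p \<in> fst c \<and> fst c \<subseteq> U \<and> subspace F \<and> dim F = dim {v. P v = v} \<and> (\<forall>q\<in>fst c. fst ` E q = {v. mderiv A (snd c) q v \<in> F})"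
      by (rule foliation_chart[OF ch.c ch.N(1) N(1) ch.N(2) N(2) ch.linP ch.idem ch.\<alpha>_smooth])
        (rule ch.P_\<alpha> ch.\<alpha>_P ch.image_integrable D, assumption+)+
    then show "\<exists>c F. compatible_chart A c \<and> p \<in> fst c \<and> fst c \<subseteq> U \<and> subspace F \<and> dim F = k \<and> (\<forall>q\<in>fst c. fst ` E q = {v. mderiv A (snd c) q v \<in> F})"
      unfolding N(4) .
  qed
qed

text \<open>A kernel could in principle become smaller nearby. The graph description, which rests on
  isotropy and rank at most one, rules this out.\<close>

lemma kernel_region:
  assumes k: "k \<le> 1"
  defines "U \<equiv> {p. dim (lag_kernel (E p)) = k}"
  shows "open U" and "regular_foliation_on A U (\<lambda>p. lag_kernel (E p))"
proof -
  have loc: "\<exists>P c N S \<alpha>. p \<in> N \<and> N \<subseteq> U \<and> kernel_chart A E P c N S \<alpha> \<and> dim {v. P v = v} = k" if p: "p \<in> U" for p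
  proof -
    have "dim (lag_kernel (E p)) \<le> 1" using p k by (simp add: U_def)
    then obtain P c N S \<alpha> where N: "p \<in> N" "kernel_chart A E P c N S \<alpha>" "dim {v. P v = v} = dim (lag_kernel (E p))"
      using kernel_chart_exists[OF dirac_manifold_axioms] by blast
    interpret ch: kernel_chart A E P c N S \<alpha> by (rule N(2))
    have dk: "dim {v. P v = v} = k" using N(3) p by (simp add: U_def)
    have "N \<subseteq> U" using ch.kernel_eq_graph ch.dim_graph_fiber dk by (auto simp: U_def)
    show ?thesis
      by (rule exI[of _ P], rule exI[of _ c], rule exI[of _ N], rule exI[of _ S], rule exI[of _ \<alpha>])
        (intro conjI N(1,2) dk \<open>N \<subseteq> U\<close>)
  qed
  show "open U"
  proof (subst open_subopen, intro ballI)
    fix p assume "p \<in> U"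
    from loc[OF this] obtain P c N S \<alpha> where N: "p \<in> N" "N \<subseteq> U" "kernel_chart A E P c N S \<alpha>" by blast
    interpret ch: kernel_chart A E P c N S \<alpha> by (rule N(3))
    show "\<exists>T. open T \<and> p \<in> T \<and> T \<subseteq> U" using ch.N(1) N(1,2) by blast
  qed
  show "regular_foliation_on A U (\<lambda>p. lag_kernel (E p))"
    unfolding regular_foliation_on_def
  proof (intro exI[of _ k] ballI)
    fix p assume "p \<in> U"
    from loc[OF this] obtain P c N S \<alpha> where N: "p \<in> N" "N \<subseteq> U" "kernel_chart A E P c N S \<alpha>" "dim {v. P v = v} = k" by blast
    interpret ch: kernel_chart A E P c N S \<alpha> by (rule N(3))
    have D: "lag_kernel (E q) = {v. chart_deriv c q v = P (chart_deriv c q v) + blinfun_apply (\<alpha> (snd c q)) (chart_deriv c q v)}" if "q \<in> N" for q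
      using ch.kernel_eq_graph[OF that] by (simp add: ch.graph_def)
    have "\<exists>c F. compatible_chart A c \<and> p \<in> fst c \<and> fst c \<subseteq> U \<and> subspace F \<and> dim F = dim {v. P v = v} \<and> (\<forall>q\<in>fst c. lag_kernel (E q) = {v. mderiv A (snd c) q v \<in> F})"
      by (rule foliation_chart[OF ch.c ch.N(1) N(1) ch.N(2) N(2) ch.linP ch.idem ch.\<alpha>_smooth])
        (rule ch.P_\<alpha> ch.\<alpha>_P ch.kernel_integrable D, assumption+)+
    then show "\<exists>c F. compatible_chart A c \<and> p \<in> fst c \<and> fst c \<subseteq> U \<and> subspace F \<and> dim F = k \<and> (\<forall>q\<in>fst c. lag_kernel (E q) = {v. mderiv A (snd c) q v \<in> F})"
      unfolding N(4) .
  qed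
qed

lemma lag_form_two_form:
  assumes U: "\<And>p. p \<in> U \<Longrightarrow> CARD('n) \<le> dim (fst ` E p) + 1"
  shows "fol_two_form_on A U (\<lambda>p. fst ` E p) (\<lambda>p. lag_form (E p))"
  unfolding fol_two_form_on_def
proof (intro conjI ballI allI impI)
  show "alternating_on (fst ` E p) (lag_form (E p))" for p by (rule alternating_lag_form[OF lagrangian_fiber])
  fix W X Y assume W: "open W" "W \<subseteq> U" and X: "smooth_vec A W X" "\<forall>p\<in>W. X p \<in> fst ` E p" and Y: "smooth_vec A W Y" "\<forall>p\<in>W. Y p \<in> fst ` E p"
  show "smooth_fun A W (\<lambda>p. lag_form (E p) (X p) (Y p))"
  proof (rule smooth_fun_local[OF W(1)])
    fix p assume p: "p \<in> W"
    then have "CARD('n) \<le> dim (fst ` E p) + 1" using U W by blast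
    from image_lift_local[OF this] obtain N where N: "open N" "p \<in> N"
      and lift: "\<forall>N' V. open N' \<longrightarrow> N' \<subseteq> N \<longrightarrow> smooth_vec A N' V \<longrightarrow> (\<forall>q\<in>N'. V q \<in> fst ` E q) \<longrightarrow>
        (\<exists>\<xi>. smooth_covec A N' \<xi> \<and> (\<forall>q\<in>N'. (V q, \<xi> q) \<in> E q))" by blast
    have O: "open (N \<inter> W)" using N W by blast
    have sX: "smooth_vec A (N \<inter> W) X" "smooth_vec A (N \<inter> W) Y" using smooth_vec_subset X(1) Y(1) by blast+
    have "\<forall>q\<in>N \<inter> W. X q \<in> fst ` E q" using X(2) by blast
    then obtain \<xi> where \<xi>: "smooth_covec A (N \<inter> W) \<xi>" "\<forall>q\<in>N \<inter> W. (X q, \<xi> q) \<in> E q"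
      using lift O sX(1) by (meson Int_lower1)
    have "smooth_fun A (N \<inter> W) (\<lambda>p. lag_form (E p) (X p) (Y p))"
    proof (rule smooth_fun_cong[OF O _ smooth_fun_pairing[OF O \<xi>(1) sX(2)]])
      fix q assume "q \<in> N \<inter> W"
      then show "blinfun_apply (\<xi> q) (Y q) = lag_form (E q) (X q) (Y q)"
        using lag_form_eq[OF lagrangian_fiber, of "X q" "\<xi> q" q "Y q"] \<xi>(2) Y(2) by auto
    qed
    then show "\<exists>N. open N \<and> p \<in> N \<and> N \<subseteq> W \<and> smooth_fun A N (\<lambda>p. lag_form (E p) (X p) (Y p))"
      using O N p by (intro exI[of _ "N \<inter> W"]) auto
  qed
qed

text \<open>After lifting the three fields to sections of E, the form values become pairings and
  \<open>dirac_identity\<close> is the Cartan formula.\<close>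

lemma lag_form_closed:
  assumes U: "\<And>p. p \<in> U \<Longrightarrow> CARD('n) \<le> dim (fst ` E p) + 1"
  shows "fol_closed_on A U (\<lambda>p. fst ` E p) (\<lambda>p. lag_form (E p))"
  unfolding fol_closed_on_def
proof (intro allI impI ballI)
  fix W V0 V1 V2 p assume W: "open W" "W \<subseteq> U" and V: "smooth_vec A W V0" "smooth_vec A W V1" "smooth_vec A W V2"
    and D: "\<forall>p\<in>W. V0 p \<in> fst ` E p \<and> V1 p \<in> fst ` E p \<and> V2 p \<in> fst ` E p" and p: "p \<in> W"
  have "CARD('n) \<le> dim (fst ` E p) + 1" using U W p by blast
  from image_lift_local[OF this] obtain N where N: "open N" "p \<in> N"
    and lift: "\<forall>N' V. open N' \<longrightarrow> N' \<subseteq> N \<longrightarrow> smooth_vec A N' V \<longrightarrow> (\<forall>q\<in>N'. V q \<in> fst ` E q) \<longrightarrow>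
      (\<exists>\<xi>. smooth_covec A N' \<xi> \<and> (\<forall>q\<in>N'. (V q, \<xi> q) \<in> E q))" by blast
  let ?N = "N \<inter> W"
  have O: "open ?N" "p \<in> ?N" using N W p by blast+
  have ex: "\<exists>\<xi>. smooth_covec A ?N \<xi> \<and> (\<forall>q\<in>?N. (V q, \<xi> q) \<in> E q)" if "smooth_vec A ?N V" "\<forall>q\<in>?N. V q \<in> fst ` E q" for V
    using lift O(1) that by (meson Int_lower1)
  have sV: "smooth_vec A ?N V0" "smooth_vec A ?N V1" "smooth_vec A ?N V2" using V smooth_vec_subset by blast+
  have DV: "\<forall>q\<in>?N. V0 q \<in> fst ` E q" "\<forall>q\<in>?N. V1 q \<in> fst ` E q" "\<forall>q\<in>?N. V2 q \<in> fst ` E q" using D by blast+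
  obtain \<xi>0 where x0: "smooth_covec A ?N \<xi>0" "\<forall>q\<in>?N. (V0 q, \<xi>0 q) \<in> E q" using ex[OF sV(1) DV(1)] by blast
  obtain \<xi>1 where x1: "smooth_covec A ?N \<xi>1" "\<forall>q\<in>?N. (V1 q, \<xi>1 q) \<in> E q" using ex[OF sV(2) DV(2)] by blast
  obtain \<xi>2 where x2: "smooth_covec A ?N \<xi>2" "\<forall>q\<in>?N. (V2 q, \<xi>2 q) \<in> E q" using ex[OF sV(3) DV(3)] by blast
  have fm: "mderiv A (\<lambda>q. lag_form (E q) (X q) (Y q)) p = mderiv A (\<lambda>q. blinfun_apply (\<xi> q) (Y q)) p"
    if "smooth_covec A ?N \<xi>" "\<forall>q\<in>?N. (X q, \<xi> q) \<in> E q" "smooth_vec A ?N Y" "\<forall>q\<in>?N. Y q \<in> fst ` E q" for X \<xi> Y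
  proof (rule mderiv_cong[OF O, symmetric, OF _ smooth_fun_pairing[OF O(1) that(1,3)]])
    fix q assume "q \<in> ?N"
    then show "blinfun_apply (\<xi> q) (Y q) = lag_form (E q) (X q) (Y q)"
      using lag_form_eq[OF lagrangian_fiber] that(2,4) by (metis (no_types, lifting))
  qed
  \<comment> \<open>The bracket is the vector part of some element of E p, so isotropy moves the
    evaluation from its covector to \<zeta>, at the cost of a sign.\<close>
  have br: "lag_form (E p) (lie_bracket A X Y p) (Z p) = - blinfun_apply (\<zeta> p) (lie_bracket A X Y p)"
    if "smooth_vec A ?N X" "smooth_covec A ?N \<xi>" "\<forall>q\<in>?N. (X q, \<xi> q) \<in> E q" "smooth_vec A ?N Y" "smooth_covec A ?N \<eta>" "\<forall>q\<in>?N. (Y q, \<eta> q) \<in> E q"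
      "\<forall>q\<in>?N. (Z q, \<zeta> q) \<in> E q" for X \<xi> Y \<eta> Z \<zeta>
  proof -
    have "lie_bracket A X Y p \<in> fst ` E p"
      by (rule dirac_lie_bracket_mem[OF O that(1,2) _ that(4,5)]) (use that(3,6) in blast)+
    then obtain \<kappa> where \<kappa>: "(lie_bracket A X Y p, \<kappa>) \<in> E p" by force
    have z: "(Z p, \<zeta> p) \<in> E p" using that(7) O(2) by blast
    then have "Z p \<in> fst ` E p" by force
    then show ?thesis
      using lag_form_eq[OF lagrangian_fiber \<kappa>] lagrangian_isotropic[OF lagrangian_fiber \<kappa> z] by simp
  qed
  have mem: "\<And>q. q \<in> ?N \<Longrightarrow> (V0 q, \<xi>0 q) \<in> E q" "\<And>q. q \<in> ?N \<Longrightarrow> (V1 q, \<xi>1 q) \<in> E q" "\<And>q. q \<in> ?N \<Longrightarrow> (V2 q, \<xi>2 q) \<in> E q"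
    using x0 x1 x2 by blast+
  show "d_two_form A (\<lambda>p. lag_form (E p)) V0 V1 V2 p = 0"
    unfolding d_two_form_def fm[OF x1 sV(3) DV(3)] fm[OF x0 sV(3) DV(3)] fm[OF x0 sV(2) DV(2)]
      br[OF sV(1) x0 sV(2) x1 x2(2)] br[OF sV(1) x0 sV(3) x2 x1(2)] br[OF sV(2) x1 sV(3) x2 x0(2)]
    using dirac_identity[OF O sV(1) x0(1) mem(1) sV(2) x1(1) mem(2) sV(3) x2(1) mem(3)] by simp
qed

lemma lag_bivector_bivector:
  assumes U: "\<And>p. p \<in> U \<Longrightarrow> dim (lag_kernel (E p)) \<le> 1"
  shows "bivector_on A U (\<lambda>p. annihilator (lag_kernel (E p))) (\<lambda>p. lag_bivector (E p))"
  unfolding bivector_on_def lagrangian_snd_image[OF lagrangian_fiber, symmetric]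
proof (intro conjI ballI allI impI)
  show "alternating_on (snd ` E p) (lag_bivector (E p))" for p by (rule alternating_lag_bivector[OF lagrangian_fiber])
  fix W \<xi> \<eta> assume W: "open W" "W \<subseteq> U" and \<xi>: "smooth_covec A W \<xi>" "\<forall>p\<in>W. \<xi> p \<in> snd ` E p" and \<eta>: "smooth_covec A W \<eta>" "\<forall>p\<in>W. \<eta> p \<in> snd ` E p"
  show "smooth_fun A W (\<lambda>p. lag_bivector (E p) (\<xi> p) (\<eta> p))"
  proof (rule smooth_fun_local[OF W(1)])
    fix p assume p: "p \<in> W"
    then have "dim (lag_kernel (E p)) \<le> 1" using U W by blast
    from kernel_lift_local[OF this] obtain N where N: "open N" "p \<in> N"
      and lift: "\<forall>N' \<eta>. open N' \<longrightarrow> N' \<subseteq> N \<longrightarrow> smooth_covec A N' \<eta> \<longrightarrow> (\<forall>q\<in>N'. \<eta> q \<in> snd ` E q) \<longrightarrow>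
        (\<exists>X. smooth_vec A N' X \<and> (\<forall>q\<in>N'. (X q, \<eta> q) \<in> E q))" by blast
    have O: "open (N \<inter> W)" using N W by blast
    have s: "smooth_covec A (N \<inter> W) \<xi>" "smooth_covec A (N \<inter> W) \<eta>" using smooth_covec_subset \<xi>(1) \<eta>(1) by blast+
    have "\<forall>q\<in>N \<inter> W. \<xi> q \<in> snd ` E q" using \<xi>(2) by blast
    then obtain X where X: "smooth_vec A (N \<inter> W) X" "\<forall>q\<in>N \<inter> W. (X q, \<xi> q) \<in> E q"
      using lift O s(1) by (meson Int_lower1)
    have "smooth_fun A (N \<inter> W) (\<lambda>p. lag_bivector (E p) (\<xi> p) (\<eta> p))"
    proof (rule smooth_fun_cong[OF O _ smooth_fun_pairing[OF O s(2) X(1)]])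
      fix q assume "q \<in> N \<inter> W"
      then show "blinfun_apply (\<eta> q) (X q) = lag_bivector (E q) (\<xi> q) (\<eta> q)"
        using lag_bivector_eq[OF lagrangian_fiber, of "X q" "\<xi> q" q "\<eta> q"] X(2) \<eta>(2) by auto
    qed
    then show "\<exists>N. open N \<and> p \<in> N \<and> N \<subseteq> W \<and> smooth_fun A N (\<lambda>p. lag_bivector (E p) (\<xi> p) (\<eta> p))"
      using O N p by (intro exI[of _ "N \<inter> W"]) auto
  qed
qed

section \<open>The bracket on functions\<close>

lemma dfun_linear_combination:
  assumes f: "smooth_fun A W f" and g: "smooth_fun A W g" and p: "p \<in> W"
  shows "dfun A (\<lambda>q. a * f q + b * g q) p = a *\<^sub>R dfun A f p + b *\<^sub>R dfun A g p"
proof (rule blinfun_eqI)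
  fix v
  let ?c = "chart_at A p"
  have "(((\<lambda>q. a * f q + b * g q) \<circ> chart_inv ?c) has_derivative (\<lambda>v. a * mderiv A f p v + b * mderiv A g p v)) (at (snd ?c p))"
    using has_derivative_add[OF has_derivative_mult_right[OF mderiv_has_derivative[OF f p], of a] has_derivative_mult_right[OF mderiv_has_derivative[OF g p], of b]]
    by (simp add: o_def)
  from fun_cong[OF frechet_derivative_at[OF this], of v, symmetric] has_derivative_bounded_linear[OF this, unfolded frechet_derivative_at[OF this]]
  show "blinfun_apply (dfun A (\<lambda>q. a * f q + b * g q) p) v = blinfun_apply (a *\<^sub>R dfun A f p + b *\<^sub>R dfun A g p) v"
    by (simp add: dfun_def[of A "\<lambda>q. a * f q + b * g q"] mderiv_chart_at[of "\<lambda>q. a * f q + b * g q"] bounded_linear_Blinfun_apply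
        blinfun.add_left blinfun.scaleR_left dfun_apply[OF f p] dfun_apply[OF g p])
qed

lemma dfun_mult:
  assumes f: "smooth_fun A W f" and g: "smooth_fun A W g" and p: "p \<in> W"
  shows "dfun A (\<lambda>q. f q * g q) p = g p *\<^sub>R dfun A f p + f p *\<^sub>R dfun A g p"
proof (rule blinfun_eqI)
  fix v
  let ?c = "chart_at A p"
  have c: "chart_inv ?c (snd ?c p) = p" by (rule chart_inv_chart[OF compatible_chart_mem[OF chart_at(1)] chart_at(2)])
  have "(((\<lambda>q. f q * g q) \<circ> chart_inv ?c) has_derivative (\<lambda>v. f p * mderiv A g p v + mderiv A f p v * g p)) (at (snd ?c p))"
    using has_derivative_mult[OF mderiv_has_derivative[OF f p] mderiv_has_derivative[OF g p]]
    by (simp add: o_def c)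
  from fun_cong[OF frechet_derivative_at[OF this], of v, symmetric] has_derivative_bounded_linear[OF this, unfolded frechet_derivative_at[OF this]]
  show "blinfun_apply (dfun A (\<lambda>q. f q * g q) p) v = blinfun_apply (g p *\<^sub>R dfun A f p + f p *\<^sub>R dfun A g p) v"
    by (simp add: dfun_def[of A "\<lambda>q. f q * g q"] mderiv_chart_at[of "\<lambda>q. f q * g q"] bounded_linear_Blinfun_apply
        blinfun.add_left blinfun.scaleR_left dfun_apply[OF f p] dfun_apply[OF g p] algebra_simps)
qed

abbreviation bracket :: "('a \<Rightarrow> real) \<Rightarrow> ('a \<Rightarrow> real) \<Rightarrow> 'a \<Rightarrow> real" where
  "bracket \<equiv> bivector_bracket A (\<lambda>p. lag_bivector (E p))"

lemma bracket_eq: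
  assumes "(v, dfun A f p) \<in> E p" "dfun A g p \<in> snd ` E p"
  shows "bracket f g p = blinfun_apply (dfun A g p) v"
  unfolding bivector_bracket_def by (rule lag_bivector_eq[OF lagrangian_fiber assms])

lemma bracket_antisym:
  assumes "dfun A f p \<in> snd ` E p" "dfun A g p \<in> snd ` E p" shows "bracket f g p = - bracket g f p"
proof -
  obtain v w where "(v, dfun A f p) \<in> E p" "(w, dfun A g p) \<in> E p" using assms by force
  then show ?thesis
    using bracket_eq[of v f p g] bracket_eq[of w g p f] assms lagrangian_isotropic[OF lagrangian_fiber, of v "dfun A f p" p w "dfun A g p"] by simp
qed

text \<open>N is chosen before f, so that the Hamiltonian fields of several functions live on a
  common neighbourhood. They are determined only modulo the kernel of E.\<close>

lemma hamiltonian_field: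
  assumes d: "dim (lag_kernel (E p)) \<le> 1" and W: "open W" "p \<in> W"
  shows "\<exists>N. open N \<and> p \<in> N \<and> N \<subseteq> W \<and> (\<forall>f. smooth_fun A W f \<longrightarrow> (\<forall>q\<in>W. dfun A f q \<in> snd ` E q) \<longrightarrow>
    (\<exists>X. smooth_vec A N X \<and> (\<forall>q\<in>N. (X q, dfun A f q) \<in> E q)))"
proof -
  from kernel_lift_local[OF d] obtain N where N: "open N" "p \<in> N"
    and lift: "\<forall>N' \<eta>. open N' \<longrightarrow> N' \<subseteq> N \<longrightarrow> smooth_covec A N' \<eta> \<longrightarrow> (\<forall>q\<in>N'. \<eta> q \<in> snd ` E q) \<longrightarrow>
      (\<exists>X. smooth_vec A N' X \<and> (\<forall>q\<in>N'. (X q, \<eta> q) \<in> E q))" by blast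
  have O: "open (N \<inter> W)" using N W by blast
  have "\<exists>X. smooth_vec A (N \<inter> W) X \<and> (\<forall>q\<in>N \<inter> W. (X q, dfun A f q) \<in> E q)"
    if "smooth_fun A W f" "\<forall>q\<in>W. dfun A f q \<in> snd ` E q" for f
  proof -
    have "smooth_covec A (N \<inter> W) (dfun A f)" using smooth_covec_subset[OF smooth_covec_dfun[OF W(1) that(1)]] by blast
    moreover have "\<forall>q\<in>N \<inter> W. dfun A f q \<in> snd ` E q" using that(2) by blast
    ultimately show ?thesis using lift O by (meson Int_lower1)
  qed
  then show ?thesis using O N W by (intro exI[of _ "N \<inter> W"]) blast
qed

text \<open>The algebra C is left open because it is instantiated both with all smooth functions and
  with the admissible ones.\<close>

lemma poisson_bracket:
  assumes U: "\<And>p. p \<in> W \<Longrightarrow> dim (lag_kernel (E p)) \<le> 1" and W: "open W"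
    and C: "\<And>f. f \<in> C \<Longrightarrow> smooth_fun A W f" "\<And>f p. f \<in> C \<Longrightarrow> p \<in> W \<Longrightarrow> dfun A f p \<in> snd ` E p"
    and closed: "\<And>f g. f \<in> C \<Longrightarrow> g \<in> C \<Longrightarrow> bracket f g \<in> C"
  shows "poisson_bracket_on W C bracket"
  unfolding poisson_bracket_on_def
proof (intro conjI ballI allI)
  fix f g assume "f \<in> C" "g \<in> C"
  then show "bracket f g \<in> C" by (rule closed)
next
  fix f g p assume "f \<in> C" "g \<in> C" "p \<in> W"
  then show "bracket f g p = - bracket g f p" using bracket_antisym C(2) by blast
next
  fix f g h a b p assume f: "f \<in> C" and g: "g \<in> C" and h: "h \<in> C" and p: "p \<in> W"
  note alt = alternating_lag_bivector[OF lagrangian_fiber[of p], unfolded alternating_on_def]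
  show "bracket h (\<lambda>q. a * f q + b * g q) p = a * bracket h f p + b * bracket h g p"
    unfolding bivector_bracket_def dfun_linear_combination[OF C(1)[OF f] C(1)[OF g] p]
    using alt C(2)[OF f p] C(2)[OF g p] C(2)[OF h p] by blast
next
  fix f g h p assume f: "f \<in> C" and g: "g \<in> C" and h: "h \<in> C" and p: "p \<in> W"
  note alt = alternating_lag_bivector[OF lagrangian_fiber[of p], unfolded alternating_on_def]
  have "bracket h (\<lambda>q. f q * g q) p = g p * bracket h f p + f p * bracket h g p"
    unfolding bivector_bracket_def dfun_mult[OF C(1)[OF f] C(1)[OF g] p]
    using alt C(2)[OF f p] C(2)[OF g p] C(2)[OF h p] by blast
  then show "bracket h (\<lambda>q. f q * g q) p = bracket h f p * g p + f p * bracket h g p" by simp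
next
  fix f g h p assume f: "f \<in> C" and g: "g \<in> C" and h: "h \<in> C" and p: "p \<in> W"
  obtain N where N: "open N" "p \<in> N" "N \<subseteq> W" and ham: "\<forall>f. smooth_fun A W f \<longrightarrow> (\<forall>q\<in>W. dfun A f q \<in> snd ` E q) \<longrightarrow>
    (\<exists>X. smooth_vec A N X \<and> (\<forall>q\<in>N. (X q, dfun A f q) \<in> E q))" using hamiltonian_field[OF U[OF p] W p] by blast
  have hamC: "\<exists>X. smooth_vec A N X \<and> (\<forall>q\<in>N. (X q, dfun A f q) \<in> E q)" if "f \<in> C" for f
    using ham C that by blast
  have sN: "smooth_fun A N f" if "f \<in> C" for f using C(1)[OF that] smooth_fun_subset N(3) by blast
  obtain X where X: "smooth_vec A N X" "\<forall>q\<in>N. (X q, dfun A f q) \<in> E q" using hamC[OF f] by blast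
  obtain Y where Y: "smooth_vec A N Y" "\<forall>q\<in>N. (Y q, dfun A g q) \<in> E q" using hamC[OF g] by blast
  obtain Z where Z: "smooth_vec A N Z" "\<forall>q\<in>N. (Z q, dfun A h q) \<in> E q" using hamC[OF h] by blast
  have mem: "\<And>q. q \<in> N \<Longrightarrow> (X q, dfun A f q) \<in> E q" "\<And>q. q \<in> N \<Longrightarrow> (Y q, dfun A g q) \<in> E q" "\<And>q. q \<in> N \<Longrightarrow> (Z q, dfun A h q) \<in> E q"
    using X Y Z by blast+
  have br: "bracket a b q = blinfun_apply (dfun A b q) (V q)" if "b \<in> C" "\<forall>q\<in>N. (V q, dfun A a q) \<in> E q" "q \<in> N" for a b q V
    using bracket_eq C(2)[OF that(1)] that N(3) by blast
  \<comment> \<open>Since {b, d} is the derivative of d along the field of b, a nested bracket is an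
    iterated derivative along Hamiltonian fields.\<close>
  have double: "bracket a (bracket b d) p = mderiv A (\<lambda>q. blinfun_apply (dfun A d q) (B q)) p (V p)"
    if "b \<in> C" "d \<in> C" "\<forall>q\<in>N. (V q, dfun A a q) \<in> E q" "\<forall>q\<in>N. (B q, dfun A b q) \<in> E q" for a b d V B
  proof -
    have bd: "bracket b d \<in> C" by (rule closed[OF that(1,2)])
    have "bracket a (bracket b d) p = mderiv A (bracket b d) p (V p)"
      using br[OF bd that(3) N(2)] dfun_apply[OF sN[OF bd] N(2)] by simp
    also have "mderiv A (bracket b d) p = mderiv A (\<lambda>q. blinfun_apply (dfun A d q) (B q)) p"
      by (rule mderiv_cong[OF N(1,2) br[OF that(2,4)] sN[OF bd]])
    finally show ?thesis .
  qed
  \<comment> \<open>With {h, f} = -{f, h} the Jacobi sum becomes X(Yh) - Y(Xh) + Z(Xg) = [X, Y]h +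
    Z(Xg), the expression that \<open>dirac_identity_exact\<close> shows to vanish for \<zeta> =
    dh.\<close>
  have anti: "bracket g (bracket h f) p = - bracket g (bracket f h) p"
  proof -
    \<comment> \<open>The term with coefficient 0 brings the sign change into the form of
      \<open>dfun_linear_combination\<close>.\<close>
    have "dfun A (bracket h f) p = dfun A (\<lambda>q. (- 1) * bracket f h q + 0 * bracket f h q) p"
    proof (rule blinfun_eqI)
      fix v
      have "mderiv A (bracket h f) p = mderiv A (\<lambda>q. (- 1) * bracket f h q + 0 * bracket f h q) p"
      proof (rule mderiv_cong[OF W p _ C(1)[OF closed[OF h f]]])
        fix q assume "q \<in> W"
        from bracket_antisym[OF C(2)[OF h this] C(2)[OF f this]]
        show "bracket h f q = (- 1) * bracket f h q + 0 * bracket f h q" by linarith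
      qed
      then show "blinfun_apply (dfun A (bracket h f) p) v = blinfun_apply (dfun A (\<lambda>q. (- 1) * bracket f h q + 0 * bracket f h q) p) v"
        by (simp add: dfun_def)
    qed
    also have "\<dots> = (- 1) *\<^sub>R dfun A (bracket f h) p + 0 *\<^sub>R dfun A (bracket f h) p"
      by (rule dfun_linear_combination[OF C(1) C(1) p]) (rule closed[OF f h])+
    finally have "dfun A (bracket h f) p = - dfun A (bracket f h) p" by simp
    then show ?thesis
      using br[OF closed[OF h f] Y(2) N(2)] br[OF closed[OF f h] Y(2) N(2)] by (simp add: blinfun.minus_left)
  qed
  show "bracket f (bracket g h) p + bracket g (bracket h f) p + bracket h (bracket f g) p = 0"
    unfolding anti double[OF g h X(2) Y(2)] double[OF f h Y(2) X(2)] double[OF f g Z(2) X(2)]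
    using dirac_identity_exact[OF N(1,2) sN[OF f] sN[OF g] X(1) mem(1) Y(1) mem(2) Z(1) smooth_covec_dfun[OF N(1) sN[OF h]] mem(3)]
      mderiv_lie_bracket[OF N(1) sN[OF h] X(1) Y(1) N(2)] dfun_apply[OF sN[OF h] N(2)]
    by simp
qed

lemma bracket_smooth:
  assumes U: "\<And>p. p \<in> W \<Longrightarrow> dim (lag_kernel (E p)) \<le> 1" and W: "open W"
    and f: "smooth_fun A W f" "\<And>p. p \<in> W \<Longrightarrow> dfun A f p \<in> snd ` E p"
    and g: "smooth_fun A W g" "\<And>p. p \<in> W \<Longrightarrow> dfun A g p \<in> snd ` E p"
  shows "smooth_fun A W (bracket f g)"
proof -
  have "bivector_on A W (\<lambda>p. snd ` E p) (\<lambda>p. lag_bivector (E p))"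
    using lag_bivector_bivector[OF U] by (simp add: lagrangian_snd_image[OF lagrangian_fiber])
  then show ?thesis
    unfolding bivector_on_def bivector_bracket_def[abs_def]
    using W smooth_covec_dfun[OF W f(1)] smooth_covec_dfun[OF W g(1)] f(2) g(2) by blast
qed

text \<open>The kernel vector v extends to a local field Z with (Z, 0) in E, and
  \<open>dirac_identity_exact\<close> is applied to it.\<close>

lemma bracket_constant_along_kernel:
  assumes W: "open W" "p \<in> W" and d: "dim (lag_kernel (E p)) \<le> 1" and v: "v \<in> lag_kernel (E p)"
    and f: "smooth_fun A W f" "\<And>p. p \<in> W \<Longrightarrow> dfun A f p \<in> snd ` E p"
    and g: "smooth_fun A W g" "\<And>p. p \<in> W \<Longrightarrow> dfun A g p \<in> snd ` E p"
    and br: "smooth_fun A W (bracket f g)"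
  shows "mderiv A (bracket f g) p v = 0"
proof -
  obtain N1 where N1: "open N1" "p \<in> N1" "N1 \<subseteq> W" and ham: "\<forall>f. smooth_fun A W f \<longrightarrow> (\<forall>q\<in>W. dfun A f q \<in> snd ` E q) \<longrightarrow>
    (\<exists>X. smooth_vec A N1 X \<and> (\<forall>q\<in>N1. (X q, dfun A f q) \<in> E q))" using hamiltonian_field[OF d W] by blast
  obtain N2 Z where N2: "open N2" "p \<in> N2" and Z: "smooth_vec A N2 Z" "\<forall>q\<in>N2. (Z q, 0) \<in> E q" "Z p = v"
    using kernel_section_local[OF d v] by blast
  obtain X where X: "smooth_vec A N1 X" "\<forall>q\<in>N1. (X q, dfun A f q) \<in> E q" using ham f by blast
  obtain Y where Y: "smooth_vec A N1 Y" "\<forall>q\<in>N1. (Y q, dfun A g q) \<in> E q" using ham g by blast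
  let ?N = "N1 \<inter> N2"
  have N: "open ?N" "p \<in> ?N" using N1 N2 by blast+
  have s: "smooth_vec A ?N X" "smooth_vec A ?N Y" "smooth_vec A ?N Z" "smooth_fun A ?N f" "smooth_fun A ?N g" "smooth_fun A ?N (bracket f g)"
    using X Y Z f g br N1(3) smooth_vec_subset smooth_fun_subset by (blast intro: smooth_vec_subset smooth_fun_subset)+
  have "smooth_covec A ?N (\<lambda>q. 0)"
    unfolding smooth_covec_def
  proof
    fix c assume "c \<in> A"
    have "covec_rep A c (\<lambda>q. 0) = (\<lambda>y. 0)"
      by (intro ext blinfun_eqI) (simp add: covec_rep_def bounded_linear_Blinfun_apply)
    then show "smooth_on (snd c ` (fst c \<inter> ?N)) (covec_rep A c (\<lambda>q. 0))" by (simp add: smooth_on_const)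
  qed
  from dirac_identity_exact[OF N s(4,5) s(1) _ s(2) _ s(3) this]
  have "mderiv A (\<lambda>q. blinfun_apply (dfun A g q) (X q)) p v = 0" using X Y Z by simp
  moreover have "mderiv A (bracket f g) p = mderiv A (\<lambda>q. blinfun_apply (dfun A g q) (X q)) p"
    by (rule mderiv_cong[OF N _ s(6)]) (use bracket_eq X(2) g(2) N1(3) in blast)
  ultimately show ?thesis by simp
qed

lemma foliated_poisson:
  assumes k: "k \<le> 1"
  defines "U \<equiv> {p. dim (lag_kernel (E p)) = k}"
  shows "foliated_poisson_on A U (\<lambda>p. lag_kernel (E p)) (\<lambda>p. lag_bivector (E p))"
  unfolding foliated_poisson_on_def
proof (intro conjI allI impI)
  have U: "dim (lag_kernel (E p)) \<le> 1" if "p \<in> U" for p using that k by (simp add: U_def)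
  show fol: "regular_foliation_on A U (\<lambda>p. lag_kernel (E p))" unfolding U_def by (rule kernel_region(2)[OF k])
  show "bivector_on A U (\<lambda>p. annihilator (lag_kernel (E p))) (\<lambda>p. lag_bivector (E p))"
    by (rule lag_bivector_bivector[OF U])
  fix W assume W: "open W" "W \<subseteq> U"
  let ?C = "admissible A (\<lambda>p. lag_kernel (E p)) W"
  have UW: "dim (lag_kernel (E p)) \<le> 1" if "p \<in> W" for p using that U W(2) by blast
  have C1: "smooth_fun A W f" if "f \<in> ?C" for f using that by (simp add: admissible_def)
  have C2: "dfun A f p \<in> snd ` E p" if "f \<in> ?C" "p \<in> W" for f p
    \<comment> \<open>An admissible function has zero derivative along the kernel, so its
      differential lies in the annihilator of the kernel, which consists of the covector parts of
      E.\<close>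
    unfolding lagrangian_snd_image[OF lagrangian_fiber] annihilator_def
    using mderiv_admissible[OF fol W that] dfun_apply[OF C1[OF that(1)] that(2)] by simp
  show "poisson_bracket_on W ?C bracket"
  proof (rule poisson_bracket[OF UW W(1) C1 C2])
    fix f g assume f: "f \<in> ?C" and g: "g \<in> ?C"
    have s: "smooth_fun A W (bracket f g)" by (rule bracket_smooth[OF UW W(1) C1[OF f] C2[OF f] C1[OF g] C2[OF g]])
    have "bracket f g q = bracket f g p" if "q \<in> leaf A (\<lambda>p. lag_kernel (E p)) W p" for p q
    proof (rule constant_on_leaf[OF W(1) s _ that])
      fix q v assume q: "q \<in> W" and v: "v \<in> lag_kernel (E q)"
      show "mderiv A (bracket f g) q v = 0"
        by (rule bracket_constant_along_kernel[OF W(1) q UW[OF q] v C1[OF f] C2[OF f] C1[OF g] C2[OF g] s])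
    qed
    then show "bracket f g \<in> ?C" using s by (simp add: admissible_def)
  qed
qed

lemma poisson:
  assumes U: "\<And>p. p \<in> U \<Longrightarrow> lag_kernel (E p) = {0}"
  shows "poisson_on A U (\<lambda>p. lag_bivector (E p))"
proof -
  have sndE: "snd ` E p = UNIV" if "p \<in> U" for p
    using U[OF that] by (auto simp: lagrangian_snd_image[OF lagrangian_fiber] annihilator_def)
  have d: "dim (lag_kernel (E p)) \<le> 1" if "p \<in> U" for p using U[OF that] by simp
  have "bivector_on A U (\<lambda>p. snd ` E p) (\<lambda>p. lag_bivector (E p))"
    using lag_bivector_bivector[OF d] by (simp add: lagrangian_snd_image[OF lagrangian_fiber])
  then have 1: "bivector_on A U (\<lambda>_. UNIV) (\<lambda>p. lag_bivector (E p))"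
    unfolding bivector_on_def using sndE by (simp add: subset_iff)
  have "poisson_bracket_on W {f. smooth_fun A W f} bracket" if W: "open W" "W \<subseteq> U" for W
  proof (rule poisson_bracket[OF _ W(1)])
    fix f g assume "f \<in> {f. smooth_fun A W f}" "g \<in> {f. smooth_fun A W f}"
    then have "smooth_fun A W f" "smooth_fun A W g" by simp_all
    then show "bracket f g \<in> {f. smooth_fun A W f}"
      using bracket_smooth[OF _ W(1), of f g] d sndE W(2) by (simp add: subset_iff)
  qed (use d sndE W(2) in auto)
  then show ?thesis using 1 by (simp add: poisson_on_def)
qed

lemma foliated_presymplectic:
  assumes k: "CARD('n) \<le> k + 1"
  shows "foliated_presymplectic_on A {p. dim (fst ` E p) = k} (\<lambda>p. fst ` E p) (\<lambda>p. lag_form (E p))"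
  unfolding foliated_presymplectic_on_def
  by (intro conjI image_region(2) lag_form_two_form lag_form_closed) (use k in auto)

lemma presymplectic:
  assumes U: "\<And>p. p \<in> U \<Longrightarrow> fst ` E p = UNIV"
  shows "presymplectic_on A U (\<lambda>p. lag_form (E p))"
proof -
  have d: "CARD('n) \<le> dim (fst ` E p) + 1" if "p \<in> U" for p using U[OF that] by simp
  have "fol_two_form_on A U (\<lambda>_. UNIV) (\<lambda>p. lag_form (E p))"
    using lag_form_two_form[OF d] U unfolding fol_two_form_on_def by (simp add: subset_iff)
  moreover have "fol_closed_on A U (\<lambda>_. UNIV) (\<lambda>p. lag_form (E p))"
    using lag_form_closed[OF d] U unfolding fol_closed_on_def by (simp add: subset_iff)
  ultimately show ?thesis by (simp add: presymplectic_on_def)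
qed

end

lemma lag_type_three:
  fixes L :: "(real ^ 3) gen set"
  assumes L: "lagrangian L"
  shows "even_lagrangian L \<Longrightarrow> dim (fst ` L) = 3 \<or> dim (lag_kernel L) = 1"
    and "odd_lagrangian L \<Longrightarrow> dim (lag_kernel L) = 0 \<or> dim (fst ` L) = 2"
    and "lag_type L = (1, 0) \<longleftrightarrow> dim (fst ` L) = 3 \<and> dim (lag_kernel L) = 1"
    and "lag_type L = (0, 1) \<longleftrightarrow> dim (lag_kernel L) = 0 \<and> dim (fst ` L) = 2"
proof -
  have t: "lag_type L = (dim (lag_kernel L), 3 - dim (fst ` L))" using lag_type_eq[OF L] by simp
  have le: "dim (fst ` L) \<le> 3" using dim_subset_UNIV[of "fst ` L"] by simp
  \<comment> \<open>The bound by 3 keeps the truncated subtraction exact, so the parity of 3 - dim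
    \<Delta> leaves two dimensions in each case. Dimension 1 forces a kernel of dimension 1, and
    dimension 0 forces kernel 0.\<close>
  have cases: "dim (fst ` L) = 0 \<or> dim (fst ` L) = 1 \<or> dim (fst ` L) = 2 \<or> dim (fst ` L) = 3"
    using le by linarith
  show "lag_type L = (1, 0) \<longleftrightarrow> dim (fst ` L) = 3 \<and> dim (lag_kernel L) = 1"
    "lag_type L = (0, 1) \<longleftrightarrow> dim (lag_kernel L) = 0 \<and> dim (fst ` L) = 2"
    using t le by auto
  show "dim (fst ` L) = 3 \<or> dim (lag_kernel L) = 1" if "even_lagrangian L"
  proof -
    have "even (3 - dim (fst ` L))" using that t by (simp add: even_lagrangian_def)
    then have "dim (fst ` L) = 3 \<or> dim (fst ` L) = 1" using cases by (elim disjE) simp_all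
    then show ?thesis using lag_kernel_of_dim_image_1[OF L] by blast
  qed
  show "dim (lag_kernel L) = 0 \<or> dim (fst ` L) = 2" if "odd_lagrangian L"
  proof -
    have "odd (3 - dim (fst ` L))" using that t by (simp add: odd_lagrangian_def)
    then have "dim (fst ` L) = 0 \<or> dim (fst ` L) = 2" using cases by (elim disjE) simp_all
    moreover have "lag_kernel L \<subseteq> fst ` L" by force
    then have "dim (lag_kernel L) \<le> dim (fst ` L)" by (rule dim_subset)
    ultimately show ?thesis by auto
  qed
qed

theorem theorem4p1:
  fixes A :: "('a::{t2_space,second_countable_topology}, real^3) chart set"
    and E :: "'a \<Rightarrow> (real^3) gen set"
  assumes "smooth_atlas A"
    and "dirac_structure A E"
  shows "((\<forall>p. even_lagrangian (E p)) \<longrightarrow>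
           (\<exists>U W \<omega> D P. open U \<and> open W \<and> U \<union> W = UNIV \<and> U \<inter> W = type_region E (1, 0) \<and>
              presymplectic_on A U \<omega> \<and> (\<forall>p\<in>U. E p = lag_of_form UNIV (\<omega> p)) \<and>
              foliated_poisson_on A W D P \<and>
              (\<forall>p\<in>W. E p = lag_of_bivector (annihilator (D p)) (P p)))) \<and>
         ((\<forall>p. odd_lagrangian (E p)) \<longrightarrow>
           (\<exists>U W P D \<epsilon>. open U \<and> open W \<and> U \<union> W = UNIV \<and> U \<inter> W = type_region E (0, 1) \<and>
              poisson_on A U P \<and> (\<forall>p\<in>U. E p = lag_of_bivector UNIV (P p)) \<and>
              foliated_presymplectic_on A W D \<epsilon> \<and>
              (\<forall>p\<in>W. E p = lag_of_form (D p) (\<epsilon> p))))"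
proof -
  interpret dirac_manifold_vec A E
    by (intro dirac_manifold_vec.intro dirac_manifold.intro smooth_manifold.intro dirac_manifold_axioms.intro assms)
  note type = lag_type_three[OF lagrangian_fiber]
  define I where "I = (\<lambda>k. {p. dim (fst ` E p) = k})"
  define K where "K = (\<lambda>k. {p. dim (lag_kernel (E p)) = k})"
  have form: "lag_of_form (fst ` E p) (lag_form (E p)) = E p"
    and bivector: "lag_of_bivector (annihilator (lag_kernel (E p))) (lag_bivector (E p)) = E p" for p
    using lag_of_form_lag_form[OF lagrangian_fiber] lag_of_bivector_lag_bivector[OF lagrangian_fiber]
    by (simp_all add: lagrangian_snd_image[OF lagrangian_fiber])
  have open_I: "open (I k)" if "2 \<le> k" for k unfolding I_def by (rule image_region(1)) (use that in simp)
  have open_K: "open (K k)" if "k \<le> 1" for k unfolding K_def by (rule kernel_region(1)[OF that])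
  have I3: "fst ` E p = UNIV" if "p \<in> I 3" for p
    using subspace_dim_equal[OF subspace_lag_image[OF lagrangian_fiber] subspace_UNIV] that by (simp add: I_def)
  have K0: "lag_kernel (E p) = {0}" if "p \<in> K 0" for p
    using that subspace_0[OF subspace_lag_kernel[OF lagrangian_fiber[of p]]] by (auto simp: K_def)
  show ?thesis
  proof (intro conjI impI)
    assume even: "\<forall>p. even_lagrangian (E p)"
    show "\<exists>U W \<omega> D P. open U \<and> open W \<and> U \<union> W = UNIV \<and> U \<inter> W = type_region E (1, 0) \<and>
              presymplectic_on A U \<omega> \<and> (\<forall>p\<in>U. E p = lag_of_form UNIV (\<omega> p)) \<and>
              foliated_poisson_on A W D P \<and>
              (\<forall>p\<in>W. E p = lag_of_bivector (annihilator (D p)) (P p))"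
    proof (rule exI[of _ "I 3"], rule exI[of _ "K 1"], rule exI[of _ "\<lambda>p. lag_form (E p)"],
        rule exI[of _ "\<lambda>p. lag_kernel (E p)"], rule exI[of _ "\<lambda>p. lag_bivector (E p)"], intro conjI)
      show "open (I 3)" "open (K 1)" using open_I open_K by simp_all
      show "I 3 \<union> K 1 = UNIV" using even type(1) by (auto simp: I_def K_def)
      show "I 3 \<inter> K 1 = type_region E (1, 0)" using type(3) by (auto simp: I_def K_def type_region_def)
      show "presymplectic_on A (I 3) (\<lambda>p. lag_form (E p))" by (rule presymplectic[OF I3])
      show "\<forall>p\<in>I 3. E p = lag_of_form UNIV (lag_form (E p))" using form I3 by metis
      show "foliated_poisson_on A (K 1) (\<lambda>p. lag_kernel (E p)) (\<lambda>p. lag_bivector (E p))"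
        unfolding K_def by (rule foliated_poisson) simp
      show "\<forall>p\<in>K 1. E p = lag_of_bivector (annihilator (lag_kernel (E p))) (lag_bivector (E p))"
        by (simp add: bivector)
    qed
  next
    assume odd: "\<forall>p. odd_lagrangian (E p)"
    show "\<exists>U W P D \<epsilon>. open U \<and> open W \<and> U \<union> W = UNIV \<and> U \<inter> W = type_region E (0, 1) \<and>
              poisson_on A U P \<and> (\<forall>p\<in>U. E p = lag_of_bivector UNIV (P p)) \<and>
              foliated_presymplectic_on A W D \<epsilon> \<and>
              (\<forall>p\<in>W. E p = lag_of_form (D p) (\<epsilon> p))"
    proof (rule exI[of _ "K 0"], rule exI[of _ "I 2"], rule exI[of _ "\<lambda>p. lag_bivector (E p)"],
        rule exI[of _ "\<lambda>p. fst ` E p"], rule exI[of _ "\<lambda>p. lag_form (E p)"], intro conjI)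
      show "open (K 0)" "open (I 2)" using open_I open_K by simp_all
      show "K 0 \<union> I 2 = UNIV" using odd type(2) by (auto simp: I_def K_def)
      show "K 0 \<inter> I 2 = type_region E (0, 1)" using type(4) by (auto simp: I_def K_def type_region_def)
      show "poisson_on A (K 0) (\<lambda>p. lag_bivector (E p))" by (rule poisson[OF K0])
      show "\<forall>p\<in>K 0. E p = lag_of_bivector UNIV (lag_bivector (E p))"
      proof
        fix p assume p: "p \<in> K 0"
        have "annihilator (lag_kernel (E p)) = UNIV" using K0[OF p] by (auto simp: annihilator_def)
        then show "E p = lag_of_bivector UNIV (lag_bivector (E p))" using bivector[of p] by simp
      qed
      show "foliated_presymplectic_on A (I 2) (\<lambda>p. fst ` E p) (\<lambda>p. lag_form (E p))"
        unfolding I_def by (rule foliated_presymplectic) simp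
      show "\<forall>p\<in>I 2. E p = lag_of_form (fst ` E p) (lag_form (E p))" by (simp add: form)
    qed
  qed
qed

end
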